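(* Let $n\ge 3$ and let $\tilde A_{n-1}$ be the $n$-cycle with vertices $0,1,\dots,n-1$ (indices mod $n$) and edges $\{i,i+1\}$; write $e_i=x_{i,i+1}$. Then $\mathcal E_{\tilde A_{n-1}}$ is a quotient of the affine nil-Coxeter algebra of type $\tilde A_{n-1}$ via $s_i\mapsto e_i$, and the kernel of the surjection from the free algebra on $e_0,\dots,e_{n-1}$ onto $\mathcal E_{\tilde A_{n-1}}$ is generated by the quadratic relations (degree-2 elements of the kernel), the braid relations $e_ie_{i+1}e_i-e_{i+1}e_ie_{i+1}$, and $n-1$ further homogeneous relations, of degrees $k(n-k)$ for $k=1,\dots,n-1$. The Hilbert series is $$\mathcal H_{\tilde A_{n-1}}(t)=[n]\cdot\prod_{k=1}^{n-1}[k(n-k)];$$ in particular $\dim\mathcal E_{\tilde A_{n-1}}=n!\,(n-1)!$ and the top degree of $\mathcal E_{\tilde A_{n-1}}$ is $\binom{n+1}{3}$.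
   Context: Let $n\ge 1$. The Fomin–Kirillov algebra $\mathcal E_n$ is the associative $\mathbb Q$-algebra with generators $x_{ij}$ for ordered pairs of distinct $i,j\in[n]$, subject to $x_{ij}=-x_{ji}$, $x_{ij}^2=0$, $x_{ij}x_{kl}=x_{kl}x_{ij}$ for distinct $i,j,k,l$, and $x_{ij}x_{jk}+x_{jk}x_{ki}+x_{ki}x_{ij}=0$ for distinct $i,j,k$. It is graded by degree. For a simple graph $G$ on vertex set identified with $[n]$, $\mathcal E_G$ is the subalgebra of $\mathcal E_n$ generated by the $x_{ij}$ with $\{i,j\}$ an edge of $G$; $\mathcal H_G(t)=\sum_d\dim\mathcal E_G^d\,t^d$, and $[k]=1+t+\cdots+t^{k-1}$. The affine nil-Coxeter algebra of type $\tilde A_{n-1}$ ($n\ge3$) has generators $s_0,\dots,s_{n-1}$ (indices mod $n$) with relations $s_i^2=0$, $s_is_j=s_js_i$ for $i-j\not\equiv\pm1$, and $s_is_{i+1}s_i=s_{i+1}s_is_{i+1}$ (for $n=3$ only the last two kinds are imposed as stated, with all $i$). *)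

theory Defs
  imports "HOL-Library.Function_Algebras" "HOL-Computational_Algebra.Polynomial"
begin

text \<open>An element of the free associative algebra over Q on an alphabet A is a
finitely supported function from words over A to rat.  Addition, zero and
subtraction are pointwise (Function_Algebras); the product is concatenation
(fa_mult), NOT the pointwise product.\<close>

type_synonym 'a fa = "'a list \<Rightarrow> rat"

definition fa_scale :: "rat \<Rightarrow> 'a fa \<Rightarrow> 'a fa" where
  "fa_scale c x = (\<lambda>w. c * x w)"

definition fa_word :: "'a list \<Rightarrow> 'a fa" where
  "fa_word u = (\<lambda>w. if w = u then 1 else 0)"

definition fa_mult :: "'a fa \<Rightarrow> 'a fa \<Rightarrow> 'a fa" where
  "fa_mult x y = (\<lambda>w. \<Sum>i\<in>{0..length w}. x (take i w) * y (drop i w))"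

definition fa_supported :: "'a set \<Rightarrow> 'a fa \<Rightarrow> bool" where
  "fa_supported A x \<longleftrightarrow> finite {w. x w \<noteq> 0} \<and> (\<forall>w. x w \<noteq> 0 \<longrightarrow> w \<in> lists A)"

definition homog :: "nat \<Rightarrow> 'a fa \<Rightarrow> bool" where
  "homog d x \<longleftrightarrow> (\<forall>w. x w \<noteq> 0 \<longrightarrow> length w = d)"

definition fa_dim :: "'a fa set \<Rightarrow> nat" where
  "fa_dim S = vector_space.dim fa_scale S"

inductive_set fa_ideal :: "'a set \<Rightarrow> 'a fa set \<Rightarrow> 'a fa set" for A R where
  base: "r \<in> R \<Longrightarrow> r \<in> fa_ideal A R"
| zero: "0 \<in> fa_ideal A R"
| add: "x \<in> fa_ideal A R \<Longrightarrow> y \<in> fa_ideal A R \<Longrightarrow> x + y \<in> fa_ideal A R"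
| smult: "x \<in> fa_ideal A R \<Longrightarrow> fa_scale c x \<in> fa_ideal A R"
| lmult: "x \<in> fa_ideal A R \<Longrightarrow> u \<in> lists A \<Longrightarrow> fa_mult (fa_word u) x \<in> fa_ideal A R"
| rmult: "x \<in> fa_ideal A R \<Longrightarrow> u \<in> lists A \<Longrightarrow> fa_mult x (fa_word u) \<in> fa_ideal A R"

definition fk_gens :: "nat \<Rightarrow> (nat \<times> nat) set" where
  "fk_gens n = {(i, j). i < n \<and> j < n \<and> i \<noteq> j}"

definition fkx :: "nat \<Rightarrow> nat \<Rightarrow> (nat \<times> nat) fa" where
  "fkx i j = fa_word [(i, j)]"

definition fk_rels :: "nat \<Rightarrow> (nat \<times> nat) fa set" where
  "fk_rels n =
     {fkx i j + fkx j i | i j. (i, j) \<in> fk_gens n}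
   \<union> {fa_mult (fkx i j) (fkx i j) | i j. (i, j) \<in> fk_gens n}
   \<union> {fa_mult (fkx i j) (fkx k l) - fa_mult (fkx k l) (fkx i j) | i j k l.
        i < n \<and> j < n \<and> k < n \<and> l < n \<and> distinct [i, j, k, l]}
   \<union> {fa_mult (fkx i j) (fkx j k) + fa_mult (fkx j k) (fkx k i) + fa_mult (fkx k i) (fkx i j)
        | i j k. i < n \<and> j < n \<and> k < n \<and> distinct [i, j, k]}"

definition fk_ideal :: "nat \<Rightarrow> (nat \<times> nat) fa set" where
  "fk_ideal n = fa_ideal (fk_gens n) (fk_rels n)"

text \<open>Degree-d part of the subalgebra E_G, G given by a symmetric edge relation E on {0..<n}:
 it is (span W_d + I_d)/I_d with W_d the degree-d words in the x_ij, ij an edge, and I_d the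
 degree-d part of the (graded) defining ideal; hence its dimension is
 dim(span(W_d \<union> I_d)) - dim(I_d).\<close>

definition edge_words :: "nat \<Rightarrow> (nat \<Rightarrow> nat \<Rightarrow> bool) \<Rightarrow> nat \<Rightarrow> (nat \<times> nat) fa set" where
  "edge_words n E d = {fa_word w | w. w \<in> lists {(i, j) \<in> fk_gens n. E i j} \<and> length w = d}"

definition fk_ideal_deg :: "nat \<Rightarrow> nat \<Rightarrow> (nat \<times> nat) fa set" where
  "fk_ideal_deg n d = {x \<in> fk_ideal n. homog d x}"

definition fkG_dim :: "nat \<Rightarrow> (nat \<Rightarrow> nat \<Rightarrow> bool) \<Rightarrow> nat \<Rightarrow> nat" where
  "fkG_dim n E d = fa_dim (edge_words n E d \<union> fk_ideal_deg n d) - fa_dim (fk_ideal_deg n d)"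

definition cycle_graph :: "nat \<Rightarrow> nat \<Rightarrow> nat \<Rightarrow> bool" where
  "cycle_graph n i j \<longleftrightarrow> j = (i + 1) mod n \<or> i = (j + 1) mod n"

definition ecyc :: "nat \<Rightarrow> nat \<Rightarrow> nat \<times> nat" where
  "ecyc n i = (i, (i + 1) mod n)"

definition cyc_map :: "nat \<Rightarrow> nat fa \<Rightarrow> (nat \<times> nat) fa" where
  "cyc_map n x = (\<lambda>w'. \<Sum>w\<in>{w. w \<in> lists {0..<n} \<and> map (ecyc n) w = w'}. x w)"

definition cyc_kernel :: "nat \<Rightarrow> nat fa set" where
  "cyc_kernel n = {x. fa_supported {0..<n} x \<and> cyc_map n x \<in> fk_ideal n}"

definition ee :: "nat \<Rightarrow> nat fa" where
  "ee i = fa_word [i]"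

definition braid_rels :: "nat \<Rightarrow> nat fa set" where
  "braid_rels n = {fa_mult (fa_mult (ee i) (ee ((i + 1) mod n))) (ee i)
                   - fa_mult (fa_mult (ee ((i + 1) mod n)) (ee i)) (ee ((i + 1) mod n)) | i. i < n}"

definition nilcox_rels :: "nat \<Rightarrow> nat fa set" where
  "nilcox_rels n =
     {fa_mult (ee i) (ee i) | i. i < n}
   \<union> {fa_mult (ee i) (ee j) - fa_mult (ee j) (ee i) | i j.
        i < n \<and> j < n \<and> i \<noteq> (j + 1) mod n \<and> j \<noteq> (i + 1) mod n}
   \<union> braid_rels n"

definition qint :: "nat \<Rightarrow> int poly" where
  "qint k = (\<Sum>i<k. monom 1 i)"

end

theory Submission
  imports Defs "HOL-Combinatorics.Transposition"
begin


text \<open>Reduced words of the affine nil-Coxeter algebra are indexed by affine permutations. For a k-subset I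
of the residues modulo n let t_I be the translation x \<mapsto> x + n [x \<in> I] - k, and let r_k be the sum of
reduced words of all t_I. Then s_i r_k = r_k s_{i-k} in the nil-Coxeter algebra.

The element r_k vanishes in the Fomin-Kirillov algebra: consider a component of maximal length of its
coproduct in the nil-Coxeter algebra of the path 1, ..., n - 1. The commutation rule forces this component
to invert all pairs of the blocks {1..k-1}, {k}, {k+1..n-1}, so its length is at least k(n - k) - 1; there
only two subsets I contribute, and they cancel by antisymmetry.

Modulo the r_k every word is a combination of words a t with t a reduced word in the letters 1, ..., n - 1
and a a reduced word of a Grassmannian permutation whose window gaps are below n. These words are
independent in the Fomin-Kirillov algebra: after multiplication to the longest element on either side,
skew derivations with nonnegative coefficients strip the word down to 1. Inserting the residues of the
window one by one gives the product formula for their number.\<close>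

section \<open>The free algebra as a vector space\<close>

text \<open>No normal form for the ideal of E_n is at hand: membership can only be shown by explicit
  relations, and non-membership only by linear maps that preserve the ideal. The coproduct serves
  the first purpose. It turns the vanishing of one element into the vanishing of all its components,
  and the rotation of letters by k, which comes from moving a reflection past a translation, links
  components of different lengths. The letters 0 and n - 1 are the two cycle edges at vertex 0; they
  have to stay in the first factor, and this makes an extremal component rigid. The derivations
  serve the second purpose; positivity excludes cancellation without any knowledge of the other
  terms. Presentation and Hilbert series come together: the same words span modulo the stated
  relations and are independent modulo the full kernel, so the two ideals coincide. The product
  formula rests on [k(n-k)] = [n-k] times [k] taken at t^(n-k): the first factors, with [n], count
  the finite symmetric group, the second ones the Grassmannian part.\<close>

declare plus_fun_apply [simp del] zero_fun_apply [simp del] minus_apply [simp del]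

lemmas pw_simps = plus_fun_apply zero_fun_apply minus_apply fa_scale_def

interpretation fa: vector_space "fa_scale :: rat \<Rightarrow> 'a fa \<Rightarrow> 'a fa"
  by unfold_locales (auto simp: pw_simps algebra_simps fun_eq_iff)

interpretation fap: vector_space_pair
  "fa_scale :: rat \<Rightarrow> 'a fa \<Rightarrow> 'a fa" "fa_scale :: rat \<Rightarrow> 'b fa \<Rightarrow> 'b fa" ..

abbreviation fa_linear :: "('a fa \<Rightarrow> 'b fa) \<Rightarrow> bool" where
  "fa_linear \<equiv> Vector_Spaces.linear fa_scale fa_scale"

lemma fa_linearI:
  assumes "\<And>x y. f (x + y) = f x + f y" "\<And>c x. f (fa_scale c x) = fa_scale c (f x)"
  shows "fa_linear f"
  using assms by (simp add: Vector_Spaces.linear_iff fa.vector_space_axioms)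

lemma fa_linear_add: "fa_linear f \<Longrightarrow> f (x + y) = f x + f y"
  by (simp add: Vector_Spaces.linear_iff)

lemma fa_linear_scale: "fa_linear f \<Longrightarrow> f (fa_scale c x) = fa_scale c (f x)"
  by (simp add: Vector_Spaces.linear_iff)

lemma fa_linear_0: "fa_linear f \<Longrightarrow> f 0 = 0"
  by (metis fa_linear_add add_cancel_right_right)

lemma fa_linear_diff: "fa_linear f \<Longrightarrow> f (x - y) = f x - f y"
  by (metis fa_linear_add add_diff_cancel_right' diff_add_cancel)

lemma fa_linear_sum: "fa_linear f \<Longrightarrow> f (\<Sum>i\<in>S. g i) = (\<Sum>i\<in>S. f (g i))"
proof (induction S rule: infinite_finite_induct)
  case (insert i S)
  then show ?case by (simp add: fa_linear_add[OF insert.prems])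
qed (simp_all add: fa_linear_0)

lemma fa_linear_comp: "fa_linear f \<Longrightarrow> fa_linear g \<Longrightarrow> fa_linear (\<lambda>x. f (g x))"
  by (rule fa_linearI) (simp_all only: fa_linear_add[of f] fa_linear_scale[of f] fa_linear_add[of g] fa_linear_scale[of g])

lemma fa_linear_plus: "fa_linear f \<Longrightarrow> fa_linear g \<Longrightarrow> fa_linear (\<lambda>x. f x + g x)"
  by (rule fa_linearI) (simp_all only: fa_linear_add[of f] fa_linear_scale[of f]
      fa_linear_add[of g] fa_linear_scale[of g] fa.scale_right_distrib ac_simps)

lemma fa_linear_minus: "fa_linear f \<Longrightarrow> fa_linear g \<Longrightarrow> fa_linear (\<lambda>x. f x - g x)"
  by (rule fa_linearI) (simp_all only: fa_linear_add[of f] fa_linear_scale[of f]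
      fa_linear_add[of g] fa_linear_scale[of g] fa.scale_right_diff_distrib add_diff_add)

lemma fa_linear_span:
  assumes "fa_linear f" "fa.subspace S" "\<And>x. x \<in> B \<Longrightarrow> f x \<in> S" "x \<in> fa.span B"
  shows "f x \<in> S"
  using assms(4)
proof (induction rule: fa.span_induct_alt)
  case base
  then show ?case by (simp only: fa_linear_0[OF assms(1)] fa.subspace_0[OF assms(2)])
next
  case (step c x y)
  then show ?case
    by (simp only: fa_linear_add[OF assms(1)] fa_linear_scale[OF assms(1)]
        fa.subspace_add[OF assms(2)] fa.subspace_scale[OF assms(2)] assms(3))
qed

lemma fa_linear_eq_span:
  assumes "fa_linear f" "fa_linear g" "\<And>x. x \<in> B \<Longrightarrow> f x = g x" "x \<in> fa.span B"
  shows "f x = g x"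
  using fa_linear_span[OF fa_linear_minus[OF assms(1,2)] fa.subspace_single_0 _ assms(4)] assms(3)
  by auto

lemma fa_word_inj: "fa_word u = fa_word v \<longleftrightarrow> u = v"
  by (metis fa_word_def zero_neq_one)

lemma fa_word_independent: "fa.independent (range (fa_word :: 'a list \<Rightarrow> 'a fa))"
proof
  assume "fa.dependent (range (fa_word :: 'a list \<Rightarrow> 'a fa))"
  then obtain u :: "'a list" where u: "fa_word u \<in> fa.span (range fa_word - {fa_word u})"
    unfolding fa.dependent_def by fastforce
  have sub: "fa.subspace {x. x u = 0}"
    by (auto simp: fa.subspace_def pw_simps)
  have "fa.span (range fa_word - {fa_word u}) \<subseteq> {x. x u = 0}"
    by (rule fa.span_minimal[OF _ sub]) (auto simp: fa_word_def)
  with u show False by (auto simp: fa_word_def)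
qed

text \<open>Built with \<open>construct\<close>, so that the map is linear on all functions,
  infinite supports included, while its values are prescribed on words alone.\<close>

definition fa_lift :: "('a list \<Rightarrow> 'b fa) \<Rightarrow> 'a fa \<Rightarrow> 'b fa" where
  "fa_lift F = fap.construct (range fa_word) (\<lambda>x. F (THE w. x = fa_word w))"

lemma fa_lift_linear: "fa_linear (fa_lift F)"
  unfolding fa_lift_def by (rule fap.linear_construct[OF fa_word_independent])

lemma fa_lift_word: "fa_lift F (fa_word w) = F w"
  unfolding fa_lift_def
  by (subst fap.construct_basis[OF fa_word_independent]) (auto simp: fa_word_inj)

lemma fa_mult_linear_right: "fa_linear (fa_mult x)"
  by (rule fa_linearI)
    (auto simp: fa_mult_def pw_simps fun_eq_iff algebra_simps sum.distrib sum_distrib_left)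

lemma fa_mult_linear_left: "fa_linear (\<lambda>x. fa_mult x y)"
  by (rule fa_linearI)
    (auto simp: fa_mult_def pw_simps fun_eq_iff algebra_simps sum.distrib sum_distrib_left)

lemma fa_mult_word: "fa_mult (fa_word u) (fa_word v) = fa_word (u @ v)"
proof
  fix w
  show "fa_mult (fa_word u) (fa_word v) w = fa_word (u @ v) w"
  proof (cases "w = u @ v")
    case True
    have "(\<Sum>i\<in>{0..length w}. fa_word u (take i w) * fa_word v (drop i w))
        = (\<Sum>i\<in>{0..length w}. if i = length u then 1 else 0)"
    proof (rule sum.cong[OF refl])
      fix i assume "i \<in> {0..length w}"
      then have "take i w = u \<Longrightarrow> i = length u" by (auto simp: min_def)
      then show "fa_word u (take i w) * fa_word v (drop i w) = (if i = length u then 1 else 0)"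
        by (auto simp: fa_word_def True)
    qed
    also have "\<dots> = 1" by (simp add: True)
    finally show ?thesis by (simp add: fa_mult_def True fa_word_def)
  next
    case False
    have "fa_word u (take i w) * fa_word v (drop i w) = 0" for i
      using False append_take_drop_id[of i w] by (auto simp: fa_word_def)
    then have "(\<Sum>i\<in>{0..length w}. fa_word u (take i w) * fa_word v (drop i w)) = 0"
      by (intro sum.neutral) blast
    then show ?thesis using False by (simp add: fa_mult_def fa_word_def)
  qed
qed

text \<open>Multiplication by one word as an operator: identities between compositions of such
  operators then follow from their values on words.\<close>

definition lm :: "'a list \<Rightarrow> 'a fa \<Rightarrow> 'a fa" where "lm u x = fa_mult (fa_word u) x"
definition rm :: "'a list \<Rightarrow> 'a fa \<Rightarrow> 'a fa" where "rm v x = fa_mult x (fa_word v)"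

lemma lm_linear: "fa_linear (lm u)" unfolding lm_def by (rule fa_mult_linear_right)
lemma rm_linear: "fa_linear (rm v)" unfolding rm_def by (rule fa_mult_linear_left)
lemma lm_word [simp]: "lm u (fa_word w) = fa_word (u @ w)" by (simp add: lm_def fa_mult_word)
lemma rm_word [simp]: "rm v (fa_word w) = fa_word (w @ v)" by (simp add: rm_def fa_mult_word)

lemmas lin_simps = fa_linear_add fa_linear_diff fa_linear_scale fa_linear_0 fa_linear_sum

lemmas lrm_simps = lin_simps[OF lm_linear] lin_simps[OF rm_linear]

lemma fa_sum_apply: "(\<Sum>i\<in>S. (f i :: 'a fa)) w = (\<Sum>i\<in>S. f i w)"
  by (induction S rule: infinite_finite_induct) (auto simp: pw_simps)

definition wspan :: "'a set \<Rightarrow> 'a fa set" where "wspan A = fa.span (fa_word ` lists A)"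

lemma wspan_subspace: "fa.subspace (wspan A)" by (simp add: wspan_def)

lemma wspan_word: "w \<in> lists A \<Longrightarrow> fa_word w \<in> wspan A"
  unfolding wspan_def by (intro fa.span_base) auto

lemmas wspan_add = fa.subspace_add[OF wspan_subspace]
lemmas wspan_diff = fa.subspace_diff[OF wspan_subspace]
lemmas wspan_scale = fa.subspace_scale[OF wspan_subspace]
lemmas wspan_0 = fa.subspace_0[OF wspan_subspace]

lemma wspan_lift:
  assumes "fa_linear f" "fa.subspace S" "\<And>w. w \<in> lists A \<Longrightarrow> f (fa_word w) \<in> S" "x \<in> wspan A"
  shows "f x \<in> S"
  using fa_linear_span[OF assms(1,2)] assms(3,4) unfolding wspan_def by blast

lemma wspan_eq:
  assumes "fa_linear f" "fa_linear g" "\<And>w. w \<in> lists A \<Longrightarrow> f (fa_word w) = g (fa_word w)"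
    "x \<in> wspan A"
  shows "f x = g x"
  using fa_linear_eq_span[OF assms(1,2)] assms(3,4) unfolding wspan_def by blast

lemma lm_wspan: "u \<in> lists A \<Longrightarrow> x \<in> wspan A \<Longrightarrow> lm u x \<in> wspan A"
  by (rule wspan_lift[OF lm_linear wspan_subspace]) (auto intro!: wspan_word)

lemma rm_wspan: "u \<in> lists A \<Longrightarrow> x \<in> wspan A \<Longrightarrow> rm u x \<in> wspan A"
  by (rule wspan_lift[OF rm_linear wspan_subspace]) (auto intro!: wspan_word)

lemma lm_lm: "x \<in> wspan A \<Longrightarrow> lm u (lm v x) = lm (u @ v) x"
  by (rule wspan_eq[OF fa_linear_comp[OF lm_linear lm_linear] lm_linear]) auto

lemma rm_rm: "x \<in> wspan A \<Longrightarrow> rm u (rm v x) = rm (v @ u) x"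
  by (rule wspan_eq[OF fa_linear_comp[OF rm_linear rm_linear] rm_linear]) auto

lemma lm_rm: "x \<in> wspan A \<Longrightarrow> lm u (rm v x) = rm v (lm u x)"
  by (rule wspan_eq[OF fa_linear_comp[OF lm_linear rm_linear] fa_linear_comp[OF rm_linear lm_linear]])
    auto

lemma fa_supported_wspan: "fa_supported A x \<longleftrightarrow> x \<in> wspan A"
proof
  assume a: "fa_supported A x"
  have "x = (\<Sum>w\<in>{w. x w \<noteq> 0}. fa_scale (x w) (fa_word w))"
  proof
    fix v
    have "(\<Sum>w\<in>{w. x w \<noteq> 0}. fa_scale (x w) (fa_word w)) v
        = (\<Sum>w\<in>{w. x w \<noteq> 0}. if w = v then x w else 0)"
      by (subst fa_sum_apply) (auto intro!: sum.cong simp: fa_scale_def fa_word_def)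
    also have "\<dots> = x v" using a by (auto simp: fa_supported_def)
    finally show "x v = (\<Sum>w\<in>{w. x w \<noteq> 0}. fa_scale (x w) (fa_word w)) v" by simp
  qed
  also have "\<dots> \<in> wspan A"
    using a by (intro fa.subspace_sum[OF wspan_subspace] wspan_scale wspan_word)
      (auto simp: fa_supported_def)
  finally show "x \<in> wspan A" .
next
  assume "x \<in> wspan A"
  then show "fa_supported A x" unfolding wspan_def
  proof (induction rule: fa.span_induct_alt)
    case base
    then show ?case by (simp add: fa_supported_def pw_simps)
  next
    case (step c x y)
    then obtain u where u: "x = fa_word u" "u \<in> lists A" by auto
    have "{w. (fa_scale c x + y) w \<noteq> 0} \<subseteq> insert u {w. y w \<noteq> 0}"
      by (auto simp: u pw_simps fa_word_def split: if_splits)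
    moreover have "finite {w. y w \<noteq> 0}" "\<forall>w. y w \<noteq> 0 \<longrightarrow> w \<in> lists A"
      using step by (auto simp: fa_supported_def)
    ultimately show ?case using u(2) unfolding fa_supported_def
      by (metis (mono_tags, lifting) finite_insert finite_subset insertE mem_Collect_eq subsetD)
  qed
qed

lemma fa_ideal_subspace: "fa.subspace (fa_ideal A R)"
  by (auto simp: fa.subspace_def intro: fa_ideal.intros)

lemma ideal_lm: "x \<in> fa_ideal A R \<Longrightarrow> u \<in> lists A \<Longrightarrow> lm u x \<in> fa_ideal A R"
  unfolding lm_def by (rule fa_ideal.lmult)

lemma ideal_rm: "x \<in> fa_ideal A R \<Longrightarrow> u \<in> lists A \<Longrightarrow> rm u x \<in> fa_ideal A R"
  unfolding rm_def by (rule fa_ideal.rmult)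

lemma ideal_mult_right:
  assumes "r \<in> fa_ideal A R" "x \<in> wspan A"
  shows "fa_mult r x \<in> fa_ideal A R"
  by (rule wspan_lift[OF fa_mult_linear_right fa_ideal_subspace _ assms(2)])
    (use assms(1) in \<open>auto intro: fa_ideal.rmult\<close>)

lemma ideal_mult_left:
  assumes "r \<in> fa_ideal A R" "x \<in> wspan A"
  shows "fa_mult x r \<in> fa_ideal A R"
  by (rule wspan_lift[OF fa_mult_linear_left fa_ideal_subspace _ assms(2)])
    (use assms(1) in \<open>auto intro: fa_ideal.lmult\<close>)

text \<open>The inductive definition interleaves left and right factors. Relators in the span of
  words allow the factors to be collected on each side, and then a linear map has to be tested only
  on the products \<open>lm u (rm v r)\<close>, as in \<open>ideal_lift\<close>.\<close>

lemma ideal_span_eq: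
  assumes R: "R \<subseteq> wspan A"
  shows "fa_ideal A R = fa.span {lm u (rm v r) | u v r. u \<in> lists A \<and> v \<in> lists A \<and> r \<in> R}"
    (is "_ = fa.span ?B")
proof
  have l: "lm a (lm u (rm v r)) = lm (a @ u) (rm v r)" if "r \<in> R" "v \<in> lists A" for a u v r
    using that R by (intro lm_lm rm_wspan) auto
  have trl_rel: "rm a (lm u (rm v r)) = lm u (rm (v @ a) r)" if "r \<in> R" "v \<in> lists A" for a u v r
  proof -
    have r: "r \<in> wspan A" using that R by auto
    show ?thesis using lm_rm[OF rm_wspan[OF that(2) r], of u a] rm_rm[OF r, of a v] by simp
  qed
  show "fa_ideal A R \<subseteq> fa.span ?B"
  proof
    fix x assume "x \<in> fa_ideal A R"
    then show "x \<in> fa.span ?B"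
    proof induction
      case (base r)
      have "lm [] y = y" if "y \<in> wspan A" for y
        by (rule wspan_eq[OF lm_linear _ _ that]) (auto intro!: fa_linearI)
      moreover have "rm [] y = y" if "y \<in> wspan A" for y
        by (rule wspan_eq[OF rm_linear _ _ that]) (auto intro!: fa_linearI)
      ultimately have "r = lm [] (rm [] r)" using base R by auto
      then show ?case using base by (intro fa.span_base) blast
    next
      case (lmult x a)
      have "lm a x \<in> fa.span ?B"
      proof (rule fa_linear_span[OF lm_linear fa.subspace_span _ lmult(3)])
        fix y assume "y \<in> ?B"
        then obtain u v r where y: "y = lm u (rm v r)" "u \<in> lists A" "v \<in> lists A" "r \<in> R" by blast
        have "a @ u \<in> lists A" using y lmult(2) by simp
        then have "lm a y \<in> ?B" using y l[OF y(4,3), of a u] by blast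
        then show "lm a y \<in> fa.span ?B" by (rule fa.span_base)
      qed
      then show ?case by (simp add: lm_def)
    next
      case (rmult x a)
      have "rm a x \<in> fa.span ?B"
      proof (rule fa_linear_span[OF rm_linear fa.subspace_span _ rmult(3)])
        fix y assume "y \<in> ?B"
        then obtain u v r where y: "y = lm u (rm v r)" "u \<in> lists A" "v \<in> lists A" "r \<in> R" by blast
        have "v @ a \<in> lists A" using y rmult(2) by simp
        then have "rm a y \<in> ?B" using y trl_rel[OF y(4,3), of a u] by blast
        then show "rm a y \<in> fa.span ?B" by (rule fa.span_base)
      qed
      then show ?case by (simp add: rm_def)
    qed (auto intro: fa.span_zero fa.span_add fa.span_scale)
  qed
next
  show "fa.span ?B \<subseteq> fa_ideal A R"
    by (rule fa.span_minimal[OF _ fa_ideal_subspace])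
      (auto intro!: ideal_lm ideal_rm intro: fa_ideal.base)
qed

lemma ideal_lift:
  assumes "R \<subseteq> wspan A" "fa_linear f" "fa.subspace S" "x \<in> fa_ideal A R"
    "\<And>u v r. u \<in> lists A \<Longrightarrow> v \<in> lists A \<Longrightarrow> r \<in> R \<Longrightarrow> f (lm u (rm v r)) \<in> S"
  shows "f x \<in> S"
  by (rule fa_linear_span[OF assms(2,3) _ assms(4)[unfolded ideal_span_eq[OF assms(1)]]])
    (use assms(5) in auto)

lemma ideal_wspan: "R \<subseteq> wspan A \<Longrightarrow> fa_ideal A R \<subseteq> wspan A"
proof
  fix x assume R: "R \<subseteq> wspan A" and "x \<in> fa_ideal A R"
  from this(2) show "x \<in> wspan A"
  proof induction
    case (lmult x u)
    then show ?case using lm_wspan[of u A x] by (simp add: lm_def)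
  next
    case (rmult x u)
    then show ?case using rm_wspan[of u A x] by (simp add: rm_def)
  qed (use R in \<open>auto intro: wspan_add wspan_scale wspan_0\<close>)
qed

lemma ideal_sub:
  assumes "R \<subseteq> fa_ideal A R'" shows "fa_ideal A R \<subseteq> fa_ideal A R'"
proof
  fix x assume "x \<in> fa_ideal A R" then show "x \<in> fa_ideal A R'"
    by induction (use assms in \<open>auto intro: fa_ideal.intros\<close>)
qed

section \<open>Affine permutations\<close>

locale cyc =
  fixes n :: nat
  assumes n3: "n \<ge> 3"
begin

abbreviation N :: int where "N \<equiv> int n"

lemma N3: "N \<ge> 3" using n3 by simp

lemma dvd_shift: "N dvd x \<Longrightarrow> \<bar>k\<bar> < N \<Longrightarrow> k \<noteq> 0 \<Longrightarrow> \<not> N dvd x + k"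
  using zdvd_imp_le[of N k] zdvd_imp_le[of N "-k"] by (cases "k > 0") (auto simp: dvd_add_right_iff)

lemma not_dvd_small: "\<bar>k\<bar> < N \<Longrightarrow> k \<noteq> 0 \<Longrightarrow> \<not> N dvd k"
  using dvd_shift[of 0 k] by simp

text \<open>A simple reflection of the affine symmetric group, realised on the integers. The index
  is an integer that matters only modulo n, which keeps \<open>i - k\<close> free of
  reductions.\<close>

definition aswap :: "int \<Rightarrow> int \<Rightarrow> int" where
  "aswap i x = (if N dvd x - i then x + 1 else if N dvd x - (i + 1) then x - 1 else x)"

lemma aswap_cong: "N dvd i - j \<Longrightarrow> aswap i = aswap j"
proof
  fix x assume a: "N dvd i - j"
  have "N dvd x - i \<longleftrightarrow> N dvd x - j" for x
    using a dvd_add_right_iff[of N "i - j" "x - i"] by (simp add: algebra_simps)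
  moreover have "N dvd x - (i + 1) \<longleftrightarrow> N dvd x - (j + 1)"
    using a dvd_add_right_iff[of N "i - j" "x - (i+1)"] by (simp add: algebra_simps)
  ultimately show "aswap i x = aswap j x" by (simp add: aswap_def)
qed

lemma aswap_at:
  "aswap y y = y + 1" "aswap y (y + 1) = y" "aswap (y + 1) y = y" "aswap y (y + 2) = y + 2" "aswap y (y - 1) = y - 1"
  "aswap (y - 1) y = y - 1" "aswap (y - 1) (y - 1) = y" "aswap (y - 1) (y + 1) = y + 1"
  "aswap (y + 1) (y + 1) = y + 2" "aswap (y + 1) (y + 2) = y + 1"
  using N3 not_dvd_small[of 1] not_dvd_small[of "-1"] not_dvd_small[of 2] not_dvd_small[of "-2"]
  by (simp_all add: aswap_def algebra_simps)

lemma aswap_aswap [simp]: "aswap i (aswap i x) = x"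
proof -
  have a: "N dvd x - i \<Longrightarrow> \<not> N dvd x - i + 1" using dvd_shift[of "x - i" 1] N3 by simp
  have b: "N dvd x - (i + 1) \<Longrightarrow> N dvd x - 1 - i" by (simp add: algebra_simps)
  show ?thesis using a b by (auto simp: aswap_def algebra_simps)
qed

lemma aswap_o_aswap [simp]: "aswap i \<circ> aswap i = id" by auto

lemma aswap_bij [simp]: "bij (aswap i)"
  by (rule o_bij[of "aswap i"]) auto

lemma aswap_inv [simp]: "inv (aswap i) = aswap i"
  by (rule inv_unique_comp) auto

definition per :: "(int \<Rightarrow> int) \<Rightarrow> bool" where "per p \<longleftrightarrow> (\<forall>x. p (x + N) = p x + N)"

lemma per_mult: assumes "per p" shows "p (x + k * N) = p x + k * N"
proof (induction k rule: int_induct[where k = 0])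
  case base
  then show ?case by simp
next
  case (step1 i)
  have "p (x + i * N + N) = p (x + i * N) + N" using assms unfolding per_def by blast
  then show ?case using step1 by (simp add: algebra_simps)
next
  case (step2 i)
  have "p (x + (i - 1) * N + N) = p (x + (i - 1) * N) + N" using assms unfolding per_def by blast
  then show ?case using step2 by (simp add: algebra_simps)
qed

lemma per_cong: "per p \<Longrightarrow> N dvd x - y \<Longrightarrow> p x - p y = x - y"
proof -
  assume p: "per p" and "N dvd x - y"
  then obtain k where "x - y = N * k" by (auto simp: dvd_def)
  then have "x = y + k * N" by (simp add: algebra_simps)
  then show ?thesis using per_mult[OF p, of y k] by simp
qed

lemma per_step:
  assumes "per p" "N dvd a - b"
  shows "p a < p (a + 1) \<longleftrightarrow> p b < p (b + 1)" "p (a + 1) < p a \<longleftrightarrow> p (b + 1) < p b"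
proof -
  have "N dvd (a + 1) - (b + 1)" using assms(2) by simp
  from per_cong[OF assms(1) this] per_cong[OF assms]
  show "p a < p (a + 1) \<longleftrightarrow> p b < p (b + 1)" "p (a + 1) < p a \<longleftrightarrow> p (b + 1) < p b" by linarith+
qed

lemma aswap_per [simp]: "per (aswap i)"
  unfolding per_def aswap_def
proof
  fix x
  have "N dvd x + N - i \<longleftrightarrow> N dvd x - i" "N dvd x + N - (i + 1) \<longleftrightarrow> N dvd x - (i + 1)"
    using dvd_add_left_iff[of N N "x - i"] dvd_add_left_iff[of N N "x - (i+1)"]
    by (simp_all add: algebra_simps)
  then show "(if N dvd x + N - i then x + N + 1 else if N dvd x + N - (i + 1) then x + N - 1 else x + N)
      = (if N dvd x - i then x + 1 else if N dvd x - (i + 1) then x - 1 else x) + N"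
    by simp
qed

lemma per_comp [simp]: "per p \<Longrightarrow> per q \<Longrightarrow> per (p \<circ> q)" by (simp add: per_def)
lemma per_id [simp]: "per id" by (simp add: per_def)

lemma per_inv: "bij p \<Longrightarrow> per p \<Longrightarrow> per (inv p)"
  unfolding per_def by (metis bij_inv_eq_iff)

lemma aswap_braid: "aswap y \<circ> aswap (y + 1) \<circ> aswap y = aswap (y + 1) \<circ> aswap y \<circ> aswap (y + 1)"
proof
  fix x
  have nd: "\<not> N dvd k" if "k \<in> {1, -1, 2, -2}" for k using that N3 by (intro not_dvd_small) auto
  have r: "aswap j (z + k) = aswap j (y + k) + (z - y)" if "N dvd z - y" for j z k
    using per_cong[OF aswap_per, of "z + k" "y + k" j] that by simp
  consider "N dvd x - y" | "N dvd x - (y + 1)" | "N dvd x - (y + 2)"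
    | "\<not> N dvd x - y" "\<not> N dvd x - (y + 1)" "\<not> N dvd x - (y + 2)" by blast
  then show "(aswap y \<circ> aswap (y + 1) \<circ> aswap y) x = (aswap (y + 1) \<circ> aswap y \<circ> aswap (y + 1)) x"
  proof cases
    case 1
    have e: "aswap j (y + k + (x - y)) = aswap j (y + k) + (x - y)" for j k
      using r[OF 1, of j k] by (simp add: algebra_simps)
    show ?thesis using e[of _ 0] e[of _ 1] e[of _ 2] by (simp add: aswap_at)
  next
    case 2
    have "N dvd (x - 1) - y" using 2 by (simp add: algebra_simps)
    note R = r[OF this]
    have e: "aswap j (y + k + (x - 1 - y)) = aswap j (y + k) + (x - 1 - y)" for j k
      using R[of j k] by (simp add: algebra_simps)
    show ?thesis using e[of _ 0] e[of _ 1] e[of _ 2] by (simp add: aswap_at)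
  next
    case 3
    have "N dvd (x - 2) - y" using 3 by (simp add: algebra_simps)
    note R = r[OF this]
    have e: "aswap j (y + k + (x - 2 - y)) = aswap j (y + k) + (x - 2 - y)" for j k
      using R[of j k] by (simp add: algebra_simps)
    show ?thesis using e[of _ 0] e[of _ 1] e[of _ 2] by (simp add: aswap_at)
  next
    case 4
    then show ?thesis by (simp add: aswap_def algebra_simps)
  qed
qed

lemma aswap_commute:
  assumes "\<not> N dvd i - j" "\<not> N dvd i - j - 1" "\<not> N dvd j - i - 1"
  shows "aswap i \<circ> aswap j = aswap j \<circ> aswap i"
proof
  fix x
  define A where "A a z \<longleftrightarrow> N dvd z - a \<or> N dvd z - (a + 1)" for a z :: int
  have m: "N dvd b - a" if "N dvd z - a" "N dvd z - b" for a b z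
    using dvd_diff[OF that] by simp
  have dis: "\<not> (A i z \<and> A j z)" for z
    using m[of z i j] m[of z "i+1" j] m[of z "j+1" i] m[of z "i+1" "j+1"] assms
      dvd_diff_commute[of N i j]
    unfolding A_def by (auto simp: algebra_simps)
  have fx: "\<not> A a z \<Longrightarrow> aswap a z = z" for a z by (simp add: A_def aswap_def)
  have state: "A a z \<Longrightarrow> A a (aswap a z)" for a z by (auto simp: A_def aswap_def algebra_simps)
  show "(aswap i \<circ> aswap j) x = (aswap j \<circ> aswap i) x"
    using dis[of x] dis[of "aswap i x"] dis[of "aswap j x"] fx state by (cases "A i x"; cases "A j x") auto
qed

text \<open>The affine permutation of a reduced word, read so that prepending the letter i precomposes with
the reflection at i; the value is None exactly when the word is not reduced.\<close>

fun state :: "nat list \<Rightarrow> (int \<Rightarrow> int) option" where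
  "state [] = Some id"
| "state (i # w) = (case state w of None \<Rightarrow> None
      | Some p \<Rightarrow> if p (int i) < p (int i + 1) then Some (p \<circ> aswap (int i)) else None)"

definition aperm :: "(int \<Rightarrow> int) \<Rightarrow> bool" where "aperm p \<longleftrightarrow> bij p \<and> per p"

lemma aperm_aswap [simp]: "aperm (aswap i)" by (simp add: aperm_def)
lemma aperm_id [simp]: "aperm id" by (simp add: aperm_def)
lemma aperm_comp: "aperm p \<Longrightarrow> aperm q \<Longrightarrow> aperm (p \<circ> q)" by (auto simp: aperm_def bij_comp)
lemma aperm_inv: "aperm p \<Longrightarrow> aperm (inv p)" by (auto simp: aperm_def bij_imp_bij_inv per_inv)
lemma aperm_inj: "aperm p \<Longrightarrow> p x = p y \<longleftrightarrow> x = y" by (auto simp: aperm_def bij_def inj_eq)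

lemma state_aperm: "state w = Some p \<Longrightarrow> aperm p"
  by (induction w arbitrary: p) (auto split: option.splits if_splits intro: aperm_comp)

lemma state_per: "state w = Some p \<Longrightarrow> per p" using state_aperm aperm_def by blast

text \<open>Any integer \<open>y\<close> in the class of the letter may represent it. This removes
  the case distinction at the step from n - 1 back to 0.\<close>

lemma state_Cons:
  assumes "state w = Some q" "N dvd int j - y"
  shows "state (j # w) = (if q y < q (y + 1) then Some (q \<circ> aswap y) else None)"
proof -
  have "q (int j) - q y = int j - y" "q (int j + 1) - q (y + 1) = int j - y"
    using per_cong[OF state_per[OF assms(1)], of "int j" y]
      per_cong[OF state_per[OF assms(1)], of "int j + 1" "y + 1"] assms(2) by auto
  then show ?thesis using assms aswap_cong[OF assms(2)] by simp
qed

lemma dvd_nat_eq: "i < n \<Longrightarrow> j < n \<Longrightarrow> N dvd int i - int j \<longleftrightarrow> i = j"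
  using not_dvd_small[of "int i - int j"] by (cases "i = j") (simp_all add: abs_less_iff)

lemma dvd_nat_Suc:
  assumes "i < n" "j < n"
  shows "N dvd int j - int i - 1 \<longleftrightarrow> j = (i + 1) mod n"
proof (cases "i + 1 = n")
  case True
  then have e: "int j - int i - 1 = int j - N" by simp
  have "N dvd int j - int i - 1 \<longleftrightarrow> N dvd int j - int 0" unfolding e using dvd_diff_left_iff[of N N "int j"] by simp
  then show ?thesis using dvd_nat_eq[of j 0] assms True by simp
next
  case False
  then show ?thesis using dvd_nat_eq[of j "i + 1"] assms by (simp add: algebra_simps)
qed

section \<open>The affine nil-Coxeter congruence on words\<close>

abbreviation letters :: "nat list set" where "letters \<equiv> lists {0..<n}"

definition nil :: "nat fa set" where "nil = fa_ideal {0..<n} (nilcox_rels n)"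

definition wcong :: "nat list \<Rightarrow> nat list \<Rightarrow> bool" where
  "wcong u v \<longleftrightarrow> fa_word u - fa_word v \<in> nil"

lemma nilcox_rels_words:
  "nilcox_rels n = {fa_word [i, i] | i. i < n}
   \<union> {fa_word [i, j] - fa_word [j, i] | i j. i < n \<and> j < n \<and> i \<noteq> (j + 1) mod n \<and> j \<noteq> (i + 1) mod n}
   \<union> {fa_word [i, (i + 1) mod n, i] - fa_word [(i + 1) mod n, i, (i + 1) mod n] | i. i < n}"
  unfolding nilcox_rels_def braid_rels_def ee_def fa_mult_word by simp

lemma nilcox_wspan: "nilcox_rels n \<subseteq> wspan {0..<n}"
  unfolding nilcox_rels_words by (auto intro!: wspan_diff wspan_word)

lemma nil_subspace: "fa.subspace nil" unfolding nil_def by (rule fa_ideal_subspace)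

lemmas nil_add = fa.subspace_add[OF nil_subspace]
lemmas nil_diff = fa.subspace_diff[OF nil_subspace]
lemmas nil_0 = fa.subspace_0[OF nil_subspace]

lemma nil_lm: "x \<in> nil \<Longrightarrow> u \<in> letters \<Longrightarrow> lm u x \<in> nil"
  unfolding nil_def by (rule ideal_lm)
lemma nil_rm: "x \<in> nil \<Longrightarrow> u \<in> letters \<Longrightarrow> rm u x \<in> nil"
  unfolding nil_def by (rule ideal_rm)

lemma wcong_refl [simp]: "wcong u u" by (simp add: wcong_def nil_0)
lemma wcong_sym: "wcong u v \<Longrightarrow> wcong v u"
  using fa.subspace_neg[OF nil_subspace] by (force simp: wcong_def)
lemma wcong_trans [trans]: "wcong u v \<Longrightarrow> wcong v w \<Longrightarrow> wcong u w"
  unfolding wcong_def using nil_add[of "fa_word u - fa_word v" "fa_word v - fa_word w"] by simp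

lemma wcong_app: "wcong u v \<Longrightarrow> x \<in> letters \<Longrightarrow> wcong (x @ u) (x @ v)"
  using nil_lm[of "fa_word u - fa_word v" x] by (simp add: wcong_def lrm_simps)
lemma wcong_app2: "wcong u v \<Longrightarrow> x \<in> letters \<Longrightarrow> wcong (u @ x) (v @ x)"
  using nil_rm[of "fa_word u - fa_word v" x] by (simp add: wcong_def lrm_simps)
lemma wcong_Cons: "wcong u v \<Longrightarrow> i < n \<Longrightarrow> wcong (i # u) (i # v)"
  using wcong_app[of u v "[i]"] by simp

lemma wcong_nil: "wcong u v \<Longrightarrow> fa_word v \<in> nil \<Longrightarrow> fa_word u \<in> nil"
  unfolding wcong_def using nil_add by fastforce

lemma word_sq: assumes "i < n" "w \<in> letters" shows "fa_word (i # i # w) \<in> nil"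
proof -
  have "fa_word [i, i] \<in> nilcox_rels n" using assms unfolding nilcox_rels_words by blast
  then have "fa_word [i,i] \<in> nil" unfolding nil_def by (rule fa_ideal.base)
  from nil_rm[OF this assms(2)] show ?thesis by simp
qed

lemma wcong_comm:
  assumes "i < n" "j < n" "i \<noteq> (j + 1) mod n" "j \<noteq> (i + 1) mod n" "w \<in> letters"
  shows "wcong (i # j # w) (j # i # w)"
proof -
  have "fa_word [i, j] - fa_word [j, i] \<in> nilcox_rels n"
    using assms unfolding nilcox_rels_words by blast
  then have "wcong [i, j] [j, i]" unfolding nil_def wcong_def by (rule fa_ideal.base)
  from wcong_app2[OF this assms(5)] show ?thesis by simp
qed

lemma wcong_braid:
  assumes "i < n" "j < n" "j = (i + 1) mod n" "w \<in> letters"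
  shows "wcong (i # j # i # w) (j # i # j # w)"
proof -
  have "fa_word [i, j, i] - fa_word [j, i, j] \<in> nilcox_rels n"
    using assms unfolding nilcox_rels_words by blast
  then have "wcong [i, j, i] [j, i, j]" unfolding nil_def wcong_def by (rule fa_ideal.base)
  from wcong_app2[OF this assms(4)] show ?thesis by simp
qed

text \<open>Exchange property. If the first letter \<open>j\<close> is neither equal to
  \<open>i\<close> nor a neighbour of it, it commutes past the \<open>i\<close> supplied by
  induction. A neighbour needs induction twice: it brings the word to the shape
  \<open>j # i # j # u''\<close>, and the braid relation moves \<open>i\<close> to the
  front.\<close>

lemma exchange:
  assumes "w \<in> letters" "state w = Some p" "i < n" "p (int i) > p (int i + 1)"
  shows "\<exists>w'\<in>letters. state w' = Some (p \<circ> aswap (int i)) \<and> Suc (length w') = length w \<and> wcong w (i # w')"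
  using assms
proof (induction "length w" arbitrary: w p i rule: less_induct)
  case less
  note IH = less.hyps
  obtain j u where w: "w = j # u" using less.prems by (cases w) auto
  then obtain q where q: "state u = Some q" "q (int j) < q (int j + 1)" "p = q \<circ> aswap (int j)"
    using less.prems by (auto split: option.splits if_splits)
  have j: "j < n" and u: "u \<in> letters" using less.prems w by auto
  have ql: "length u < length w" using w by simp
  let ?i = "int i"
  consider "j = i" | "j \<noteq> i" "j \<noteq> (i + 1) mod n" "i \<noteq> (j + 1) mod n"
    | "j = (i + 1) mod n" "j \<noteq> i" | "i = (j + 1) mod n" "j \<noteq> i" by blast
  then show ?case
  proof cases
    case 1
    have "p \<circ> aswap ?i = q" using q 1 by (simp add: comp_assoc)
    then show ?thesis using q w u 1 by (intro bexI[of _ u]) auto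
  next
    case 2
    have nd: "\<not> N dvd int j - ?i" "\<not> N dvd ?i - int j" "\<not> N dvd int j - ?i - 1" "\<not> N dvd ?i - int j - 1"
      using 2 dvd_nat_eq[OF j less.prems(3)] dvd_nat_eq[OF less.prems(3) j]
        dvd_nat_Suc[OF less.prems(3) j] dvd_nat_Suc[OF j less.prems(3)] by auto
    have f: "aswap a b = b" if "\<not> N dvd a - b" "\<not> N dvd b - a - 1" for a b
      using that by (simp add: aswap_def dvd_diff_commute[of N b a] algebra_simps)
    have f1: "aswap a (b + 1) = b + 1" if "\<not> N dvd a - b" "\<not> N dvd a - b - 1" for a b
    proof -
      have "\<not> N dvd (b + 1) - a" using that(2) dvd_diff_commute[of N "b+1" a] by (simp add: algebra_simps)
      moreover have "\<not> N dvd (b + 1) - (a + 1)" using that(1) dvd_diff_commute[of N b a] by simp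
      ultimately show ?thesis by (simp add: aswap_def)
    qed
    have "q ?i > q (?i + 1)" using less.prems(4) q(3) f[of "int j" ?i] f1[of "int j" ?i] nd by simp
    from IH[OF ql u q(1) less.prems(3) this] obtain u' where
      u': "u' \<in> letters" "state u' = Some (q \<circ> aswap ?i)" "Suc (length u') = length u" "wcong u (i # u')" by blast
    have c: "aswap ?i \<circ> aswap (int j) = aswap (int j) \<circ> aswap ?i"
      by (rule aswap_commute) (use nd in auto)
    have "state (j # u') = Some (q \<circ> aswap ?i \<circ> aswap (int j))"
      using u'(2) q(2) f[of ?i "int j"] f1[of ?i "int j"] nd by simp
    also have "\<dots> = Some (p \<circ> aswap ?i)" using q(3) c by (simp add: comp_assoc)
    finally have s: "state (j # u') = Some (p \<circ> aswap ?i)" .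
    have "wcong w (j # i # u')" unfolding w using u'(4) j by (rule wcong_Cons)
    also have "wcong (j # i # u') (i # j # u')" using 2 j less.prems(3) u'(1) by (intro wcong_comm) auto
    finally show ?thesis using s u' j w by (intro bexI[of _ "j # u'"]) auto
  next
    case 3
    have d: "N dvd int j - (?i + 1)" using dvd_nat_Suc[OF less.prems(3) j] 3 by (simp add: algebra_simps)
    have swj: "aswap (int j) = aswap (?i + 1)" by (rule aswap_cong[OF d])
    have up: "q (?i + 1) < q (?i + 2)"
      using state_Cons[OF q(1) d] w less.prems(2) by (auto split: if_splits simp del: state.simps simp: add.assoc)
    have p: "p ?i = q ?i" "p (?i + 1) = q (?i + 2)" unfolding q(3) swj by (simp_all only: comp_apply aswap_at(3,9))
    \<comment> \<open>The value at \<open>i\<close> exceeds the next two, so \<open>i\<close> is a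
      descent of \<open>q\<close>, and \<open>j\<close> is a descent of what remains after
      \<open>i\<close> is removed.\<close>
    from p less.prems(4) up have h: "q ?i > q (?i + 1)" "q ?i > q (?i + 2)" by auto
    from IH[OF ql u q(1) less.prems(3) h(1)] obtain u' where
      u': "u' \<in> letters" "state u' = Some (q \<circ> aswap ?i)" "Suc (length u') = length u" "wcong u (i # u')" by blast
    have lt: "length u' < length w" using u'(3) ql by simp
    have ds: "(q \<circ> aswap ?i) (int j) > (q \<circ> aswap ?i) (int j + 1)"
    proof -
      have e: "?i + 1 + 1 = ?i + 2" by simp
      have "(q \<circ> aswap ?i) (?i + 1) > (q \<circ> aswap ?i) (?i + 1 + 1)"
        unfolding e using h by (simp only: comp_apply aswap_at(2,4))
      then show ?thesis using per_step(2)[OF state_per[OF u'(2)] d] by blast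
    qed
    from IH[OF lt u'(1,2) j ds] obtain u'' where
      u'': "u'' \<in> letters" "state u'' = Some (q \<circ> aswap ?i \<circ> aswap (int j))" "Suc (length u'') = length u'" "wcong u' (j # u'')" by blast
    let ?q = "q \<circ> aswap ?i \<circ> aswap (?i + 1)"
    have s1: "state (i # u'') = Some (?q \<circ> aswap ?i)"
    proof -
      have z: "N dvd ?i - ?i" by simp
      show ?thesis unfolding state_Cons[OF u''(2) z] swj using up
        by (simp only: comp_apply aswap_at(1,3,4,9) if_True add.assoc one_add_one)
    qed
    have s2: "state (j # i # u'') = Some (?q \<circ> aswap ?i \<circ> aswap (?i + 1))"
    proof -
      have e: "?i + 1 + 1 = ?i + 2" by simp
      show ?thesis unfolding state_Cons[OF s1 d] e using h
        by (simp only: comp_apply aswap_at(1,2,3,4,10) if_True add.assoc one_add_one)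
    qed
    have "?q \<circ> aswap ?i \<circ> aswap (?i + 1) = q \<circ> (aswap ?i \<circ> aswap (?i + 1) \<circ> aswap ?i) \<circ> aswap (?i + 1)" by (simp add: comp_assoc)
    also have "\<dots> = p \<circ> aswap ?i" unfolding aswap_braid q(3) swj by (simp add: comp_assoc)
    finally have s: "state (j # i # u'') = Some (p \<circ> aswap ?i)" using s2 by simp
    have "wcong w (j # i # u')" unfolding w using u'(4) j by (rule wcong_Cons)
    also have "wcong (j # i # u') (j # i # j # u'')" using u''(4) j less.prems(3) by (intro wcong_Cons)
    also have "wcong (j # i # j # u'') (i # j # i # u'')"
      using 3 j less.prems(3) u''(1) by (intro wcong_sym[OF wcong_braid]) auto
    finally show ?thesis using s u' u'' j w less.prems(3) by (intro bexI[of _ "j # i # u''"]) auto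
  next
    case 4
    have d: "N dvd int j - (?i - 1)"
      using dvd_nat_Suc[OF j less.prems(3)] 4 dvd_diff_commute[of N "int j" "?i - 1"] by (simp add: algebra_simps)
    have swj: "aswap (int j) = aswap (?i - 1)" by (rule aswap_cong[OF d])
    have up: "q (?i - 1) < q ?i"
      using state_Cons[OF q(1) d] w less.prems(2) by (auto split: if_splits)
    have p: "p ?i = q (?i - 1)" "p (?i + 1) = q (?i + 1)" using q(3) swj by (simp_all add: aswap_at)
    from p less.prems(4) up have h: "q ?i > q (?i + 1)" "q (?i - 1) > q (?i + 1)" by auto
    from IH[OF ql u q(1) less.prems(3) h(1)] obtain u' where
      u': "u' \<in> letters" "state u' = Some (q \<circ> aswap ?i)" "Suc (length u') = length u" "wcong u (i # u')" by blast
    have lt: "length u' < length w" using u'(3) ql by simp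
    have ds: "(q \<circ> aswap ?i) (int j) > (q \<circ> aswap ?i) (int j + 1)"
    proof -
      have "(q \<circ> aswap ?i) (?i - 1) > (q \<circ> aswap ?i) ?i" using h by (simp add: aswap_at)
      then show ?thesis using per_step(2)[OF state_per[OF u'(2)] d] by simp
    qed
    from IH[OF lt u'(1,2) j ds] obtain u'' where
      u'': "u'' \<in> letters" "state u'' = Some (q \<circ> aswap ?i \<circ> aswap (int j))" "Suc (length u'') = length u'" "wcong u' (j # u'')" by blast
    let ?q = "q \<circ> aswap ?i \<circ> aswap (?i - 1)"
    have s1: "state (i # u'') = Some (?q \<circ> aswap ?i)"
    proof -
      have z: "N dvd ?i - ?i" by simp
      show ?thesis unfolding state_Cons[OF u''(2) z] swj using up
        by (simp only: comp_apply aswap_at(2,5,6,8) if_True diff_add_cancel)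
    qed
    have s2: "state (j # i # u'') = Some (?q \<circ> aswap ?i \<circ> aswap (?i - 1))"
    proof -
      have e: "?i - 1 + 1 = ?i" by simp
      show ?thesis unfolding state_Cons[OF s1 d] e using h
        by (simp only: comp_apply aswap_at(1,2,5,7,8) if_True diff_add_cancel)
    qed
    have b: "aswap ?i \<circ> aswap (?i - 1) \<circ> aswap ?i = aswap (?i - 1) \<circ> aswap ?i \<circ> aswap (?i - 1)"
      using aswap_braid[of "?i - 1"] by simp
    have "?q \<circ> aswap ?i \<circ> aswap (?i - 1) = q \<circ> (aswap ?i \<circ> aswap (?i - 1) \<circ> aswap ?i) \<circ> aswap (?i - 1)" by (simp add: comp_assoc)
    also have "\<dots> = p \<circ> aswap ?i" unfolding b q(3) swj by (simp add: comp_assoc)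
    finally have s: "state (j # i # u'') = Some (p \<circ> aswap ?i)" using s2 by simp
    have "wcong w (j # i # u')" unfolding w using u'(4) j by (rule wcong_Cons)
    also have "wcong (j # i # u') (j # i # j # u'')" using u''(4) j less.prems(3) by (intro wcong_Cons)
    also have "wcong (j # i # j # u'') (i # j # i # u'')"
      using 4 j less.prems(3) u''(1) by (intro wcong_braid) auto
    finally show ?thesis using s u' u'' j w less.prems(3) by (intro bexI[of _ "j # i # u''"]) auto
  qed
qed

text \<open>Matsumoto's theorem for this group: the first letter of \<open>u\<close> is a descent of
  \<open>p\<close>, and \<open>exchange\<close> brings it to the front of \<open>v\<close>.\<close>

theorem state_eq_wcong:
  "u \<in> letters \<Longrightarrow> v \<in> letters \<Longrightarrow> state u = Some p \<Longrightarrow> state v = Some p \<Longrightarrow> wcong u v"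
proof (induction u arbitrary: v p)
  case Nil
  then have pid: "state v = Some id" by (simp only: state.simps)
  have "v = []"
  proof (cases v)
    case (Cons i u)
    then obtain q where q: "q (int i) < q (int i + 1)" "q \<circ> aswap (int i) = id"
      using pid by (auto split: option.splits if_splits)
    from fun_cong[OF q(2), of "int i"] fun_cong[OF q(2), of "int i + 1"]
    have "q (int i + 1) = int i" "q (int i) = int i + 1" by (simp_all add: aswap_at)
    then show ?thesis using q(1) by simp
  qed
  then show ?case by simp
next
  case (Cons i u)
  then obtain q where q: "state u = Some q" "q (int i) < q (int i + 1)" "p = q \<circ> aswap (int i)"
    by (auto split: option.splits if_splits)
  have "p (int i) > p (int i + 1)" using q by (simp add: aswap_at)
  from exchange[OF Cons.prems(2,4) _ this] Cons.prems(1) obtain v' where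
    v': "v' \<in> letters" "state v' = Some (p \<circ> aswap (int i))" "wcong v (i # v')" by auto
  have "state v' = Some q" using v'(2) q(3) by (simp add: comp_assoc)
  from Cons.IH[OF _ v'(1) q(1) this] Cons.prems(1) have "wcong u v'" by simp
  then have "wcong (i # u) (i # v')" using Cons.prems(1) by (intro wcong_Cons) auto
  then show ?case using v'(3) wcong_sym wcong_trans by blast
qed

text \<open>The first letter that breaks reducedness, read from the right, is a descent of the
  reduced word behind it; \<open>exchange\<close> then exposes a repeated letter.\<close>

theorem state_None_nil: "w \<in> letters \<Longrightarrow> state w = None \<Longrightarrow> fa_word w \<in> nil"
proof (induction w)
  case (Cons i w)
  show ?case
  proof (cases "state w")
    case None
    then have "fa_word w \<in> nil" using Cons by simp
    from nil_lm[OF this, of "[i]"] show ?thesis using Cons.prems by simp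
  next
    case (Some p)
    then have "\<not> p (int i) < p (int i + 1)" using Cons.prems by (auto split: if_splits)
    moreover have "p (int i) \<noteq> p (int i + 1)" using aperm_inj[OF state_aperm[OF Some]] by simp
    ultimately have "p (int i) > p (int i + 1)" by linarith
    from exchange[OF _ Some _ this] Cons.prems obtain w' where
      w': "w' \<in> letters" "wcong w (i # w')" by auto
    have "wcong (i # w) (i # i # w')" using w'(2) Cons.prems by (intro wcong_Cons) auto
    then show ?thesis using word_sq[OF _ w'(1)] Cons.prems wcong_nil by auto
  qed
qed simp


section \<open>Length, reduced words and right multiplication\<close>

lemma N_pos: "N > 0" using N3 by simp

lemma div_succ: assumes "\<not> N dvd x + 1" shows "(x + 1) div N = x div N"
proof -
  have "x mod N \<noteq> N - 1"
  proof
    assume a: "x mod N = N - 1"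
    have "x + 1 = N * (x div N) + (x mod N + 1)" using div_mult_mod_eq[of x N] by simp
    also have "\<dots> = N * (x div N + 1)" unfolding a by (simp add: algebra_simps)
    finally show False using assms by simp
  qed
  moreover have "0 \<le> x mod N" "x mod N < N" using N_pos by auto
  moreover have "x + 1 = N * (x div N) + (x mod N + 1)" using div_mult_mod_eq[of x N] by simp
  ultimately show ?thesis by (intro int_div_pos_eq[where r = "x mod N + 1"]) linarith+
qed

lemma div_pred: "\<not> N dvd x \<Longrightarrow> (x - 1) div N = x div N"
  using div_succ[of "x - 1"] by simp

definition wcls :: "int \<Rightarrow> int" where "wcls z = (z - 1) mod N + 1"

lemma wcls_range: "1 \<le> wcls z" "wcls z \<le> N"
  using N_pos pos_mod_bound[of N "z - 1"] pos_mod_sign[of N "z - 1"] unfolding wcls_def by linarith+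

lemma wcls_dvd: "N dvd z - wcls z"
proof -
  have "z - wcls z = (z - 1) - (z - 1) mod N" by (simp add: wcls_def)
  then show ?thesis by (metis dvd_minus_mod)
qed

lemma small_eq: "N dvd a - b \<Longrightarrow> \<bar>a - b\<bar> < N \<Longrightarrow> a = b"
  using not_dvd_small[of "a - b"] by force

lemma wcls_eqI: "N dvd z - c \<Longrightarrow> 1 \<le> c \<Longrightarrow> c \<le> N \<Longrightarrow> wcls z = c"
proof (rule small_eq)
  assume a: "N dvd z - c" "1 \<le> c" "c \<le> N"
  show "N dvd wcls z - c" using dvd_diff[OF a(1) wcls_dvd[of z]] by simp
  show "\<bar>wcls z - c\<bar> < N" using wcls_range[of z] a by linarith
qed

lemma wcls_id: "1 \<le> c \<Longrightarrow> c \<le> N \<Longrightarrow> wcls c = c" by (rule wcls_eqI) auto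

lemma aperm_dvd_iff: assumes "aperm p" shows "N dvd p x - p y \<longleftrightarrow> N dvd x - y"
proof
  assume "N dvd x - y"
  then show "N dvd p x - p y" using per_cong[of p x y] assms by (simp add: aperm_def)
next
  assume "N dvd p x - p y"
  then have "inv p (p x) - inv p (p y) = p x - p y"
    using per_cong[of "inv p"] aperm_inv[OF assms] by (simp add: aperm_def)
  moreover have "inv p (p z) = z" for z using assms by (simp add: aperm_def bij_is_inj)
  ultimately show "N dvd x - y" using \<open>N dvd p x - p y\<close> by simp
qed

lemma aperm_inv_f [simp]: "aperm p \<Longrightarrow> inv p (p z) = z" by (simp add: aperm_def bij_is_inj)
lemma aperm_f_inv [simp]: "aperm p \<Longrightarrow> p (inv p z) = z" by (simp add: aperm_def bij_is_surj surj_f_inv_f)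
lemma aperm_inv_inv: "aperm p \<Longrightarrow> inv (inv p) = p" by (simp add: aperm_def inv_inv_eq)
lemma aperm_inv_aswap: "aperm p \<Longrightarrow> inv (p \<circ> aswap y) = aswap y \<circ> inv p"
  by (simp add: aperm_def o_inv_distrib)
lemma aperm_inv_sw2: "aperm p \<Longrightarrow> inv (aswap y \<circ> p) = inv p \<circ> aswap y"
  by (simp add: aperm_def o_inv_distrib)
lemma aperm_cong: "aperm p \<Longrightarrow> N dvd x - y \<Longrightarrow> p x - p y = x - y"
  using per_cong aperm_def by blast
lemma aperm_add: "aperm p \<Longrightarrow> p (x + N * k) = p x + N * k"
  using aperm_cong[of p "x + N * k" x] by simp

definition window_pairs :: "(int \<times> int) set" where "window_pairs = {(a, b). 1 \<le> a \<and> a < b \<and> b \<le> N}"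

lemma finite_window_pairs [simp]: "finite window_pairs"
  by (rule finite_subset[of _ "{1..N} \<times> {1..N}"]) (auto simp: window_pairs_def)

text \<open>Shi's formula for the Coxeter length.\<close>

definition ell :: "(int \<Rightarrow> int) \<Rightarrow> int" where
  "ell p = (\<Sum>(a, b)\<in>window_pairs. \<bar>(inv p b - inv p a) div N\<bar>)"

lemma ell_nonneg: "ell p \<ge> 0" unfolding ell_def by (intro sum_nonneg) auto

lemma ell_id: "ell id = 0"
  unfolding ell_def by (intro sum.neutral) (auto simp: window_pairs_def div_pos_pos_trivial)

text \<open>Passing to \<open>p \<circ> aswap y\<close> changes the inverse only in the classes of
  \<open>p y\<close> and \<open>p (y + 1)\<close>, by one each. For the pair formed by these two
  classes the quotient in Shi's formula grows by one in absolute value; for every other pair the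
  difference crosses no multiple of n.\<close>

lemma ell_up:
  assumes p: "aperm p" and up: "p y < p (y + 1)"
  shows "ell (p \<circ> aswap y) = ell p + 1"
proof -
  define v where "v = inv p"
  have v: "aperm v" unfolding v_def using p by (rule aperm_inv)
  have pv: "p (v z) = z" "v (p z) = z" for z using p by (simp_all add: v_def)
  define al be where "al = wcls (p y)" and "be = wcls (p (y + 1))"
  have ra: "1 \<le> al" "al \<le> N" "1 \<le> be" "be \<le> N" unfolding al_def be_def using wcls_range by auto
  obtain A where A: "p y = al + N * A" using wcls_dvd[of "p y"] unfolding al_def
    by (metis add_diff_cancel_left' add_diff_eq dvd_def diff_add_cancel add.commute)
  obtain B where B: "p (y + 1) = be + N * B" using wcls_dvd[of "p (y + 1)"] unfolding be_def
    by (metis add_diff_cancel_left' add_diff_eq dvd_def diff_add_cancel add.commute)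
  have va: "v al = y - N * A" using aperm_add[OF v, of al A] pv(2)[of y] A by simp
  have vb: "v be = y + 1 - N * B" using aperm_add[OF v, of be B] pv(2)[of "y + 1"] B by simp
  have ia: "N dvd v c - y \<longleftrightarrow> c = al" if "1 \<le> c" "c \<le> N" for c
  proof
    assume "N dvd v c - y"
    then have "N dvd v c - y + N * A" by simp
    also have "v c - y + N * A = v c - v al" using va by simp
    finally have "N dvd v c - v al" .
    then have "N dvd c - al" using aperm_dvd_iff[OF v] by simp
    then show "c = al" using ra that by (intro small_eq) (auto simp: abs_less_iff)
  qed (simp add: va)
  have ib: "N dvd v c - (y + 1) \<longleftrightarrow> c = be" if "1 \<le> c" "c \<le> N" for c
  proof
    assume "N dvd v c - (y + 1)"
    then have "N dvd v c - (y + 1) + N * B" by simp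
    also have "v c - (y + 1) + N * B = v c - v be" using vb by simp
    finally have "N dvd c - be" using aperm_dvd_iff[OF v] by simp
    then show "c = be" using ra that by (intro small_eq) (auto simp: abs_less_iff)
  qed (simp add: vb)
  have ab: "al \<noteq> be"
  proof
    assume "al = be"
    then have "N dvd p y - p (y + 1)" using A B by (simp flip: right_diff_distrib)
    then have "N dvd y - (y + 1)" using aperm_dvd_iff[OF p] by blast
    then show False using not_dvd_small[of "-1"] N3 by simp
  qed
  have sv: "aswap y (v c) = v c + (if c = al then 1 else 0) - (if c = be then 1 else 0)"
    if "1 \<le> c" "c \<le> N" for c
    using ia[OF that] ib[OF that] ab by (auto simp: aswap_def)
  define f where "f = (\<lambda>(a, b). \<bar>(v b - v a) div N\<bar>)"
  define g where "g = (\<lambda>(a, b). \<bar>(aswap y (v b) - aswap y (v a)) div N\<bar>)"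
  define t where "t = (min al be, max al be)"
  have tau_pair: "t \<in> window_pairs" using ra ab by (auto simp: t_def window_pairs_def min_def max_def)
  have other: "g s = f s" if s: "s \<in> window_pairs" "s \<noteq> t" for s
  proof -
    obtain a b where sab: "s = (a, b)" by force
    then have r: "1 \<le> a" "a \<le> N" "1 \<le> b" "b \<le> N" "a < b" using s by (auto simp: window_pairs_def)
    have ndv: "\<not> N dvd v b - v a"
    proof
      assume "N dvd v b - v a"
      then have "N dvd b - a" using aperm_dvd_iff[OF v] by simp
      then show False using not_dvd_small[of "b - a"] r by simp
    qed
    have np: "\<not> N dvd v b - v a + 1" if "b = al" "a \<noteq> be"
    proof
      assume "N dvd v b - v a + 1"
      then have "N dvd v a - (y + 1)" using that va dvd_diff_commute[of N "v a" "y + 1"]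
          dvd_diff_left_iff[of N "N * A" "y + 1 - v a"] by (simp add: algebra_simps)
      then show False using ib r that by auto
    qed
    have np2: "\<not> N dvd v b - v a + 1" if "a = be" "b \<noteq> al"
    proof
      assume "N dvd v b - v a + 1"
      then have "N dvd v b - y" using that vb
          dvd_add_left_iff[of N "N * B" "v b - y"] by (simp add: algebra_simps)
      then show False using ia r that by auto
    qed
    consider "a = al" "b \<noteq> be" | "a = be" "b \<noteq> al" | "b = al" "a \<noteq> be" | "b = be" "a \<noteq> al"
      | "a \<noteq> al" "a \<noteq> be" "b \<noteq> al" "b \<noteq> be"
      using s(2) ab r sab unfolding t_def by (auto simp: min_def max_def split: if_splits)
    then show ?thesis
    proof cases
      case 1
      then have "aswap y (v b) - aswap y (v a) = v b - v a - 1" using sv[of a] sv[of b] r ab by simp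
      then show ?thesis using div_pred[OF ndv] by (simp only: g_def f_def sab prod.case)
    next
      case 2
      then have "aswap y (v b) - aswap y (v a) = v b - v a + 1" using sv[of a] sv[of b] r ab by simp
      then show ?thesis using div_succ[OF np2[OF 2]] by (simp only: g_def f_def sab prod.case)
    next
      case 3
      then have "aswap y (v b) - aswap y (v a) = v b - v a + 1" using sv[of a] sv[of b] r ab by simp
      then show ?thesis using div_succ[OF np[OF 3]] by (simp only: g_def f_def sab prod.case)
    next
      case 4
      then have "aswap y (v b) - aswap y (v a) = v b - v a - 1" using sv[of a] sv[of b] r ab by simp
      then show ?thesis using div_pred[OF ndv] by (simp only: g_def f_def sab prod.case)
    next
      case 5
      then show ?thesis using sv[of a] sv[of b] r by (simp add: g_def f_def sab)
    qed
  qed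
  have gt: "g t = f t + 1"
  proof (cases "be < al")
    case True
    have "N * (B - A) > al - be" using up A B by (simp add: algebra_simps)
    then have "N * (B - A) > 0" using True by linarith
    then have K: "B - A \<ge> 1" using N_pos by (simp add: zero_less_mult_iff)
    have 1: "(v al - v be) div N = B - A - 1"
      by (rule int_div_pos_eq[where r = "N - 1"]) (use va vb N3 in \<open>auto simp: algebra_simps\<close>)
    have 2: "(v al + 1 - (v be - 1)) div N = B - A"
      by (rule int_div_pos_eq[where r = 1]) (use va vb N3 in \<open>auto simp: algebra_simps\<close>)
    show ?thesis using True 1 2 K sv[of al] sv[of be] ra ab by (simp add: t_def f_def g_def)
  next
    case False
    have "N * (B - A) > al - be" using up A B by (simp add: algebra_simps)
    then have "N * (B - A) > - N" using ra by linarith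
    then have "N * (B - A + 1) > 0" by (simp add: algebra_simps)
    then have K: "B - A \<ge> 0" using N_pos by (simp add: zero_less_mult_iff)
    have 1: "(v be - v al) div N = - (B - A)"
      by (rule int_div_pos_eq[where r = 1]) (use va vb N3 in \<open>auto simp: algebra_simps\<close>)
    have 2: "(v be - 1 - (v al + 1)) div N = - (B - A) - 1"
      by (rule int_div_pos_eq[where r = "N - 1"]) (use va vb N3 in \<open>auto simp: algebra_simps\<close>)
    show ?thesis using False 1 2 K sv[of al] sv[of be] ra ab by (simp add: t_def f_def g_def min_def max_def)
  qed
  have "ell (p \<circ> aswap y) = sum g window_pairs" unfolding ell_def g_def aperm_inv_aswap[OF p] v_def by simp
  also have "\<dots> = g t + sum g (window_pairs - {t})" using tau_pair by (simp add: sum.remove)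
  also have "sum g (window_pairs - {t}) = sum f (window_pairs - {t})" using other by (intro sum.cong) auto
  also have "g t + sum f (window_pairs - {t}) = sum f window_pairs + 1" using tau_pair gt by (simp add: sum.remove)
  also have "sum f window_pairs = ell p" unfolding ell_def f_def v_def ..
  finally show ?thesis .
qed

lemma ell_down: "aperm p \<Longrightarrow> p (y + 1) < p y \<Longrightarrow> ell (p \<circ> aswap y) = ell p - 1"
  using ell_up[of "p \<circ> aswap y" y] by (simp add: aperm_comp aswap_at comp_assoc)

lemma state_ell: "state w = Some p \<Longrightarrow> ell p = int (length w)"
proof (induction w arbitrary: p)
  case (Cons i w)
  then obtain q where q: "state w = Some q" "q (int i) < q (int i + 1)" "p = q \<circ> aswap (int i)"
    by (auto split: option.splits if_splits)
  show ?case unfolding q(3) using ell_up[OF state_aperm[OF q(1)] q(2)] Cons.IH[OF q(1)] by (simp del: o_apply)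
qed (simp add: ell_id)

text \<open>Total displacement over one period, a homomorphism to the integers. Its kernel
  \<open>AffSym\<close> is the affine symmetric group inside the group of all periodic bijections,
  which also contains the shifts.\<close>

definition drift :: "(int \<Rightarrow> int) \<Rightarrow> int" where "drift p = (\<Sum>x\<in>{0..<N}. p x - x)"

lemma periodic_mod:
  fixes f :: "int \<Rightarrow> int"
  assumes "\<And>x. f (x + N) = f x" shows "N dvd x - y \<Longrightarrow> f x = f y"
proof -
  assume d: "N dvd x - y"
  have "per (\<lambda>x. f x + x)" using assms by (simp add: per_def)
  from per_cong[OF this d] show ?thesis by simp
qed

text \<open>\<open>h\<close> permutes the residues modulo n, and \<open>f\<close> depends on the
  residue only.\<close>

lemma sum_period:
  fixes f :: "int \<Rightarrow> int"
  assumes f: "\<And>x. f (x + N) = f x" and h: "aperm h"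
  shows "(\<Sum>x\<in>{0..<N}. f (h x)) = (\<Sum>x\<in>{0..<N}. f x)"
proof -
  have inj: "inj_on (\<lambda>x. h x mod N) {0..<N}"
  proof (rule inj_onI)
    fix x y assume a: "x \<in> {0..<N}" "y \<in> {0..<N}" "h x mod N = h y mod N"
    then have "N dvd h x - h y" by (simp add: mod_eq_dvd_iff)
    then have "N dvd x - y" using aperm_dvd_iff[OF h] by simp
    then show "x = y" using a by (intro small_eq) (auto simp: abs_less_iff)
  qed
  have "(\<lambda>x. h x mod N) ` {0..<N} = {0..<N}"
    by (rule endo_inj_surj) (use inj N_pos in auto)
  then have bij: "bij_betw (\<lambda>x. h x mod N) {0..<N} {0..<N}" using inj by (simp add: bij_betw_def)
  have "(\<Sum>x\<in>{0..<N}. f (h x)) = (\<Sum>x\<in>{0..<N}. f (h x mod N))"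
  proof (rule sum.cong[OF refl])
    fix x
    have "N dvd h x - h x mod N" by (rule dvd_minus_mod)
    then show "f (h x) = f (h x mod N)" by (rule periodic_mod[of f, OF f])
  qed
  also have "\<dots> = (\<Sum>x\<in>{0..<N}. f x)" by (rule sum.reindex_bij_betw[OF bij])
  finally show ?thesis .
qed

lemma drift_comp: assumes "aperm p" "aperm h" shows "drift (p \<circ> h) = drift p + drift h"
proof -
  have "drift (p \<circ> h) = (\<Sum>x\<in>{0..<N}. (p (h x) - h x) + (h x - x))" unfolding drift_def by simp
  also have "\<dots> = (\<Sum>x\<in>{0..<N}. p (h x) - h x) + drift h" unfolding drift_def by (rule sum.distrib)
  also have "(\<Sum>x\<in>{0..<N}. p (h x) - h x) = drift p" unfolding drift_def
    by (rule sum_period[where f = "\<lambda>x. p x - x"]) (use assms in \<open>auto simp: aperm_def per_def\<close>)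
  finally show ?thesis .
qed

lemma drift_id: "drift id = 0" by (simp add: drift_def)

lemma drift_aswap: "drift (aswap y) = 0" using drift_comp[of "aswap y" "aswap y"] by (simp add: drift_id)

lemma drift_inv: "aperm p \<Longrightarrow> drift (inv p) = - drift p"
proof -
  assume p: "aperm p"
  then have "p \<circ> inv p = id" by (simp add: aperm_def bij_is_surj surj_iff[symmetric])
  then show ?thesis using drift_comp[OF p aperm_inv[OF p]] by (simp add: drift_id)
qed

definition AffSym :: "(int \<Rightarrow> int) set" where "AffSym = {p. aperm p \<and> drift p = 0}"

lemma AffSym_aperm: "p \<in> AffSym \<Longrightarrow> aperm p" by (simp add: AffSym_def)
lemma AffSym_aswap: "aswap y \<in> AffSym" by (simp add: AffSym_def drift_aswap)
lemma AffSym_id: "id \<in> AffSym" by (simp add: AffSym_def drift_id)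
lemma AffSym_comp: "p \<in> AffSym \<Longrightarrow> q \<in> AffSym \<Longrightarrow> p \<circ> q \<in> AffSym" by (simp add: AffSym_def drift_comp aperm_comp)

lemma state_AffSym: "state w = Some p \<Longrightarrow> p \<in> AffSym"
  by (induction w arbitrary: p) (auto split: option.splits if_splits intro: AffSym_comp AffSym_aswap AffSym_id)

text \<open>Without descents \<open>p\<close> is strictly increasing; n steps of size at least one
  must add up to n, so each step is exactly one. The remaining constant is zero because
  \<open>drift p = 0\<close>.\<close>

lemma no_descent_id:
  assumes p: "p \<in> AffSym" and nd: "\<And>i. i < n \<Longrightarrow> \<not> p (int i + 1) < p (int i)"
  shows "p = id"
proof -
  have b: "aperm p" using p by (rule AffSym_aperm)
  have up: "p x < p (x + 1)" for x
  proof -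
    have "N dvd x - x mod N" by (rule dvd_minus_mod)
    moreover have "x mod N = int (nat (x mod N))" "nat (x mod N) < n" using N_pos
      by (auto simp: nat_less_iff)
    ultimately have "\<not> p (x + 1) < p x" using nd[of "nat (x mod N)"] per_step(2)[of p x "x mod N"] b
      by (simp add: aperm_def)
    moreover have "p x \<noteq> p (x + 1)" using aperm_inj[OF b] by simp
    ultimately show ?thesis by linarith
  qed
  have ge: "p (x + int k) \<ge> p x + int k" for x k
  proof (induction k)
    case (Suc k)
    then show ?case using up[of "x + int k"] by (simp add: algebra_simps)
  qed simp
  have one: "p (x + 1) = p x + 1" for x
  proof -
    have "p (x + 1 + int (n - 1)) \<ge> p (x + 1) + int (n - 1)" by (rule ge)
    moreover have "x + 1 + int (n - 1) = x + N" using n3 by simp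
    moreover have "p (x + N) = p x + N" using b by (simp add: aperm_def per_def)
    ultimately show ?thesis using up[of x] n3 by simp
  qed
  have e: "p x = p 0 + x" for x
  proof (induction x rule: int_induct[where k = 0])
    case (step1 i)
    then show ?case using one[of i] by simp
  next
    case (step2 i)
    then show ?case using one[of "i - 1"] by simp
  qed simp
  have "drift p = (\<Sum>x\<in>{0..<N}. p 0)" unfolding drift_def
  proof (rule sum.cong[OF refl])
    fix x show "p x - x = p 0" using e[of x] by simp
  qed
  also have "\<dots> = N * p 0" by simp
  finally have "p 0 = 0" using p N_pos by (simp add: AffSym_def)
  show ?thesis
  proof
    fix x show "p x = id x" using e[of x] \<open>p 0 = 0\<close> by simp
  qed
qed

lemma ex_descent: "p \<in> AffSym \<Longrightarrow> p \<noteq> id \<Longrightarrow> \<exists>i<n. p (int i + 1) < p (int i)"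
  using no_descent_id by blast

theorem ex_word: "p \<in> AffSym \<Longrightarrow> \<exists>w\<in>letters. state w = Some p"
proof (induction "nat (ell p)" arbitrary: p rule: less_induct)
  case less
  show ?case
  proof (cases "p = id")
    case True
    then show ?thesis by (intro bexI[of _ "[]"]) auto
  next
    case False
    then obtain i where i: "i < n" "p (int i + 1) < p (int i)" using ex_descent less.prems by blast
    let ?q = "p \<circ> aswap (int i)"
    have "ell ?q = ell p - 1" using ell_down[OF AffSym_aperm[OF less.prems] i(2)] .
    moreover have "ell ?q \<ge> 0" by (rule ell_nonneg)
    ultimately have "nat (ell ?q) < nat (ell p)" by linarith
    moreover have "?q \<in> AffSym" using less.prems AffSym_aswap by (rule AffSym_comp)
    ultimately obtain w where w: "w \<in> letters" "state w = Some ?q" using less.hyps by blast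
    then have "state (i # w) = Some p" using i by (simp add: aswap_at comp_assoc)
    then show ?thesis using w i by (intro bexI[of _ "i # w"]) auto
  qed
qed

text \<open>Each integer moves by at most one, so only distances one and two are critical; at
  distance two the entries would have to move to the same integer.\<close>

lemma aswap_less:
  assumes "z < z'" "\<not> (z' = z + 1 \<and> N dvd z - j)" shows "aswap j z < aswap j z'"
proof (cases "z' = z + 1")
  case True
  then have nd: "\<not> N dvd z - j" using assms by auto
  have "aswap j z \<le> z" using nd by (auto simp: aswap_def)
  moreover have "aswap j (z + 1) \<ge> z + 1" if "aswap j z = z"
    using nd that by (auto simp: aswap_def algebra_simps)
  moreover have "aswap j (z + 1) \<ge> z" by (auto simp: aswap_def)
  moreover have "aswap j z = z \<or> aswap j z = z - 1" using nd by (auto simp: aswap_def)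
  ultimately show ?thesis using True by auto
next
  case False
  then have "z' \<ge> z + 2" using assms by simp
  moreover have "aswap j z \<le> z + 1" "aswap j z' \<ge> z' - 1" by (auto simp: aswap_def)
  moreover have "\<not> (z' = z + 2 \<and> aswap j z = z + 1 \<and> aswap j z' = z' - 1)"
  proof
    assume a: "z' = z + 2 \<and> aswap j z = z + 1 \<and> aswap j z' = z' - 1"
    then have "N dvd z - j" by (auto simp: aswap_def split: if_splits)
    moreover have "N dvd z + 2 - (j + 1)" using a by (auto simp: aswap_def split: if_splits)
    ultimately show False using dvd_shift[of "z - j" 1] N3 by (simp add: algebra_simps)
  qed
  ultimately show ?thesis by linarith
qed

lemma aswap_flip: "N dvd z - j \<Longrightarrow> aswap j (z + 1) < aswap j z"
proof -
  assume a: "N dvd z - j"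
  then have "\<not> N dvd z + 1 - j" using dvd_shift[of "z - j" 1] N3 by (simp add: algebra_simps)
  with a show ?thesis by (simp add: aswap_def)
qed

text \<open>The exceptional case of \<open>aswap_less\<close>: here
  \<open>aswap j \<circ> q = q \<circ> aswap y\<close>, one reflection seen from both sides.\<close>

lemma adj_swap:
  assumes "aperm q" "inv q (j + 1) = inv q j + 1" "N dvd inv q j - y"
  shows "q (y + 1) = q y + 1" "N dvd q y - j"
proof -
  have 1: "q (inv q j) - q y = inv q j - y" by (rule aperm_cong[OF assms(1,3)])
  have "N dvd (inv q j + 1) - (y + 1)" using assms(3) by simp
  from aperm_cong[OF assms(1) this] have 2: "q (inv q (j+1)) - q (y + 1) = inv q j - y"
    using assms(2) by simp
  show "q (y + 1) = q y + 1" using 1 2 assms(1) by simp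
  show "N dvd q y - j" using 1 assms(1,3) by (simp add: dvd_diff_commute[of N "q y" j])
qed

lemma adj_swap2:
  assumes "aperm q" "inv q j = inv q (j + 1) + 1" "N dvd inv q (j + 1) - y"
  shows "q (y + 1) < q y"
proof -
  have 1: "q (inv q (j + 1)) - q y = inv q (j + 1) - y" by (rule aperm_cong[OF assms(1,3)])
  have "N dvd (inv q (j + 1) + 1) - (y + 1)" using assms(3) by simp
  from aperm_cong[OF assms(1) this] have 2: "q (inv q j) - q (y + 1) = inv q (j + 1) - y"
    using assms(2) by simp
  show ?thesis using 1 2 assms(1) by simp
qed

text \<open>\<open>state\<close> is defined by prepending, whereas the commutation rule and the
  splitting of words need letters at the end. By \<open>aswap_less\<close> the conditions for
  \<open>i\<close> at the front and \<open>j\<close> at the back are independent unless the two are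
  the same reflection, and then both orders fail together.\<close>

theorem state_snoc:
  "state w = Some p \<Longrightarrow> state (w @ [j]) = (if inv p (int j) < inv p (int j + 1) then Some (aswap (int j) \<circ> p) else None)"
  "state w = None \<Longrightarrow> state (w @ [j]) = None"
proof (induction w arbitrary: p)
  case Nil
  {
    case 1
    then show ?case by simp
  next
    case 2
    then show ?case by simp
  }
next
  case (Cons i w)
  let ?i = "int i" and ?j = "int j"
  {
    case 1
    then obtain q where q: "state w = Some q" "q ?i < q (?i + 1)" "p = q \<circ> aswap ?i"
      by (auto split: option.splits if_splits)
    have b: "aperm q" using q(1) by (rule state_aperm)
    have ip: "inv p = aswap ?i \<circ> inv q" using q(3) aperm_inv_aswap[OF b] by simp
    have ne: "inv q ?j \<noteq> inv q (?j + 1)" using aperm_inj[OF aperm_inv[OF b]] by simp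
    show ?case
    proof (cases "inv q ?j < inv q (?j + 1)")
      case True
      have s: "state (w @ [j]) = Some (aswap ?j \<circ> q)" using Cons.IH(1)[OF q(1)] True by simp
      show ?thesis
      proof (cases "inv q (?j + 1) = inv q ?j + 1 \<and> N dvd inv q ?j - ?i")
        case e: True
        have "\<not> inv p ?j < inv p (?j + 1)" using e aswap_flip[of "inv q ?j" ?i] ip by simp
        moreover have "\<not> aswap ?j (q ?i) < aswap ?j (q (?i + 1))"
          using adj_swap[OF b, of ?j ?i] e aswap_flip[of "q ?i" ?j] by simp
        ultimately show ?thesis using s by simp
      next
        case e: False
        have "inv p ?j < inv p (?j + 1)" using aswap_less[OF True e] ip by simp
        moreover have "aswap ?j (q ?i) < aswap ?j (q (?i + 1))"
        proof (rule aswap_less[OF q(2)])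
          show "\<not> (q (?i + 1) = q ?i + 1 \<and> N dvd q ?i - ?j)"
            using adj_swap[OF aperm_inv[OF b], of ?i ?j] aperm_inv_inv[OF b] e by auto
        qed
        moreover from this have "state ((i # w) @ [j]) = Some (aswap ?j \<circ> q \<circ> aswap ?i)" using s by simp
        ultimately show ?thesis using q(3) by (simp only: comp_assoc if_True)
      qed
    next
      case False
      then have s: "state (w @ [j]) = None" using Cons.IH(1)[OF q(1)] by simp
      have gt: "inv q (?j + 1) < inv q ?j" using False ne by linarith
      have "inv p (?j + 1) < inv p ?j"
        unfolding ip comp_apply
      proof (rule aswap_less[OF gt])
        show "\<not> (inv q ?j = inv q (?j + 1) + 1 \<and> N dvd inv q (?j + 1) - ?i)"
          using adj_swap2[OF b, of ?j ?i] q(2) by auto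
      qed
      then show ?thesis using s by simp
    qed
  next
    case 2
    show ?case
    proof (cases "state w")
      case None
      then show ?thesis using Cons.IH(2) by simp
    next
      case (Some q)
      have b: "aperm q" using Some by (rule state_aperm)
      have "\<not> q ?i < q (?i + 1)" using 2 Some by (auto split: if_splits)
      moreover have "q ?i \<noteq> q (?i + 1)" using aperm_inj[OF b] by simp
      ultimately have gt: "q (?i + 1) < q ?i" by linarith
      show ?thesis
      proof (cases "inv q ?j < inv q (?j + 1)")
        case True
        have "aswap ?j (q (?i + 1)) < aswap ?j (q ?i)"
        proof (rule aswap_less[OF gt])
          show "\<not> (q ?i = q (?i + 1) + 1 \<and> N dvd q (?i + 1) - ?j)"
            using adj_swap2[OF aperm_inv[OF b], of ?i ?j] aperm_inv_inv[OF b] True by auto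
        qed
        then show ?thesis using Cons.IH(1)[OF Some] True by simp
      next
        case False
        then show ?thesis using Cons.IH(1)[OF Some] by simp
      qed
    qed
  }
qed

lemma aswap_shift: "aswap (i + k) (x + k) = aswap i x + k"
proof -
  have e: "x + k - (i + k) = x - i" "x + k - (i + k + 1) = x - (i + 1)" by simp_all
  show ?thesis unfolding aswap_def e by simp
qed

text \<open>Rotation of the cycle conjugates by a shift of the integers and so preserves
  reducedness.\<close>

lemma state_shift:
  "state w = Some p \<Longrightarrow> state (map (\<lambda>i. (i + k) mod n) w) = Some (\<lambda>x. p (x - int k) + int k)"
proof (induction w arbitrary: p)
  case Nil
  then show ?case by (auto simp: fun_eq_iff)
next
  case (Cons i w)
  then obtain q where q: "state w = Some q" "q (int i) < q (int i + 1)" "p = q \<circ> aswap (int i)"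
    by (auto split: option.splits if_splits)
  have d: "N dvd int ((i + k) mod n) - (int i + int k)"
    using dvd_minus_mod[of N "int i + int k"] dvd_diff_commute[of N "int i + int k" "(int i + int k) mod N"]
    by (simp add: of_nat_mod)
  have "state (map (\<lambda>i. (i + k) mod n) (i # w)) = Some ((\<lambda>x. q (x - int k) + int k) \<circ> aswap (int i + int k))"
    using state_Cons[OF Cons.IH[OF q(1)] d] q(2) by simp
  moreover have "(\<lambda>x. q (x - int k) + int k) \<circ> aswap (int i + int k) = (\<lambda>x. p (x - int k) + int k)"
  proof
    fix x
    show "((\<lambda>x. q (x - int k) + int k) \<circ> aswap (int i + int k)) x = p (x - int k) + int k"
      using aswap_shift[of "int i" "int k" "x - int k"] q(3) by simp
  qed
  ultimately show ?case by simp
qed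


section \<open>Translations and the elements generating the kernel\<close>

definition vtx :: "int \<Rightarrow> nat" where "vtx x = nat (x mod N)"

lemma vtx_less [simp]: "vtx x < n" using N_pos by (simp add: vtx_def nat_less_iff)
lemma int_vtx: "int (vtx x) = x mod N" using N_pos by (simp add: vtx_def)
lemma vtx_dvd: "N dvd x - int (vtx x)" unfolding int_vtx by (rule dvd_minus_mod)
lemma vtx_eq_iff: "vtx x = vtx y \<longleftrightarrow> N dvd x - y"
  by (metis int_vtx mod_eq_dvd_iff of_nat_eq_iff)
lemma vtx_of_nat: "i < n \<Longrightarrow> vtx (int i) = i" by (simp add: vtx_def)
lemma vtx_add_N [simp]: "vtx (x + N) = vtx x" by (simp add: vtx_def)
lemma vtx_Suc: "i < n \<Longrightarrow> vtx (int i + 1) = (i + 1) mod n"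
  by (metis Suc_eq_plus1 nat_int of_nat_Suc of_nat_mod vtx_def add.commute)

definition tau :: "nat \<Rightarrow> nat \<Rightarrow> nat" where "tau i = transpose i ((i + 1) mod n)"

lemma tau_tau [simp]: "tau i (tau i x) = x" by (simp add: tau_def)

lemma tau_less: "i < n \<Longrightarrow> x < n \<Longrightarrow> tau i x < n"
  by (auto simp: tau_def transpose_def)

lemma Suc_mod_neq: "i < n \<Longrightarrow> (i + 1) mod n \<noteq> i"
  using n3 by (metis Suc_eq_plus1 mod_Suc mod_less n_not_Suc_n not_less_zero Suc_n_not_le_n le_antisym zero_le numeral_3_eq_3 Suc_le_mono nat.simps(3) le_zero_eq)

lemma vtx_aswap: assumes "i < n" shows "vtx (aswap (int i) x) = tau i (vtx x)"
proof -
  have a: "N dvd x - int i \<longleftrightarrow> vtx x = i"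
    using vtx_eq_iff[of x "int i"] vtx_of_nat[OF assms] by simp
  have b: "N dvd x - (int i + 1) \<longleftrightarrow> vtx x = (i + 1) mod n"
    using vtx_eq_iff[of x "int i + 1"] vtx_Suc[OF assms] by simp
  show ?thesis
  proof (cases "vtx x = i")
    case True
    then have "N dvd x - int i" using a by simp
    then have "vtx (x + 1) = vtx (int i + 1)" using vtx_eq_iff by simp
    then show ?thesis using True a vtx_Suc[OF assms] by (simp add: aswap_def tau_def)
  next
    case F: False
    show ?thesis
    proof (cases "vtx x = (i + 1) mod n")
      case True
      then have "N dvd x - (int i + 1)" using b by simp
      then have "N dvd (x - 1) - int i" by (simp add: algebra_simps)
      then have "vtx (x - 1) = i" using vtx_eq_iff[of "x - 1" "int i"] vtx_of_nat[OF assms] by simp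
      then show ?thesis using True F a b by (simp add: aswap_def tau_def)
    next
      case False
      then show ?thesis using F a b by (simp add: aswap_def tau_def transpose_def)
    qed
  qed
qed

text \<open>The translation by the indicator vector of I, followed by the shift by - k that brings it back
into the affine symmetric group.\<close>

definition trl :: "nat \<Rightarrow> nat set \<Rightarrow> int \<Rightarrow> int" where
  "trl k I x = x + (if vtx x \<in> I then N else 0) - int k"

definition trl_inv :: "nat \<Rightarrow> nat set \<Rightarrow> int \<Rightarrow> int" where
  "trl_inv k I z = z + int k - (if vtx (z + int k) \<in> I then N else 0)"

lemma trl_inverse: "trl k I \<circ> trl_inv k I = id" "trl_inv k I \<circ> trl k I = id"
proof -
  have m: "vtx (x - N) = vtx x" for x using vtx_add_N[of "x - N"] by simp
  have 1: "vtx (x + N - int k + int k) = vtx x" for x using vtx_add_N[of x] by (simp del: vtx_add_N)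
  show "trl k I \<circ> trl_inv k I = id" "trl_inv k I \<circ> trl k I = id"
    using m 1 by (auto simp: trl_def trl_inv_def fun_eq_iff)
qed

lemma trl_aperm: "aperm (trl k I)"
proof -
  have "bij (trl k I)" by (rule o_bij[OF trl_inverse(2,1)])
  then show ?thesis by (auto simp: aperm_def per_def trl_def)
qed

lemma trl_inv: "inv (trl k I) = trl_inv k I" by (rule inv_unique_comp[OF trl_inverse])

definition Sub :: "nat \<Rightarrow> nat set set" where "Sub k = {I. I \<subseteq> {0..<n} \<and> card I = k}"

lemma finite_Sub [simp]: "finite (Sub k)"
  by (rule finite_subset[of _ "Pow {0..<n}"]) (auto simp: Sub_def)

lemma int_interval: "{0..<N} = int ` {0..<n}"
  by (metis image_int_atLeastLessThan int_ops(1))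

lemma trl_AffSym: assumes "I \<in> Sub k" shows "trl k I \<in> AffSym"
proof -
  have I: "I \<subseteq> {0..<n}" "card I = k" using assms by (auto simp: Sub_def)
  have "drift (trl k I) = (\<Sum>x\<in>{0..<n}. (if vtx (int x) \<in> I then N else 0) - int k)"
    unfolding drift_def int_interval by (subst sum.reindex) (auto simp: trl_def)
  also have "\<dots> = (\<Sum>x\<in>{0..<n}. (if x \<in> I then N else 0) - int k)"
    by (rule sum.cong) (simp_all add: vtx_of_nat)
  also have "\<dots> = (\<Sum>x\<in>{0..<n}. (if x \<in> I then N else 0)) - N * int k"
    by (simp add: sum_subtractf vtx_of_nat)
  also have "(\<Sum>x\<in>{0..<n}. (if x \<in> I then N else 0)) = (\<Sum>x\<in>I. N)"
    using I(1) by (intro sum.mono_neutral_cong_right) auto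
  also have "\<dots> = N * int k" using I by simp
  finally show ?thesis using trl_aperm by (simp add: AffSym_def)
qed

text \<open>In Shi's formula the quotient of a pair of window entries is nonzero, and then of
  absolute value one, exactly when the translation separates the two entries. So the length counts
  the pairs between \<open>S\<close> and its complement.\<close>

lemma trl_ell: assumes "I \<in> Sub k" "k \<le> n" shows "ell (trl k I) = int (k * (n - k))"
proof -
  have I: "I \<subseteq> {0..<n}" "card I = k" using assms by (auto simp: Sub_def)
  define S where "S = {a \<in> {1..N}. vtx (a + int k) \<in> I}"
  have bS: "bij_betw (\<lambda>a. vtx (a + int k)) S I"
  proof (rule bij_betw_imageI)
    show "inj_on (\<lambda>a. vtx (a + int k)) S"
    proof (rule inj_onI)
      fix a b assume ab: "a \<in> S" "b \<in> S" "vtx (a + int k) = vtx (b + int k)"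
      then have "N dvd a - b" using vtx_eq_iff by simp
      then show "a = b" using ab by (intro small_eq) (auto simp: S_def abs_less_iff)
    qed
    show "(\<lambda>a. vtx (a + int k)) ` S = I"
    proof
      show "I \<subseteq> (\<lambda>a. vtx (a + int k)) ` S"
      proof
        fix i assume i: "i \<in> I"
        let ?a = "wcls (int i - int k)"
        have "N dvd int i - (?a + int k)" using wcls_dvd[of "int i - int k"] by (simp add: algebra_simps)
        then have "vtx (?a + int k) = vtx (int i)" using vtx_eq_iff by metis
        moreover have "i < n" using i I by auto
        ultimately have "vtx (?a + int k) = i" using vtx_of_nat by simp
        then show "i \<in> (\<lambda>a. vtx (a + int k)) ` S" using wcls_range i
          by (intro image_eqI[of _ _ ?a]) (auto simp: S_def)
      qed
    qed (auto simp: S_def)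
  qed
  have cS: "card S = k" using bij_betw_same_card[OF bS] I by simp
  have fS: "S \<subseteq> {1..N}" "finite S" by (auto simp: S_def intro: finite_subset[of _ "{1..N}"])
  define P where "P = {(a, b) \<in> window_pairs. (a \<in> S) \<noteq> (b \<in> S)}"
  have "ell (trl k I) = (\<Sum>t\<in>window_pairs. if t \<in> P then 1 else 0)"
    unfolding ell_def trl_inv
  proof (rule sum.cong[OF refl])
    fix t assume t: "t \<in> window_pairs"
    obtain a b where ab: "t = (a, b)" by force
    then have r: "1 \<le> a" "a < b" "b \<le> N" using t by (auto simp: window_pairs_def)
    have sa: "a \<in> S \<longleftrightarrow> vtx (a + int k) \<in> I" "b \<in> S \<longleftrightarrow> vtx (b + int k) \<in> I" using r by (auto simp: S_def)
    have d0: "(b - a) div N = 0" using r by (simp add: div_pos_pos_trivial)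
    have d1: "(b - a + N) div N = 1" using d0 N_pos by simp
    have d2: "(b - a - N) div N = -1"
      by (rule int_div_pos_eq[where r = "b - a"]) (use r in auto)
    show "(case t of (a, b) \<Rightarrow> \<bar>(trl_inv k I b - trl_inv k I a) div N\<bar>) = (if t \<in> P then 1 else 0)"
    proof (cases "a \<in> S"; cases "b \<in> S")
      assume "a \<in> S" "b \<notin> S"
      then have "trl_inv k I b - trl_inv k I a = b - a + N" using sa by (simp add: trl_inv_def)
      then show ?thesis using d1 t ab \<open>a \<in> S\<close> \<open>b \<notin> S\<close> by (simp add: P_def)
    next
      assume "a \<notin> S" "b \<in> S"
      then have "trl_inv k I b - trl_inv k I a = b - a - N" using sa by (simp add: trl_inv_def)
      then show ?thesis using d2 t ab \<open>a \<notin> S\<close> \<open>b \<in> S\<close> by (simp add: P_def)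
    next
      assume "a \<in> S" "b \<in> S"
      then have "trl_inv k I b - trl_inv k I a = b - a" using sa by (simp add: trl_inv_def)
      then show ?thesis using d0 t ab \<open>a \<in> S\<close> \<open>b \<in> S\<close> by (simp add: P_def)
    next
      assume "a \<notin> S" "b \<notin> S"
      then have "trl_inv k I b - trl_inv k I a = b - a" using sa by (simp add: trl_inv_def)
      then show ?thesis using d0 t ab \<open>a \<notin> S\<close> \<open>b \<notin> S\<close> by (simp add: P_def)
    qed
  qed
  also have "\<dots> = int (card P)"
    using sum.inter_filter[of window_pairs "\<lambda>_. 1::int" "\<lambda>t. t \<in> P"]
    by (simp add: P_def) (metis (no_types, lifting) Collect_cong P_def Collect_case_prodD mem_Collect_eq case_prodI2 case_prodE)
  also have "card P = card (S \<times> ({1..N} - S))"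
  proof (rule bij_betw_same_card[of "\<lambda>(a, b). if a \<in> S then (a, b) else (b, a)"], rule bij_betw_imageI)
    show "inj_on (\<lambda>(a, b). if a \<in> S then (a, b) else (b, a)) P"
      by (auto simp: inj_on_def P_def window_pairs_def split: if_splits)
    show "(\<lambda>(a, b). if a \<in> S then (a, b) else (b, a)) ` P = S \<times> ({1..N} - S)"
    proof
      show "S \<times> ({1..N} - S) \<subseteq> (\<lambda>(a, b). if a \<in> S then (a, b) else (b, a)) ` P"
      proof
        fix t assume "t \<in> S \<times> ({1..N} - S)"
        then obtain a b where t: "t = (a, b)" "a \<in> S" "b \<notin> S" "b \<in> {1..N}" by auto
        have ra: "a \<in> {1..N}" using t fS by auto
        have "a \<noteq> b" using t by auto
        show "t \<in> (\<lambda>(a, b). if a \<in> S then (a, b) else (b, a)) ` P"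
        proof (cases "a < b")
          case True
          then show ?thesis using t ra by (intro image_eqI[of _ _ "(a, b)"]) (auto simp: P_def window_pairs_def)
        next
          case False
          then show ?thesis using t ra \<open>a \<noteq> b\<close> by (intro image_eqI[of _ _ "(b, a)"]) (auto simp: P_def window_pairs_def)
        qed
      qed
    qed (use fS in \<open>auto simp: P_def window_pairs_def\<close>)
  qed
  also have "\<dots> = k * (n - k)" using cS fS by (simp add: card_cartesian_product card_Diff_subset)
  finally show ?thesis .
qed

text \<open>Conjugation by a reflection permutes the translation vectors, here \<open>I\<close> by
  \<open>tau i\<close>; the shift by \<open>- k\<close> accounts for the change of the letter to
  \<open>i - k\<close>.\<close>

lemma trl_aswap:
  assumes "i < n" "N dvd int j - (int i - int k)"
  shows "trl k I \<circ> aswap (int i) = aswap (int j) \<circ> trl k (tau i ` I)"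
proof
  fix x
  have m: "tau i y \<in> I \<longleftrightarrow> y \<in> tau i ` I" for y
  proof
    assume "tau i y \<in> I"
    then show "y \<in> tau i ` I" by (intro image_eqI[of _ _ "tau i y"]) auto
  qed auto
  define c where "c = (if vtx x \<in> tau i ` I then 1 else 0 :: int)"
  have "aswap (int j) (x + N * c - int k) = aswap (int i - int k) (x + N * c - int k)"
    using aswap_cong[OF assms(2)] by simp
  also have "\<dots> = aswap (int i) (x + N * c) - int k"
    using aswap_shift[of "int i" "- int k" "x + N * c"] by simp
  also have "\<dots> = aswap (int i) x + N * c - int k" using aperm_add[OF aperm_aswap] by simp
  finally show "(trl k I \<circ> aswap (int i)) x = (aswap (int j) \<circ> trl k (tau i ` I)) x"
    using vtx_aswap[OF assms(1), of x] m by (cases "vtx x \<in> tau i ` I") (simp_all add: trl_def c_def)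
qed

lemma tau_Sub: assumes "i < n" "I \<in> Sub k" shows "tau i ` I \<in> Sub k"
proof -
  have "inj_on (tau i) I" by (rule inj_on_inverseI[of _ "tau i"]) simp
  then show ?thesis using assms tau_less by (auto simp: Sub_def card_image)
qed

text \<open>The reading word of a rectangle with k rows of length n - k: row \<open>j\<close>
  consists of the consecutive letters from \<open>j\<close> to n - k + j - 1, and the last row is
  read first.\<close>

definition rect_word :: "nat \<Rightarrow> nat list" where
  "rect_word k = concat (map (\<lambda>j. [j..<n - k + j]) (rev [0..<k]))"

text \<open>For the two subsets {0..<k} and {1..k} the reduced words are fixed, because these are the only
summands of the k-th relation that meet just one of the two letters 0 and n - 1.\<close>

definition trl_word :: "nat \<Rightarrow> nat set \<Rightarrow> nat list" where
  "trl_word k I = (if I = {0..<k} then rect_word k else if I = {1..k} then map Suc (rect_word k)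
     else (SOME w. w \<in> letters \<and> state w = Some (trl k I)))"

definition trl_rel :: "nat \<Rightarrow> nat fa" where "trl_rel k = (\<Sum>I\<in>Sub k. fa_word (trl_word k I))"

lemma aswap_mod:
  assumes "t + 1 < n"
  shows "aswap (int t) x = (if x mod N = int t then x + 1 else if x mod N = int t + 1 then x - 1 else x)"
proof -
  have "N dvd x - int t \<longleftrightarrow> x mod N = int t" "N dvd x - (int t + 1) \<longleftrightarrow> x mod N = int t + 1"
    using assms by (simp_all add: mod_eq_dvd_iff[symmetric])
  then show ?thesis by (simp add: aswap_def)
qed

lemma mod_succ: "x mod N + 1 < N \<Longrightarrow> (x + 1) mod N = x mod N + 1"
  using div_mult_mod_eq[of x N] pos_mod_sign[OF N_pos, of x]
  by (intro int_mod_pos_eq[of _ _ "x div N"]) (auto simp: algebra_simps)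

lemma mod_pred: "x mod N \<ge> 1 \<Longrightarrow> (x - 1) mod N = x mod N - 1"
  using div_mult_mod_eq[of x N] pos_mod_bound[OF N_pos, of x]
  by (intro int_mod_pos_eq[of _ _ "x div N"]) (auto simp: algebra_simps)

lemma state_rect_word: assumes "1 \<le> k" "k < n" shows "state (rect_word k) = Some (trl k {0..<k})"
proof -
  \<comment> \<open>Permutation of the rows below \<open>r\<close>, which form a suffix of the word:
    the first \<open>r\<close> residues go up by n - k, and the next n - k go down by
    \<open>r\<close>.\<close>
  define Q where "Q r x = (let y = x mod N in if y < int r then x + int (n - k)
      else if y < int (n - k + r) then x - int r else x)" for r x
  \<comment> \<open>The same in the middle of row \<open>r\<close>, with its letters from
    \<open>t\<close> on already prepended: residue \<open>t\<close> jumps to the end of the row, and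
    those it passes move down by one more.\<close>
  define Q' where "Q' r t x = (let y = x mod N in if y < int r then x + int (n - k)
      else if y < int t then x - int r
      else if y = int t then x + (int (n - k + r) - int t)
      else if y \<le> int (n - k + r) then x - 1 - int r else x)" for r t x
  have inner: "state ([t..<n - k + r] @ z) = Some (Q' r t)"
    if z: "state z = Some (Q r)" and rk: "r < k" and t: "r \<le> t" "t \<le> n - k + r" for r t z
    using t(2)
  proof (induction rule: inc_induct)
    case base
    have "Q r = Q' r (n - k + r)" by (auto simp: Q_def Q'_def Let_def fun_eq_iff)
    then show ?case using z by simp
  next
    case (step t)
    have IH: "state ([Suc t..<n - k + r] @ z) = Some (Q' r (Suc t))" using step by simp
    have tn: "t + 1 < n" "r \<le> t" "t < n - k + r" using step rk assms \<open>r \<le> _\<close> by auto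
    have l: "[t..<n - k + r] = t # [Suc t..<n - k + r]" using step by (simp add: upt_conv_Cons)
    have a: "Q' r (Suc t) (int t) = int t - int r" using tn by (simp add: Q'_def)
    have b: "Q' r (Suc t) (int t + 1) = int (n - k + r)" using tn by (simp add: Q'_def)
    have c: "Q' r (Suc t) \<circ> aswap (int t) = Q' r t"
    proof
      fix x
      consider "x mod N = int t" | "x mod N = int t + 1" | "x mod N \<noteq> int t" "x mod N \<noteq> int t + 1" by blast
      then show "(Q' r (Suc t) \<circ> aswap (int t)) x = Q' r t x"
      proof cases
        case 1
        then have "(x + 1) mod N = int t + 1" using mod_succ[of x] tn by simp
        then show ?thesis using 1 tn by (simp add: Q'_def aswap_mod)
      next
        case c2: 2
        then have "(x - 1) mod N = int t" using mod_pred[of x] tn by simp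
        then show ?thesis using c2 tn by (simp add: Q'_def aswap_mod)
      next
        case 3
        then show ?thesis using tn by (auto simp: Q'_def aswap_mod Let_def)
      qed
    qed
    have "state (t # ([Suc t..<n - k + r] @ z)) = Some (Q' r (Suc t) \<circ> aswap (int t))"
      using state_Cons[OF IH, of t "int t"] a b tn by simp
    then show ?case unfolding l c by simp
  qed
  have "r \<le> k \<Longrightarrow> state (concat (map (\<lambda>j. [j..<n - k + j]) (rev [0..<r]))) = Some (Q r)" for r
  proof (induction r)
    case 0
    have "Q 0 = id"
    proof
      fix x show "Q 0 x = id x" using pos_mod_sign[OF N_pos, of x] by (simp add: Q_def Let_def)
    qed
    then show ?case by (simp del: id_apply)
  next
    case (Suc r)
    have "state ([r..<n - k + r] @ concat (map (\<lambda>j. [j..<n - k + j]) (rev [0..<r]))) = Some (Q' r r)"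
      by (rule inner) (use Suc in auto)
    moreover have "Q' r r = Q (Suc r)"
      by (auto simp: Q_def Q'_def Let_def fun_eq_iff)
    ultimately show ?case by simp
  qed
  from this[of k] have "state (rect_word k) = Some (Q k)" by (simp add: rect_word_def)
  moreover have "Q k = trl k {0..<k}"
  proof
    fix x
    have "x mod N < N" "0 \<le> x mod N" using N_pos by auto
    then show "Q k x = trl k {0..<k} x" using assms int_vtx[of x]
      by (auto simp: Q_def trl_def Let_def)
  qed
  ultimately show ?thesis by simp
qed

lemma rect_word_letters: "1 \<le> k \<Longrightarrow> k < n \<Longrightarrow> set (rect_word k) \<subseteq> {0..<n - 1}"
  by (auto simp: rect_word_def)

lemma state_y1: assumes "1 \<le> k" "k < n" shows "state (map Suc (rect_word k)) = Some (trl k {1..k})"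
proof -
  have "map Suc (rect_word k) = map (\<lambda>i. (i + 1) mod n) (rect_word k)"
    using rect_word_letters[OF assms] n3 by (intro map_cong) auto
  then have "state (map Suc (rect_word k)) = Some (\<lambda>x. trl k {0..<k} (x - 1) + 1)"
    using state_shift[OF state_rect_word[OF assms], of 1] by (simp only: of_nat_1)
  moreover have "(\<lambda>x. trl k {0..<k} (x - 1) + 1) = trl k {1..k}"
  proof
    fix x
    have "vtx (x - 1) < k \<longleftrightarrow> 1 \<le> vtx x \<and> vtx x \<le> k"
    proof (cases "x mod N \<ge> 1")
      case True
      then show ?thesis using mod_pred[OF True] int_vtx[of x] int_vtx[of "x - 1"] by linarith
    next
      case False
      then have "x mod N = 0" using N_pos pos_mod_sign[of N x] by linarith
      then have z: "vtx x = 0" and "N dvd x" using int_vtx[of x] by (auto simp: vtx_def)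
      then have "N dvd (x - 1) - (N - 1)" by simp
      then have "vtx (x - 1) = vtx (int (n - 1))" using vtx_eq_iff n3 by (simp add: of_nat_diff)
      then show ?thesis using z assms vtx_of_nat[of "n - 1"] by simp
    qed
    then show "trl k {0..<k} (x - 1) + 1 = trl k {1..k} x" by (simp add: trl_def)
  qed
  ultimately show ?thesis by simp
qed

lemma trl_word_props:
  assumes "1 \<le> k" "k < n" "I \<in> Sub k"
  shows "trl_word k I \<in> letters" "state (trl_word k I) = Some (trl k I)" "length (trl_word k I) = k * (n - k)"
proof -
  have "trl_word k I \<in> letters \<and> state (trl_word k I) = Some (trl k I)"
  proof -
    have ex: "\<exists>w. w \<in> letters \<and> state w = Some (trl k I)" using ex_word[OF trl_AffSym[OF assms(3)]] by blast
    have yl: "rect_word k \<in> letters" "map Suc (rect_word k) \<in> letters" using rect_word_letters[OF assms(1,2)] by fastforce+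
    show ?thesis using yl state_rect_word[OF assms(1,2)] state_y1[OF assms(1,2)] someI_ex[OF ex]
      unfolding trl_word_def by presburger
  qed
  then show "trl_word k I \<in> letters" "state (trl_word k I) = Some (trl k I)" by auto
  then show "length (trl_word k I) = k * (n - k)"
    using state_ell[of "trl_word k I"] trl_ell[OF assms(3)] assms by (simp del: of_nat_mult)
qed

text \<open>Only the letter n - 1 carries an integer across the border between -1 and 0.\<close>

lemma state_no_last:
  "w \<in> letters \<Longrightarrow> n - 1 \<notin> set w \<Longrightarrow> state w = Some p \<Longrightarrow> x \<ge> 0 \<Longrightarrow> p x \<ge> 0"
proof (induction w arbitrary: p x)
  case (Cons i w)
  then obtain q where q: "state w = Some q" "p = q \<circ> aswap (int i)"
    by (auto split: option.splits if_splits)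
  have "aswap (int i) x \<ge> 0"
  proof (rule ccontr)
    assume a: "\<not> aswap (int i) x \<ge> 0"
    then have "x = 0" using Cons.prems(4) by (auto simp: aswap_def split: if_splits)
    then have "N dvd - (int i + 1)" using a by (auto simp: aswap_def split: if_splits)
    then have "N dvd int (i + 1)" by (metis dvd_minus_iff of_nat_Suc Suc_eq_plus1 add.commute)
    then have "n dvd i + 1" by (simp only: int_dvd_int_iff)
    then have "n \<le> i + 1" by (simp add: dvd_imp_le)
    then show False using Cons.prems(1,2) by auto
  qed
  then show ?case using Cons.IH[OF _ _ q(1)] Cons.prems q(2) by simp
qed simp

text \<open>Likewise only the letter 0 crosses the border between 0 and 1.\<close>

lemma state_no_zero:
  "w \<in> letters \<Longrightarrow> 0 \<notin> set w \<Longrightarrow> state w = Some p \<Longrightarrow> x \<ge> 1 \<Longrightarrow> p x \<ge> 1"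
proof (induction w arbitrary: p x)
  case (Cons i w)
  then obtain q where q: "state w = Some q" "p = q \<circ> aswap (int i)"
    by (auto split: option.splits if_splits)
  have "aswap (int i) x \<ge> 1"
  proof (rule ccontr)
    assume a: "\<not> aswap (int i) x \<ge> 1"
    then have "x = 1" using Cons.prems(4) by (auto simp: aswap_def split: if_splits)
    then have "N dvd - int i" using a by (auto simp: aswap_def split: if_splits)
    then have "n dvd i" by (simp only: dvd_minus_iff int_dvd_int_iff)
    then have "i = 0" using Cons.prems(1) by (auto dest: dvd_imp_le)
    then show False using Cons.prems(2) by auto
  qed
  then show ?case using Cons.IH[OF _ _ q(1)] Cons.prems q(2) by simp
qed simp

text \<open>A missing letter makes one of these borders impassable. The translation, however, sends
  a small residue outside \<open>I\<close> below the border, so \<open>I\<close> would have to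
  contain a full interval of k residues.\<close>

lemma trl_word_has_both:
  assumes k: "1 \<le> k" "k < n" and I: "I \<in> Sub k" "I \<noteq> {0..<k}" "I \<noteq> {1..k}"
  shows "n - 1 \<in> set (trl_word k I)" "0 \<in> set (trl_word k I)"
proof -
  note w = trl_word_props[OF k I(1)]
  have fin: "finite I" "card I = k" using I by (auto simp: Sub_def intro: finite_subset)
  show "n - 1 \<in> set (trl_word k I)"
  proof (rule ccontr)
    assume a: "n - 1 \<notin> set (trl_word k I)"
    have "{0..<k} \<subseteq> I"
    proof (rule ccontr)
      assume "\<not> {0..<k} \<subseteq> I"
      then obtain x where x: "x < k" "x \<notin> I" by (auto simp: subset_iff)
      then have "trl k I (int x) < 0" using k by (simp add: trl_def vtx_of_nat)
      then show False using state_no_last[OF w(1) a w(2), of "int x"] by simp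
    qed
    then show False using card_subset_eq[OF fin(1), of "{0..<k}"] fin(2) I(2) by simp
  qed
  show "0 \<in> set (trl_word k I)"
  proof (rule ccontr)
    assume a: "0 \<notin> set (trl_word k I)"
    have "{1..k} \<subseteq> I"
    proof (rule ccontr)
      assume "\<not> {1..k} \<subseteq> I"
      then obtain x where x: "1 \<le> x" "x \<le> k" "x \<notin> I" by (auto simp: subset_iff)
      then have "trl k I (int x) < 1" using k by (simp add: trl_def vtx_of_nat)
      then show False using state_no_zero[OF w(1) a w(2), of "int x"] x by simp
    qed
    then show False using card_subset_eq[OF fin(1), of "{1..k}"] fin(2) I(3) by simp
  qed
qed

text \<open>The summand of \<open>I\<close> on the left is matched with the summand of its image
  under \<open>tau i\<close> on the right. By \<open>trl_aswap\<close> both words have the same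
  permutation, and they are reduced under the same condition \<open>U\<close>; otherwise both
  vanish.\<close>

theorem trl_rel_commute:
  assumes k: "1 \<le> k" "k < n" and i: "i < n" and j: "j < n" "N dvd int j - (int i - int k)"
  shows "lm [i] (trl_rel k) - rm [j] (trl_rel k) \<in> nil"
proof -
  have bij: "bij_betw (\<lambda>I. tau i ` I) (Sub k) (Sub k)"
    by (rule bij_betw_byWitness[where f' = "\<lambda>I. tau i ` I"])
      (use tau_Sub[OF i] in \<open>auto simp: image_image\<close>)
  have "rm [j] (trl_rel k) = (\<Sum>J\<in>Sub k. fa_word (trl_word k J @ [j]))" by (simp add: trl_rel_def lrm_simps)
  also have "\<dots> = (\<Sum>I\<in>Sub k. fa_word (trl_word k (tau i ` I) @ [j]))"
    by (rule sum.reindex_bij_betw[OF bij, symmetric])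
  finally have "lm [i] (trl_rel k) - rm [j] (trl_rel k)
      = (\<Sum>I\<in>Sub k. fa_word (i # trl_word k I) - fa_word (trl_word k (tau i ` I) @ [j]))"
    by (simp add: trl_rel_def lrm_simps sum_subtractf)
  also have "\<dots> \<in> nil"
  proof (rule fa.subspace_sum[OF nil_subspace])
    fix I assume I: "I \<in> Sub k"
    let ?J = "tau i ` I"
    note w = trl_word_props[OF k I] and w' = trl_word_props[OF k tau_Sub[OF i I]]
    let ?s = "(i + 1) mod n"
    have Jm: "y \<in> ?J \<longleftrightarrow> tau i y \<in> I" for y
    proof
      assume "tau i y \<in> I"
      then show "y \<in> ?J" by (intro image_eqI[of _ _ "tau i y"]) auto
    qed auto
    have Ji: "i \<in> ?J \<longleftrightarrow> ?s \<in> I" "?s \<in> ?J \<longleftrightarrow> i \<in> I" unfolding Jm by (simp_all add: tau_def)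
    define U where "U \<longleftrightarrow> \<not> (i \<in> I \<and> ?s \<notin> I)"
    have l: "trl k I (int i) < trl k I (int i + 1) \<longleftrightarrow> U"
      using vtx_of_nat[OF i] vtx_Suc[OF i] N3 by (auto simp: trl_def U_def)
    have s1: "state (i # trl_word k I) = (if U then Some (trl k I \<circ> aswap (int i)) else None)"
      using w(2) l by simp
    have "inv (trl k ?J) (int j) < inv (trl k ?J) (int j + 1) \<longleftrightarrow>
        trl_inv k ?J (int i - int k) < trl_inv k ?J (int i - int k + 1)"
      using per_step(1)[OF _ j(2), of "inv (trl k ?J)"] aperm_inv[OF trl_aperm, of k ?J] unfolding trl_inv by (simp add: aperm_def)
    also have "\<dots> \<longleftrightarrow> U"
      using vtx_of_nat[OF i] vtx_Suc[OF i] N3 Ji by (auto simp: trl_inv_def U_def add.commute)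
    finally have "state (trl_word k ?J @ [j]) = (if U then Some (aswap (int j) \<circ> trl k ?J) else None)"
      using state_snoc(1)[OF w'(2), of j] by simp
    then have s2: "state (trl_word k ?J @ [j]) = state (i # trl_word k I)" using s1 trl_aswap[OF i j(2), of I] by simp
    have le: "i # trl_word k I \<in> letters" "trl_word k ?J @ [j] \<in> letters" using w w' i j by auto
    show "fa_word (i # trl_word k I) - fa_word (trl_word k ?J @ [j]) \<in> nil"
    proof (cases U)
      case True
      then show ?thesis using state_eq_wcong[OF le] s1 s2 by (auto simp: wcong_def)
    next
      case False
      then show ?thesis using state_None_nil[OF le(1)] state_None_nil[OF le(2)] s1 s2 by (intro nil_diff) auto
    qed
  qed
  finally show ?thesis .
qed

section \<open>Braid moves on the two fixed rectangle words\<close>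

lemma state_app_cong: "state w = state w' \<Longrightarrow> state (u @ w) = state (u @ w')" by (induction u) auto

lemma state_comm:
  assumes "i < n" "j < n" "i \<noteq> j" "i \<noteq> (j + 1) mod n" "j \<noteq> (i + 1) mod n"
  shows "state (i # j # w) = state (j # i # w)"
proof (cases "state w")
  case (Some q)
  have nd: "\<not> N dvd int i - int j" "\<not> N dvd int j - int i" "\<not> N dvd int i - int j - 1" "\<not> N dvd int j - int i - 1"
    using assms dvd_nat_eq dvd_nat_Suc by auto
  have f: "aswap a b = b" "aswap a (b + 1) = b + 1" if "\<not> N dvd b - a" "\<not> N dvd b - a - 1" "\<not> N dvd a - b - 1" for a b
    using that dvd_diff_commute[of N "b + 1" a] by (simp_all add: aswap_def algebra_simps)
  have c: "aswap (int i) \<circ> aswap (int j) = aswap (int j) \<circ> aswap (int i)"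
    by (rule aswap_commute) (use nd in auto)
  have c': "q \<circ> aswap (int i) \<circ> aswap (int j) = q \<circ> aswap (int j) \<circ> aswap (int i)" using c by (simp add: comp_assoc)
  show ?thesis using Some f[of "int i" "int j"] f[of "int j" "int i"] nd c' by simp
qed simp

text \<open>Either side is reduced exactly when \<open>q\<close> increases at three consecutive
  places; if it does not, both sides are \<open>None\<close>, so the identity also covers
  non-reduced words.\<close>

lemma state_braid:
  assumes "i < n" "j = (i + 1) mod n"
  shows "state (i # j # i # w) = state (j # i # j # w)"
proof (cases "state w")
  case (Some q)
  let ?i = "int i"
  have jn: "j < n" using assms n3 by simp
  have d: "N dvd int j - (?i + 1)" using dvd_nat_Suc[OF assms(1) jn] assms(2) by (simp add: algebra_simps)
  have z: "N dvd ?i - ?i" by simp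
  have e: "?i + 1 + 1 = ?i + 2" by simp
  note S = state_Cons[OF _ z] state_Cons[OF _ d]
  have N1: "state (a # v) = None" if "state v = None" for a v using that by simp
  have b: "q \<circ> aswap ?i \<circ> aswap (?i + 1) \<circ> aswap ?i = q \<circ> aswap (?i + 1) \<circ> aswap ?i \<circ> aswap (?i + 1)"
    using aswap_braid[of ?i] by (simp add: comp_assoc)
  consider "q ?i < q (?i + 1)" "q (?i + 1) < q (?i + 2)" | "\<not> q ?i < q (?i + 1)" | "\<not> q (?i + 1) < q (?i + 2)" by blast
  then show ?thesis
  proof cases
    case 1
    have l1: "state (i # w) = Some (q \<circ> aswap ?i)" using S(1)[OF Some] 1 by simp
    have l2: "state (j # i # w) = Some (q \<circ> aswap ?i \<circ> aswap (?i + 1))"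
      unfolding S(2)[OF l1] e using 1 by (simp only: comp_apply aswap_at(2,4) if_True less_trans[OF 1])
    have l3: "state (i # j # i # w) = Some (q \<circ> aswap ?i \<circ> aswap (?i + 1) \<circ> aswap ?i)"
      unfolding S(1)[OF l2] using 1 by (simp only: comp_apply aswap_at(1,3,4,9) if_True add.assoc one_add_one)
    have r1: "state (j # w) = Some (q \<circ> aswap (?i + 1))" unfolding S(2)[OF Some] e using 1 by simp
    have r2: "state (i # j # w) = Some (q \<circ> aswap (?i + 1) \<circ> aswap ?i)"
      unfolding S(1)[OF r1] using 1 by (simp only: comp_apply aswap_at(3,9) if_True less_trans[OF 1])
    have r3: "state (j # i # j # w) = Some (q \<circ> aswap (?i + 1) \<circ> aswap ?i \<circ> aswap (?i + 1))"
      unfolding S(2)[OF r2] e using 1 by (simp only: comp_apply aswap_at(2,3,4,10) if_True)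
    show ?thesis using l3 r3 b by simp
  next
    case 2
    then have l: "state (i # j # i # w) = None" using S(1)[OF Some] N1 by metis
    have "state (j # i # j # w) = None"
    proof (cases "state (i # j # w)")
      case (Some p)
      then have c: "state (j # w) = Some (q \<circ> aswap (?i + 1))" "p = q \<circ> aswap (?i + 1) \<circ> aswap ?i"
        using S(2)[OF \<open>state w = Some q\<close>] S(1)[of "j # w" "q \<circ> aswap (?i + 1)"] N1[of "j # w" i]
        by (auto split: if_splits simp del: state.simps o_apply)
      show ?thesis unfolding S(2)[OF Some] e c(2) using 2
        by (simp only: comp_apply aswap_at(2,3,4,10) if_False)
    qed simp
    then show ?thesis using l by simp
  next
    case 3
    then have r: "state (j # i # j # w) = None" using S(2)[OF Some] e N1 by metis
    have "state (i # j # i # w) = None"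
    proof (cases "state (j # i # w)")
      case (Some p)
      then have c: "state (i # w) = Some (q \<circ> aswap ?i)" "p = q \<circ> aswap ?i \<circ> aswap (?i + 1)"
        using S(1)[OF \<open>state w = Some q\<close>] S(2)[of "i # w" "q \<circ> aswap ?i"] N1[of "i # w" j]
        by (auto split: if_splits simp del: state.simps o_apply)
      show ?thesis unfolding S(1)[OF Some] c(2) using 3
        by (simp only: comp_apply aswap_at(1,3,4,9) if_False add.assoc one_add_one)
    qed simp
    then show ?thesis using r by simp
  qed
qed simp

lemma state_comm_list:
  assumes "\<And>x. x \<in> set u \<Longrightarrow> x < n \<and> x \<noteq> i \<and> i \<noteq> (x + 1) mod n \<and> x \<noteq> (i + 1) mod n" "i < n"
  shows "state (i # u @ z) = state (u @ i # z)"
  using assms(1)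
proof (induction u)
  case (Cons x u)
  have "state (i # x # u @ z) = state (x # i # u @ z)" using Cons.prems[of x] assms(2) by (intro state_comm) auto
  also have "\<dots> = state (x # u @ i # z)" using state_app_cong[OF Cons.IH, of "[x]"] Cons.prems by simp
  finally show ?case by simp
qed simp

text \<open>The letter \<open>l + 1\<close> commutes up to the pair \<open>l\<close>,
  \<open>l + 1\<close> of the run, the braid relation turns it into \<open>l\<close>, and this
  \<open>l\<close> commutes with the rest.\<close>

lemma state_row:
  assumes "1 \<le> j" "j \<le> l" "l + 1 < m" "m \<le> n"
  shows "state ((l + 1) # [j..<m] @ z) = state ([j..<m] @ l # z)"
proof -
  have sp: "[j..<m] = [j..<l] @ l # (l + 1) # [l + 2..<m]"
  proof -
    have "[j..<m] = [j..<l] @ [l..<m]" using assms upt_add_eq_append[of j l "m - l"] by simp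
    also have "[l..<m] = l # (l + 1) # [l + 2..<m]" using assms by (simp add: upt_conv_Cons)
    finally show ?thesis .
  qed
  have "state ((l + 1) # [j..<m] @ z) = state ([j..<l] @ (l + 1) # l # (l + 1) # [l + 2..<m] @ z)"
    unfolding sp using state_comm_list[of "[j..<l]" "l + 1" "l # (l + 1) # [l + 2..<m] @ z"] assms
    by (auto simp: mod_Suc split: if_splits)
  also have "state ((l + 1) # l # (l + 1) # [l + 2..<m] @ z) = state (l # (l + 1) # l # [l + 2..<m] @ z)"
    using state_braid[of l "l + 1"] assms by simp
  then have "state ([j..<l] @ (l + 1) # l # (l + 1) # [l + 2..<m] @ z) = state ([j..<l] @ l # (l + 1) # l # [l + 2..<m] @ z)"
    by (rule state_app_cong)
  also have "state (l # [l + 2..<m] @ z) = state ([l + 2..<m] @ l # z)"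
    using assms by (intro state_comm_list) (auto simp: mod_Suc split: if_splits)
  then have "state ([j..<l] @ l # (l + 1) # l # [l + 2..<m] @ z) = state (([j..<l] @ [l, l + 1]) @ ([l + 2..<m] @ l # z))"
    using state_app_cong[of "l # [l + 2..<m] @ z" "[l + 2..<m] @ l # z" "[j..<l] @ [l, l + 1]"] by simp
  also have "\<dots> = state ([j..<m] @ l # z)" unfolding sp by simp
  finally show ?thesis .
qed

text \<open>The rows shared by the two fixed words: the first word has row 0 behind them, the
  shifted word has a new top row, beginning with k, in front.\<close>

definition rect_rest :: "nat \<Rightarrow> nat list" where "rect_rest k = concat (map (\<lambda>j. [j..<n - k + j]) (rev [1..<k]))"

lemma rect_word_rect_rest: assumes "1 \<le> k" "k < n" shows "rect_word k = rect_rest k @ [0] @ [1..<n - k]"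
proof -
  have "[0..<k] = 0 # [1..<k]" using assms by (simp add: upt_conv_Cons)
  then show ?thesis using assms by (simp add: rect_word_def rect_rest_def upt_conv_Cons)
qed

lemma y1_rect_rest: assumes "1 \<le> k" "k < n" shows "map Suc (rect_word k) = [k..<n - 1] @ [n - 1] @ rect_rest k"
proof -
  have "map Suc (rect_word k) = concat (map (\<lambda>j. [j..<n - k + j]) (rev [1..<Suc k]))"
  proof -
    have "map Suc (rev [0..<k]) = rev [1..<Suc k]" using map_Suc_upt[of 0 k] by (simp add: rev_map[symmetric] del: upt_Suc)
    moreover have "map Suc (rect_word k) = concat (map (\<lambda>j. [j..<n - k + j]) (map Suc (rev [0..<k])))"
      by (simp add: rect_word_def map_concat comp_def map_Suc_upt del: map_map flip: map_map) (simp add: comp_def map_Suc_upt)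
    ultimately show ?thesis by simp
  qed
  also have "\<dots> = [k..<n] @ rect_rest k" using assms by (simp add: rect_rest_def)
  also have "[k..<n] = [k..<n - 1] @ [n - 1]" using assms
    by (metis Suc_diff_1 Suc_le_eq le_zero_eq not_gr_zero upt_Suc_append Suc_pred bot_nat_0.not_eq_extremum less_Suc_eq_le n3 zero_less_numeral less_le_trans)
  finally show ?thesis by simp
qed

lemma rect_rest_letters: "k < n \<Longrightarrow> set (rect_rest k) \<subseteq> {1..<n - 1}" by (auto simp: rect_rest_def)

text \<open>Deleting 0 from one fixed word and n - 1 from the other leaves these two words. In
  crossing the k - 1 rows a letter drops by one per row, from \<open>i + k - 1\<close> to
  \<open>i\<close>. Because of this equality the top components of the two words sit at the same
  permutation.\<close>

lemma state_rect_rest: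
  assumes "1 \<le> k" "k < n"
  shows "state (rect_rest k @ [1..<n - k]) = state ([k..<n - 1] @ rect_rest k)"
proof -
  have row: "1 \<le> r \<Longrightarrow> r \<le> k \<Longrightarrow> 1 \<le> i \<Longrightarrow> i < n - k \<Longrightarrow>
     state ((i + r - 1) # concat (map (\<lambda>j. [j..<n - k + j]) (rev [1..<r])) @ z)
      = state (concat (map (\<lambda>j. [j..<n - k + j]) (rev [1..<r])) @ i # z)" for r i z
  proof (induction r rule: nat_induct_at_least)
    case (Suc r)
    let ?B = "concat (map (\<lambda>j. [j..<n - k + j]) (rev [1..<r]))"
    have e: "concat (map (\<lambda>j. [j..<n - k + j]) (rev [1..<Suc r])) = [r..<n - k + r] @ ?B" using Suc by simp
    have "state ((i + r - 1 + 1) # [r..<n - k + r] @ ?B @ z) = state ([r..<n - k + r] @ (i + r - 1) # ?B @ z)"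
      by (rule state_row) (use Suc assms in auto)
    also have "\<dots> = state ([r..<n - k + r] @ ?B @ i # z)" by (rule state_app_cong) (use Suc in auto)
    finally show ?case unfolding e using Suc.prems Suc.hyps by simp
  qed simp
  have "set L \<subseteq> {1..<n - k} \<Longrightarrow> state (map (\<lambda>i. i + k - 1) L @ rect_rest k) = state (rect_rest k @ L)" for L
  proof (induction L)
    case (Cons i L)
    have "state (map (\<lambda>i. i + k - 1) (i # L) @ rect_rest k) = state ((i + k - 1) # rect_rest k @ L)"
      using state_app_cong[of _ _ "[i + k - 1]"] Cons by simp
    also have "\<dots> = state (rect_rest k @ i # L)" using row[of k i L] assms Cons.prems by (simp add: rect_rest_def)
    finally show ?case .
  qed simp
  from this[of "[1..<n - k]"] have "state (map (\<lambda>i. i + k - 1) [1..<n - k] @ rect_rest k) = state (rect_rest k @ [1..<n - k])" by simp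
  moreover have "map (\<lambda>i. i + k - 1) [1..<n - k] = [k..<n - 1]"
    by (rule nth_equalityI) (use assms in auto)
  ultimately show ?thesis by simp
qed


section \<open>A braided comultiplication for words along the cycle\<close>

abbreviation FK :: "(nat \<times> nat) fa set" where "FK \<equiv> fk_ideal n"
abbreviation fkS :: "(nat \<times> nat) fa set" where "fkS \<equiv> wspan (fk_gens n)"

lemma fk_rels_words:
  "fk_rels n =
     {fa_word [(i, j)] + fa_word [(j, i)] | i j. (i, j) \<in> fk_gens n}
   \<union> {fa_word [(i, j), (i, j)] | i j. (i, j) \<in> fk_gens n}
   \<union> {fa_word [(i, j), (k, l)] - fa_word [(k, l), (i, j)] | i j k l.
        i < n \<and> j < n \<and> k < n \<and> l < n \<and> distinct [i, j, k, l]}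
   \<union> {fa_word [(i, j), (j, k)] + fa_word [(j, k), (k, i)] + fa_word [(k, i), (i, j)]
        | i j k. i < n \<and> j < n \<and> k < n \<and> distinct [i, j, k]}"
  unfolding fk_rels_def fkx_def fa_mult_word by simp

lemma fk_rels_wspan: "fk_rels n \<subseteq> fkS"
  unfolding fk_rels_words
  by (auto intro!: wspan_add wspan_diff wspan_word simp: fk_gens_def)

lemma FK_subspace: "fa.subspace FK" unfolding fk_ideal_def by (rule fa_ideal_subspace)
lemma FK_wspan: "FK \<subseteq> fkS" unfolding fk_ideal_def by (rule ideal_wspan[OF fk_rels_wspan])

lemmas FK_add = fa.subspace_add[OF FK_subspace]
lemmas FK_diff = fa.subspace_diff[OF FK_subspace]
lemmas FK_0 = fa.subspace_0[OF FK_subspace]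
lemmas FK_scale = fa.subspace_scale[OF FK_subspace]
lemma FK_lm: "x \<in> FK \<Longrightarrow> u \<in> lists (fk_gens n) \<Longrightarrow> lm u x \<in> FK"
  unfolding fk_ideal_def by (rule ideal_lm)
lemma FK_rm: "x \<in> FK \<Longrightarrow> u \<in> lists (fk_gens n) \<Longrightarrow> rm u x \<in> FK"
  unfolding fk_ideal_def by (rule ideal_rm)

lemma FK_rel_mult: assumes "r \<in> fk_rels n" "x \<in> fkS" shows "fa_mult r x \<in> FK"
  unfolding fk_ideal_def
  by (rule ideal_mult_right[OF _ assms(2)]) (rule fa_ideal.base[OF assms(1)])

lemma fa_mult_words:
  "fa_mult (fa_word u + fa_word v) x = lm u x + lm v x"
  "fa_mult (fa_word u - fa_word v) x = lm u x - lm v x"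
  "fa_mult (fa_word u + fa_word v + fa_word w) x = lm u x + lm v x + lm w x"
  unfolding lm_def by (simp_all add: lin_simps[OF fa_mult_linear_left])

lemma FK_anti: "(a, b) \<in> fk_gens n \<Longrightarrow> x \<in> fkS \<Longrightarrow> lm [(a, b)] x + lm [(b, a)] x \<in> FK"
  using FK_rel_mult[of "fa_word [(a, b)] + fa_word [(b, a)]" x]
  unfolding fa_mult_words fk_rels_words by blast

lemma FK_sq: "(a, b) \<in> fk_gens n \<Longrightarrow> x \<in> fkS \<Longrightarrow> lm [(a, b)] (lm [(a, b)] x) \<in> FK"
  using FK_rel_mult[of "fa_word [(a, b), (a, b)]" x]
  unfolding fk_rels_words lm_def[symmetric] by (simp add: lm_lm) blast

lemma FK_comm: "a < n \<Longrightarrow> b < n \<Longrightarrow> c < n \<Longrightarrow> d < n \<Longrightarrow> distinct [a, b, c, d] \<Longrightarrow> x \<in> fkS \<Longrightarrow>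
   lm [(a, b)] (lm [(c, d)] x) - lm [(c, d)] (lm [(a, b)] x) \<in> FK"
  using FK_rel_mult[of "fa_word [(a, b), (c, d)] - fa_word [(c, d), (a, b)]" x]
  unfolding fk_rels_words fa_mult_words by (simp add: lm_lm) blast

lemma FK_tri: "a < n \<Longrightarrow> b < n \<Longrightarrow> c < n \<Longrightarrow> distinct [a, b, c] \<Longrightarrow> x \<in> fkS \<Longrightarrow>
   lm [(a, b)] (lm [(b, c)] x) + lm [(b, c)] (lm [(c, a)] x) + lm [(c, a)] (lm [(a, b)] x) \<in> FK"
  using FK_rel_mult[of "fa_word [(a, b), (b, c)] + fa_word [(b, c), (c, a)] + fa_word [(c, a), (a, b)]" x]
  unfolding fk_rels_words fa_mult_words by (simp add: lm_lm) blast

definition tau_pair :: "nat \<Rightarrow> nat \<times> nat \<Rightarrow> nat \<times> nat" where "tau_pair i = map_prod (tau i) (tau i)"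

lemma tau_pair_tau_pair [simp]: "tau_pair i (tau_pair i c) = c" by (cases c) (simp add: tau_pair_def)

lemma tau_inj: "tau i x = tau i y \<longleftrightarrow> x = y" by (metis tau_tau)

lemma tau_pair_gens: "i < n \<Longrightarrow> c \<in> fk_gens n \<Longrightarrow> tau_pair i c \<in> fk_gens n"
  by (cases c) (auto simp: tau_pair_def fk_gens_def tau_less tau_inj)

text \<open>The transposition of two neighbouring vertices acting on the generators. It is an
  involution, so plain precomposition gives the action.\<close>

definition relabel :: "nat \<Rightarrow> (nat \<times> nat) fa \<Rightarrow> (nat \<times> nat) fa" where
  "relabel i x = (\<lambda>w. x (map (tau_pair i) w))"

lemma relabel_linear: "fa_linear (relabel i)"
  by (rule fa_linearI) (auto simp: relabel_def pw_simps)

lemma relabel_word [simp]: "relabel i (fa_word w) = fa_word (map (tau_pair i) w)"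
proof -
  have "map (tau_pair i) u = w \<longleftrightarrow> u = map (tau_pair i) w" for u
    by (auto simp: comp_def)
  then show ?thesis by (simp add: relabel_def fa_word_def fun_eq_iff)
qed

lemma relabel_relabel [simp]: "relabel i (relabel i x) = x"
  by (simp add: relabel_def comp_def)

lemmas relabel_simps = lin_simps[OF relabel_linear]

lemma relabel_wspan: "i < n \<Longrightarrow> x \<in> fkS \<Longrightarrow> relabel i x \<in> fkS"
  by (rule wspan_lift[OF relabel_linear wspan_subspace]) (auto intro!: wspan_word tau_pair_gens)

lemma relabel_lm: "x \<in> fkS \<Longrightarrow> relabel i (lm u x) = lm (map (tau_pair i) u) (relabel i x)"
  by (rule wspan_eq[OF fa_linear_comp[OF relabel_linear lm_linear] fa_linear_comp[OF lm_linear relabel_linear]]) auto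

lemma relabel_rm: "x \<in> fkS \<Longrightarrow> relabel i (rm u x) = rm (map (tau_pair i) u) (relabel i x)"
  by (rule wspan_eq[OF fa_linear_comp[OF relabel_linear rm_linear] fa_linear_comp[OF rm_linear relabel_linear]]) auto

lemma relabel_rels: assumes i: "i < n" and r: "r \<in> fk_rels n" shows "relabel i r \<in> fk_rels n"
proof -
  have g: "(tau i a, tau i b) \<in> fk_gens n" if "(a, b) \<in> fk_gens n" for a b
    using tau_pair_gens[OF i that] by (simp add: tau_pair_def)
  have d: "distinct (map (tau i) l) \<longleftrightarrow> distinct l" for l
    by (simp add: distinct_map inj_on_def tau_inj)
  from r[unfolded fk_rels_words] consider
      (1) a b where "r = fa_word [(a, b)] + fa_word [(b, a)]" "(a, b) \<in> fk_gens n"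
    | (2) a b where "r = fa_word [(a, b), (a, b)]" "(a, b) \<in> fk_gens n"
    | (3) a b c e where "r = fa_word [(a, b), (c, e)] - fa_word [(c, e), (a, b)]"
        "a < n" "b < n" "c < n" "e < n" "distinct [a, b, c, e]"
    | (4) a b c where "r = fa_word [(a, b), (b, c)] + fa_word [(b, c), (c, a)] + fa_word [(c, a), (a, b)]"
        "a < n" "b < n" "c < n" "distinct [a, b, c]" by blast
  then show ?thesis
  proof cases
    case 1
    then have "relabel i r = fa_word [(tau i a, tau i b)] + fa_word [(tau i b, tau i a)]"
      by (simp add: relabel_simps tau_pair_def)
    then show ?thesis unfolding fk_rels_words using g[OF 1(2)] by blast
  next
    case 2
    then have "relabel i r = fa_word [(tau i a, tau i b), (tau i a, tau i b)]" by (simp add: tau_pair_def)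
    then show ?thesis unfolding fk_rels_words using g[OF 2(2)] by blast
  next
    case 3
    then have "relabel i r = fa_word [(tau i a, tau i b), (tau i c, tau i e)] - fa_word [(tau i c, tau i e), (tau i a, tau i b)]"
      by (simp add: relabel_simps tau_pair_def)
    moreover have "distinct [tau i a, tau i b, tau i c, tau i e]" using d[of "[a, b, c, e]"] 3 by simp
    ultimately show ?thesis unfolding fk_rels_words using 3 tau_less[OF i] by blast
  next
    case 4
    then have "relabel i r = fa_word [(tau i a, tau i b), (tau i b, tau i c)] + fa_word [(tau i b, tau i c), (tau i c, tau i a)]
       + fa_word [(tau i c, tau i a), (tau i a, tau i b)]"
      by (simp add: relabel_simps tau_pair_def)
    moreover have "distinct [tau i a, tau i b, tau i c]" using d[of "[a, b, c]"] 4 by simp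
    ultimately show ?thesis unfolding fk_rels_words using 4 tau_less[OF i] by blast
  qed
qed

lemma relabel_FK: assumes "i < n" "x \<in> FK" shows "relabel i x \<in> FK"
proof (rule ideal_lift[OF fk_rels_wspan relabel_linear FK_subspace assms(2)[unfolded fk_ideal_def]])
  fix u v r assume a: "u \<in> lists (fk_gens n)" "v \<in> lists (fk_gens n)" "r \<in> fk_rels n"
  have r: "r \<in> fkS" using a fk_rels_wspan by auto
  have l: "map (tau_pair i) w \<in> lists (fk_gens n)" if "w \<in> lists (fk_gens n)" for w
    using that tau_pair_gens[OF assms(1)] by auto
  have "relabel i (lm u (rm v r)) = lm (map (tau_pair i) u) (rm (map (tau_pair i) v) (relabel i r))"
    using relabel_lm[OF rm_wspan[OF a(2) r]] relabel_rm[OF r] by simp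
  moreover have "relabel i r \<in> FK" unfolding fk_ideal_def by (rule fa_ideal.base[OF relabel_rels[OF assms(1) a(3)]])
  ultimately show "relabel i (lm u (rm v r)) \<in> FK" using l a by (simp add: FK_lm FK_rm)
qed

lemma relabel_FK_iff: "i < n \<Longrightarrow> relabel i x \<in> FK \<longleftrightarrow> x \<in> FK"
  using relabel_FK[of i x] relabel_FK[of i "relabel i x"] by auto

definition inner :: "nat \<Rightarrow> bool" where "inner i \<longleftrightarrow> 1 \<le> i \<and> i \<le> n - 2"

lemma inner_less: "inner i \<Longrightarrow> i + 1 < n" using n3 by (auto simp: inner_def)

text \<open>The letters 1..n - 2 generate the symmetric group on the vertices 1..n - 1, and v runs through it.\<close>

definition inner_desc :: "nat \<Rightarrow> (int \<Rightarrow> int) \<Rightarrow> bool" where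
  "inner_desc i v \<longleftrightarrow> inner i \<and> v (int i + 1) < v (int i)"

text \<open>A tensor with second factor in the nil-Coxeter algebra is stored as the family of its
  coefficients at the basis elements \<open>v\<close>; equality is taken in each component modulo
  \<open>FK\<close>.\<close>

type_synonym fam = "(int \<Rightarrow> int) \<Rightarrow> (nat \<times> nat) fa"

text \<open>Left multiplication by a generator, seen through the braided coproduct whose second factor is
projected to the nil-Coxeter algebra on the letters 1..n - 2. The argument v indexes the component
in that factor.\<close>

definition cop_letter :: "nat \<Rightarrow> fam \<Rightarrow> fam" where
  "cop_letter i \<Psi> v = lm [ecyc n i] (\<Psi> v) + (if inner_desc i v then relabel i (\<Psi> (v \<circ> aswap (int i))) else 0)"

lemma ecyc_gens: "i < n \<Longrightarrow> ecyc n i \<in> fk_gens n"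
  using Suc_mod_neq[of i] by (auto simp: ecyc_def fk_gens_def)

definition fam_in_span :: "fam \<Rightarrow> bool" where "fam_in_span \<Psi> \<longleftrightarrow> (\<forall>v. \<Psi> v \<in> fkS)"
definition fam_in_FK :: "fam \<Rightarrow> bool" where "fam_in_FK \<Psi> \<longleftrightarrow> (\<forall>v. \<Psi> v \<in> FK)"

lemma cop_letter_ok: "i < n \<Longrightarrow> fam_in_span \<Psi> \<Longrightarrow> fam_in_span (cop_letter i \<Psi>)"
  unfolding fam_in_span_def cop_letter_def using ecyc_gens[of i]
  by (auto intro!: wspan_add lm_wspan relabel_wspan wspan_0)

lemma cop_letter_fam_in_FK: "i < n \<Longrightarrow> fam_in_FK \<Psi> \<Longrightarrow> fam_in_FK (cop_letter i \<Psi>)"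
  unfolding fam_in_FK_def cop_letter_def using ecyc_gens[of i]
  by (auto intro!: FK_add FK_lm relabel_FK FK_0)

lemma cop_letter_diff: "cop_letter i (\<lambda>v. \<Psi> v - \<Phi> v) = (\<lambda>v. cop_letter i \<Psi> v - cop_letter i \<Phi> v)"
  by (auto simp: cop_letter_def fun_eq_iff[where 'b = "(nat \<times> nat) fa"] lrm_simps relabel_simps algebra_simps)

text \<open>Both mixed terms carry the same coefficient \<open>?y\<close>, once multiplied by
  x_{i,i+1} and once by its relabelled form x_{i+1,i}, and antisymmetry cancels them. A double
  transfer of \<open>i\<close> is impossible, since \<open>v \<circ> aswap (int i)\<close> no longer
  descends at \<open>i\<close>.\<close>

lemma cop_letter_sq: assumes "i < n" "fam_in_span \<Psi>" shows "fam_in_FK (cop_letter i (cop_letter i \<Psi>))"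
  unfolding fam_in_FK_def
proof
  fix v
  let ?s = "aswap (int i)" and ?e = "ecyc n i"
  have ok: "\<Psi> v \<in> fkS" for v using assms(2) by (simp add: fam_in_span_def)
  have e: "?e = (i, (i + 1) mod n)" by (simp add: ecyc_def)
  have te: "tau_pair i ?e = ((i + 1) mod n, i)" by (simp add: tau_pair_def tau_def ecyc_def)
  have sq: "lm [?e] (lm [?e] (\<Psi> v)) \<in> FK" using FK_sq ecyc_gens[OF assms(1)] ok unfolding e by blast
  show "cop_letter i (cop_letter i \<Psi>) v \<in> FK"
  proof (cases "inner_desc i v")
    case True
    then have f: "\<not> inner_desc i (v \<circ> ?s)" by (auto simp: inner_desc_def aswap_at)
    let ?y = "relabel i (\<Psi> (v \<circ> ?s))"
    have y: "?y \<in> fkS" using relabel_wspan[OF assms(1) ok] .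
    have "cop_letter i (cop_letter i \<Psi>) v = lm [?e] (lm [?e] (\<Psi> v)) + (lm [?e] ?y + lm [tau_pair i ?e] ?y)"
      using True f by (simp add: cop_letter_def lrm_simps relabel_lm[OF ok])
    moreover have "lm [?e] ?y + lm [tau_pair i ?e] ?y \<in> FK"
      using FK_anti[of i "(i + 1) mod n" ?y, OF _ y] ecyc_gens[OF assms(1)] unfolding te unfolding e by simp
    ultimately show ?thesis using sq by (simp add: FK_add)
  next
    case False
    then show ?thesis using sq by (simp add: cop_letter_def)
  qed
qed

lemma tau_comm:
  assumes "i < n" "j < n" "i \<noteq> j" "i \<noteq> (j + 1) mod n" "j \<noteq> (i + 1) mod n"
  shows "tau i j = j" "tau i ((j + 1) mod n) = (j + 1) mod n"
    "distinct [i, (i + 1) mod n, j, (j + 1) mod n]"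
proof -
  have "(i + 1) mod n \<noteq> (j + 1) mod n"
  proof
    assume "(i + 1) mod n = (j + 1) mod n"
    then have "N dvd (int i + 1) - (int j + 1)"
      using vtx_Suc[OF assms(1)] vtx_Suc[OF assms(2)] vtx_eq_iff by metis
    then show False using dvd_nat_eq[OF assms(1,2)] assms(3) by simp
  qed
  then show "tau i j = j" "tau i ((j + 1) mod n) = (j + 1) mod n"
    "distinct [i, (i + 1) mod n, j, (j + 1) mod n]"
    using assms Suc_mod_neq[OF assms(1)] Suc_mod_neq[OF assms(2)] by (auto simp: tau_def transpose_def)
qed

text \<open>The two edges have no vertex in common, so neither letter relabels the other and the
  terms can be compared one by one.\<close>

lemma cop_letter_comm:
  assumes ij: "i < n" "j < n" "i \<noteq> j" "i \<noteq> (j + 1) mod n" "j \<noteq> (i + 1) mod n" and "fam_in_span \<Psi>"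
  shows "fam_in_FK (\<lambda>v. cop_letter i (cop_letter j \<Psi>) v - cop_letter j (cop_letter i \<Psi>) v)"
  unfolding fam_in_FK_def
proof
  fix v
  let ?si = "aswap (int i)" and ?sj = "aswap (int j)" and ?e = "ecyc n i" and ?f = "ecyc n j"
  have ji: "j < n" "i < n" "j \<noteq> i" "j \<noteq> (i + 1) mod n" "i \<noteq> (j + 1) mod n" using ij by auto
  have ok: "\<Psi> v \<in> fkS" for v using assms(6) by (simp add: fam_in_span_def)
  have nd: "\<not> N dvd int i - int j" "\<not> N dvd int j - int i" "\<not> N dvd int i - int j - 1" "\<not> N dvd int j - int i - 1"
    using ij dvd_nat_eq dvd_nat_Suc by auto
  have fx: "aswap a b = b" "aswap a (b + 1) = b + 1" if "\<not> N dvd b - a" "\<not> N dvd b - a - 1" "\<not> N dvd a - b - 1" for a b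
    using that dvd_diff_commute[of N "b + 1" a] by (simp_all add: aswap_def algebra_simps)
  have D: "inner_desc i (v \<circ> ?sj) = inner_desc i v" "inner_desc j (v \<circ> ?si) = inner_desc j v"
    using fx[of "int i" "int j"] fx[of "int j" "int i"] nd by (simp_all add: inner_desc_def)
  have c: "v \<circ> ?si \<circ> ?sj = v \<circ> ?sj \<circ> ?si"
    using aswap_commute[of "int i" "int j"] nd by (simp add: comp_assoc)
  have t: "tau_pair i ?f = ?f" "tau_pair j ?e = ?e" using tau_comm[OF ij] tau_comm[OF ji] by (simp_all add: tau_pair_def ecyc_def)
  have tt: "tau i (tau j x) = tau j (tau i x)" for x
    using tau_comm[OF ij] tau_comm[OF ji] unfolding tau_def by (auto simp: transpose_def)
  have SS: "relabel i (relabel j x) = relabel j (relabel i x)" for x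
  proof -
    have "tau_pair i (tau_pair j c) = tau_pair j (tau_pair i c)" for c by (cases c) (simp add: tau_pair_def tt)
    then show ?thesis by (simp add: relabel_def comp_def)
  qed
  have cm: "lm [?e] (lm [?f] (\<Psi> v)) - lm [?f] (lm [?e] (\<Psi> v)) \<in> FK"
    unfolding ecyc_def using tau_comm[OF ij] ij by (intro FK_comm ok) auto
  have "cop_letter i (cop_letter j \<Psi>) v - cop_letter j (cop_letter i \<Psi>) v = lm [?e] (lm [?f] (\<Psi> v)) - lm [?f] (lm [?e] (\<Psi> v))"
    using D t c SS by (simp add: cop_letter_def lrm_simps relabel_simps relabel_lm[OF ok] del: o_apply)
  then show "cop_letter i (cop_letter j \<Psi>) v - cop_letter j (cop_letter i \<Psi>) v \<in> FK" using cm by simp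
qed

lemma three_distinct:
  assumes "i < n" "j = (i + 1) mod n" "k = (j + 1) mod n"
  shows "j < n" "k < n" "distinct [i, j, k]"
proof -
  show j: "j < n" "k < n" using assms n3 by auto
  have "k \<noteq> i"
  proof
    assume ki: "k = i"
    have "N dvd int j - int i - 1" using dvd_nat_Suc[OF assms(1) j(1)] assms(2) by simp
    moreover have "N dvd int i - int j - 1" using dvd_nat_Suc[OF j(1) assms(1)] assms(3) ki by simp
    ultimately have "N dvd (int j - int i - 1) + (int i - int j - 1)" by (rule dvd_add)
    then show False using not_dvd_small[of "-2"] N3 by simp
  qed
  then show "distinct [i, j, k]"
    using Suc_mod_neq[OF assms(1)] Suc_mod_neq[OF j(1)] assms by auto
qed

text \<open>Both sides are expanded by which letters enter the second factor. With two or three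
  transferred letters the terms agree, the latter by the braid relation of permutations and
  relabellings. With one letter the difference is a triangle relation up to signs, and with none it
  is the braid relation of E_n.\<close>

lemma cop_letter_braid:
  assumes i: "i < n" and jd: "j = (i + 1) mod n" and okP: "fam_in_span \<Psi>"
  shows "fam_in_FK (\<lambda>v. cop_letter i (cop_letter j (cop_letter i \<Psi>)) v - cop_letter j (cop_letter i (cop_letter j \<Psi>)) v)"
  unfolding fam_in_FK_def
proof
  fix v
  define k where "k = (j + 1) mod n"
  note td = three_distinct[OF i jd k_def]
  let ?si = "aswap (int i)" and ?sj = "aswap (int j)" and ?e = "ecyc n i" and ?f = "ecyc n j"
  have ok: "\<Psi> v \<in> fkS" for v using okP by (simp add: fam_in_span_def)
  have ef: "?e = (i, j)" "?f = (j, k)" by (simp_all add: ecyc_def jd k_def)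
  have tpi: "tau_pair i (i, j) = (j, i)" "tau_pair i (j, k) = (i, k)" "tau_pair i (i, k) = (j, k)"
    using td unfolding tau_pair_def tau_def jd[symmetric] by (auto simp: transpose_def)
  have tpj: "tau_pair j (j, k) = (k, j)" "tau_pair j (i, j) = (i, k)" "tau_pair j (i, k) = (i, j)"
    using td unfolding tau_pair_def tau_def k_def[symmetric] by (auto simp: transpose_def)
  have g: "(i, j) \<in> fk_gens n" "(j, k) \<in> fk_gens n" "(i, k) \<in> fk_gens n"
     "(j, i) \<in> fk_gens n" "(k, j) \<in> fk_gens n" "(k, i) \<in> fk_gens n"
    using td i by (auto simp: fk_gens_def)
  have ws: "lm [c] x \<in> fkS" if "c \<in> fk_gens n" "x \<in> fkS" for c x using that by (intro lm_wspan) auto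
  \<comment> \<open>One \<open>i\<close> transferred: two choices on the left against a single one
    on the right. After antisymmetry this is an instance of the triangle relation.\<close>
  have R1: "lm [(i, j)] (lm [(j, k)] y) + lm [(i, k)] (lm [(j, i)] y) - lm [(j, k)] (lm [(i, k)] y) \<in> FK"
    if y: "y \<in> fkS" for y
  proof -
    have 1: "lm [(i, j)] (lm [(j, k)] y) + lm [(j, k)] (lm [(k, i)] y) + lm [(k, i)] (lm [(i, j)] y) \<in> FK"
      using FK_tri[of i j k y] td i y by simp
    have 2: "lm [(j, k)] (lm [(i, k)] y + lm [(k, i)] y) \<in> FK"
      using FK_anti[OF g(3) y] g by (intro FK_lm) auto
    have 3: "lm [(i, k)] (lm [(i, j)] y) + lm [(k, i)] (lm [(i, j)] y) \<in> FK"
      using FK_anti[OF g(3) ws[OF g(1) y]] .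
    have 4: "lm [(i, k)] (lm [(i, j)] y + lm [(j, i)] y) \<in> FK"
      using FK_anti[OF g(1) y] g by (intro FK_lm) auto
    have "lm [(i, j)] (lm [(j, k)] y) + lm [(i, k)] (lm [(j, i)] y) - lm [(j, k)] (lm [(i, k)] y)
      = (lm [(i, j)] (lm [(j, k)] y) + lm [(j, k)] (lm [(k, i)] y) + lm [(k, i)] (lm [(i, j)] y))
       - lm [(j, k)] (lm [(i, k)] y + lm [(k, i)] y)
       - (lm [(i, k)] (lm [(i, j)] y) + lm [(k, i)] (lm [(i, j)] y))
       + lm [(i, k)] (lm [(i, j)] y + lm [(j, i)] y)" by (simp add: lrm_simps algebra_simps)
    then show ?thesis using 1 2 3 4 by (simp only: FK_add FK_diff)
  qed
  have R2: "lm [(i, j)] (lm [(i, k)] y) - lm [(j, k)] (lm [(i, j)] y) - lm [(i, k)] (lm [(k, j)] y) \<in> FK"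
    if y: "y \<in> fkS" for y
  proof -
    have 1: "lm [(k, j)] (lm [(j, i)] y) + lm [(j, i)] (lm [(i, k)] y) + lm [(i, k)] (lm [(k, j)] y) \<in> FK"
      using FK_tri[of k j i y] td i y by simp
    have 2: "lm [(j, k)] (lm [(i, j)] y + lm [(j, i)] y) \<in> FK"
      using FK_anti[OF g(1) y] g by (intro FK_lm) auto
    have 3: "lm [(j, k)] (lm [(j, i)] y) + lm [(k, j)] (lm [(j, i)] y) \<in> FK"
      using FK_anti[OF g(2) ws[OF g(4) y]] .
    have 4: "lm [(i, j)] (lm [(i, k)] y) + lm [(j, i)] (lm [(i, k)] y) \<in> FK"
      using FK_anti[OF g(1) ws[OF g(3) y]] .
    have "lm [(i, j)] (lm [(i, k)] y) - lm [(j, k)] (lm [(i, j)] y) - lm [(i, k)] (lm [(k, j)] y)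
      = (lm [(i, j)] (lm [(i, k)] y) + lm [(j, i)] (lm [(i, k)] y))
       - (lm [(k, j)] (lm [(j, i)] y) + lm [(j, i)] (lm [(i, k)] y) + lm [(i, k)] (lm [(k, j)] y))
       - lm [(j, k)] (lm [(i, j)] y + lm [(j, i)] y)
       + (lm [(j, k)] (lm [(j, i)] y) + lm [(k, j)] (lm [(j, i)] y))" by (simp add: lrm_simps algebra_simps)
    then show ?thesis using 1 2 3 4 by (simp only: FK_add FK_diff)
  qed
  \<comment> \<open>The triangle relation is multiplied by x_{ij} on the right and by x_{jk} on the
    left; in the difference the surplus terms contain squares.\<close>
  have R0: "lm [(i, j)] (lm [(j, k)] (lm [(i, j)] y)) - lm [(j, k)] (lm [(i, j)] (lm [(j, k)] y)) \<in> FK"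
    if y: "y \<in> fkS" for y
  proof -
    have a: "lm [(i, j)] (lm [(j, k)] (lm [(i, j)] y)) + lm [(j, k)] (lm [(k, i)] (lm [(i, j)] y))
       + lm [(k, i)] (lm [(i, j)] (lm [(i, j)] y)) \<in> FK"
      using FK_tri[of i j k "lm [(i, j)] y"] td i ws[OF g(1) y] by simp
    have b: "lm [(k, i)] (lm [(i, j)] (lm [(i, j)] y)) \<in> FK"
      by (rule FK_lm[OF FK_sq[OF g(1) y]]) (use g in auto)
    have c: "lm [(j, k)] (lm [(i, j)] (lm [(j, k)] y) + lm [(j, k)] (lm [(k, i)] y) + lm [(k, i)] (lm [(i, j)] y)) \<in> FK"
      using FK_tri[of i j k y] td i y g by (intro FK_lm) auto
    have d: "lm [(j, k)] (lm [(j, k)] (lm [(k, i)] y)) \<in> FK"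
      using FK_sq[OF g(2) ws[OF g(6) y]] .
    have "lm [(i, j)] (lm [(j, k)] (lm [(i, j)] y)) - lm [(j, k)] (lm [(i, j)] (lm [(j, k)] y))
      = (lm [(i, j)] (lm [(j, k)] (lm [(i, j)] y)) + lm [(j, k)] (lm [(k, i)] (lm [(i, j)] y))
       + lm [(k, i)] (lm [(i, j)] (lm [(i, j)] y))) - lm [(k, i)] (lm [(i, j)] (lm [(i, j)] y))
       - lm [(j, k)] (lm [(i, j)] (lm [(j, k)] y) + lm [(j, k)] (lm [(k, i)] y) + lm [(k, i)] (lm [(i, j)] y))
       + lm [(j, k)] (lm [(j, k)] (lm [(k, i)] y))" by (simp add: lrm_simps algebra_simps)
    then show ?thesis using a b c d by (simp only: FK_add FK_diff)
  qed
  define Bi Bj Bij Bji B3 where "Bi = inner_desc i v" and "Bj = inner_desc j v" and "Bij = (inner_desc i v \<and> inner_desc j (v \<circ> ?si))"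
    and "Bji = (inner_desc j v \<and> inner_desc i (v \<circ> ?sj))" and "B3 = (inner_desc i v \<and> inner_desc j (v \<circ> ?si) \<and> inner_desc i (v \<circ> ?si \<circ> ?sj))"
  have pij: "int j = int i + 1" if "inner i" using inner_less[OF that] jd by simp
  have ndi: "inner_desc i v \<Longrightarrow> \<not> inner_desc i (v \<circ> ?si)" "inner_desc j v \<Longrightarrow> \<not> inner_desc j (v \<circ> ?sj)" for v by (auto simp: inner_desc_def aswap_at)
  \<comment> \<open>Both descriptions say that \<open>v\<close> decreases at three consecutive
    places.\<close>
  have B3': "B3 \<longleftrightarrow> inner_desc j v \<and> inner_desc i (v \<circ> ?sj) \<and> inner_desc j (v \<circ> ?sj \<circ> ?si)"
  proof (cases "inner i \<and> inner j")
    case True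
    then have e: "int j = int i + 1" "int i + 1 + 1 = int i + 2" using pij by auto
    show ?thesis using True unfolding B3_def inner_desc_def e
      by (auto simp: comp_def aswap_at add.assoc)
  qed (auto simp: B3_def inner_desc_def)
  have br: "v \<circ> ?si \<circ> ?sj \<circ> ?si = v \<circ> ?sj \<circ> ?si \<circ> ?sj" if B3
  proof -
    have "inner i" using that by (simp add: B3_def inner_desc_def)
    then show ?thesis using aswap_braid[of "int i"] pij by (simp add: comp_assoc)
  qed
  have tb: "tau_pair i (tau_pair j (tau_pair i c)) = tau_pair j (tau_pair i (tau_pair j c))" for c
    using td unfolding tau_pair_def tau_def jd[symmetric] k_def[symmetric]
    by (cases c) (auto simp: transpose_def)
  have SSS: "relabel i (relabel j (relabel i x)) = relabel j (relabel i (relabel j x))" for x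
    using tb by (simp add: relabel_def comp_def)
  note Sl = relabel_lm[OF ok] relabel_lm[OF ws[OF _ ok]] relabel_lm[OF relabel_wspan[OF _ ok]]
  have L: "cop_letter i (cop_letter j (cop_letter i \<Psi>)) v =
     lm [(i, j)] (lm [(j, k)] (lm [(i, j)] (\<Psi> v)))
     + (if Bi then lm [(i, j)] (lm [(j, k)] (relabel i (\<Psi> (v \<circ> ?si)))) + lm [(i, k)] (lm [(j, i)] (relabel i (\<Psi> (v \<circ> ?si)))) else 0)
     + (if Bj then lm [(i, j)] (lm [(i, k)] (relabel j (\<Psi> (v \<circ> ?sj)))) else 0)
     + (if Bji then lm [(i, j)] (relabel j (relabel i (\<Psi> (v \<circ> ?sj \<circ> ?si)))) else 0)
     + (if Bij then lm [(j, k)] (relabel i (relabel j (\<Psi> (v \<circ> ?si \<circ> ?sj)))) else 0)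
     + (if B3 then relabel i (relabel j (relabel i (\<Psi> (v \<circ> ?si \<circ> ?sj \<circ> ?si)))) else 0)"
    using ndi(1)[of v] td i unfolding cop_letter_def ef Bi_def Bj_def Bij_def Bji_def B3_def
    by (auto simp: lrm_simps relabel_simps Sl g tpi tpj algebra_simps simp del: o_apply)
  have R: "cop_letter j (cop_letter i (cop_letter j \<Psi>)) v =
     lm [(j, k)] (lm [(i, j)] (lm [(j, k)] (\<Psi> v)))
     + (if Bi then lm [(j, k)] (lm [(i, k)] (relabel i (\<Psi> (v \<circ> ?si)))) else 0)
     + (if Bj then lm [(j, k)] (lm [(i, j)] (relabel j (\<Psi> (v \<circ> ?sj)))) + lm [(i, k)] (lm [(k, j)] (relabel j (\<Psi> (v \<circ> ?sj)))) else 0)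
     + (if Bji then lm [(i, j)] (relabel j (relabel i (\<Psi> (v \<circ> ?sj \<circ> ?si)))) else 0)
     + (if Bij then lm [(j, k)] (relabel i (relabel j (\<Psi> (v \<circ> ?si \<circ> ?sj)))) else 0)
     + (if B3 then relabel j (relabel i (relabel j (\<Psi> (v \<circ> ?sj \<circ> ?si \<circ> ?sj)))) else 0)"
    using ndi(2)[of v] td i unfolding cop_letter_def ef Bi_def Bj_def Bij_def Bji_def B3'
    by (auto simp: lrm_simps relabel_simps Sl g tpi tpj algebra_simps simp del: o_apply)
  let ?x = "relabel i (\<Psi> (v \<circ> ?si))" and ?y = "relabel j (\<Psi> (v \<circ> ?sj))"
  have ok2: "?x \<in> fkS" "?y \<in> fkS" using relabel_wspan ok i td by auto
  have e3: "(if B3 then relabel i (relabel j (relabel i (\<Psi> (v \<circ> ?si \<circ> ?sj \<circ> ?si)))) else 0)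
      = (if B3 then relabel j (relabel i (relabel j (\<Psi> (v \<circ> ?sj \<circ> ?si \<circ> ?sj)))) else 0)"
    using br SSS by simp
  have "cop_letter i (cop_letter j (cop_letter i \<Psi>)) v - cop_letter j (cop_letter i (cop_letter j \<Psi>)) v =
     (lm [(i, j)] (lm [(j, k)] (lm [(i, j)] (\<Psi> v))) - lm [(j, k)] (lm [(i, j)] (lm [(j, k)] (\<Psi> v))))
     + (if Bi then lm [(i, j)] (lm [(j, k)] ?x) + lm [(i, k)] (lm [(j, i)] ?x) - lm [(j, k)] (lm [(i, k)] ?x) else 0)
     + (if Bj then lm [(i, j)] (lm [(i, k)] ?y) - lm [(j, k)] (lm [(i, j)] ?y) - lm [(i, k)] (lm [(k, j)] ?y) else 0)"
    unfolding L R e3 by (simp add: algebra_simps)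
  also have "\<dots> \<in> FK" using R0[OF ok] R1[OF ok2(1)] R2[OF ok2(2)] by (intro FK_add) (auto intro: FK_0)
  finally show "cop_letter i (cop_letter j (cop_letter i \<Psi>)) v - cop_letter j (cop_letter i (cop_letter j \<Psi>)) v \<in> FK" .
qed


section \<open>The coproduct on words and its descent to the nil-Coxeter algebra\<close>

fun cop_word :: "nat list \<Rightarrow> fam" where
  "cop_word [] v = (if v = id then fa_word [] else 0)"
| "cop_word (i # w) v = cop_letter i (cop_word w) v"

definition cop :: "(int \<Rightarrow> int) \<Rightarrow> nat fa \<Rightarrow> (nat \<times> nat) fa" where
  "cop v = fa_lift (\<lambda>w. cop_word w v)"

lemma cop_linear: "fa_linear (cop v)" unfolding cop_def by (rule fa_lift_linear)
lemma cop_word [simp]: "cop v (fa_word w) = cop_word w v" by (simp add: cop_def fa_lift_word)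
lemmas cop_simps = lin_simps[OF cop_linear]

lemma cop_word_Cons: "cop_word (i # w) = cop_letter i (cop_word w)" by (rule ext) simp

declare cop_word.simps(2) [simp del]

lemma cop_word_ok: "w \<in> letters \<Longrightarrow> fam_in_span (cop_word w)"
proof (induction w)
  case Nil
  show ?case by (auto simp: fam_in_span_def intro: wspan_word wspan_0)
next
  case (Cons i w)
  then show ?case unfolding cop_word_Cons by (intro cop_letter_ok) auto
qed

lemma cop_word_app_fam_in_FK:
  assumes "u \<in> letters" "fam_in_FK (\<lambda>v. cop_word a v - cop_word b v)" shows "fam_in_FK (\<lambda>v. cop_word (u @ a) v - cop_word (u @ b) v)"
  using assms(1)
proof (induction u)
  case Nil
  then show ?case using assms(2) by simp
next
  case (Cons i u)
  then have "fam_in_FK (cop_letter i (\<lambda>v. cop_word (u @ a) v - cop_word (u @ b) v))" by (intro cop_letter_fam_in_FK) auto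
  then show ?case by (simp add: cop_letter_diff cop_word_Cons)
qed

lemma cop_word_app_zf0: "u \<in> letters \<Longrightarrow> fam_in_FK (cop_word a) \<Longrightarrow> fam_in_FK (cop_word (u @ a))"
  by (induction u) (auto simp: cop_word_Cons intro: cop_letter_fam_in_FK)

text \<open>The relations hold for \<open>cop_letter\<close> on every family in the span, which
  covers the word behind a relator; the operators of the word in front preserve
  \<open>fam_in_FK\<close>.\<close>

lemma cop_nil: assumes "x \<in> nil" shows "cop v x \<in> FK"
proof (rule ideal_lift[OF nilcox_wspan cop_linear FK_subspace assms[unfolded nil_def]])
  fix u z r assume u: "u \<in> letters" and z: "z \<in> letters" and r: "r \<in> nilcox_rels n"
  note ok = cop_word_ok[OF z]
  from r[unfolded nilcox_rels_words] consider
      (1) i where "r = fa_word [i, i]" "i < n"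
    | (2) i j where "r = fa_word [i, j] - fa_word [j, i]" "i < n" "j < n" "i \<noteq> (j + 1) mod n" "j \<noteq> (i + 1) mod n"
    | (3) i where "r = fa_word [i, (i + 1) mod n, i] - fa_word [(i + 1) mod n, i, (i + 1) mod n]" "i < n"
    by blast
  then show "cop v (lm u (rm z r)) \<in> FK"
  proof cases
    case 1
    have "fam_in_FK (cop_word ([i, i] @ z))" using cop_letter_sq[OF 1(2) ok] by (simp add: cop_word_Cons)
    from cop_word_app_zf0[OF u this] 1 show ?thesis by (simp add: fam_in_FK_def)
  next
    case 2
    have "fam_in_FK (\<lambda>v. cop_word ([i, j] @ z) v - cop_word ([j, i] @ z) v)"
    proof (cases "i = j")
      case True
      then show ?thesis by (simp add: fam_in_FK_def FK_0)
    next
      case False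
      from cop_letter_comm[OF 2(2,3) False 2(4,5) ok] show ?thesis by (simp add: cop_word_Cons)
    qed
    from cop_word_app_fam_in_FK[OF u this] 2 show ?thesis by (simp add: fam_in_FK_def lrm_simps cop_simps)
  next
    case 3
    have "fam_in_FK (\<lambda>v. cop_word ([i, (i + 1) mod n, i] @ z) v - cop_word ([(i + 1) mod n, i, (i + 1) mod n] @ z) v)"
      using cop_letter_braid[OF 3(2) refl ok] by (simp add: cop_word_Cons)
    from cop_word_app_fam_in_FK[OF u this] 3 show ?thesis by (simp add: fam_in_FK_def lrm_simps cop_simps)
  qed
qed

text \<open>The identity has no descents, so no letter is transferred, and this component is the map
  to E_n itself. Through \<open>cop_nil\<close> it shows that the nil-Coxeter relations lie in the
  kernel.\<close>

lemma cop_word_id: "cop_word w id = fa_word (map (ecyc n) w)"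
proof (induction w)
  case (Cons i w)
  have "\<not> inner_desc i id" by (simp add: inner_desc_def)
  then show ?case using Cons by (simp add: cop_word_Cons cop_letter_def del: id_apply)
qed (simp del: id_apply)

lemma cyc_map_linear: "fa_linear (cyc_map n)"
  by (rule fa_linearI) (auto simp: cyc_map_def pw_simps fun_eq_iff sum.distrib sum_distrib_left)

lemma cyc_map_word: assumes "w \<in> letters" shows "cyc_map n (fa_word w) = fa_word (map (ecyc n) w)"
proof
  fix w'
  let ?S = "{u. u \<in> letters \<and> map (ecyc n) u = w'}"
  have "?S \<subseteq> {u. set u \<subseteq> {0..<n} \<and> length u = length w'}" by auto
  then have fin: "finite ?S" by (rule finite_subset) (simp add: finite_lists_length_eq)
  have "cyc_map n (fa_word w) w' = (\<Sum>u\<in>?S. if u = w then 1 else 0)"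
    by (simp add: cyc_map_def fa_word_def)
  also have "\<dots> = (if w \<in> ?S then 1 else 0)" using fin by simp
  also have "\<dots> = fa_word (map (ecyc n) w) w'" using assms by (auto simp: fa_word_def)
  finally show "cyc_map n (fa_word w) w' = fa_word (map (ecyc n) w) w'" .
qed

lemma cyc_map_cop: "x \<in> wspan {0..<n} \<Longrightarrow> cyc_map n x = cop id x"
  by (rule wspan_eq[OF cyc_map_linear cop_linear]) (simp_all add: cyc_map_word cop_word_id)

lemma kernel_iff: "x \<in> cyc_kernel n \<longleftrightarrow> x \<in> wspan {0..<n} \<and> cop id x \<in> FK"
  by (auto simp: cyc_kernel_def fa_supported_wspan cyc_map_cop)

lemma nil_wspan: "nil \<subseteq> wspan {0..<n}"
  unfolding nil_def by (rule ideal_wspan[OF nilcox_wspan])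

lemma nil_kernel: "nil \<subseteq> cyc_kernel n"
  using nil_wspan cop_nil by (auto simp: kernel_iff)

lemma nilcox_rels_kernel: "nilcox_rels n \<subseteq> cyc_kernel n"
  using nil_kernel unfolding nil_def by (auto intro: fa_ideal.base)

text \<open>The coproduct is braided, so multiplying on the right moves the new letter across the component v:
this relabels its end points.\<close>

definition moved_letter :: "nat \<Rightarrow> (int \<Rightarrow> int) \<Rightarrow> nat \<times> nat" where
  "moved_letter j v = (vtx (inv v (int j)), vtx (inv v (int j + 1)))"

definition inner_rdesc :: "nat \<Rightarrow> (int \<Rightarrow> int) \<Rightarrow> bool" where
  "inner_rdesc j v \<longleftrightarrow> inner j \<and> inv v (int j + 1) < inv v (int j)"

text \<open>Here \<open>y\<close> is removed from \<open>v\<close> on the right and \<open>j\<close>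
  on the left. Removing one preserves the other descent unless both are the same reflection, and
  then the second removal is impossible in either order.\<close>

lemma cond_swap1:
  assumes v: "aperm v" and 1: "v (y + 1) < v y" and 2: "aswap y (inv v (j + 1)) < aswap y (inv v j)"
  shows "inv v (j + 1) < inv v j \<and> aswap j (v (y + 1)) < aswap j (v y)"
proof
  show a: "inv v (j + 1) < inv v j"
  proof (rule ccontr)
    assume "\<not> ?thesis"
    moreover have "inv v j \<noteq> inv v (j + 1)" using aperm_inj[OF aperm_inv[OF v]] by simp
    ultimately have lt: "inv v j < inv v (j + 1)" by simp
    have "inv v (j + 1) = inv v j + 1 \<and> N dvd inv v j - y"
      using aswap_less[OF lt, of y] 2 by fastforce
    then have "v (y + 1) = v y + 1" using adj_swap(1)[OF v] by blast
    then show False using 1 by simp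
  qed
  show "aswap j (v (y + 1)) < aswap j (v y)"
  proof (rule aswap_less[OF 1], rule notI, elim conjE)
    assume h: "v y = v (y + 1) + 1" "N dvd v (y + 1) - j"
    have e1: "inv v (v (y + 1)) - inv v j = v (y + 1) - j"
      by (rule aperm_cong[OF aperm_inv[OF v] h(2)])
    have "N dvd v y - (j + 1)" using h by simp
    from aperm_cong[OF aperm_inv[OF v] this] have e2: "inv v (v y) - inv v (j + 1) = v y - (j + 1)" .
    have e3: "inv v j = inv v (j + 1) + 1" and e4: "inv v (j + 1) - y = j - v (y + 1)"
      using e1 e2 h(1) unfolding aperm_inv_f[OF v] by linarith+
    have "N dvd inv v (j + 1) - y" unfolding e4 using h(2) by (simp add: dvd_diff_commute)
    from aswap_flip[OF this] show False using 2 e3 by simp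
  qed
qed

lemma cond_swap:
  assumes v: "aperm v"
  shows "v (y + 1) < v y \<and> aswap y (inv v (j + 1)) < aswap y (inv v j)
    \<longleftrightarrow> inv v (j + 1) < inv v j \<and> aswap j (v (y + 1)) < aswap j (v y)"
  using cond_swap1[OF v] cond_swap1[OF aperm_inv[OF v], of j y] aperm_inv_inv[OF v] by auto

text \<open>Induction from the front: relabelling by \<open>y\<close> turns the moved letter for
  \<open>v \<circ> aswap (int y)\<close> into the one for \<open>v\<close>, and
  \<open>cond_swap\<close> matches the terms that transfer letters at both ends.\<close>

lemma cop_word_snoc:
  "w \<in> letters \<Longrightarrow> j < n \<Longrightarrow> aperm v \<Longrightarrow>
    cop_word (w @ [j]) v = rm [moved_letter j v] (cop_word w v) + (if inner_rdesc j v then cop_word w (aswap (int j) \<circ> v) else 0)"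
proof (induction w arbitrary: v)
  case Nil
  have L: "moved_letter j id = ecyc n j" using Nil by (simp add: moved_letter_def ecyc_def vtx_of_nat vtx_Suc)
  have S: "relabel j (cop_word [] u) = cop_word [] u" for u by (simp add: relabel_simps)
  have e1: "v \<circ> aswap (int j) = id \<longleftrightarrow> v = aswap (int j)"
    unfolding fun_eq_iff comp_apply id_apply using aswap_aswap by metis
  have e2: "aswap (int j) \<circ> v = id \<longleftrightarrow> v = aswap (int j)"
    unfolding fun_eq_iff comp_apply id_apply using aswap_aswap by metis
  have e3: "inner_desc j (aswap (int j)) \<longleftrightarrow> inner_rdesc j (aswap (int j))" by (simp add: inner_desc_def inner_rdesc_def aswap_at)
  have "lm [ecyc n j] (cop_word [] v) = rm [moved_letter j v] (cop_word [] v)"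
    using L by (simp add: lrm_simps del: id_apply)
  moreover have "(if inner_desc j v then relabel j (cop_word [] (v \<circ> aswap (int j))) else 0)
      = (if inner_rdesc j v then cop_word [] (aswap (int j) \<circ> v) else 0)"
    unfolding S cop_word.simps(1) e1 e2 using e3 by (auto simp: relabel_simps)
  ultimately show ?case by (simp add: cop_word_Cons cop_letter_def del: o_apply cop_word.simps)
next
  case (Cons y w)
  let ?s = "aswap (int y)" and ?t = "aswap (int j)"
  have w: "w \<in> letters" "y < n" using Cons.prems by auto
  have okw: "cop_word w u \<in> fkS" for u using cop_word_ok[OF w(1)] by (simp add: fam_in_span_def)
  have bs: "aperm (v \<circ> ?s)" "aperm (?t \<circ> v)" using Cons.prems by (auto intro: aperm_comp)
  have tl: "tau_pair y (moved_letter j (v \<circ> ?s)) = moved_letter j v"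
    using Cons.prems w by (simp add: moved_letter_def tau_pair_def aperm_inv_aswap vtx_aswap)
  have cd: "inner_desc y v \<and> inner_rdesc j (v \<circ> ?s) \<longleftrightarrow> inner_rdesc j v \<and> inner_desc y (?t \<circ> v)"
    using cond_swap[OF Cons.prems(3), of "int y" "int j"] Cons.prems
    by (auto simp: inner_desc_def inner_rdesc_def aperm_inv_aswap)
  have "cop_word ((y # w) @ [j]) v = lm [ecyc n y] (rm [moved_letter j v] (cop_word w v) + (if inner_rdesc j v then cop_word w (?t \<circ> v) else 0))
     + (if inner_desc y v then relabel y (rm [moved_letter j (v \<circ> ?s)] (cop_word w (v \<circ> ?s)) + (if inner_rdesc j (v \<circ> ?s) then cop_word w (?t \<circ> (v \<circ> ?s)) else 0)) else 0)"
    using Cons.IH[OF w(1) Cons.prems(2) Cons.prems(3)] Cons.IH[OF w(1) Cons.prems(2) bs(1)]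
    by (simp add: cop_word_Cons cop_letter_def del: o_apply)
  also have "\<dots> = lm [ecyc n y] (rm [moved_letter j v] (cop_word w v)) + (if inner_rdesc j v then lm [ecyc n y] (cop_word w (?t \<circ> v)) else 0)
     + (if inner_desc y v then rm [moved_letter j v] (relabel y (cop_word w (v \<circ> ?s))) else 0)
     + (if inner_desc y v \<and> inner_rdesc j (v \<circ> ?s) then relabel y (cop_word w (?t \<circ> v \<circ> ?s)) else 0)"
    by (simp add: lrm_simps relabel_simps relabel_rm[OF okw] tl comp_assoc del: o_apply)
  also have "\<dots> = rm [moved_letter j v] (cop_word (y # w) v) + (if inner_rdesc j v then cop_word (y # w) (?t \<circ> v) else 0)"
    unfolding cd by (simp add: cop_word_Cons cop_letter_def lrm_simps lm_rm[OF okw] del: o_apply)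
  finally show ?case .
qed

lemma cop_rm:
  assumes "x \<in> wspan {0..<n}" "j < n" "aperm v"
  shows "cop v (rm [j] x) = rm [moved_letter j v] (cop v x) + (if inner_rdesc j v then cop (aswap (int j) \<circ> v) x else 0)"
proof (cases "inner_rdesc j v")
  case True
  have "cop v (rm [j] x) = rm [moved_letter j v] (cop v x) + cop (aswap (int j) \<circ> v) x"
    by (rule wspan_eq[OF fa_linear_comp[OF cop_linear rm_linear]
      fa_linear_plus[OF fa_linear_comp[OF rm_linear cop_linear] cop_linear] _ assms(1)])
      (use assms True in \<open>simp add: cop_word_snoc del: o_apply\<close>)
  then show ?thesis using True by simp
next
  case False
  have "cop v (rm [j] x) = rm [moved_letter j v] (cop v x)"
    by (rule wspan_eq[OF fa_linear_comp[OF cop_linear rm_linear] fa_linear_comp[OF rm_linear cop_linear] _ assms(1)])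
      (use assms False in \<open>simp add: cop_word_snoc\<close>)
  then show ?thesis using False by simp
qed

lemma cop_lm:
  assumes "x \<in> wspan {0..<n}"
  shows "cop v (lm [i] x) = lm [ecyc n i] (cop v x) + (if inner_desc i v then relabel i (cop (v \<circ> aswap (int i)) x) else 0)"
proof (cases "inner_desc i v")
  case True
  have "cop v (lm [i] x) = lm [ecyc n i] (cop v x) + relabel i (cop (v \<circ> aswap (int i)) x)"
    by (rule wspan_eq[OF fa_linear_comp[OF cop_linear lm_linear]
      fa_linear_plus[OF fa_linear_comp[OF lm_linear cop_linear] fa_linear_comp[OF relabel_linear cop_linear]] _ assms(1)])
      (use assms True in \<open>simp add: cop_word_Cons cop_letter_def del: o_apply\<close>)
  then show ?thesis using True by simp
next
  case False
  have "cop v (lm [i] x) = lm [ecyc n i] (cop v x)"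
    by (rule wspan_eq[OF fa_linear_comp[OF cop_linear lm_linear] fa_linear_comp[OF lm_linear cop_linear] _ assms(1)])
      (use assms False in \<open>simp add: cop_word_Cons cop_letter_def\<close>)
  then show ?thesis using False by simp
qed

section \<open>Components of large length\<close>

abbreviation npath :: "nat list \<Rightarrow> nat" where "npath w \<equiv> length (filter inner w)"

text \<open>Every letter of a reduced word for \<open>v\<close> has to be transferred from a letter
  in 1..n - 2.\<close>

lemma cop_word_level: "aperm v \<Longrightarrow> int (npath w) < ell v \<Longrightarrow> cop_word w v = 0"
proof (induction w arbitrary: v)
  case Nil
  then show ?case using ell_id by (auto simp del: id_apply)
next
  case (Cons i w)
  have "cop_word w v = 0" using Cons.prems by (intro Cons.IH) (auto split: if_splits)
  moreover have "cop_word w (v \<circ> aswap (int i)) = 0" if "inner_desc i v"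
  proof (rule Cons.IH)
    show "aperm (v \<circ> aswap (int i))" using Cons by (intro aperm_comp) auto
    show "int (npath w) < ell (v \<circ> aswap (int i))"
      using ell_down[of v "int i"] that Cons.prems by (simp add: inner_desc_def del: o_apply)
  qed
  ultimately show ?case by (simp add: cop_word_Cons cop_letter_def lrm_simps relabel_simps del: o_apply)
qed

lemma state_Cons_iff:
  "state (i # w) = Some v \<longleftrightarrow> state w = Some (v \<circ> aswap (int i)) \<and> v (int i + 1) < v (int i)"
proof
  assume "state (i # w) = Some v"
  then obtain q where q: "state w = Some q" "q (int i) < q (int i + 1)" "v = q \<circ> aswap (int i)"
    by (auto split: option.splits if_splits)
  then show "state w = Some (v \<circ> aswap (int i)) \<and> v (int i + 1) < v (int i)"
    by (simp add: comp_assoc aswap_at)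
next
  assume "state w = Some (v \<circ> aswap (int i)) \<and> v (int i + 1) < v (int i)"
  then show "state (i # w) = Some v" by (simp add: aswap_at comp_assoc del: o_apply) (simp add: aswap_at)
qed

lemma cop_word_top:
  "aperm v \<Longrightarrow> set u \<subseteq> Collect inner \<Longrightarrow> ell v = int (length u) \<Longrightarrow>
    cop_word u v = (if state u = Some v then fa_word [] else 0)"
proof (induction u arbitrary: v)
  case Nil
  then show ?case by (auto simp del: id_apply)
next
  case (Cons i u)
  have 0: "cop_word u v = 0" 
  proof (rule cop_word_level[OF Cons.prems(1)])
    show "int (npath u) < ell v"
      unfolding Cons.prems(3) of_nat_less_iff length_Cons less_Suc_eq_le by (rule length_filter_le)
  qed
  show ?case
  proof (cases "inner_desc i v")
    case True
    have "cop_word u (v \<circ> aswap (int i)) = (if state u = Some (v \<circ> aswap (int i)) then fa_word [] else 0)"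
      using Cons.prems True ell_down[of v "int i"]
      by (intro Cons.IH) (auto simp: inner_desc_def intro: aperm_comp simp del: o_apply)
    moreover have "state (i # u) = Some v \<longleftrightarrow> state u = Some (v \<circ> aswap (int i))"
      using True unfolding state_Cons_iff inner_desc_def by simp
    ultimately show ?thesis using 0 True by (simp add: cop_word_Cons cop_letter_def lrm_simps relabel_simps del: o_apply state.simps)
  next
    case False
    then have "state (i # u) \<noteq> Some v" using Cons.prems unfolding state_Cons_iff inner_desc_def by auto
    then show ?thesis using 0 False by (simp add: cop_word_Cons cop_letter_def lrm_simps del: state.simps)
  qed
qed

text \<open>The outer letter \<open>c\<close> stays in the first factor and all others must be
  transferred; those in front of \<open>c\<close> relabel its end points on their way.\<close>

lemma cop_word_subtop:
  assumes c: "\<not> inner c" and u': "set u' \<subseteq> Collect inner"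
  shows "aperm v \<Longrightarrow> set u \<subseteq> Collect inner \<Longrightarrow> ell v = int (length u + length u') \<Longrightarrow>
    cop_word (u @ c # u') v = (if state (u @ u') = Some v then fa_word [foldr tau_pair u (ecyc n c)] else 0)"
proof (induction u arbitrary: v)
  case Nil
  then have "cop_word u' v = (if state u' = Some v then fa_word [] else 0)"
    using cop_word_top[OF Nil(1) u'] by simp
  then show ?case using c by (simp add: cop_word_Cons cop_letter_def inner_desc_def lrm_simps)
next
  case (Cons i u)
  have 0: "cop_word (u @ c # u') v = 0"
  proof (rule cop_word_level[OF Cons.prems(1)])
    have "npath (u @ c # u') \<le> length u + length u'" using c by (simp add: add_mono)
    then show "int (npath (u @ c # u')) < ell v" unfolding Cons.prems(3) of_nat_less_iff by simp
  qed
  show ?case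
  proof (cases "inner_desc i v")
    case True
    have "cop_word (u @ c # u') (v \<circ> aswap (int i)) = (if state (u @ u') = Some (v \<circ> aswap (int i)) then fa_word [foldr tau_pair u (ecyc n c)] else 0)"
      using Cons.prems True ell_down[of v "int i"]
      by (intro Cons.IH) (auto simp: inner_desc_def intro: aperm_comp simp del: o_apply)
    moreover have "state (i # u @ u') = Some v \<longleftrightarrow> state (u @ u') = Some (v \<circ> aswap (int i))"
      using True unfolding state_Cons_iff inner_desc_def by simp
    ultimately show ?thesis using 0 True by (simp add: cop_word_Cons cop_letter_def lrm_simps relabel_simps del: o_apply state.simps) simp
  next
    case False
    then have "state (i # u @ u') \<noteq> Some v" using Cons.prems unfolding state_Cons_iff inner_desc_def by auto
    then show ?thesis using 0 False by (simp add: cop_word_Cons cop_letter_def lrm_simps del: state.simps)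
  qed
qed

lemma tau_path: "inner i \<Longrightarrow> tau i = transpose i (Suc i)"
  using inner_less[of i] by (simp add: tau_def)

lemma tau_upt: "a < b \<Longrightarrow> set [a..<b] \<subseteq> Collect inner \<Longrightarrow> foldr tau [a..<b] b = a"
proof (induction b)
  case (Suc b)
  then have p: "inner b" by auto
  show ?case
  proof (cases "a = b")
    case True
    then show ?thesis using p by (simp add: tau_path)
  next
    case False
    then have "foldr tau [a..<b] b = a" using Suc by auto
    then show ?thesis using False Suc.prems p by (simp add: tau_path)
  qed
qed simp

lemma tau_upt_first: "a < b \<Longrightarrow> set [a..<b] \<subseteq> Collect inner \<Longrightarrow> foldr tau [a..<b] a = Suc a"
proof -
  assume a: "a < b" "set [a..<b] \<subseteq> Collect inner"
  have "inner x" if "a \<le> x" "x < b" for x using a that by auto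
  then have "foldr tau u a = a" if "set u \<subseteq> {Suc a..<b}" for u
    using that by (induction u) (auto simp: tau_path transpose_def)
  from this[of "[Suc a..<b]"] show ?thesis using a by (simp add: upt_conv_Cons tau_path)
qed

lemma foldr_tau_pair: "foldr tau_pair u (a, b) = (foldr tau u a, foldr tau u b)"
  by (induction u) (auto simp: tau_pair_def)

lemma tau_zero: "set u \<subseteq> Collect inner \<Longrightarrow> foldr tau u 0 = 0"
  by (induction u) (auto simp: tau_path inner_def transpose_def)

text \<open>Row \<open>r\<close> carries the vertex \<open>r\<close> to \<open>r + 1\<close>, so one
  end point of the letter 0 climbs from 1 to k through the k - 1 rows.\<close>

lemma tau_rect_rest: assumes "k < n" shows "1 \<le> r \<Longrightarrow> r \<le> k \<Longrightarrow>
   foldr tau (concat (map (\<lambda>j. [j..<n - k + j]) (rev [1..<r]))) 1 = r"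
proof (induction r)
  case (Suc r)
  show ?case
  proof (cases "r = 0")
    case False
    have "foldr tau [r..<n - k + r] r = Suc r"
      using assms Suc.prems False by (intro tau_upt_first) (auto simp: inner_def)
    then show ?thesis using Suc False by simp
  qed simp
qed simp

lemma trl_rel_wspan: assumes "1 \<le> k" "k < n" shows "trl_rel k \<in> wspan {0..<n}"
  unfolding trl_rel_def by (intro fa.subspace_sum[OF wspan_subspace] wspan_word trl_word_props(1)[OF assms])

lemma filter_two: assumes "a \<noteq> b" "a \<in> set w" "b \<in> set w" "\<not> P a" "\<not> P b"
  shows "length (filter P w) + 2 \<le> length w"
proof -
  have "card {a, b} \<le> card (set (filter (\<lambda>x. \<not> P x) w))" using assms by (intro card_mono) auto
  then have "2 \<le> length (filter (\<lambda>x. \<not> P x) w)" using assms(1) card_length[of "filter (\<lambda>x. \<not> P x) w"] by simp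
  then show ?thesis using sum_length_filter_compl[of P w] by simp
qed

text \<open>In lengths at least k(n - k) - 1 only the two summands with a single letter outside 1..n - 2 survive,
and they contribute x_{0,k} and x_{k,0}, whose sum vanishes.\<close>

lemma trl_rel_top:
  assumes k: "1 \<le> k" "k < n" and v: "aperm v" "int (k * (n - k)) - 1 \<le> ell v"
  shows "cop v (trl_rel k) \<in> FK"
proof -
  let ?I0 = "{0..<k}" and ?I1 = "{1..k}"
  have I: "?I0 \<in> Sub k" "?I1 \<in> Sub k" "?I0 \<noteq> ?I1" using k by (auto simp: Sub_def)
  have "cop v (trl_rel k) = (\<Sum>I\<in>Sub k. cop_word (trl_word k I) v)" by (simp add: trl_rel_def cop_simps)
  also have "\<dots> = (\<Sum>I\<in>{?I0, ?I1}. cop_word (trl_word k I) v)"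
  proof (rule sum.mono_neutral_right)
    show "\<forall>I\<in>Sub k - {?I0, ?I1}. cop_word (trl_word k I) v = 0"
    proof
      fix I assume "I \<in> Sub k - {?I0, ?I1}"
      then have J: "I \<in> Sub k" "I \<noteq> ?I0" "I \<noteq> ?I1" by auto
      have "npath (trl_word k I) + 2 \<le> length (trl_word k I)"
        using trl_word_has_both[OF k J] n3 by (intro filter_two[of 0 "n - 1"]) (auto simp: inner_def)
      then have "int (npath (trl_word k I)) + 2 \<le> int (k * (n - k))" using trl_word_props(3)[OF k J(1)] by linarith
      then show "cop_word (trl_word k I) v = 0" using v by (intro cop_word_level) linarith+
    qed
  qed (use I in auto)
  also have "\<dots> = cop_word (rect_word k) v + cop_word (map Suc (rect_word k)) v" using I by (simp add: trl_word_def)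
  finally have e: "cop v (trl_rel k) = cop_word (rect_word k) v + cop_word (map Suc (rect_word k)) v" .
  define b c where "b = [1..<n - k]" and "c = [k..<n - 1]"
  have y: "rect_word k = rect_rest k @ 0 # b" "map Suc (rect_word k) = c @ (n - 1) # rect_rest k"
    using rect_word_rect_rest[OF k] y1_rect_rest[OF k] by (simp_all add: b_def c_def)
  have "{1..<n - 1} \<subseteq> Collect inner" by (auto simp: inner_def)
  then have ps: "set (rect_rest k) \<subseteq> Collect inner" "set b \<subseteq> Collect inner" "set c \<subseteq> Collect inner"
    using rect_rest_letters[OF k(2)] k by (auto simp: b_def c_def inner_def)
  have np: "\<not> inner 0" "\<not> inner (n - 1)" using n3 by (auto simp: inner_def)
  have len: "length (rect_rest k) + length b + 1 = k * (n - k)" "length (rect_rest k) + length c + 1 = k * (n - k)"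
    using trl_word_props(3)[OF k I(1)] arg_cong[OF y(1), of length] arg_cong[OF y(2), of length]
    by (simp_all add: trl_word_def)
  have stt: "state (rect_rest k @ b) = state (c @ rect_rest k)" using state_rect_rest[OF k] by (simp add: b_def c_def)
  show ?thesis
  proof (cases "ell v = int (k * (n - k)) - 1")
    case True
    have z: "foldr tau (rect_rest k) 1 = k" unfolding rect_rest_def by (rule tau_rect_rest[OF k(2) k(1)]) simp
    have z2: "foldr tau c (n - 1) = k"
    proof (cases "k = n - 1")
      case True
      then show ?thesis by (simp add: c_def)
    next
      case False
      then show ?thesis using k ps(3) unfolding c_def by (intro tau_upt) auto
    qed
    have el: "ell v = int (length (rect_rest k) + length b)" "ell v = int (length c + length (rect_rest k))"
      using True len by linarith+
    have 1: "cop_word (rect_word k) v = (if state (rect_rest k @ b) = Some v then fa_word [(0, k)] else 0)"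
      unfolding y(1) using cop_word_subtop[OF np(1) ps(2) v(1) ps(1) el(1)] n3 z tau_zero[OF ps(1)]
      by (simp add: ecyc_def foldr_tau_pair)
    have 2: "cop_word (map Suc (rect_word k)) v = (if state (rect_rest k @ b) = Some v then fa_word [(k, 0)] else 0)"
      unfolding y(2) stt using cop_word_subtop[OF np(2) ps(1) v(1) ps(3) el(2)] n3 z2 tau_zero[OF ps(3)]
      by (simp add: ecyc_def foldr_tau_pair)
    have "fa_word [(0, k)] + fa_word [(k, 0)] \<in> FK"
      using FK_anti[of 0 k "fa_word []"] k n3 by (auto simp: fk_gens_def wspan_word)
    then show ?thesis unfolding e 1 2 by (simp add: FK_0)
  next
    case False
    have np3: "npath (u @ c # u') \<le> length u + length u'" if "\<not> inner c" for u c u'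
      using that by (simp add: add_mono)
    have "npath (rect_word k) + 1 \<le> k * (n - k)" "npath (map Suc (rect_word k)) + 1 \<le> k * (n - k)"
      using np3[OF np(1), of "rect_rest k" b] np3[OF np(2), of c "rect_rest k"] len
      unfolding y(1)[symmetric] y(2)[symmetric] by linarith+
    then have "int (npath (rect_word k)) < ell v" "int (npath (map Suc (rect_word k))) < ell v"
      using False v(2) by linarith+
    then have "cop_word (rect_word k) v = 0" "cop_word (map Suc (rect_word k)) v = 0" using v(1) by (auto intro!: cop_word_level)
    then show ?thesis unfolding e by (simp add: FK_0)
  qed
qed

text \<open>A form of the parabolic subgroup of the letters 1..n - 2 that shows the values at the
  places directly; all components outside it vanish.\<close>

definition stab_zero :: "(int \<Rightarrow> int) set" where
  "stab_zero = {v \<in> AffSym. v 0 = 0 \<and> (\<forall>x. 1 \<le> x \<and> x \<le> N - 1 \<longrightarrow> 1 \<le> v x \<and> v x \<le> N - 1)}"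

lemma aswap_path: "inner i \<Longrightarrow> 1 \<le> x \<Longrightarrow> x \<le> N - 1 \<Longrightarrow>
   aswap (int i) x = (if x = int i then x + 1 else if x = int i + 1 then x - 1 else x)"
  using inner_less[of i] by (subst aswap_mod) auto

lemma stab_zero_aswap: assumes "inner i" "v \<in> stab_zero" shows "v \<circ> aswap (int i) \<in> stab_zero"
proof -
  have i: "1 \<le> int i" "int i + 1 \<le> N - 1" using assms(1) inner_less[OF assms(1)] by (auto simp: inner_def)
  have "aswap (int i) 0 = 0" using inner_less[OF assms(1)] i by (subst aswap_mod) auto
  then show ?thesis using assms i by (auto simp: stab_zero_def AffSym_comp AffSym_aswap aswap_path)
qed

lemma stab_zero_id: "id \<in> stab_zero" using AffSym_id by (simp add: stab_zero_def)

lemma cop_word_stab_zero: "cop_word w v \<noteq> 0 \<Longrightarrow> v \<in> stab_zero"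
proof (induction w arbitrary: v)
  case Nil
  then show ?case using stab_zero_id by (auto split: if_splits simp del: id_apply)
next
  case (Cons i w)
  show ?case
  proof (cases "cop_word w v = 0")
    case True
    then have "inner_desc i v" "cop_word w (v \<circ> aswap (int i)) \<noteq> 0" using Cons.prems
      by (auto simp: cop_word_Cons cop_letter_def lrm_simps relabel_simps simp del: o_apply split: if_splits)
    then have "v \<circ> aswap (int i) \<circ> aswap (int i) \<in> stab_zero" using Cons.IH by (rule_tac stab_zero_aswap) (auto simp: inner_desc_def simp del: o_apply)
    then show ?thesis by (simp add: comp_assoc)
  qed (use Cons.IH in auto)
qed

lemma cop_stab_zero: assumes "cop v x \<noteq> 0" "x \<in> wspan {0..<n}" shows "v \<in> stab_zero"
proof (rule ccontr)
  assume "v \<notin> stab_zero"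
  then have "cop v (fa_word w) = 0" for w using cop_word_stab_zero by auto
  then have "cop v x \<in> {0}" by (intro wspan_lift[OF cop_linear _ _ assms(2)]) (auto simp: fa.subspace_single_0)
  then show False using assms by simp
qed

lemma ell_right_down:
  assumes "v \<in> AffSym" "inv v (int j + 1) < inv v (int j)"
  shows "ell (aswap (int j) \<circ> v) = ell v - 1"
proof -
  let ?u = "aswap (int j) \<circ> v"
  have u: "?u \<in> AffSym" using assms(1) by (intro AffSym_comp AffSym_aswap)
  then obtain w where w: "state w = Some ?u" using ex_word by blast
  have "inv ?u (int j) < inv ?u (int j + 1)"
    using assms aperm_inv_sw2[OF AffSym_aperm[OF assms(1)]] by (simp add: aswap_at)
  then have "state (w @ [j]) = Some (aswap (int j) \<circ> ?u)" using state_snoc(1)[OF w, of j] by (simp del: o_apply)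
  moreover have "aswap (int j) \<circ> ?u = v" by (simp add: fun_eq_iff)
  ultimately have "ell v = int (length (w @ [j]))" using state_ell by (metis (no_types))
  then show ?thesis using state_ell[OF w] by simp
qed

text \<open>A letter appended on the right can raise the length of a component by one only if it is
  transferred, hence only if it lies in 1..n - 2.\<close>

lemma trl_rel_level:
  assumes k: "1 \<le> k" "k < n"
    and lev: "\<And>v. v \<in> AffSym \<Longrightarrow> m < ell v \<Longrightarrow> cop v (trl_rel k) \<in> FK"
  shows "v \<in> AffSym \<Longrightarrow> z \<in> letters \<Longrightarrow> m + int (npath z) < ell v \<Longrightarrow> cop v (rm z (trl_rel k)) \<in> FK"
proof (induction z arbitrary: v rule: rev_induct)
  case Nil
  have "rm [] (trl_rel k) = trl_rel k"
    by (rule wspan_eq[OF rm_linear fa.linear_ident _ trl_rel_wspan[OF k]]) simp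
  then show ?case using Nil lev by simp
next
  case (snoc j z)
  have rs: "trl_rel k \<in> wspan {0..<n}" by (rule trl_rel_wspan[OF k])
  have z: "z \<in> letters" "j < n" using snoc by auto
  have e: "rm (z @ [j]) (trl_rel k) = rm [j] (rm z (trl_rel k))" using rm_rm[OF rs] by simp
  have zz: "rm z (trl_rel k) \<in> wspan {0..<n}" using z rs by (intro rm_wspan) auto
  have 1: "cop v (rm z (trl_rel k)) \<in> FK" using snoc z by (intro snoc.IH) (auto split: if_splits)
  have bv: "aperm v" using snoc AffSym_aperm by blast
  have "moved_letter j v \<in> fk_gens n"
  proof -
    have "\<not> N dvd inv v (int j) - inv v (int j + 1)"
      using aperm_dvd_iff[OF aperm_inv[OF bv], of "int j" "int j + 1"] not_dvd_small[of "-1"] N3 by simp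
    then show ?thesis using vtx_eq_iff by (auto simp: moved_letter_def fk_gens_def)
  qed
  then have 2: "rm [moved_letter j v] (cop v (rm z (trl_rel k))) \<in> FK" using 1 by (intro FK_rm) auto
  have 3: "cop (aswap (int j) \<circ> v) (rm z (trl_rel k)) \<in> FK" if "inner_rdesc j v"
  proof (rule snoc.IH)
    show "aswap (int j) \<circ> v \<in> AffSym" using snoc by (intro AffSym_comp AffSym_aswap)
    show "m + int (npath z) < ell (aswap (int j) \<circ> v)"
      using ell_right_down[of v j] that snoc.prems by (simp add: inner_rdesc_def del: o_apply)
  qed (rule z)
  show ?case unfolding e cop_rm[OF zz z(2) bv] using 2 3 by (simp add: FK_add del: o_apply)
qed

text \<open>Rearrangement inequality for one swap. The sum is the induction measure of
  \<open>trl_rel_block_inverted\<close>; positivity of the values lets it be taken in the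
  naturals.\<close>

lemma sum_swap_less:
  fixes v :: "int \<Rightarrow> int"
  assumes i: "inner i" and v: "v \<in> stab_zero" and up: "v (int i) < v (int i + 1)"
  shows "nat (\<Sum>x\<in>{1..N - 1}. x * (v \<circ> aswap (int i)) x) < nat (\<Sum>x\<in>{1..N - 1}. x * v x)"
proof -
  let ?i = "int i" and ?v = "v \<circ> aswap (int i)"
  have ii: "1 \<le> ?i" "?i + 1 \<le> N - 1" using i inner_less[OF i] by (auto simp: inner_def)
  let ?R = "{1..N - 1} - {?i, ?i + 1}"
  have sp: "(\<Sum>x\<in>{1..N - 1}. f x) = f ?i + f (?i + 1) + (\<Sum>x\<in>?R. f x)" for f :: "int \<Rightarrow> int"
  proof -
    have "{1..N - 1} = insert ?i (insert (?i + 1) ?R)" using ii by auto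
    then have "(\<Sum>x\<in>{1..N - 1}. f x) = (\<Sum>x\<in>insert ?i (insert (?i + 1) ?R). f x)" by simp
    also have "\<dots> = f ?i + f (?i + 1) + (\<Sum>x\<in>?R. f x)" by (subst sum.insert, auto)+
    finally show ?thesis .
  qed
  have r: "(\<Sum>x\<in>?R. x * ?v x) = (\<Sum>x\<in>?R. x * v x)"
    using i by (intro sum.cong) (auto simp: aswap_path)
  have "(\<Sum>x\<in>{1..N - 1}. x * ?v x) < (\<Sum>x\<in>{1..N - 1}. x * v x)"
    unfolding sp r unfolding comp_apply aswap_at using up by (simp add: algebra_simps)
  moreover have "0 \<le> (\<Sum>x\<in>{1..N - 1}. x * ?v x)"
  proof (rule sum_nonneg)
    fix x assume x: "x \<in> {1..N - 1}"
    have "1 \<le> ?v x" using stab_zero_aswap[OF i v] x unfolding stab_zero_def mem_Collect_eq by auto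
    then show "0 \<le> x * ?v x" using x by (intro mult_nonneg_nonneg) auto
  qed
  ultimately show ?thesis by simp
qed

lemma ex_ascent_between:
  fixes v :: "int \<Rightarrow> int" assumes "a < b" "v a < v b" shows "\<exists>i\<ge>a. i < b \<and> v i < v (i + 1)"
proof (rule ccontr)
  assume h: "\<not> ?thesis"
  have "c \<le> b \<longrightarrow> v c \<le> v a" if "a \<le> c" for c
    using that
  proof (induction c rule: int_ge_induct)
    case (step i)
    then show ?case using h by (auto simp: not_less)
  qed simp
  from this[of b] show False using assms by auto
qed

text \<open>Moving a letter i through the k-th relation turns it into i - k. For i = k - 1 and i = k the result
is one of n - 1 and 0, which cannot raise the length. Hence a component of maximal length has
descents at these places, also after it is multiplied up by the other letters.\<close>

lemma trl_rel_block_inverted: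
  assumes k: "1 \<le> k" "k < n"
    and lev: "\<And>v. v \<in> AffSym \<Longrightarrow> m < ell v \<Longrightarrow> cop v (trl_rel k) \<in> FK"
  shows "v \<in> stab_zero \<Longrightarrow> z \<in> letters \<Longrightarrow> cop v (rm z (trl_rel k)) \<notin> FK \<Longrightarrow> ell v = m + int (length z) \<Longrightarrow>
     1 \<le> a \<Longrightarrow> a < b \<Longrightarrow> b \<le> N - 1 \<Longrightarrow> a \<le> int k \<Longrightarrow> int k \<le> b \<Longrightarrow> v b < v a"
proof (induction "nat (\<Sum>x\<in>{1..N - 1}. x * v x)" arbitrary: v z a b rule: less_induct)
  case less
  have level: "cop v (rm z (trl_rel k)) \<in> FK" if "v \<in> AffSym" "z \<in> letters" "m + int (npath z) < ell v" for v z
    using trl_rel_level[of k m v z] k lev that by blast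
  have G: "v \<in> AffSym" and bv: "aperm v" using less.prems(1) AffSym_aperm by (auto simp: stab_zero_def)
  have rs: "trl_rel k \<in> wspan {0..<n}" by (rule trl_rel_wspan[OF k])
  have zz: "rm z (trl_rel k) \<in> wspan {0..<n}" using less.prems rs by (intro rm_wspan) auto
  show ?case
  proof (rule ccontr)
    assume "\<not> ?thesis"
    moreover have "v a \<noteq> v b" using aperm_inj[OF bv] less.prems by simp
    ultimately have ab: "v a < v b" by simp
    from ex_ascent_between[OF less.prems(6) ab] obtain i' where i': "a \<le> i'" "i' < b" "v i' < v (i' + 1)" by blast
    define i where "i = nat i'"
    have i: "int i = i'" using i' less.prems by (simp add: i_def)
    have up: "v (int i) < v (int i + 1)" using i i' by simp
    have pi: "inner i" using i i' less.prems by (auto simp: inner_def)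
    have iN: "i < n" using inner_less[OF pi] by simp
    let ?v = "v \<circ> aswap (int i)"
    have v'P: "?v \<in> stab_zero" by (rule stab_zero_aswap[OF pi less.prems(1)])
    then have G': "?v \<in> AffSym" by (simp add: stab_zero_def)
    have el: "ell ?v = m + int (length z) + 1" using ell_up[OF bv up] less.prems by simp
    define j where "j = vtx (int i - int k)"
    have j: "j < n" by (simp add: j_def)
    have jd: "N dvd int j - (int i - int k)"
      unfolding j_def using vtx_dvd[of "int i - int k"] by (simp add: dvd_diff_commute)
    have 1: "cop ?v (rm z (trl_rel k)) \<in> FK"
      using less.prems el length_filter_le[of inner z] by (intro level[OF G']) auto
    have D: "inner_desc i ?v" using pi up by (simp add: inner_desc_def aswap_at)
    \<comment> \<open>The letter \<open>i\<close> either stays, and the component vanishes because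
      it is too long, or is transferred, which leaves a relabelled copy of the nonzero component at
      \<open>v\<close>.\<close>
    have "cop ?v (lm [i] (rm z (trl_rel k))) \<notin> FK"
    proof
      assume "cop ?v (lm [i] (rm z (trl_rel k))) \<in> FK"
      then have "lm [ecyc n i] (cop ?v (rm z (trl_rel k))) + relabel i (cop v (rm z (trl_rel k))) \<in> FK"
        using cop_lm[OF zz, of ?v i] D by (simp add: comp_assoc del: o_apply)
      moreover have "lm [ecyc n i] (cop ?v (rm z (trl_rel k))) \<in> FK"
        using 1 ecyc_gens[OF iN] by (intro FK_lm) auto
      ultimately have "relabel i (cop v (rm z (trl_rel k))) \<in> FK"
        using FK_diff by (metis add_diff_cancel_left')
      then show False using less.prems relabel_FK_iff[OF iN] by simp
    qed
    moreover have "lm [i] (rm z (trl_rel k)) - rm (j # z) (trl_rel k) \<in> nil"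
    proof -
      have "rm z (lm [i] (trl_rel k) - rm [j] (trl_rel k)) \<in> nil"
        by (rule nil_rm[OF trl_rel_commute[OF k iN j jd] less.prems(2)])
      then show ?thesis using rm_rm[OF rs, of z "[j]"] lm_rm[OF rs] by (simp add: lrm_simps)
    qed
    then have "cop ?v (lm [i] (rm z (trl_rel k))) - cop ?v (rm (j # z) (trl_rel k)) \<in> FK"
      using cop_nil[of _ ?v] by (simp add: cop_simps[symmetric] del: o_apply)
    ultimately have nF: "cop ?v (rm (j # z) (trl_rel k)) \<notin> FK"
      using FK_add by (metis diff_add_cancel)
    \<comment> \<open>If \<open>j\<close> were 0 or n - 1, it would not count in
      \<open>npath\<close>, and the component would exceed the length bound.\<close>
    have "\<not> (m + int (npath (j # z)) < ell ?v)"
      using level[OF G', of "j # z"] nF less.prems j by auto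
    then have pj: "inner j" using el length_filter_le[of inner z] by (auto split: if_splits)
    have ik: "int i \<noteq> int k" "int i + 1 \<noteq> int k"
    proof -
      show "int i \<noteq> int k" using pj by (auto simp: j_def vtx_def inner_def)
      show "int i + 1 \<noteq> int k"
      proof
        assume "int i + 1 = int k"
        then have "int i - int k = -1" by simp
        then have "j = n - 1" using N3 by (simp add: j_def vtx_def zmod_minus1)
        then show False using pj n3 by (auto simp: inner_def)
      qed
    qed
    have swb: "aswap (int i) x = (if x = int i then x + 1 else if x = int i + 1 then x - 1 else x)"
      if "1 \<le> x" "x \<le> N - 1" for x using aswap_path[OF pi that] .
    \<comment> \<open>Since k is neither \<open>i\<close> nor \<open>i + 1\<close>, the swap fixes k
      and keeps the two places on their sides of it. The values at \<open>a\<close> and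
      \<open>b\<close> reappear at \<open>a'\<close> and \<open>b'\<close>, so the inversion of the
      longer component contradicts \<open>ab\<close>.\<close>
    define a' b' where "a' = aswap (int i) a" and "b' = aswap (int i) b"
    have ib: "1 \<le> int i" "int i + 1 \<le> N - 1" using i i' less.prems by auto
    have "1 \<le> a' \<and> a' < b' \<and> b' \<le> N - 1 \<and> a' \<le> int k \<and> int k \<le> b'"
      unfolding a'_def b'_def using less.prems ik ib swb[of a] swb[of b] by (auto split: if_splits)
    then have "?v b' < ?v a'"
      using less.hyps[OF sum_swap_less[OF pi less.prems(1) up] v'P _ nF] el less.prems j
      by (auto simp del: o_apply)
    then show False using ab by (simp add: a'_def b'_def)
  qed
qed

text \<open>The inverted pairs are those of the first k - 1 places with the places from k on, and
  those of k with the places behind it: (k-1)(n-k) + (n-1-k) = k(n-k) - 1. Each contributes at least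
  one to Shi's formula.\<close>

lemma ell_ge_cross:
  assumes k: "1 \<le> k" "k < n" and v: "v \<in> stab_zero"
    and h: "\<And>a b. 1 \<le> a \<Longrightarrow> a < b \<Longrightarrow> b \<le> N - 1 \<Longrightarrow> a \<le> int k \<Longrightarrow> int k \<le> b \<Longrightarrow> v b < v a"
  shows "int (k * (n - k)) - 1 \<le> ell v"
proof -
  have bv: "aperm v" using v AffSym_aperm by (auto simp: stab_zero_def)
  let ?A = "{1..int k - 1} \<times> {int k..N - 1}" and ?B = "{int k} \<times> {int k + 1..N - 1}"
  let ?g = "\<lambda>(a, b). (v b, v a)"
  have inj: "inj_on ?g (?A \<union> ?B)" using aperm_inj[OF bv] by (auto simp: inj_on_def)
  have sub: "?g ` (?A \<union> ?B) \<subseteq> window_pairs"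
  proof -
    have "1 \<le> v x \<and> v x \<le> N - 1" if "1 \<le> x" "x \<le> N - 1" for x using v that by (auto simp: stab_zero_def)
    then show ?thesis using h k by (auto simp: window_pairs_def order_trans[of _ "N - 1" N])
  qed
  have "int (card (?A \<union> ?B)) = (int k - 1) * (N - int k) + (N - 1 - int k)"
  proof -
    have "card (?A \<union> ?B) = card ?A + card ?B" by (rule card_Un_disjoint) auto
    then show ?thesis using k by (simp add: card_cartesian_product)
  qed
  also have "\<dots> = int (k * (n - k)) - 1" using k by (simp add: algebra_simps of_nat_diff)
  finally have c: "int (k * (n - k)) - 1 = int (card (?g ` (?A \<union> ?B)))" using card_image[OF inj] by simp
  also have "\<dots> = (\<Sum>(a, b)\<in>?g ` (?A \<union> ?B). 1)" by (simp add: case_prod_unfold)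
  also have "\<dots> \<le> (\<Sum>(a, b)\<in>?g ` (?A \<union> ?B). \<bar>(inv v b - inv v a) div N\<bar>)"
  proof (rule sum_mono)
    fix x assume "x \<in> ?g ` (?A \<union> ?B)"
    then obtain y where y: "y \<in> ?A \<union> ?B" "x = ?g y" by blast
    obtain a b where ab: "y = (a, b)" by (cases y)
    have x: "x = (v b, v a)" "1 \<le> a" "a < b" "b \<le> N - 1" using y k unfolding ab by auto
    have "(a - b + N) div N = 0" using x N3 by (intro div_pos_pos_trivial) auto
    then have "(a - b) div N = -1" using N_pos by simp
    then show "(case x of (a, b) \<Rightarrow> 1) \<le> (case x of (a, b) \<Rightarrow> \<bar>(inv v b - inv v a) div N\<bar>)"
      using x bv by simp
  qed
  also have "\<dots> \<le> ell v" unfolding ell_def by (rule sum_mono2[OF _ sub]) auto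
  finally show ?thesis .
qed

theorem trl_rel_kernel: assumes k: "1 \<le> k" "k < n" shows "trl_rel k \<in> cyc_kernel n"
proof -
  have "cop v (trl_rel k) \<in> FK" if "v \<in> AffSym" for v
  proof (rule ccontr)
    assume n: "cop v (trl_rel k) \<notin> FK"
    let ?P = "\<lambda>u. u \<in> AffSym \<and> cop u (trl_rel k) \<notin> FK"
    \<comment> \<open>\<open>trl_rel_top\<close> bounds the length of a nonzero component, so one of
      maximal length exists.\<close>
    have bd: "nat (ell u) < k * (n - k)" if "?P u" for u
    proof -
      have "ell u < int (k * (n - k))" using trl_rel_top[OF k AffSym_aperm[of u]] that by linarith
      then show ?thesis by (simp only: nat_less_iff[OF ell_nonneg])
    qed
    have "\<exists>u. ?P u \<and> (\<forall>w. ?P w \<longrightarrow> nat (ell w) \<le> nat (ell u))"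
      by (rule ex_has_greatest_nat[where b = "k * (n - k)"]) (use that n bd in \<open>auto intro: less_imp_le\<close>)
    then obtain u where u: "u \<in> AffSym" "cop u (trl_rel k) \<notin> FK"
      and mx: "\<forall>w. ?P w \<longrightarrow> nat (ell w) \<le> nat (ell u)" by auto
    have lev: "cop w (trl_rel k) \<in> FK" if "w \<in> AffSym" "ell u < ell w" for w
      using mx that ell_nonneg[of u] by (metis eq_nat_nat_iff linorder_not_le nat_mono_iff order_le_less_trans)
    have uP: "u \<in> stab_zero" by (rule cop_stab_zero[OF _ trl_rel_wspan[OF k]]) (use u FK_0 in auto)
    have e: "rm [] (trl_rel k) = trl_rel k"
      by (rule wspan_eq[OF rm_linear fa.linear_ident _ trl_rel_wspan[OF k]]) simp
    have "int (k * (n - k)) - 1 \<le> ell u"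
      by (rule ell_ge_cross[OF k uP], rule trl_rel_block_inverted[where z = "[]", OF k lev uP]) (use u e in auto)
    then show False using trl_rel_top[OF k AffSym_aperm[OF u(1)]] u by simp
  qed
  then show ?thesis using AffSym_id trl_rel_wspan[OF k] by (simp add: kernel_iff)
qed


section \<open>A spanning set\<close>

definition rel_ideal :: "nat fa set" where
  "rel_ideal = fa_ideal {0..<n} ({x \<in> cyc_kernel n. homog 2 x} \<union> braid_rels n \<union> trl_rel ` {1..n - 1})"

lemma rel_ideal_subspace: "fa.subspace rel_ideal" unfolding rel_ideal_def by (rule fa_ideal_subspace)

lemma homog_diff: "homog d x \<Longrightarrow> homog d y \<Longrightarrow> homog d (x - y)"
  unfolding homog_def minus_apply by (metis diff_self)

lemma homog_word: "length w = d \<Longrightarrow> homog d (fa_word w)" by (simp add: homog_def fa_word_def)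

text \<open>Squares and commutators are quadratic elements of the kernel, so the nil-Coxeter
  relations are among the generators of \<open>rel_ideal\<close>.\<close>

lemma nil_rel_ideal: "nil \<subseteq> rel_ideal"
  unfolding nil_def rel_ideal_def
proof (rule ideal_sub, rule subsetI, rule fa_ideal.base)
  fix r assume r: "r \<in> nilcox_rels n"
  have "homog 2 r \<or> r \<in> braid_rels n"
    using r unfolding nilcox_rels_def ee_def fa_mult_word
    by (auto intro!: homog_word homog_diff)
  then show "r \<in> {x \<in> cyc_kernel n. homog 2 x} \<union> braid_rels n \<union> trl_rel ` {1..n - 1}"
    using nilcox_rels_kernel r by blast
qed

lemma trl_rel_rel_ideal: "1 \<le> k \<Longrightarrow> k < n \<Longrightarrow> trl_rel k \<in> rel_ideal"
  unfolding rel_ideal_def by (rule fa_ideal.base) auto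

lemma rel_ideal_lm: "x \<in> rel_ideal \<Longrightarrow> u \<in> letters \<Longrightarrow> lm u x \<in> rel_ideal"
  unfolding rel_ideal_def by (rule ideal_lm)
lemma rel_ideal_rm: "x \<in> rel_ideal \<Longrightarrow> u \<in> letters \<Longrightarrow> rm u x \<in> rel_ideal"
  unfolding rel_ideal_def by (rule ideal_rm)

abbreviation path_lists :: "nat list set" where "path_lists \<equiv> lists {1..n - 1}"

lemma path_lists_letters: "t \<in> path_lists \<Longrightarrow> t \<in> letters" using n3 by (fastforce simp: in_lists_conv_set)

text \<open>Grassmannian affine permutations with all window gaps below n. A gap above n at position k can be
removed with the k-th relation.\<close>

definition Box :: "(int \<Rightarrow> int) set" where
  "Box = {p \<in> AffSym. \<forall>j\<in>{1..n - 1}. inv p (int j) < inv p (int j + 1) \<and> inv p (int j + 1) - inv p (int j) < N}"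

text \<open>The symmetric group S_n as the parabolic subgroup of the letters 1..n - 1, acting on the
  window 1..n.\<close>

definition FinSym :: "(int \<Rightarrow> int) set" where "FinSym = {u. \<exists>t\<in>path_lists. state t = Some u}"

definition red_word :: "(int \<Rightarrow> int) \<Rightarrow> nat list" where "red_word p = (SOME w. w \<in> letters \<and> state w = Some p)"
definition path_word :: "(int \<Rightarrow> int) \<Rightarrow> nat list" where "path_word u = (SOME t. t \<in> path_lists \<and> state t = Some u)"

lemma red_word: "p \<in> AffSym \<Longrightarrow> red_word p \<in> letters" "p \<in> AffSym \<Longrightarrow> state (red_word p) = Some p"
  using someI_ex[of "\<lambda>w. w \<in> letters \<and> state w = Some p"] ex_word[of p] unfolding red_word_def by blast+

lemma path_word: "u \<in> FinSym \<Longrightarrow> path_word u \<in> path_lists" "u \<in> FinSym \<Longrightarrow> state (path_word u) = Some u"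
  using someI_ex[of "\<lambda>t. t \<in> path_lists \<and> state t = Some u"] unfolding path_word_def FinSym_def by blast+

definition basis_words :: "nat \<Rightarrow> nat fa set" where
  "basis_words d = {fa_word (red_word g @ path_word u) | g u. g \<in> Box \<and> u \<in> FinSym \<and> ell g + ell u = int d}"

definition basis_span :: "nat \<Rightarrow> nat fa set" where "basis_span d = fa.span (basis_words d \<union> rel_ideal)"

lemma basis_span_subspace: "fa.subspace (basis_span d)" by (simp add: basis_span_def)
lemma rel_ideal_basis_span: "x \<in> rel_ideal \<Longrightarrow> x \<in> basis_span d" unfolding basis_span_def by (rule fa.span_base) simp

lemma basis_span_wcong: assumes "wcong u v" "fa_word v \<in> basis_span d" shows "fa_word u \<in> basis_span d"
proof -
  have "fa_word u - fa_word v \<in> basis_span d" using assms(1) nil_rel_ideal rel_ideal_basis_span by (auto simp: wcong_def)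
  from fa.subspace_add[OF basis_span_subspace this assms(2)] show ?thesis by simp
qed

lemma ell_sub:
  "state x = Some r \<Longrightarrow> aperm q \<Longrightarrow> ell (q \<circ> r) \<le> ell q + int (length x)"
proof (induction x arbitrary: r)
  case (Cons i x)
  then obtain r' where r: "state x = Some r'" "r = r' \<circ> aswap (int i)"
    by (auto split: option.splits if_splits)
  have b: "aperm (q \<circ> r')" using Cons.prems state_aperm[OF r(1)] by (intro aperm_comp)
  have "ell (q \<circ> r' \<circ> aswap (int i)) \<le> ell (q \<circ> r') + 1"
  proof (cases "(q \<circ> r') (int i) < (q \<circ> r') (int i + 1)")
    case True
    then show ?thesis using ell_up[OF b] by simp
  next
    case False
    then have "(q \<circ> r') (int i + 1) < (q \<circ> r') (int i)" using aperm_inj[OF b, of "int i" "int i + 1"] by linarith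
    then show ?thesis using ell_down[OF b] by simp
  qed
  then show ?case using Cons.IH[OF r(1) Cons.prems(2)] r(2) by (simp add: comp_assoc del: o_apply)
qed simp

text \<open>Every letter changes the length by one, and prepending \<open>x\<close> adds its full
  length; so no letter of \<open>x\<close> can meet a descent.\<close>

lemma state_append_ell:
  assumes y: "state y = Some q"
  shows "state x = Some r \<Longrightarrow> ell (q \<circ> r) = ell q + int (length x) \<Longrightarrow> state (x @ y) = Some (q \<circ> r)"
proof (induction x arbitrary: r)
  case Nil
  then show ?case using y by (simp del: id_apply)
next
  case (Cons i x)
  then obtain r' where r: "state x = Some r'" "r = r' \<circ> aswap (int i)"
    by (auto split: option.splits if_splits)
  have bq: "aperm q" by (rule state_aperm[OF y])
  have b: "aperm (q \<circ> r')" using bq state_aperm[OF r(1)] by (intro aperm_comp)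
  have le: "ell (q \<circ> r') \<le> ell q + int (length x)" by (rule ell_sub[OF r(1) bq])
  have e: "ell (q \<circ> r' \<circ> aswap (int i)) = ell q + int (length x) + 1"
    using Cons.prems r(2) by (simp add: comp_assoc del: o_apply)
  have up: "(q \<circ> r') (int i) < (q \<circ> r') (int i + 1)"
  proof (rule ccontr)
    assume "\<not> ?thesis"
    then have "(q \<circ> r') (int i + 1) < (q \<circ> r') (int i)" using aperm_inj[OF b, of "int i" "int i + 1"] by linarith
    then show False using ell_down[OF b] e le by simp
  qed
  then have "ell (q \<circ> r') = ell q + int (length x)" using ell_up[OF b up] e by (simp del: o_apply)
  from Cons.IH[OF r(1) this] have "state (x @ y) = Some (q \<circ> r')" .
  then show ?case using up r(2) by (simp add: comp_def)
qed

text \<open>Without such a descent the positions \<open>S\<close> of \<open>I\<close> in the window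
  are closed downwards, hence equal to 1..k. So every summand of the relation but one ends, up to
  congruence, in a letter from 1..n - 1.\<close>

lemma trl_descent:
  assumes k: "1 \<le> k" "k < n" and I: "I \<in> Sub k" "I \<noteq> (\<lambda>z. vtx (int z + int k)) ` {1..k}"
  shows "\<exists>j\<in>{1..n - 1}. inv (trl k I) (int j + 1) < inv (trl k I) (int j)"
proof (rule ccontr)
  assume h: "\<not> ?thesis"
  let ?f = "\<lambda>z. vtx (int z + int k)"
  define S where "S = {z \<in> {1..n}. ?f z \<in> I}"
  have finI: "I \<subseteq> {0..<n}" "card I = k" using I by (auto simp: Sub_def)
  have inj: "inj_on ?f {1..n}"
  proof (rule inj_onI)
    fix x y assume a: "x \<in> {1..n}" "y \<in> {1..n}" "?f x = ?f y"
    then have "N dvd int x - int y" using vtx_eq_iff by fastforce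
    moreover have "\<bar>int x - int y\<bar> < N" using a by auto
    ultimately show "x = y" using not_dvd_small[of "int x - int y"] by auto
  qed
  have "?f ` {1..n} = {0..<n}"
    using inj by (intro card_subset_eq) (auto simp: card_image)
  then have "I \<subseteq> ?f ` {1..n}" using finI(1) by simp
  have im: "?f ` S = I"
  proof
    show "?f ` S \<subseteq> I" by (auto simp: S_def)
    show "I \<subseteq> ?f ` S"
    proof
      fix y assume y: "y \<in> I"
      then obtain z where "z \<in> {1..n}" "y = ?f z" using \<open>I \<subseteq> ?f ` {1..n}\<close> by blast
      then show "y \<in> ?f ` S" using y by (simp add: S_def)
    qed
  qed
  have cS: "card S = k"
  proof -
    have "inj_on ?f S" by (rule inj_on_subset[OF inj]) (auto simp: S_def)
    from card_image[OF this] show ?thesis using im finI(2) by simp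
  qed
  have dn: "z \<in> S" if "Suc z \<in> S" "1 \<le> z" for z
  proof (rule ccontr)
    assume "z \<notin> S"
    then have a: "vtx (int z + int k) \<notin> I" "vtx (int z + 1 + int k) \<in> I" and z: "z \<in> {1..n - 1}"
      using that by (auto simp: S_def algebra_simps)
    have "inv (trl k I) (int z + 1) < inv (trl k I) (int z)" unfolding trl_inv trl_inv_def using a N3 by simp
    then show False using h z by blast
  qed
  have dn2: "a \<in> S" if "b \<in> S" "1 \<le> a" "a \<le> b" for a b
    using that(3,1,2) by (induction rule: dec_induct) (use dn in auto)
  have "finite S" by (simp add: S_def)
  have "S \<noteq> {}" using cS k by auto
  define M where "M = Max S"
  have "M \<in> S" unfolding M_def using \<open>finite S\<close> \<open>S \<noteq> {}\<close> by (rule Max_in)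
  moreover have "x \<le> M" if "x \<in> S" for x unfolding M_def using \<open>finite S\<close> that by (rule Max_ge)
  moreover have "1 \<le> x" if "x \<in> S" for x using that by (simp add: S_def)
  ultimately have "S = {1..M}" using dn2[of M] by (intro set_eqI) (meson atLeastAtMost_iff)
  then have "S = {1..k}" using cS by simp
  then show False using im I by simp
qed

text \<open>The exchange property at the other end of the word, obtained from
  \<open>state_snoc\<close> and the congruence of reduced words.\<close>

lemma split_last:
  assumes z: "z \<in> letters" "state z = Some p" and j: "j \<in> {1..n - 1}" "inv p (int j + 1) < inv p (int j)"
  shows "\<exists>z'\<in>letters. wcong z (z' @ [j]) \<and> length z = Suc (length z')"
proof -
  have G: "p \<in> AffSym" by (rule state_AffSym[OF z(2)])
  let ?p = "aswap (int j) \<circ> p"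
  have "?p \<in> AffSym" using G by (intro AffSym_comp AffSym_aswap)
  then obtain z' where z': "z' \<in> letters" "state z' = Some ?p" using ex_word by blast
  have "inv ?p (int j) < inv ?p (int j + 1)" using j aperm_inv_sw2[OF AffSym_aperm[OF G]] by (simp add: aswap_at)
  moreover have "aswap (int j) \<circ> ?p = p" by (simp add: fun_eq_iff)
  ultimately have s: "state (z' @ [j]) = Some p" using state_snoc(1)[OF z'(2), of j] by (simp del: o_apply)
  have "wcong z (z' @ [j])" using state_eq_wcong[OF z(1) _ z(2) s] z' j n3 by auto
  moreover have "length z = Suc (length z')" using state_ell[OF z(2)] state_ell[OF s] by simp
  ultimately show ?thesis using z' by blast
qed

definition Grass :: "(int \<Rightarrow> int) \<Rightarrow> bool" where
  "Grass p \<longleftrightarrow> (\<forall>j\<in>{1..n - 1}. inv p (int j) < inv p (int j + 1))"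

lemma Grass_step: "Grass p \<Longrightarrow> 1 \<le> j \<Longrightarrow> j < N \<Longrightarrow> inv p j < inv p (j + 1)"
  unfolding Grass_def by (drule bspec[of _ _ "nat j"]) (auto simp: nat_le_iff of_nat_diff le_nat_iff)

lemma Grass_mono: assumes "Grass p" "1 \<le> a" "a < b" "b \<le> N" shows "inv p a < inv p b"
proof -
  have "b \<le> N \<longrightarrow> inv p a < inv p b" if "a + 1 \<le> b" for b using that
  proof (induction b rule: int_ge_induct)
    case base
    then show ?case using Grass_step[OF assms(1,2)] by simp
  next
    case (step b)
    then show ?case using Grass_step[OF assms(1), of b] assms(2) by fastforce
  qed
  from this[of b] show ?thesis using assms by simp
qed

text \<open>Splitting off the translation lowers the window gap at k by n, so each of the k(n-k)
  pairs across the gap loses one in Shi's formula and all other pairs are unchanged. The lengths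
  therefore add, and \<open>p\<close> has a reduced word that ends in the word of the
  translation.\<close>

lemma nonbox_factor:
  assumes k: "1 \<le> k" "k < n" and p: "p \<in> AffSym"
    and Grass: "\<And>j. j \<in> {1..n - 1} \<Longrightarrow> inv p (int j) < inv p (int j + 1)"
    and gap: "N \<le> inv p (int k + 1) - inv p (int k)"
  defines "I \<equiv> (\<lambda>z. vtx (int z + int k)) ` {1..k}"
  shows "I \<in> Sub k \<and> (\<exists>x\<in>letters. state (x @ trl_word k I) = Some p)"
proof -
  have aperm: "aperm p" by (rule AffSym_aperm[OF p])
  define v where "v = inv p"
  have v: "aperm v" unfolding v_def by (rule aperm_inv[OF aperm])
  have "Grass p" using Grass by (simp add: Grass_def)
  then have mono: "v a < v b" if "1 \<le> a" "a < b" "b \<le> N" for a b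
    using Grass_mono that unfolding v_def by blast
  have gap': "v a + N < v b" if "1 \<le> a" "a \<le> int k" "int k < b" "b \<le> N" for a b
  proof -
    have "v a \<le> v (int k)" using mono[of a "int k"] that k by (cases "a = int k") auto
    moreover have "v (int k + 1) \<le> v b" using mono[of "int k + 1" b] that k by (cases "b = int k + 1") auto
    \<comment> \<open>Consecutive window entries lie in different classes, so a gap of at least n is
      strictly larger and stays positive after the reduction.\<close>
    moreover have "v (int k + 1) - v (int k) \<noteq> N"
      using aperm_dvd_iff[OF v, of "int k + 1" "int k"] not_dvd_small[of 1] N3 by (auto intro: dvd_refl)
    ultimately show ?thesis using gap unfolding v_def by linarith
  qed
  have inj: "inj_on (\<lambda>z. vtx (int z + int k)) {1..k}"
  proof (rule inj_onI)
    fix x y assume a: "x \<in> {1..k}" "y \<in> {1..k}" "vtx (int x + int k) = vtx (int y + int k)"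
    then have "N dvd int x - int y" using vtx_eq_iff by fastforce
    moreover have "\<bar>int x - int y\<bar> < N" using a k by auto
    ultimately show "x = y" using not_dvd_small[of "int x - int y"] by auto
  qed
  have IS: "I \<in> Sub k" unfolding I_def Sub_def using card_image[OF inj] by auto
  have inI: "vtx (a + int k) \<in> I \<longleftrightarrow> a \<le> int k" if a: "1 \<le> a" "a \<le> N" for a
  proof
    assume "vtx (a + int k) \<in> I"
    then obtain z where z: "1 \<le> z" "z \<le> k" "vtx (a + int k) = vtx (int z + int k)" by (auto simp: I_def)
    then have "N dvd a - int z" using vtx_eq_iff by fastforce
    moreover have "\<bar>a - int z\<bar> < N" using a z k by auto
    ultimately have "a = int z" using not_dvd_small[of "a - int z"] by auto
    then show "a \<le> int k" using z by simp
  next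
    assume "a \<le> int k"
    then show "vtx (a + int k) \<in> I" using a unfolding I_def by (intro image_eqI[of _ _ "nat a"]) auto
  qed
  define r where "r = inv (trl k I) \<circ> p"
  have TG: "inv (trl k I) \<in> AffSym"
    using trl_AffSym[OF IS] by (simp add: AffSym_def aperm_inv drift_inv)
  have rG: "r \<in> AffSym" unfolding r_def by (rule AffSym_comp[OF TG p])
  have Tr: "trl k I \<circ> r = p" unfolding r_def using trl_aperm by (simp add: fun_eq_iff)
  have ir: "inv r = v \<circ> trl k I"
    unfolding r_def v_def using aperm trl_aperm[of k I]
    by (subst o_inv_distrib) (simp_all add: aperm_def bij_imp_bij_inv inv_inv_eq)
  obtain x where x: "x \<in> letters" "state x = Some r" using ex_word[OF rG] by blast
  \<comment> \<open>Rotating the letters preserves the length and lines the window of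
    \<open>r\<close> up with that of \<open>p\<close>.\<close>
  define x' where "x' = map (\<lambda>i. (i + (n - k)) mod n) x"
  define r' where "r' = (\<lambda>y. r (y - int (n - k)) + int (n - k))"
  have sx': "state x' = Some r'" unfolding x'_def r'_def by (rule state_shift[OF x(2)])
  have br: "aperm r" by (rule AffSym_aperm[OF rG])
  have ir': "inv r' a = inv r (a - int (n - k)) + int (n - k)" for a
  proof (rule inv_f_eq)
    show "inj r'" using state_aperm[OF sx'] by (simp add: aperm_def bij_is_inj)
    show "r' (inv r (a - int (n - k)) + int (n - k)) = a" using br by (simp add: r'_def)
  qed
  have v': "inv r' a = v a + (if a \<le> int k then N else 0) + int (n - k) - N" if a: "1 \<le> a" "a \<le> N" for a
  proof -
    have e: "a - int (n - k) = a + int k - N" using k by simp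
    have "trl k I (a + int k - N) = a + (if a \<le> int k then N else 0) - N"
      using inI[OF a] vtx_add_N[of "a + int k - N"] by (simp add: trl_def)
    then have "inv r' a = v (a + (if a \<le> int k then N else 0) - N) + int (n - k)"
      unfolding ir' e ir by simp
    also have "v (a + (if a \<le> int k then N else 0) - N) = v a + (if a \<le> int k then N else 0) - N"
      using aperm_cong[OF v, of "a - N" a] by (auto simp: algebra_simps)
    finally show ?thesis by simp
  qed
  have "ell p = ell r' + int (k * (n - k))"
  proof -
    have t: "\<bar>(inv p b - inv p a) div N\<bar> = \<bar>(inv r' b - inv r' a) div N\<bar> + (if a \<le> int k \<and> int k < b then 1 else 0)"
      if "(a, b) \<in> window_pairs" for a b
    proof -
      have ab: "1 \<le> a" "a < b" "b \<le> N" using that by (auto simp: window_pairs_def)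
      have m: "v a < v b" using mono ab by simp
      show ?thesis
      proof (cases "a \<le> int k \<and> int k < b")
        case True
        then have "inv r' b - inv r' a = v b - v a - N" using v'[of a] v'[of b] ab by simp
        moreover have "v a + N < v b" using gap' True ab by simp
        moreover have "(v b - v a) div N = (v b - v a - N) div N + 1"
          using N_pos by (metis add.commute diff_add_cancel div_add_self2 less_irrefl)
        moreover have "0 \<le> (v b - v a - N) div N" using calculation(2) N_pos by (intro pos_imp_zdiv_nonneg_iff[THEN iffD2]) auto
        ultimately show ?thesis using True by (simp add: v_def)
      next
        case False
        then have "inv r' b - inv r' a = v b - v a" using v'[of a] v'[of b] ab by auto
        then show ?thesis using False by (simp add: v_def)
      qed
    qed
    have "ell p = (\<Sum>(a, b)\<in>window_pairs. \<bar>(inv r' b - inv r' a) div N\<bar> + (if a \<le> int k \<and> int k < b then 1 else 0))"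
      unfolding ell_def by (rule sum.cong) (use t in auto)
    also have "\<dots> = ell r' + (\<Sum>(a, b)\<in>window_pairs. (if a \<le> int k \<and> int k < b then 1 else 0))"
      unfolding ell_def by (simp add: case_prod_unfold sum.distrib)
    also have "(\<Sum>(a, b)\<in>window_pairs. (if a \<le> int k \<and> int k < b then 1 else 0 :: int)) = (\<Sum>x\<in>{1..int k} \<times> {int k + 1..N}. 1)"
      by (rule sum.mono_neutral_cong_right) (auto simp: window_pairs_def[THEN eq_reflection] finite_window_pairs[unfolded window_pairs_def] split: if_splits)
    also have "\<dots> = int (k * (n - k))" using k by (simp add: card_cartesian_product of_nat_diff)
    finally show ?thesis .
  qed
  moreover have "ell r' = int (length x)" using state_ell[OF sx'] by (simp add: x'_def)
  ultimately have "ell (trl k I \<circ> r) = ell (trl k I) + int (length x)" unfolding Tr using trl_ell[OF IS] k by simp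
  from state_append_ell[OF trl_word_props(2)[OF k IS] x(2) this] show ?thesis unfolding Tr using x(1) IS by blast
qed

text \<open>Induction on the left factor \<open>z\<close>. A descent of its inverse permutation
  among 1..n - 1 moves a letter over to \<open>t\<close>. If there is none but some gap is large,
  the k-th relation replaces the word by words that have such a descent; otherwise \<open>z\<close>
  already belongs to the box.\<close>

lemma basis_span_spanning:
  "z \<in> letters \<Longrightarrow> t \<in> path_lists \<Longrightarrow> fa_word (z @ t) \<in> basis_span (length z + length t)"
proof (induction "length z" arbitrary: z t rule: less_induct)
  case less
  have tl: "t \<in> letters" using less.prems path_lists_letters by blast
  have nilSP: "x \<in> nil \<Longrightarrow> x \<in> basis_span d" for x d using nil_rel_ideal rel_ideal_basis_span by blast
  show ?case
  proof (cases "state z")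
    case None
    then have "fa_word z \<in> nil" using state_None_nil less.prems by blast
    then have "fa_word (z @ t) \<in> nil" using nil_rm[OF _ tl] by fastforce
    then show ?thesis by (rule nilSP)
  next
    case (Some p)
    have G: "p \<in> AffSym" by (rule state_AffSym[OF Some])
    have red: "fa_word ((x @ y) @ t) \<in> basis_span (length z + length t)"
      if "x \<in> letters" "y \<in> letters" "state y = Some q" "length (x @ y) = length z"
        "j \<in> {1..n - 1}" "inv q (int j + 1) < inv q (int j)" for x y q j
    proof -
      note sl = split_last[OF that(2,3,5,6)]
      obtain z' where z': "z' \<in> letters" "wcong y (z' @ [j])" "length y = Suc (length z')"
        using sl by blast
      have "fa_word ((x @ z') @ (j # t)) \<in> basis_span (length (x @ z') + length (j # t))"
        using z' that less.prems by (intro less.hyps) auto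
      moreover have "wcong ((x @ y) @ t) ((x @ z' @ [j]) @ t)"
        by (rule wcong_app2[OF wcong_app[OF z'(2) that(1)] tl])
      moreover have "length (x @ z') + length (j # t) = length z + length t" using z'(3) that(4) by simp
      ultimately show ?thesis using basis_span_wcong by (metis append_assoc append_Cons append_Nil)
    qed
    consider (d) j where "j \<in> {1..n - 1}" "inv p (int j + 1) < inv p (int j)"
      | (b) "p \<in> Box"
      | (g) k where "k \<in> {1..n - 1}" "\<And>j. j \<in> {1..n - 1} \<Longrightarrow> inv p (int j) < inv p (int j + 1)"
          "N \<le> inv p (int k + 1) - inv p (int k)"
    proof -
      have "inv p (int j) \<noteq> inv p (int j + 1)" for j using aperm_inj[OF aperm_inv[OF AffSym_aperm[OF G]]] by simp
      then have ne: "inv p (int j) < inv p (int j + 1) \<or> inv p (int j + 1) < inv p (int j)" for j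
        by (meson linorder_neqE)
      show ?thesis
      proof (cases "\<exists>j\<in>{1..n - 1}. inv p (int j + 1) < inv p (int j)")
        case True
        then show ?thesis using that(1) by blast
      next
        case False
        then have gr: "\<And>j. j \<in> {1..n - 1} \<Longrightarrow> inv p (int j) < inv p (int j + 1)" using ne by blast
        show ?thesis
        proof (cases "\<exists>k\<in>{1..n - 1}. N \<le> inv p (int k + 1) - inv p (int k)")
          case True
          then show ?thesis using that(3) gr by blast
        next
          case False
          then have "p \<in> Box" using G gr unfolding Box_def by (auto simp: not_le)
          then show ?thesis by (rule that(2))
        qed
      qed
    qed
    then show ?thesis
    proof cases
      case d
      show ?thesis using red[OF _ less.prems(1) Some _ d, of "[]"] by simp
    next
      case b
      show ?thesis
      proof (cases "state t")
        case None
        then have "fa_word t \<in> nil" using state_None_nil tl by blast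
        then have "fa_word (z @ t) \<in> nil" using nil_lm[OF _ less.prems(1)] by fastforce
        then show ?thesis by (rule nilSP)
      next
        case (Some u)
        have u: "u \<in> FinSym" using Some less.prems by (auto simp: FinSym_def)
        have 1: "wcong z (red_word p)" using state_eq_wcong[OF less.prems(1) red_word(1)[OF G] \<open>state z = Some p\<close> red_word(2)[OF G]] .
        have 2: "wcong t (path_word u)" using state_eq_wcong[OF tl path_lists_letters[OF path_word(1)[OF u]] Some path_word(2)[OF u]] .
        have "wcong (z @ t) (red_word p @ path_word u)"
          using wcong_trans[OF wcong_app2[OF 1 tl] wcong_app[OF 2 red_word(1)[OF G]]] .
        moreover have "fa_word (red_word p @ path_word u) \<in> basis_words (length z + length t)"
          using b u state_ell[OF Some] state_ell[OF \<open>state z = Some p\<close>] unfolding basis_words_def by force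
        ultimately show ?thesis using basis_span_wcong fa.span_base unfolding basis_span_def by blast
      qed
    next
      case g
      then have k: "1 \<le> k" "k < n" using n3 by auto
      let ?I = "(\<lambda>z. vtx (int z + int k)) ` {1..k}"
      obtain x where IS: "?I \<in> Sub k" and x: "x \<in> letters" "state (x @ trl_word k ?I) = Some p"
        using nonbox_factor[OF k G g(2,3)] by blast
      have lens: "length (x @ trl_word k I) = length z" if "I \<in> Sub k" for I
      proof -
        have "length z = length (x @ trl_word k ?I)" using state_ell[OF x(2)] state_ell[OF Some] by linarith
        then show ?thesis using trl_word_props(3)[OF k IS] trl_word_props(3)[OF k that] by simp
      qed
      have rest: "fa_word ((x @ trl_word k I) @ t) \<in> basis_span (length z + length t)" if "I \<in> Sub k - {?I}" for I
      proof -
        have I: "I \<in> Sub k" "I \<noteq> ?I" using that by auto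
        obtain j where j: "j \<in> {1..n - 1}" "inv (trl k I) (int j + 1) < inv (trl k I) (int j)"
          using trl_descent[OF k I] by blast
        show ?thesis by (rule red[OF x(1) trl_word_props(1,2)[OF k I(1)] lens[OF I(1)] j])
      qed
      have "rm t (lm x (trl_rel k)) \<in> rel_ideal" using rel_ideal_rm[OF rel_ideal_lm[OF trl_rel_rel_ideal[OF k] x(1)] tl] .
      moreover have "rm t (lm x (trl_rel k)) = (\<Sum>I\<in>Sub k. fa_word ((x @ trl_word k I) @ t))"
        by (simp add: trl_rel_def lrm_simps)
      moreover have "\<dots> = fa_word ((x @ trl_word k ?I) @ t) + (\<Sum>I\<in>Sub k - {?I}. fa_word ((x @ trl_word k I) @ t))"
        by (rule sum.remove[OF finite_Sub IS])
      moreover have "(\<Sum>I\<in>Sub k - {?I}. fa_word ((x @ trl_word k I) @ t)) \<in> basis_span (length z + length t)"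
        by (rule fa.subspace_sum[OF basis_span_subspace rest])
      ultimately have "fa_word ((x @ trl_word k ?I) @ t) \<in> basis_span (length z + length t)"
        using fa.subspace_diff[OF basis_span_subspace] rel_ideal_basis_span by (metis add_diff_cancel_right')
      moreover have "wcong z (x @ trl_word k ?I)"
        using state_eq_wcong[OF less.prems(1) _ Some x(2)] x(1) trl_word_props(1)[OF k IS] by auto
      ultimately show ?thesis using basis_span_wcong[OF wcong_app2[OF _ tl]] by blast
    qed
  qed
qed

end

section \<open>Skew derivations\<close>

text \<open>Pairing of two oriented edges, antisymmetric in each as the generators are.\<close>

definition pair_sign :: "nat \<times> nat \<Rightarrow> nat \<times> nat \<Rightarrow> rat" where
  "pair_sign ab pq = (if pq = ab then 1 else 0) - (if prod.swap pq = ab then 1 else 0)"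

lemma pair_sign_swap: "pair_sign ab (q, p) = - pair_sign ab (p, q)" by (simp add: pair_sign_def)

fun act :: "('a \<Rightarrow> nat \<times> nat) \<Rightarrow> 'a list \<Rightarrow> nat \<Rightarrow> nat" where
  "act e [] x = x"
| "act e (c # u) x = act e u (transpose (fst (e c)) (snd (e c)) x)"

text \<open>Deletes the letters of a word one at a time. The deleted letter is weighted by its sign against ab
after it has been moved to the right end of the word, which applies the transpositions of the
letters it passes to its end points.\<close>

fun sder_word :: "('a \<Rightarrow> nat \<times> nat) \<Rightarrow> (nat \<Rightarrow> nat) \<Rightarrow> nat \<times> nat \<Rightarrow> 'a list \<Rightarrow> 'a fa" where
  "sder_word e f ab [] = 0"
| "sder_word e f ab (c # u) = fa_scale (pair_sign ab (f (act e u (fst (e c))), f (act e u (snd (e c))))) (fa_word u)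
     + lm [c] (sder_word e f ab u)"

definition sder :: "('a \<Rightarrow> nat \<times> nat) \<Rightarrow> (nat \<Rightarrow> nat) \<Rightarrow> nat \<times> nat \<Rightarrow> 'a fa \<Rightarrow> 'a fa" where
  "sder e f ab = fa_lift (sder_word e f ab)"

lemma sder_linear: "fa_linear (sder e f ab)" unfolding sder_def by (rule fa_lift_linear)
lemma sder_word [simp]: "sder e f ab (fa_word w) = sder_word e f ab w" by (simp add: sder_def fa_lift_word)
lemmas sder_simps = lin_simps[OF sder_linear]

lemma act_append: "act e (u @ v) x = act e v (act e u x)"
  by (induction u arbitrary: x) auto

lemma lm_Nil: "x \<in> wspan A \<Longrightarrow> lm [] x = x"
  by (rule wspan_eq[OF lm_linear fa.linear_ident]) auto
lemma sder_word_wspan: "w \<in> lists A \<Longrightarrow> sder_word e f ab w \<in> wspan A"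
  by (induction w) (auto intro!: wspan_add wspan_scale wspan_0 wspan_word lm_wspan)

text \<open>Leibniz rule: a letter deleted in \<open>u\<close> has still to cross \<open>v\<close>,
  which is absorbed into the relabelling. This is why \<open>sder_word\<close> carries the parameter
  \<open>f\<close>.\<close>

lemma sder_word_append:
  "sder_word e f ab (u @ v) = rm v (sder_word e (\<lambda>x. f (act e v x)) ab u) + lm u (sder_word e f ab v)"
proof (induction u)
  case Nil
  show ?case using lm_Nil[OF sder_word_wspan[of v UNIV e f ab]] by (simp add: lrm_simps)
next
  case (Cons c u)
  have 1: "sder_word e f ab v \<in> wspan UNIV" for v f by (rule sder_word_wspan) auto
  show ?case using Cons lm_lm[OF 1, of "[c]" u] lm_rm[OF 1, of "[c]" v]
    by (simp add: lrm_simps act_append)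
qed

lemma sder_word_sum:
  "sder_word e f ab w = (\<Sum>k<length w. fa_scale (pair_sign ab (f (act e (drop (Suc k) w) (fst (e (w ! k)))),
      f (act e (drop (Suc k) w) (snd (e (w ! k)))))) (fa_word (take k w @ drop (Suc k) w)))"
proof (induction w)
  case (Cons c u)
  then show ?case by (simp add: sum.lessThan_Suc_shift lrm_simps del: sum.lessThan_Suc)
qed simp

lemma fa_mult_lm: "fa_mult (fa_word u) x = lm u x" by (simp add: lm_def)
lemma fa_mult_rm: "fa_mult x (fa_word u) = rm u x" by (simp add: rm_def)

text \<open>Letters deleted in \<open>u\<close> cross all of \<open>r\<close>, so the words of
  \<open>r\<close> must act by one common permutation \<open>g\<close>. The relators satisfy this
  because E_n is graded by the symmetric group.\<close>

lemma sder_conj: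
  assumes r: "r \<in> fa.span (fa_word ` {w. \<forall>x. act e w x = g x})"
  shows "sder e f ab (lm u (rm z r)) =
     rm z (fa_mult (sder_word e (\<lambda>x. f (act e z (g x))) ab u) r)
     + lm u (rm z (sder e (\<lambda>x. f (act e z x)) ab r)) + lm u (fa_mult r (sder_word e f ab z))"
proof (rule fa_linear_eq_span[OF _ _ _ r])
  show "fa_linear (\<lambda>r. sder e f ab (lm u (rm z r)))"
    by (rule fa_linear_comp[OF sder_linear fa_linear_comp[OF lm_linear rm_linear]])
  show "fa_linear (\<lambda>r. rm z (fa_mult (sder_word e (\<lambda>x. f (act e z (g x))) ab u) r)
     + lm u (rm z (sder e (\<lambda>x. f (act e z x)) ab r)) + lm u (fa_mult r (sder_word e f ab z)))"
    by (intro fa_linear_plus fa_linear_comp[OF rm_linear] fa_linear_comp[OF lm_linear]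
        fa_mult_linear_right fa_mult_linear_left sder_linear)
next
  fix x assume "x \<in> fa_word ` {w. \<forall>x. act e w x = g x}"
  then obtain w where w: "\<And>x. act e w x = g x" and x: "x = fa_word w" by auto
  have 1: "sder_word e f ab v \<in> wspan UNIV" for v f by (rule sder_word_wspan) auto
  show "sder e f ab (lm u (rm z x)) = rm z (fa_mult (sder_word e (\<lambda>x. f (act e z (g x))) ab u) x)
     + lm u (rm z (sder e (\<lambda>x. f (act e z x)) ab x)) + lm u (fa_mult x (sder_word e f ab z))"
    unfolding x fa_mult_lm fa_mult_rm
    by (simp add: sder_word_append act_append w rm_rm[OF 1] lrm_simps lm_lm[OF 1])
qed

context cyc
begin

text \<open>In the triangle relation each letter survives in two of the three words, and the deleted
  letters then have opposite labels, so the six terms cancel in pairs.\<close>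

lemma sder_rels: assumes "r \<in> fk_rels n" shows "sder id f ab r = 0 \<and> (\<exists>g. r \<in> fa.span (fa_word ` {w. \<forall>x. act id w x = g x}))"
proof -
  from assms[unfolded fk_rels_words] consider
      (1) a b where "r = fa_word [(a, b)] + fa_word [(b, a)]" "(a, b) \<in> fk_gens n"
    | (2) a b where "r = fa_word [(a, b), (a, b)]" "(a, b) \<in> fk_gens n"
    | (3) a b c e where "r = fa_word [(a, b), (c, e)] - fa_word [(c, e), (a, b)]"
        "a < n" "b < n" "c < n" "e < n" "distinct [a, b, c, e]"
    | (4) a b c where "r = fa_word [(a, b), (b, c)] + fa_word [(b, c), (c, a)] + fa_word [(c, a), (a, b)]"
        "a < n" "b < n" "c < n" "distinct [a, b, c]" by blast
  then show ?thesis
  proof cases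
    case 1
    have "sder id f ab r = 0"
      using 1 by (simp add: sder_simps lrm_simps pair_sign_swap[of ab "f a" "f b"] fa.scale_minus_left)
    moreover have "r \<in> fa.span (fa_word ` {w. \<forall>x. act id w x = act id [(a, b)] x})"
      unfolding 1(1) by (intro fa.span_add fa.span_base imageI) (simp_all add: transpose_commute)
    ultimately show ?thesis by blast
  next
    case 2
    have "sder id f ab r = 0"
      using 2 by (simp add: sder_simps lrm_simps pair_sign_swap[of ab "f b" "f a"] fa.scale_minus_left)
    moreover have "r \<in> fa.span (fa_word ` {w. \<forall>x. act id w x = act id [(a, b), (a, b)] x})"
      unfolding 2(1) by (intro fa.span_base imageI) simp
    ultimately show ?thesis by blast
  next
    case 3
    have "sder id f ab r = 0"
      using 3 by (simp add: sder_simps lrm_simps)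
    moreover have "r \<in> fa.span (fa_word ` {w. \<forall>x. act id w x = act id [(a, b), (c, e)] x})"
      unfolding 3(1) using 3 by (intro fa.span_diff fa.span_base imageI) (auto simp: transpose_def)
    ultimately show ?thesis by blast
  next
    case 4
    have "sder id f ab r = 0"
      using 4 by (simp add: sder_simps lrm_simps pair_sign_swap[of ab "f b" "f a"] pair_sign_swap[of ab "f c" "f b"]
        pair_sign_swap[of ab "f a" "f c"] fa.scale_minus_left)
    moreover have "r \<in> fa.span (fa_word ` {w. \<forall>x. act id w x = act id [(a, b), (b, c)] x})"
      unfolding 4(1) using 4 by (intro fa.span_add fa.span_base imageI) (auto simp: transpose_def)
    ultimately show ?thesis by blast
  qed
qed

lemma sder_FK: assumes "x \<in> FK" shows "sder id f ab x \<in> FK"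
proof (rule ideal_lift[OF fk_rels_wspan sder_linear FK_subspace assms[unfolded fk_ideal_def]])
  fix u v r assume a: "u \<in> lists (fk_gens n)" "v \<in> lists (fk_gens n)" "r \<in> fk_rels n"
  obtain g where g: "r \<in> fa.span (fa_word ` {w. \<forall>x. act id w x = g x})" using sder_rels[OF a(3)] by blast
  have rF: "r \<in> FK" unfolding fk_ideal_def by (rule fa_ideal.base[OF a(3)])
  have 0: "sder id f ab r = 0" for f using sder_rels[OF a(3)] by blast
  have "fa_mult (sder_word id f ab u) r \<in> FK" for f
    using rF sder_word_wspan[OF a(1)] unfolding fk_ideal_def by (intro ideal_mult_left)
  moreover have "fa_mult r (sder_word id f ab v) \<in> FK" for f
    using rF sder_word_wspan[OF a(2)] unfolding fk_ideal_def by (intro ideal_mult_right)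
  ultimately show "sder id f ab (lm u (rm v r)) \<in> FK"
    unfolding sder_conj[OF g] 0 using a by (simp add: lrm_simps FK_add FK_lm FK_rm)
qed

abbreviation sder_cyc :: "nat \<times> nat \<Rightarrow> nat fa \<Rightarrow> nat fa" where "sder_cyc ab \<equiv> sder (ecyc n) id ab"

lemma sder_cyc_wspan: "x \<in> wspan {0..<n} \<Longrightarrow> sder_cyc ab x \<in> wspan {0..<n}"
  by (rule wspan_lift[OF sder_linear wspan_subspace]) (auto intro: sder_word_wspan simp del: id_apply)

lemma act_map: "act id (map (ecyc n) u) x = act (ecyc n) u x"
  by (induction u arbitrary: x) auto

lemma inner_desc_id: "\<not> inner_desc i id" by (simp add: inner_desc_def)

lemma cop_sder_word: "u \<in> letters \<Longrightarrow> cop id (sder_word (ecyc n) id ab u) = sder_word id id ab (map (ecyc n) u)"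
proof (induction u)
  case (Cons i u)
  have "sder_word (ecyc n) id ab u \<in> wspan {0..<n}" using Cons.prems by (intro sder_word_wspan) auto
  then show ?case using Cons inner_desc_id[of i]
    by (simp add: cop_simps cop_lm act_map cop_word_id del: id_apply) simp
qed (simp add: cop_simps del: id_apply)

lemma cop_sder_cyc: "x \<in> wspan {0..<n} \<Longrightarrow> cop id (sder_cyc ab x) = sder id id ab (cop id x)"
  by (rule wspan_eq[OF fa_linear_comp[OF cop_linear sder_linear] fa_linear_comp[OF sder_linear cop_linear]])
    (auto simp: cop_sder_word cop_word_id simp del: id_apply)

abbreviation K :: "nat fa set" where "K \<equiv> cyc_kernel n"

lemma sder_cyc_K: "x \<in> K \<Longrightarrow> sder_cyc ab x \<in> K"
  using cop_sder_cyc[of x ab] sder_FK[of "cop id x" id ab] sder_cyc_wspan[of x ab] by (simp add: kernel_iff)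

lemma K_subspace: "fa.subspace K"
proof -
  have "K = wspan {0..<n} \<inter> {x. cop id x \<in> FK}" by (auto simp: kernel_iff)
  moreover have "fa.subspace {x. cop id x \<in> FK}"
    by (rule fa.subspaceI) (auto simp: cop_simps FK_0 FK_add FK_scale)
  ultimately show ?thesis using fa.subspace_inter[OF wspan_subspace] by simp
qed

lemma cop_id_mult:
  "x \<in> wspan {0..<n} \<Longrightarrow> u \<in> letters \<Longrightarrow> cop id (lm u x) = lm (map (ecyc n) u) (cop id x)"
  "x \<in> wspan {0..<n} \<Longrightarrow> u \<in> letters \<Longrightarrow> cop id (rm u x) = rm (map (ecyc n) u) (cop id x)"
  by (rule wspan_eq[OF fa_linear_comp[OF cop_linear lm_linear] fa_linear_comp[OF lm_linear cop_linear]],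
      simp_all add: cop_word_id del: id_apply)
    (rule wspan_eq[OF fa_linear_comp[OF cop_linear rm_linear] fa_linear_comp[OF rm_linear cop_linear]],
      simp_all add: cop_word_id del: id_apply)

lemma map_ecyc: "u \<in> letters \<Longrightarrow> map (ecyc n) u \<in> lists (fk_gens n)"
  by (auto simp: in_lists_conv_set intro!: ecyc_gens)

lemma K_lm: "x \<in> K \<Longrightarrow> u \<in> letters \<Longrightarrow> lm u x \<in> K"
  by (simp add: kernel_iff cop_id_mult lm_wspan FK_lm map_ecyc del: in_lists_conv_set lists_eq_set)
lemma K_rm: "x \<in> K \<Longrightarrow> u \<in> letters \<Longrightarrow> rm u x \<in> K"
  by (simp add: kernel_iff cop_id_mult rm_wspan FK_rm map_ecyc del: in_lists_conv_set lists_eq_set)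

lemma FK_Nil: "x \<in> FK \<Longrightarrow> x [] = 0"
proof -
  assume x: "x \<in> FK"
  have s: "fa.subspace {x :: (nat \<times> nat) fa. x [] = 0}" by (rule fa.subspaceI) (auto simp: pw_simps)
  have "x \<in> {x. x [] = 0}"
  proof (rule ideal_lift[OF fk_rels_wspan fa.linear_ident s x[unfolded fk_ideal_def]])
    fix u v :: "(nat \<times> nat) list" and r assume r: "r \<in> fk_rels n"
    have nz: "fa_word (u @ c # w) [] = (0 :: rat)" for c w by (simp add: fa_word_def)
    show "lm u (rm v r) \<in> {x. x [] = 0}"
      using r unfolding fk_rels_words by (auto simp: lrm_simps pw_simps nz)
  qed
  then show "x [] = 0" by simp
qed

lemma cop_id_Nil: assumes "x \<in> wspan {0..<n}" shows "cop id x [] = x []"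
proof -
  have nw1: "fa_word w [] = (if w = [] then 1 else 0)" for w :: "nat list" by (auto simp: fa_word_def)
  have nw2: "fa_word w [] = (if w = [] then 1 else 0)" for w :: "(nat \<times> nat) list" by (auto simp: fa_word_def)
  have l: "fa_linear (\<lambda>x :: 'a fa. fa_scale (x []) (fa_word [] :: nat fa))"
    by (rule fa_linearI) (auto simp: pw_simps fun_eq_iff algebra_simps)
  have "fa_scale (cop id x []) (fa_word [] :: nat fa) = fa_scale (x []) (fa_word [])"
    by (rule wspan_eq[OF fa_linear_comp[OF l cop_linear] l _ assms]) (simp_all add: cop_word_id nw1 nw2 del: id_apply)
  from fun_cong[OF this, of "[]"] show ?thesis by (simp add: fa_scale_def fa_word_def)
qed

text \<open>The unit survives in E_n: the constant term is the functional that finally detects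
  non-membership.\<close>

lemma K_Nil: "x \<in> K \<Longrightarrow> x [] = 0"
  using FK_Nil[of "cop id x"] cop_id_Nil[of x] by (simp add: kernel_iff)

end

text \<open>Nonnegative combinations of words from \<open>Q\<close>, modulo \<open>M\<close>. Words
  can be rewritten only modulo an ideal, while the sign information sits on words; the cone carries
  both.\<close>

inductive_set cone :: "'a list set \<Rightarrow> 'a fa set \<Rightarrow> 'a fa set" for Q M where
  base: "m \<in> M \<Longrightarrow> m \<in> cone Q M"
| step: "x \<in> cone Q M \<Longrightarrow> w \<in> Q \<Longrightarrow> 0 \<le> c \<Longrightarrow> fa_scale c (fa_word w) + x \<in> cone Q M"

lemma cone_add:
  assumes M: "fa.subspace M" and x: "x \<in> cone Q M" and y: "y \<in> cone Q M" shows "x + y \<in> cone Q M"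
  using x
proof induction
  case (base m)
  show ?case using y
  proof induction
    case (base m')
    then show ?case using \<open>m \<in> M\<close> by (intro cone.base fa.subspace_add[OF M])
  next
    case (step y w c)
    then show ?case using cone.step[of "m + y" Q M w c] by (simp add: add.left_commute)
  qed
next
  case (step x w c)
  then show ?case using cone.step[of "x + y" Q M w c] by (simp add: add.assoc)
qed

lemma cone_scale:
  assumes M: "fa.subspace M" and x: "x \<in> cone Q M" and "0 \<le> c" shows "fa_scale c x \<in> cone Q M"
  using x
proof induction
  case (base m)
  then show ?case by (intro cone.base fa.subspace_scale[OF M])
next
  case (step x w d)
  then show ?case using cone.step[of "fa_scale c x" Q M w "c * d"] \<open>0 \<le> c\<close>
    by (simp add: fa.scale_right_distrib)
qed

lemma cone_word: "fa.subspace M \<Longrightarrow> w \<in> Q \<Longrightarrow> fa_word w \<in> cone Q M"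
  using cone.step[of 0 Q M w 1] cone.base[of 0 M Q] fa.subspace_0[of M] by simp

lemma cone_sum:
  assumes M: "fa.subspace M" and "\<And>k. k \<in> S \<Longrightarrow> x k \<in> cone Q M" shows "(\<Sum>k\<in>S. x k) \<in> cone Q M"
  using assms(2)
proof (induction S rule: infinite_finite_induct)
  case (insert k S)
  then show ?case by (simp add: cone_add[OF M])
qed (auto intro: cone.base fa.subspace_0[OF M])

lemma cone_map:
  assumes M: "fa.subspace M" and D: "fa_linear D" "\<And>m. m \<in> M \<Longrightarrow> D m \<in> M" "\<And>w. w \<in> Q \<Longrightarrow> D (fa_word w) \<in> cone Q M"
    and x: "x \<in> cone Q M"
  shows "D x \<in> cone Q M"
  using x
proof induction
  case (base m)
  then show ?case using D by (intro cone.base)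
next
  case (step x w c)
  then show ?case by (simp add: lin_simps[OF D(1)] cone_add[OF M] cone_scale[OF M] D)
qed

lemma cone_Nil:
  assumes "\<And>m. m \<in> M \<Longrightarrow> m [] = 0" "x \<in> cone Q M" shows "0 \<le> x []"
  using assms(2)
proof induction
  case (step x w c)
  then show ?case by (simp add: pw_simps fa_word_def)
qed (simp add: assms(1))

definition letter_label :: "('a \<Rightarrow> nat \<times> nat) \<Rightarrow> 'a \<Rightarrow> 'a list \<Rightarrow> nat \<times> nat" where
  "letter_label e i u = (act e u (fst (e i)), act e u (snd (e i)))"

definition sder_chain :: "('a \<Rightarrow> nat \<times> nat) \<Rightarrow> (nat \<times> nat) list \<Rightarrow> 'a fa \<Rightarrow> 'a fa" where
  "sder_chain e Ls x = fold (\<lambda>L y. sder e id L y) Ls x"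

lemma sder_chain_simps [simp]: "sder_chain e [] x = x" "sder_chain e (L # Ls) x = sder_chain e Ls (sder e id L x)"
  by (simp_all add: sder_chain_def)

lemma sder_chain_linear: "fa_linear (sder_chain e Ls)"
proof (induction Ls)
  case Nil
  show ?case unfolding sder_chain_simps(1) by (rule fa.linear_ident)
next
  case (Cons L Ls)
  show ?case unfolding sder_chain_simps(2) by (rule fa_linear_comp[OF Cons sder_linear])
qed

lemma pair_sign_refl: "fst L \<noteq> snd L \<Longrightarrow> pair_sign L L = 1" by (cases L) (simp add: pair_sign_def)

lemma pair_sign_nonneg: "prod.swap pq \<noteq> ab \<Longrightarrow> 0 \<le> pair_sign ab pq" by (simp add: pair_sign_def)

lemma pair_sign_zero: "pq \<noteq> ab \<Longrightarrow> prod.swap pq \<noteq> ab \<Longrightarrow> pair_sign ab pq = 0" by (simp add: pair_sign_def)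

text \<open>Along the chain all weights are nonnegative, so the deletion of first letters cannot be cancelled.\<close>

lemma chain:
  assumes M: "fa.subspace M"
    and pos: "\<And>w k L. w \<in> Q \<Longrightarrow> k < length w \<Longrightarrow> L \<in> LL \<Longrightarrow> 0 \<le> pair_sign L (letter_label e (w ! k) (drop (Suc k) w))"
    and rem: "\<And>w k. w \<in> Q \<Longrightarrow> k < length w \<Longrightarrow> fa_word (take k w @ drop (Suc k) w) \<in> cone Q M"
    and DM: "\<And>L m. L \<in> LL \<Longrightarrow> m \<in> M \<Longrightarrow> sder e id L m \<in> M"
    and Q1: "Q1 \<subseteq> Q" "\<And>i u. i # u \<in> Q1 \<Longrightarrow> u \<in> Q1 \<and> letter_label e i u \<in> LL \<and> fst (letter_label e i u) \<noteq> snd (letter_label e i u)"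
  shows "z \<in> Q1 \<Longrightarrow> x \<in> cone Q M \<Longrightarrow>
    \<exists>Ls\<in>lists LL. length Ls = length z \<and> (\<exists>y\<in>cone Q M. sder_chain e Ls (fa_word z + x) = fa_word [] + y)"
proof (induction z arbitrary: x)
  case Nil
  then show ?case by (intro bexI[of _ "[]"]) auto
next
  case (Cons i u)
  \<comment> \<open>Deriving by the label of the first letter gives the deletion of that letter
    weight one; all other deletions go to the cone.\<close>
  define L where "L = letter_label e i u"
  note q = Q1(2)[OF Cons.prems(1)]
  have L: "L \<in> LL" "pair_sign L L = 1" using q by (auto simp: L_def intro: pair_sign_refl)
  have tm: "fa_scale (pair_sign L (letter_label e (w ! k) (drop (Suc k) w))) (fa_word (take k w @ drop (Suc k) w)) \<in> cone Q M"
    if "w \<in> Q" "k < length w" for w k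
    using pos[OF that L(1)] rem[OF that] by (intro cone_scale[OF M])
  have Dw: "sder e id L (fa_word w) = (\<Sum>k<length w. fa_scale (pair_sign L (letter_label e (w ! k) (drop (Suc k) w))) (fa_word (take k w @ drop (Suc k) w)))" for w
    by (simp add: sder_word_sum letter_label_def)
  have cD: "sder e id L y \<in> cone Q M" if "y \<in> cone Q M" for y
    by (rule cone_map[OF M sder_linear DM[OF L(1)] _ that]) (auto simp: Dw simp del: sder_word intro!: cone_sum[OF M] tm)
  let ?w = "i # u"
  have wQ: "?w \<in> Q" using Cons.prems Q1 by blast
  let ?rest = "\<Sum>k<length u. fa_scale (pair_sign L (letter_label e (?w ! Suc k) (drop (Suc (Suc k)) ?w))) (fa_word (take (Suc k) ?w @ drop (Suc (Suc k)) ?w))"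
  have "sder e id L (fa_word ?w) = fa_word u + ?rest"
    unfolding Dw using L(2) by (simp add: sum.lessThan_Suc_shift L_def[symmetric] del: sum.lessThan_Suc)
  moreover have "?rest \<in> cone Q M" using wQ by (intro cone_sum[OF M] tm) auto
  ultimately obtain y where y: "y \<in> cone Q M" "sder e id L (fa_word ?w + x) = fa_word u + y"
    using cone_add[OF M _ cD[OF Cons.prems(2)]] by (auto simp: sder_simps add.assoc simp del: sder_word)
  obtain Ls where "Ls \<in> lists LL" "length Ls = length u" "\<exists>y'\<in>cone Q M. sder_chain e Ls (fa_word u + y) = fa_word [] + y'"
    using Cons.IH[OF _ y(1)] q by blast
  then show ?case using L y(2) by (intro bexI[of _ "L # Ls"]) auto
qed

section \<open>Independence of the Grassmannian factor\<close>

context cyc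
begin

lemma act_state: "u \<in> letters \<Longrightarrow> state u = Some q \<Longrightarrow> act (ecyc n) u (vtx x) = vtx (q x)"
proof (induction u arbitrary: q x)
  case (Cons i u)
  then obtain q' where q: "state u = Some q'" "q = q' \<circ> aswap (int i)"
    by (auto split: option.splits if_splits)
  have "act (ecyc n) (i # u) (vtx x) = act (ecyc n) u (tau i (vtx x))" by (simp add: ecyc_def tau_def)
  also have "tau i (vtx x) = vtx (aswap (int i) x)" using Cons.prems vtx_aswap by simp
  finally show ?case using Cons.IH[OF _ q(1)] Cons.prems q(2) by simp
qed simp

lemma letter_label_state: assumes "i < n" "u \<in> letters" "state u = Some q"
  shows "letter_label (ecyc n) i u = (vtx (q (int i)), vtx (q (int i + 1)))"
  using act_state[OF assms(2,3), of "int i"] act_state[OF assms(2,3), of "int i + 1"] assms(1)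
  by (simp add: letter_label_def ecyc_def vtx_of_nat vtx_Suc)

lemma vtx_inj: "1 \<le> x \<Longrightarrow> x \<le> N \<Longrightarrow> 1 \<le> y \<Longrightarrow> y \<le> N \<Longrightarrow> vtx x = vtx y \<longleftrightarrow> x = y"
  using vtx_eq_iff[of x y] small_eq[of x y] by auto

lemma vtx_wcls: "vtx (wcls x) = vtx x"
  using vtx_eq_iff wcls_dvd by (simp add: dvd_diff_commute)

text \<open>Two pairs of window places ordered in the same direction are never reverses of each
  other.\<close>

lemma pair_sign_pos:
  assumes "1 \<le> a" "a < b" "b \<le> N" "1 \<le> c" "c < d" "d \<le> N"
  shows "0 \<le> pair_sign (vtx a, vtx b) (vtx c, vtx d)" "0 \<le> pair_sign (vtx b, vtx a) (vtx d, vtx c)"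
proof -
  have "vtx d = vtx a \<longleftrightarrow> d = a" "vtx c = vtx b \<longleftrightarrow> c = b" using assms by (simp_all add: vtx_inj)
  then have n: "\<not> (vtx d = vtx a \<and> vtx c = vtx b)" using assms by linarith
  show "0 \<le> pair_sign (vtx a, vtx b) (vtx c, vtx d)" "0 \<le> pair_sign (vtx b, vtx a) (vtx d, vtx c)"
    by (rule pair_sign_nonneg, use n in \<open>simp only: swap_simp prod.inject, blast\<close>)+
qed

lemma aswap_fin: assumes "1 \<le> i" "i \<le> N - 1" "1 \<le> x" "x \<le> N"
  shows "aswap i x = (if x = i then x + 1 else if x = i + 1 then x - 1 else x)"
  using not_dvd_small[of "x - i"] not_dvd_small[of "x - (i + 1)"] assms by (auto simp: aswap_def)

lemma FinSym_range: "t \<in> path_lists \<Longrightarrow> state t = Some q \<Longrightarrow> 1 \<le> x \<Longrightarrow> x \<le> N \<Longrightarrow> 1 \<le> q x \<and> q x \<le> N"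
proof (induction t arbitrary: q x)
  case (Cons i t)
  then obtain q' where q: "state t = Some q'" "q = q' \<circ> aswap (int i)"
    by (auto split: option.splits if_splits)
  have i: "1 \<le> int i" "int i \<le> N - 1" using Cons.prems(1) by auto
  have "1 \<le> aswap (int i) x" "aswap (int i) x \<le> N" using aswap_fin[OF i Cons.prems(3,4)] Cons.prems i by auto
  then show ?case using Cons.IH[OF _ q(1)] Cons.prems(1) q(2) by simp
qed simp

definition path_end :: "nat fa set" where
  "path_end = {fa_word (w @ [j]) | w j. w \<in> letters \<and> j \<in> {1..n - 1}}"
text \<open>Modulo this subspace only the Grassmannian factor of a word remains: a reduced word
  whose permutation is not Grassmannian ends, up to congruence, in a letter from 1..n - 1.\<close>

definition ker_path :: "nat fa set" where "ker_path = fa.span (K \<union> path_end)"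

lemma ker_path_subspace: "fa.subspace ker_path" by (simp add: ker_path_def)
lemma K_ker_path: "x \<in> K \<Longrightarrow> x \<in> ker_path" unfolding ker_path_def by (rule fa.span_base) simp
lemma path_end_ker_path: "w \<in> letters \<Longrightarrow> j \<in> {1..n - 1} \<Longrightarrow> fa_word (w @ [j]) \<in> ker_path"
  unfolding ker_path_def by (rule fa.span_base) (auto simp: path_end_def)
lemma nil_ker_path: "x \<in> nil \<Longrightarrow> x \<in> ker_path" using nil_kernel K_ker_path by blast

lemma ker_path_Nil: "m \<in> ker_path \<Longrightarrow> m [] = 0"
proof -
  assume m: "m \<in> ker_path"
  have s: "fa.subspace {x :: nat fa. x [] = 0}" by (rule fa.subspaceI) (auto simp: pw_simps)
  have "ker_path \<subseteq> {x. x [] = 0}"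
    unfolding ker_path_def by (rule fa.span_minimal[OF _ s]) (auto simp: path_end_def fa_word_def K_Nil)
  then show "m [] = 0" using m by blast
qed

lemma ker_path_wcong: assumes "wcong u v" "fa_word v \<in> ker_path" shows "fa_word u \<in> ker_path"
proof -
  have "fa_word u - fa_word v \<in> ker_path" using assms(1) nil_ker_path by (auto simp: wcong_def)
  from fa.subspace_add[OF ker_path_subspace this assms(2)] show ?thesis by simp
qed

lemma ker_path_rm: assumes "x \<in> wspan {0..<n}" "j \<in> {1..n - 1}" shows "rm [j] x \<in> ker_path"
  by (rule wspan_lift[OF rm_linear ker_path_subspace _ assms(1)]) (use assms path_end_ker_path in auto)

text \<open>On a word ending in \<open>j\<close> the derivation either deletes an earlier letter,
  which keeps the ending, or deletes \<open>j\<close>, with weight zero by the condition on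
  \<open>L\<close>.\<close>

lemma ker_path_D:
  assumes L: "\<And>j. j \<in> {1..n - 1} \<Longrightarrow> pair_sign L (ecyc n j) = 0" and m: "m \<in> ker_path" shows "sder_cyc L m \<in> ker_path"
proof (rule fa_linear_span[OF sder_linear ker_path_subspace _ m[unfolded ker_path_def]])
  fix x assume "x \<in> K \<union> path_end"
  then show "sder_cyc L x \<in> ker_path"
  proof
    assume "x \<in> K" then show ?thesis using sder_cyc_K K_ker_path by blast
  next
    assume "x \<in> path_end"
    then obtain w j where x: "x = fa_word (w @ [j])" "w \<in> letters" "j \<in> {1..n - 1}" by (auto simp: path_end_def)
    have "sder_word (ecyc n) id L [j] = 0" using L[OF x(3)] by (simp add: lrm_simps)
    then have "sder_cyc L x = rm [j] (sder_word (ecyc n) (\<lambda>y. id (act (ecyc n) [j] y)) L w)"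
      unfolding x(1) sder_word sder_word_append by (simp add: lrm_simps del: sder_word.simps)
    then show ?thesis using ker_path_rm[OF sder_word_wspan[OF x(2)] x(3)] by simp
  qed
qed

lemma nonGr_ker_path: assumes "w \<in> letters" "state w = Some p" "\<not> Grass p" shows "fa_word w \<in> ker_path"
proof -
  have "inv p (int j) \<noteq> inv p (int j + 1)" for j using aperm_inj[OF aperm_inv[OF state_aperm[OF assms(2)]]] by simp
  then obtain j where j: "j \<in> {1..n - 1}" "inv p (int j + 1) < inv p (int j)"
    using assms(3) unfolding Grass_def by (meson linorder_neqE)
  obtain z' where "z' \<in> letters" "wcong w (z' @ [j])" using split_last[OF assms(1,2) j] by blast
  then show ?thesis using ker_path_wcong path_end_ker_path j by blast
qed

definition Grass_words :: "nat list set" where "Grass_words = {w \<in> letters. \<exists>p. state w = Some p \<and> Grass p}"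

text \<open>Deleting a letter from a Grassmannian word may leave any word. It vanishes, or can be
  given an ending in 1..n - 1, or is Grassmannian again, so the cone is stable under
  deletions.\<close>

lemma cone_all: assumes "w \<in> letters" shows "fa_word w \<in> cone Grass_words ker_path"
proof (cases "state w")
  case None
  then show ?thesis using state_None_nil[OF assms] nil_ker_path by (intro cone.base) auto
next
  case (Some p)
  show ?thesis
  proof (cases "Grass p")
    case True
    then show ?thesis using Some assms by (intro cone_word[OF ker_path_subspace]) (auto simp: Grass_words_def)
  next
    case False
    then show ?thesis using nonGr_ker_path[OF assms Some] by (intro cone.base)
  qed
qed

lemma state_Cons_obtain:
  assumes "state (i # u) = Some p"
  obtains q where "state u = Some q" "q (int i) < q (int i + 1)" "p = q \<circ> aswap (int i)"
  using assms by (auto split: option.splits if_splits)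

text \<open>A descent of the inverse is lost under a prepended letter only if that letter is the
  same reflection, and then the longer word would not be reduced.\<close>

lemma Grass_suffix:
  assumes "state (i # u) = Some p" "Grass p" "state u = Some q" shows "Grass q"
  unfolding Grass_def
proof (rule ballI, rule ccontr)
  fix j assume j: "j \<in> {1..n - 1}" and h: "\<not> inv q (int j) < inv q (int j + 1)"
  have b: "aperm q" by (rule state_aperm[OF assms(3)])
  have up: "q (int i) < q (int i + 1)" and p: "p = q \<circ> aswap (int i)" using assms by (auto split: if_splits)
  have "inv q (int j + 1) \<noteq> inv q (int j)" using aperm_inj[OF aperm_inv[OF b]] by simp
  with h have lt: "inv q (int j + 1) < inv q (int j)" by simp
  have "inv p (int j) < inv p (int j + 1)" using assms(2) j by (simp add: Grass_def)
  then have "\<not> aswap (int i) (inv q (int j + 1)) < aswap (int i) (inv q (int j))"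
    unfolding p aperm_inv_aswap[OF b] by simp
  then have "inv q (int j) = inv q (int j + 1) + 1 \<and> N dvd inv q (int j + 1) - int i"
    using aswap_less[OF lt] by blast
  then show False using adj_swap2[OF b, of "int j" "int i"] up by auto
qed

lemma Grass_words_drop: "w \<in> Grass_words \<Longrightarrow> drop k w \<in> Grass_words"
proof (induction w arbitrary: k)
  case (Cons i u)
  then obtain p where p: "state (i # u) = Some p" "Grass p" by (auto simp: Grass_words_def simp del: state.simps)
  obtain q where q: "state u = Some q" using state_Cons_obtain[OF p(1)] by metis
  have "u \<in> Grass_words" using Grass_suffix[OF p q] q Cons.prems by (auto simp: Grass_words_def)
  then show ?case using Cons by (cases k) auto
qed simp

text \<open>Window bookkeeping of one step: in the inverse window the entry at
  \<open>\<alpha>\<close> rises by one and the entry at \<open>\<beta>\<close> falls by one, and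
  \<open>A\<close>, \<open>B\<close> count the periods.\<close>

lemma step_data:
  fixes y :: int
  assumes b: "aperm q"
  defines "\<alpha> \<equiv> wcls (q y)" and "\<beta> \<equiv> wcls (q (y + 1))"
  obtains A B where "1 \<le> \<alpha>" "\<alpha> \<le> N" "1 \<le> \<beta>" "\<beta> \<le> N" "\<alpha> \<noteq> \<beta>"
    "q y = \<alpha> + N * A" "q (y + 1) = \<beta> + N * B" "inv q \<alpha> = y - N * A" "inv q \<beta> = y + 1 - N * B"
    "inv (q \<circ> aswap y) \<alpha> = inv q \<alpha> + 1" "inv (q \<circ> aswap y) \<beta> = inv q \<beta> - 1"
    "\<And>c. 1 \<le> c \<Longrightarrow> c \<le> N \<Longrightarrow> c \<noteq> \<alpha> \<Longrightarrow> c \<noteq> \<beta> \<Longrightarrow> inv (q \<circ> aswap y) c = inv q c"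
proof -
  have v: "aperm (inv q)" by (rule aperm_inv[OF b])
  obtain A where A: "q y = \<alpha> + N * A" using wcls_dvd[of "q y"] unfolding \<alpha>_def
    by (metis add_diff_cancel_left' add_diff_eq dvd_def diff_add_cancel add.commute)
  obtain B where B: "q (y + 1) = \<beta> + N * B" using wcls_dvd[of "q (y + 1)"] unfolding \<beta>_def
    by (metis add_diff_cancel_left' add_diff_eq dvd_def diff_add_cancel add.commute)
  have ra: "1 \<le> \<alpha>" "\<alpha> \<le> N" "1 \<le> \<beta>" "\<beta> \<le> N" unfolding \<alpha>_def \<beta>_def using wcls_range by auto
  have va: "inv q \<alpha> = y - N * A" using aperm_add[OF v, of \<alpha> A] A b by (metis add_diff_cancel_right' aperm_inv_f)
  have vb: "inv q \<beta> = y + 1 - N * B" using aperm_add[OF v, of \<beta> B] B b by (metis add_diff_cancel_right' aperm_inv_f)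
  have nd: "\<not> N dvd 1" "\<not> N dvd -1" using not_dvd_small[of 1] not_dvd_small[of "-1"] N3 by auto
  have ab: "\<alpha> \<noteq> \<beta>"
  proof
    assume "\<alpha> = \<beta>"
    then have "N dvd q y - q (y + 1)" using A B by (simp add: dvd_def) (metis right_diff_distrib')
    then have "N dvd y - (y + 1)" using aperm_dvd_iff[OF b] by blast
    then show False using nd by simp
  qed
  have i: "inv (q \<circ> aswap y) c = aswap y (inv q c)" for c by (simp add: aperm_inv_aswap[OF b])
  have 1: "inv (q \<circ> aswap y) \<alpha> = inv q \<alpha> + 1"
    unfolding i va by (simp add: aswap_def)
  have 2: "inv (q \<circ> aswap y) \<beta> = inv q \<beta> - 1"
  proof -
    have "\<not> N dvd y + 1 - N * B - y"
    proof
      assume "N dvd y + 1 - N * B - y"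
      from dvd_add[OF this dvd_triv_left[of N B]] show False using nd by simp
    qed
    then show ?thesis unfolding i vb by (simp add: aswap_def)
  qed
  have 3: "inv (q \<circ> aswap y) c = inv q c" if c: "1 \<le> c" "c \<le> N" "c \<noteq> \<alpha>" "c \<noteq> \<beta>" for c
  proof -
    have "\<not> N dvd inv q c - y"
    proof
      assume "N dvd inv q c - y"
      then have "N dvd q (inv q c) - q y" using aperm_dvd_iff[OF b] by blast
      then have "vtx c = vtx \<alpha>" using b vtx_eq_iff[of c "q y"] vtx_wcls[of "q y"] by (simp add: \<alpha>_def)
      then show False using vtx_inj c ra by simp
    qed
    moreover have "\<not> N dvd inv q c - (y + 1)"
    proof
      assume "N dvd inv q c - (y + 1)"
      then have "N dvd q (inv q c) - q (y + 1)" using aperm_dvd_iff[OF b] by blast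
      then have "vtx c = vtx \<beta>" using b vtx_eq_iff[of c "q (y + 1)"] vtx_wcls[of "q (y + 1)"] by (simp add: \<beta>_def)
      then show False using vtx_inj c ra by simp
    qed
    ultimately show ?thesis unfolding i by (simp add: aswap_def)
  qed
  show ?thesis by (rule that[OF ra ab A B va vb 1 2 3])
qed

text \<open>If the label of \<open>q y\<close> were the smaller one, Grassmannian order before and
  after the step would give \<open>q y\<close> more periods than \<open>q (y + 1)\<close>, against
  the ascent. So every label along a Grassmannian word points from a larger to a smaller window
  place.\<close>

lemma Grass_label:
  assumes b: "aperm q" and q: "Grass q" and up: "q y < q (y + 1)" and p: "Grass (q \<circ> aswap y)"
  shows "wcls (q (y + 1)) < wcls (q y)"
proof (rule ccontr)
  assume h: "\<not> ?thesis"
  obtain A B where d: "1 \<le> wcls (q y)" "wcls (q y) \<le> N" "1 \<le> wcls (q (y + 1))" "wcls (q (y + 1)) \<le> N" "wcls (q y) \<noteq> wcls (q (y + 1))"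
    "q y = wcls (q y) + N * A" "q (y + 1) = wcls (q (y + 1)) + N * B"
    "inv q (wcls (q y)) = y - N * A" "inv q (wcls (q (y + 1))) = y + 1 - N * B"
    "inv (q \<circ> aswap y) (wcls (q y)) = inv q (wcls (q y)) + 1" "inv (q \<circ> aswap y) (wcls (q (y + 1))) = inv q (wcls (q (y + 1))) - 1"
    by (rule step_data[OF b, of y]) blast
  have lt: "wcls (q y) < wcls (q (y + 1))" using h d(5) by simp
  have 1: "inv q (wcls (q y)) < inv q (wcls (q (y + 1)))" by (rule Grass_mono[OF q d(1) lt d(4)])
  have 2: "inv (q \<circ> aswap y) (wcls (q y)) < inv (q \<circ> aswap y) (wcls (q (y + 1)))" by (rule Grass_mono[OF p d(1) lt d(4)])
  have "N * B < N * A" using 2 d(8,9) unfolding d(10,11) by linarith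
  then have "B + 1 \<le> A" using N_pos by simp
  then have "N * (B + 1) \<le> N * A" using N_pos by simp
  then show False using up d(1-4,6,7) by (simp add: distrib_left)
qed


lemma Box_AffSym: "p \<in> Box \<Longrightarrow> p \<in> AffSym" by (simp add: Box_def)
lemma Box_aperm: "p \<in> Box \<Longrightarrow> aperm p" using Box_AffSym AffSym_aperm by blast
lemma Box_Grass: "p \<in> Box \<Longrightarrow> Grass p" by (simp add: Box_def Grass_def)
lemma Box_gap: "p \<in> Box \<Longrightarrow> 1 \<le> j \<Longrightarrow> j < N \<Longrightarrow> inv p (j + 1) - inv p j < N"
  unfolding Box_def mem_Collect_eq
  by (elim conjE, drule bspec[of _ _ "nat j"]) (auto simp: nat_le_iff of_nat_diff le_nat_iff)

lemma Box_I:
  assumes "p \<in> AffSym" "\<And>j. 1 \<le> j \<Longrightarrow> j < N \<Longrightarrow> inv p j < inv p (j + 1)"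
    "\<And>j. 1 \<le> j \<Longrightarrow> j < N \<Longrightarrow> inv p (j + 1) - inv p j < N"
  shows "p \<in> Box"
  unfolding Box_def using assms by auto

lemma inv_gap_neq: "aperm p \<Longrightarrow> inv p (j + 1) - inv p j \<noteq> N \<and> inv p (j + 1) - inv p j \<noteq> 0"
proof -
  assume p: "aperm p"
  have "\<not> N dvd inv p (j + 1) - inv p j"
    using aperm_dvd_iff[OF aperm_inv[OF p], of "j + 1" j] not_dvd_small[of 1] N3 by simp
  then show ?thesis by (metis dvd_0_right dvd_refl)
qed

text \<open>For adjacent places the gap after the step would be 1 + n(B - A) with A < B, hence above
  n, which the box excludes.\<close>

lemma Box_down:
  assumes q: "q \<in> AffSym" and up: "q y < q (y + 1)" and p: "q \<circ> aswap y \<in> Box" and Gq: "Grass q"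
  shows "q \<in> Box" "wcls (q (y + 1)) + 2 \<le> wcls (q y)"
proof -
  have b: "aperm q" by (rule AffSym_aperm[OF q])
  define \<alpha> \<beta> where "\<alpha> = wcls (q y)" and "\<beta> = wcls (q (y + 1))"
  obtain A B where d: "1 \<le> \<alpha>" "\<alpha> \<le> N" "1 \<le> \<beta>" "\<beta> \<le> N" "\<alpha> \<noteq> \<beta>"
    "q y = \<alpha> + N * A" "q (y + 1) = \<beta> + N * B" "inv q \<alpha> = y - N * A" "inv q \<beta> = y + 1 - N * B"
    "inv (q \<circ> aswap y) \<alpha> = inv q \<alpha> + 1" "inv (q \<circ> aswap y) \<beta> = inv q \<beta> - 1"
    "\<And>c. 1 \<le> c \<Longrightarrow> c \<le> N \<Longrightarrow> c \<noteq> \<alpha> \<Longrightarrow> c \<noteq> \<beta> \<Longrightarrow> inv (q \<circ> aswap y) c = inv q c"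
    unfolding \<alpha>_def \<beta>_def by (rule step_data[OF b, of y]) blast
  have ba: "\<beta> < \<alpha>" unfolding \<alpha>_def \<beta>_def by (rule Grass_label[OF b Gq up Box_Grass[OF p]])
  have AB: "A + 1 \<le> B"
  proof -
    have "N * A < N * B" using up d(6,7) ba by linarith
    then show ?thesis using N_pos by simp
  qed
  have "\<alpha> \<noteq> \<beta> + 1"
  proof
    assume e: "\<alpha> = \<beta> + 1"
    have "inv (q \<circ> aswap y) (\<beta> + 1) - inv (q \<circ> aswap y) \<beta> < N" by (rule Box_gap[OF p]) (use e d in auto)
    then have "1 + N * B - N * A < N" unfolding e[symmetric] d(10,11) d(8,9) by linarith
    moreover have "N * (A + 1) \<le> N * B" using AB N_pos by simp
    ultimately show False by (simp add: distrib_left)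
  qed
  then show "wcls (q (y + 1)) + 2 \<le> wcls (q y)" using ba by (simp add: \<alpha>_def \<beta>_def)
  show "q \<in> Box"
  proof (rule Box_I[OF q Grass_step[OF Gq]])
    fix j assume j: "1 \<le> j" "j < N"
    have g: "inv (q \<circ> aswap y) (j + 1) - inv (q \<circ> aswap y) j < N" by (rule Box_gap[OF p j])
    have 1: "inv q (j + 1) \<le> inv (q \<circ> aswap y) (j + 1) + (if j + 1 = \<beta> then 1 else 0)"
      using d(10,11) d(12)[of "j + 1"] j by (cases "j + 1 = \<alpha>"; cases "j + 1 = \<beta>") auto
    have 2: "inv (q \<circ> aswap y) j \<le> inv q j + (if j = \<alpha> then 1 else 0)"
      using d(10,11) d(12)[of j] j by (cases "j = \<alpha>"; cases "j = \<beta>") auto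
    \<comment> \<open>Undoing the step enlarges a gap by at most one; the value n itself is excluded
      by the residues.\<close>
    have "inv q (j + 1) - inv q j \<le> N"
      using 1 2 g ba by (auto split: if_splits)
    then show "inv q (j + 1) - inv q j < N" using inv_gap_neq[OF b, of j] by linarith
  qed
qed

text \<open>Converse of \<open>Box_down\<close>: labels at distance at least two never belong to one
  gap, so each gap changes by at most one. The strict bounds become weak ones, which the residues
  sharpen again.\<close>

lemma Box_up:
  assumes q: "q \<in> Box" and c: "wcls (q (y + 1)) + 2 \<le> wcls (q y)"
  shows "q y < q (y + 1)" "q \<circ> aswap y \<in> Box"
proof -
  have b: "aperm q" by (rule Box_aperm[OF q])
  define \<alpha> \<beta> where "\<alpha> = wcls (q y)" and "\<beta> = wcls (q (y + 1))"
  obtain A B where d: "1 \<le> \<alpha>" "\<alpha> \<le> N" "1 \<le> \<beta>" "\<beta> \<le> N" "\<alpha> \<noteq> \<beta>"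
    "q y = \<alpha> + N * A" "q (y + 1) = \<beta> + N * B" "inv q \<alpha> = y - N * A" "inv q \<beta> = y + 1 - N * B"
    "inv (q \<circ> aswap y) \<alpha> = inv q \<alpha> + 1" "inv (q \<circ> aswap y) \<beta> = inv q \<beta> - 1"
    "\<And>c. 1 \<le> c \<Longrightarrow> c \<le> N \<Longrightarrow> c \<noteq> \<alpha> \<Longrightarrow> c \<noteq> \<beta> \<Longrightarrow> inv (q \<circ> aswap y) c = inv q c"
    unfolding \<alpha>_def \<beta>_def by (rule step_data[OF b, of y]) blast
  have ba: "\<beta> + 2 \<le> \<alpha>" using c by (simp add: \<alpha>_def \<beta>_def)
  have "inv q \<beta> < inv q \<alpha>" by (rule Grass_mono[OF Box_Grass[OF q]]) (use d ba in auto)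
  then have "N * A < N * B" using d(8,9) by linarith
  then have "A + 1 \<le> B" using N_pos by simp
  then have "N * (A + 1) \<le> N * B" using N_pos by simp
  then show "q y < q (y + 1)" using d(1-4) unfolding d(6,7) by (simp add: distrib_left)
  have G: "q \<circ> aswap y \<in> AffSym" by (intro AffSym_comp Box_AffSym[OF q] AffSym_aswap)
  have b': "aperm (q \<circ> aswap y)" by (rule AffSym_aperm[OF G])
  show "q \<circ> aswap y \<in> Box"
  proof (rule Box_I[OF G])
    fix j assume j: "1 \<le> j" "j < N"
    have g: "inv q (j + 1) - inv q j < N" "inv q j < inv q (j + 1)"
      by (rule Box_gap[OF q j]) (rule Grass_step[OF Box_Grass[OF q] j])
    have 1: "inv (q \<circ> aswap y) (j + 1) = inv q (j + 1) + (if j + 1 = \<alpha> then 1 else 0) - (if j + 1 = \<beta> then 1 else 0)"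
      using d(5,10,11) d(12)[of "j + 1"] j by (cases "j + 1 = \<alpha>"; cases "j + 1 = \<beta>") auto
    have 2: "inv (q \<circ> aswap y) j = inv q j + (if j = \<alpha> then 1 else 0) - (if j = \<beta> then 1 else 0)"
      using d(5,10,11) d(12)[of j] j by (cases "j = \<alpha>"; cases "j = \<beta>") auto
    have "inv (q \<circ> aswap y) (j + 1) - inv (q \<circ> aswap y) j \<le> N" "0 \<le> inv (q \<circ> aswap y) (j + 1) - inv (q \<circ> aswap y) j"
      unfolding 1 2 using g ba by (auto split: if_splits)
    then show "inv (q \<circ> aswap y) (j + 1) - inv (q \<circ> aswap y) j < N" "inv (q \<circ> aswap y) j < inv (q \<circ> aswap y) (j + 1)"
      using inv_gap_neq[OF b', of j] by linarith+
  qed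
qed

definition is_top :: "(int \<Rightarrow> int) \<Rightarrow> bool" where
  "is_top p \<longleftrightarrow> p \<in> Box \<and> (\<forall>j. 1 \<le> j \<and> j < N \<longrightarrow> inv p (j + 1) - inv p j = N - 1)"

text \<open>If no move within the box is possible, the residues of the window decrease by one cyclically at each
step, so all gaps equal n - 1.\<close>

lemma no_up_is_top:
  assumes q: "q \<in> Box" and h: "\<And>y. \<not> wcls (q (y + 1)) + 2 \<le> wcls (q y)"
  shows "is_top q"
proof -
  define v where "v = inv q"
  have b: "aperm q" by (rule Box_aperm[OF q])
  have bv: "aperm v" unfolding v_def by (rule aperm_inv[OF b])
  have C: "int d \<le> N - 1 \<Longrightarrow> N dvd v (N - int d) - (v N + int d)" for d
  proof (induction d rule: less_induct)
    case (less d)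
    show ?case
    proof (cases d)
      case 0
      then show ?thesis by simp
    next
      case (Suc e)
      define j where "j = N - int e"
      have j: "2 \<le> j" "j \<le> N" using Suc less.prems by (auto simp: j_def)
      have e: "N dvd v j - (v N + int e)" unfolding j_def using less.IH[of e] less.prems Suc by simp
      define m where "m = wcls (q (v j + 1))"
      have m: "1 \<le> m" "m \<le> N" using wcls_range by (auto simp: m_def)
      have "wcls (q (v j)) = j" using b j by (simp add: v_def wcls_id)
      then have mj: "j - 1 \<le> m" using h[of "v j"] by (simp add: m_def)
      have "N dvd v (q (v j + 1)) - v m" using wcls_dvd[of "q (v j + 1)"] aperm_dvd_iff[OF bv] by (simp add: m_def)
      then have vm: "N dvd v j + 1 - v m" using b by (simp add: v_def)
      \<comment> \<open>The residue of \<open>v j + 1\<close> cannot sit at a place from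
        \<open>j\<close> on, since those places were assigned other residues in earlier
        steps.\<close>
      have "m < j"
      proof (rule ccontr)
        assume "\<not> m < j"
        then obtain f where f: "m = N - int f" "f \<le> e"
          using m that[of "nat (N - m)"] by (metis j_def diff_add_cancel diff_ge_0_iff_ge le_diff_eq linorder_not_less nat_0_le of_nat_le_iff add.commute diff_diff_eq2 add_diff_cancel_left' nat_int zle_diff1_eq diff_left_mono)
        have "N dvd v m - (v N + int f)" unfolding f(1) using less.IH[of f] less.prems Suc f by simp
        from dvd_add[OF dvd_add[OF vm this] dvd_diff_commute[THEN iffD1, OF e]]
        have "N dvd 1 + int e - int f" by (simp add: algebra_simps)
        then show False using not_dvd_small[of "1 + int e - int f"] f(2) less.prems Suc by simp
      qed
      then have "m = N - int d" using mj Suc by (simp add: j_def)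
      moreover have "N dvd v m - (v N + int d)"
        using dvd_diff[OF e vm] Suc by (simp add: algebra_simps)
      ultimately show ?thesis by simp
    qed
  qed
  have "v (j + 1) - v j = N - 1" if j: "1 \<le> j" "j < N" for j
  proof -
    have 1: "N dvd v j - (v N + (N - j))" using C[of "nat (N - j)"] j by simp
    have 2: "N dvd v (j + 1) - (v N + (N - (j + 1)))" using C[of "nat (N - (j + 1))"] j by simp
    have "N dvd v (j + 1) - v j - (N - 1)"
      using dvd_diff[OF dvd_diff[OF 2 1] dvd_refl] by (simp add: algebra_simps)
    moreover have "0 < v (j + 1) - v j" "v (j + 1) - v j < N"
      using Grass_step[OF Box_Grass[OF q] j] Box_gap[OF q j] by (simp_all add: v_def)
    ultimately show ?thesis by (intro small_eq) auto
  qed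
  then show ?thesis using q by (simp add: is_top_def v_def)
qed

lemma aperm_eqI:
  assumes "aperm p" "aperm q" "\<And>x. 1 \<le> x \<Longrightarrow> x \<le> N \<Longrightarrow> inv p x = inv q x" shows "p = q"
proof -
  have "inv p x = inv q x" for x
  proof -
    have "inv p x - inv p (wcls x) = inv q x - inv q (wcls x)"
      using aperm_cong[OF aperm_inv[OF assms(1)] wcls_dvd] aperm_cong[OF aperm_inv[OF assms(2)] wcls_dvd] by simp
    then show ?thesis using assms(3)[OF wcls_range] by simp
  qed
  then have "inv p = inv q" by blast
  then show ?thesis using aperm_inv_inv assms by metis
qed

lemma drift_window: assumes "aperm v" shows "drift v = (\<Sum>i<n. v (int i + 1) - (int i + 1))"
proof -
  have "aperm (\<lambda>x. x + 1)"
    unfolding aperm_def per_def by (auto intro!: bijI injI surjI[of _ "\<lambda>x. x - 1"])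
  from sum_period[of "\<lambda>x. v x - x", OF _ this]
  have "drift v = (\<Sum>x\<in>{0..<N}. v (x + 1) - (x + 1))"
    using assms by (simp add: drift_def aperm_def per_def)
  also have "\<dots> = (\<Sum>i<n. v (int i + 1) - (int i + 1))"
    by (rule sum.reindex_bij_witness[of _ int nat]) auto
  finally show ?thesis .
qed

text \<open>Equal gaps determine the window up to a constant, and n times this constant is the
  difference of the drifts.\<close>

lemma AffSym_gap_eq:
  assumes "p \<in> AffSym" "q \<in> AffSym" and g: "\<And>j. 1 \<le> j \<Longrightarrow> j < N \<Longrightarrow> inv p (j + 1) - inv p j = inv q (j + 1) - inv q j"
  shows "p = q"
proof -
  have bb: "aperm p" "aperm q" using assms AffSym_aperm by auto
  define c where "c = inv p 1 - inv q 1"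
  have f: "x \<le> N \<longrightarrow> inv p x = inv q x + c" if "1 \<le> x" for x
    using that
  proof (induction x rule: int_ge_induct)
    case (step i)
    then show ?case using g[of i] by auto
  qed (simp add: c_def)
  have "drift (inv p) = (\<Sum>i<n. inv p (int i + 1) - (int i + 1))" by (rule drift_window[OF aperm_inv[OF bb(1)]])
  also have "\<dots> = (\<Sum>i<n. inv q (int i + 1) - (int i + 1) + c)" using f by (intro sum.cong) auto
  also have "\<dots> = drift (inv q) + N * c" using drift_window[OF aperm_inv[OF bb(2)]] by (simp add: sum.distrib)
  finally have "c = 0" using assms bb N_pos by (simp add: drift_inv AffSym_def)
  then show ?thesis using f by (intro aperm_eqI[OF bb]) simp
qed

lemma is_top_unique: assumes "is_top p" "is_top q" shows "p = q"
  by (rule AffSym_gap_eq) (use assms Box_AffSym in \<open>auto simp: is_top_def\<close>)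

lemma Box_ell_bound: assumes "p \<in> Box" shows "ell p \<le> int (card window_pairs) * N"
proof -
  have gap: "b \<le> N \<longrightarrow> inv p b - inv p a \<le> N * (b - a)" if "1 \<le> a" "a \<le> b" for a b
    using that(2)
  proof (induction b rule: int_ge_induct)
    case (step b)
    have "b < N \<longrightarrow> inv p (b + 1) - inv p b < N" using Box_gap[OF assms] step that by simp
    then show ?case using step by (auto simp: algebra_simps)
  qed simp
  have "ell p \<le> (\<Sum>x\<in>window_pairs. N)" unfolding ell_def
  proof (rule sum_mono)
    fix x assume x: "x \<in> window_pairs"
    obtain a b where ab: "x = (a, b)" by (cases x)
    have r: "1 \<le> a" "a < b" "b \<le> N" using x by (auto simp: ab window_pairs_def)
    have "(inv p b - inv p a) div N \<le> (N * (b - a)) div N"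
      using gap[of a b] r N_pos by (intro zdiv_mono1) auto
    also have "\<dots> = b - a" using N_pos by simp
    finally have "(inv p b - inv p a) div N \<le> N" using r by simp
    moreover have "0 \<le> (inv p b - inv p a) div N"
      using Grass_mono[OF Box_Grass[OF assms] r] N_pos by (simp add: pos_imp_zdiv_nonneg_iff)
    ultimately show "(case x of (a, b) \<Rightarrow> \<bar>(inv p b - inv p a) div N\<bar>) \<le> N" by (simp add: ab)
  qed
  then show ?thesis by simp
qed

text \<open>Admissible steps stay in the box and raise a bounded length, so they end where no
  further step is possible, which \<open>no_up_is_top\<close> identifies as the top.\<close>

lemma reach_top:
  assumes "q \<in> Box" "y \<in> letters" "state y = Some q"
  shows "\<exists>x\<in>letters. \<exists>p. is_top p \<and> state (x @ y) = Some p"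
  using assms
proof (induction "nat (int (card window_pairs) * N - ell q)" arbitrary: q y rule: less_induct)
  case less
  show ?case
  proof (cases "\<exists>z. wcls (q (z + 1)) + 2 \<le> wcls (q z)")
    case False
    then have "is_top q" using no_up_is_top[OF less.prems(1)] by blast
    then show ?thesis using less.prems by (intro bexI[of _ "[]"]) auto
  next
    case True
    then obtain z where z: "wcls (q (z + 1)) + 2 \<le> wcls (q z)" by blast
    note up = Box_up[OF less.prems(1) z]
    define i where "i = vtx z"
    have i: "i < n" "N dvd int i - z" using vtx_dvd[of z] by (auto simp: i_def dvd_diff_commute)
    have s: "state (i # y) = Some (q \<circ> aswap z)" using state_Cons[OF less.prems(3) i(2)] up by simp
    have "ell (q \<circ> aswap z) = ell q + 1" by (rule ell_up[OF Box_aperm[OF less.prems(1)] up(1)])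
    moreover have "ell (q \<circ> aswap z) \<le> int (card window_pairs) * N" by (rule Box_ell_bound[OF up(2)])
    ultimately have "nat (int (card window_pairs) * N - ell (q \<circ> aswap z)) < nat (int (card window_pairs) * N - ell q)" by simp
    from less.hyps[OF this up(2) _ s] obtain x p where "x \<in> letters" "is_top p" "state (x @ i # y) = Some p"
      using less.prems i by auto
    then show ?thesis using i by (intro bexI[of _ "x @ [i]"]) auto
  qed
qed

definition Box_words :: "nat list set" where "Box_words = {w \<in> letters. \<exists>p. state w = Some p \<and> p \<in> Box}"

text \<open>Places at distance at least two in the window are never the ends of an edge
  \<open>j\<close>, \<open>j + 1\<close> with \<open>j\<close> in 1..n - 1, as
  \<open>ker_path_D\<close> requires; the pair of places n and 1 is the edge of the letter
  0.\<close>

definition Box_labels :: "(nat \<times> nat) set" where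
  "Box_labels = {(vtx a, vtx b) | a b. 1 \<le> b \<and> b + 2 \<le> a \<and> a \<le> N}"

lemma Box_labels_ker_path: assumes "L \<in> Box_labels" "m \<in> ker_path" shows "sder_cyc L m \<in> ker_path"
proof (rule ker_path_D[OF _ assms(2)])
  fix j assume j: "j \<in> {1..n - 1}"
  obtain a b where L: "L = (vtx a, vtx b)" and ab: "1 \<le> b" "b + 2 \<le> a" "a \<le> N" using assms(1) by (auto simp: Box_labels_def)
  have e: "ecyc n j = (vtx (int j), vtx (int j + 1))" using j n3 vtx_of_nat[of j] vtx_Suc[of j] by (auto simp: ecyc_def)
  have "vtx (int j) = vtx a \<longleftrightarrow> int j = a" "vtx (int j + 1) = vtx b \<longleftrightarrow> int j + 1 = b"
    "vtx (int j) = vtx b \<longleftrightarrow> int j = b" "vtx (int j + 1) = vtx a \<longleftrightarrow> int j + 1 = a"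
  proof -
    have "1 \<le> int j" "int j + 1 \<le> N" using j n3 by auto
    then show "vtx (int j) = vtx a \<longleftrightarrow> int j = a" "vtx (int j + 1) = vtx b \<longleftrightarrow> int j + 1 = b"
      "vtx (int j) = vtx b \<longleftrightarrow> int j = b" "vtx (int j + 1) = vtx a \<longleftrightarrow> int j + 1 = a"
      using ab by (simp_all add: vtx_inj)
  qed
  then have "\<not> (vtx (int j) = vtx a \<and> vtx (int j + 1) = vtx b)" "\<not> (vtx (int j + 1) = vtx a \<and> vtx (int j) = vtx b)"
    using ab by linarith+
  then show "pair_sign L (ecyc n j) = 0" unfolding e L by (intro pair_sign_zero) (simp_all only: swap_simp prod.inject, blast+)
qed

lemma Grass_words_pos:
  assumes "w \<in> Grass_words" "k < length w" "L \<in> Box_labels" shows "0 \<le> pair_sign L (letter_label (ecyc n) (w ! k) (drop (Suc k) w))"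
proof -
  have d: "drop k w = w ! k # drop (Suc k) w" using assms(2) by (simp add: Cons_nth_drop_Suc)
  have "w ! k # drop (Suc k) w \<in> Grass_words" using Grass_words_drop[OF assms(1), of k] d by simp
  then obtain p where p: "w ! k < n" "drop (Suc k) w \<in> letters" "state (w ! k # drop (Suc k) w) = Some p" "Grass p"
    by (auto simp: Grass_words_def simp del: state.simps)
  obtain q where q: "state (drop (Suc k) w) = Some q" "q (int (w ! k)) < q (int (w ! k) + 1)" "p = q \<circ> aswap (int (w ! k))"
    by (rule state_Cons_obtain[OF p(3)])
  have lt: "wcls (q (int (w ! k) + 1)) < wcls (q (int (w ! k)))"
    using Grass_label[OF state_aperm[OF q(1)] Grass_suffix[OF p(3,4) q(1)] q(2)] p(4) q(3) by simp
  obtain a b where L: "L = (vtx a, vtx b)" and ab: "1 \<le> b" "b + 2 \<le> a" "a \<le> N" using assms(3) by (auto simp: Box_labels_def)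
  have "letter_label (ecyc n) (w ! k) (drop (Suc k) w) = (vtx (wcls (q (int (w ! k)))), vtx (wcls (q (int (w ! k) + 1))))"
    unfolding vtx_wcls by (rule letter_label_state[OF p(1,2) q(1)])
  then show ?thesis unfolding L using pair_sign_pos(2)[of b a "wcls (q (int (w ! k) + 1))" "wcls (q (int (w ! k)))"] ab lt wcls_range by simp
qed

lemma Box_words_step: assumes "i # u \<in> Box_words"
  shows "u \<in> Box_words \<and> letter_label (ecyc n) i u \<in> Box_labels \<and> fst (letter_label (ecyc n) i u) \<noteq> snd (letter_label (ecyc n) i u)"
proof -
  obtain p where p: "i < n" "u \<in> letters" "state (i # u) = Some p" "p \<in> Box"
    using assms by (auto simp: Box_words_def simp del: state.simps)
  obtain q where q: "state u = Some q" "q (int i) < q (int i + 1)" "p = q \<circ> aswap (int i)"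
    by (rule state_Cons_obtain[OF p(3)])
  have Gq: "Grass q" by (rule Grass_suffix[OF p(3) Box_Grass[OF p(4)] q(1)])
  note d = Box_down[OF state_AffSym[OF q(1)] q(2) p(4)[unfolded q(3)] Gq]
  have l: "letter_label (ecyc n) i u = (vtx (wcls (q (int i))), vtx (wcls (q (int i + 1))))"
    unfolding vtx_wcls by (rule letter_label_state[OF p(1,2) q(1)])
  have "letter_label (ecyc n) i u \<in> Box_labels" unfolding l Box_labels_def using d(2) wcls_range by blast
  moreover have "vtx (wcls (q (int i))) \<noteq> vtx (wcls (q (int i + 1)))"
    using d(2) vtx_inj[OF wcls_range wcls_range, of "q (int i)" "q (int i + 1)"] by simp
  moreover have "u \<in> Box_words" using p q d(1) by (auto simp: Box_words_def)
  ultimately show ?thesis using l by simp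
qed

text \<open>Otherwise \<open>chain\<close> would put 1 plus a cone element into
  \<open>ker_path\<close>. Its constant term is at least one, while all constant terms in
  \<open>ker_path\<close> are zero.\<close>

lemma Box_notin_ker_path: assumes "w \<in> letters" "state w = Some p" "p \<in> Box" shows "fa_word w \<notin> ker_path"
proof
  assume h: "fa_word w \<in> ker_path"
  have QBG: "Box_words \<subseteq> Grass_words" using Box_Grass by (auto simp: Box_words_def Grass_words_def)
  have w: "w \<in> Box_words" using assms by (auto simp: Box_words_def)
  have rem: "fa_word (take k w @ drop (Suc k) w) \<in> cone Grass_words ker_path" if "w \<in> Grass_words" for w k
    using that by (intro cone_all) (auto simp: Grass_words_def dest: in_set_takeD in_set_dropD)
  have "0 \<in> cone Grass_words ker_path" by (intro cone.base fa.subspace_0[OF ker_path_subspace])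
  from chain[OF ker_path_subspace Grass_words_pos rem Box_labels_ker_path QBG Box_words_step w this]
  obtain Ls y where Ls: "Ls \<in> lists Box_labels" and y: "y \<in> cone Grass_words ker_path" "sder_chain (ecyc n) Ls (fa_word w + 0) = fa_word [] + y" by blast
  have "sder_chain (ecyc n) Ls x \<in> ker_path" if "x \<in> ker_path" for x
    using Ls that by (induction Ls arbitrary: x) (auto intro: Box_labels_ker_path)
  from this[OF h] have "fa_word [] + y \<in> ker_path" unfolding y(2)[symmetric] by simp
  then have "(fa_word [] + y) [] = 0" by (rule ker_path_Nil)
  moreover have "0 \<le> y []" using cone_Nil[of ker_path y Grass_words] ker_path_Nil y(1) by blast
  ultimately show False by (simp add: pw_simps fa_word_def)
qed

end

lemma subspace_cancel: "fa.subspace S \<Longrightarrow> x + y \<in> S \<Longrightarrow> y \<in> S \<Longrightarrow> x \<in> S"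
  using fa.subspace_diff[of S "x + y" y] by simp

section \<open>Independence of the finite factor\<close>

context cyc
begin

text \<open>\<open>state\<close> without the test for reducedness, compatible with concatenation of
  arbitrary words.\<close>

fun word_perm :: "nat list \<Rightarrow> int \<Rightarrow> int" where
  "word_perm [] = id"
| "word_perm (i # w) = word_perm w \<circ> aswap (int i)"

lemma word_perm_append: "word_perm (x @ y) = word_perm y \<circ> word_perm x"
  by (induction x) (auto simp: comp_assoc simp del: o_apply id_apply)

lemma state_word_perm: "state w = Some p \<Longrightarrow> p = word_perm w"
proof (induction w arbitrary: p)
  case (Cons i w)
  obtain q where q: "state w = Some q" "p = q \<circ> aswap (int i)" using state_Cons_obtain[OF Cons.prems] by metis
  then show ?case using Cons.IH[OF q(1)] by (simp del: o_apply)
qed simp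

lemma word_perm_aperm: "aperm (word_perm w)" by (induction w) (auto intro: aperm_comp simp del: id_apply o_apply)

lemma FinSym_inv_range: "t \<in> path_lists \<Longrightarrow> state t = Some q \<Longrightarrow> 1 \<le> x \<Longrightarrow> x \<le> N \<Longrightarrow> 1 \<le> inv q x \<and> inv q x \<le> N"
proof (induction t arbitrary: q x)
  case Nil
  then show ?case by (auto simp: inv_id[unfolded id_def])
next
  case (Cons i t)
  obtain q' where q: "state t = Some q'" "q = q' \<circ> aswap (int i)" using state_Cons_obtain[OF Cons.prems(2)] by metis
  have i: "1 \<le> int i" "int i \<le> N - 1" using Cons.prems(1) by auto
  have r: "1 \<le> inv q' x" "inv q' x \<le> N" using Cons.IH[OF _ q(1) Cons.prems(3,4)] Cons.prems(1) by auto
  have "1 \<le> aswap (int i) (inv q' x) \<and> aswap (int i) (inv q' x) \<le> N" using aswap_fin[OF i r] r i by auto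
  then show ?case unfolding q(2) aperm_inv_aswap[OF state_aperm[OF q(1)]] by simp
qed

definition path_red :: "nat list set" where "path_red = {w \<in> path_lists. \<exists>q. state w = Some q}"

definition path_labels :: "(nat \<times> nat) set" where
  "path_labels = {(vtx a, vtx b) | a b. 1 \<le> a \<and> a < b \<and> b \<le> N}"

lemma path_red_step: assumes "i # u \<in> path_red"
  shows "u \<in> path_red \<and> letter_label (ecyc n) i u \<in> path_labels \<and> fst (letter_label (ecyc n) i u) \<noteq> snd (letter_label (ecyc n) i u)"
proof -
  obtain p where p: "i \<in> {1..n - 1}" "u \<in> path_lists" "state (i # u) = Some p" using assms by (auto simp: path_red_def simp del: state.simps)
  obtain q where q: "state u = Some q" "q (int i) < q (int i + 1)"
    using state_Cons_obtain[OF p(3)] by metis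
  have i: "i < n" "1 \<le> int i" "int i + 1 \<le> N" using p(1) n3 by auto
  have r: "1 \<le> q (int i)" "q (int i + 1) \<le> N" using FinSym_range[OF p(2) q(1)] i by auto
  have l: "letter_label (ecyc n) i u = (vtx (q (int i)), vtx (q (int i + 1)))"
    by (rule letter_label_state[OF i(1) path_lists_letters[OF p(2)] q(1)])
  have "letter_label (ecyc n) i u \<in> path_labels" unfolding l path_labels_def using r q(2) by blast
  moreover have "vtx (q (int i)) \<noteq> vtx (q (int i + 1))" using vtx_inj[of "q (int i)" "q (int i + 1)"] r q(2) by simp
  ultimately show ?thesis using p q l by (auto simp: path_red_def)
qed

lemma path_red_drop: "w \<in> path_red \<Longrightarrow> drop k w \<in> path_red"
proof (induction w arbitrary: k)
  case (Cons i u)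
  then show ?case using path_red_step[OF Cons.prems] by (cases k) auto
qed simp

lemma path_red_pos:
  assumes "w \<in> path_red" "k < length w" "L \<in> path_labels" shows "0 \<le> pair_sign L (letter_label (ecyc n) (w ! k) (drop (Suc k) w))"
proof -
  have "drop k w = w ! k # drop (Suc k) w" using assms(2) by (simp add: Cons_nth_drop_Suc)
  then have "w ! k # drop (Suc k) w \<in> path_red" using path_red_drop[OF assms(1), of k] by simp
  then have "letter_label (ecyc n) (w ! k) (drop (Suc k) w) \<in> path_labels" using path_red_step by blast
  then obtain c d where l: "letter_label (ecyc n) (w ! k) (drop (Suc k) w) = (vtx c, vtx d)" and cd: "1 \<le> c" "c < d" "d \<le> N"
    unfolding path_labels_def by blast
  obtain a b where L: "L = (vtx a, vtx b)" and ab: "1 \<le> a" "a < b" "b \<le> N" using assms(3) unfolding path_labels_def by blast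
  show ?thesis unfolding l L by (rule pair_sign_pos(1)[OF ab cd])
qed

lemma cone_path: assumes "w \<in> path_lists" shows "fa_word w \<in> cone path_red K"
proof (cases "state w")
  case None
  then show ?thesis using state_None_nil[OF path_lists_letters[OF assms]] nil_kernel by (intro cone.base) auto
next
  case (Some p)
  then show ?thesis using assms by (intro cone_word[OF K_subspace]) (auto simp: path_red_def)
qed

definition path_span :: "nat \<Rightarrow> nat fa set" where "path_span m = fa.span (fa_word ` {t \<in> path_lists. length t = m})"
text \<open>A filtration by the length of a tail in the letters 1..n - 1. A derivation shortens the
  tail by at most one letter, and not at all when it deletes a letter in front.\<close>

definition path_tail :: "nat \<Rightarrow> nat fa set" where
  "path_tail r = fa.span {fa_word (a @ t) | a t. a \<in> letters \<and> t \<in> path_lists \<and> r \<le> length t}"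

lemma path_span_subspace: "fa.subspace (path_span m)" by (simp add: path_span_def)
lemma path_tail_subspace: "fa.subspace (path_tail m)" by (simp add: path_tail_def)
lemma path_span_word: "t \<in> path_lists \<Longrightarrow> length t = m \<Longrightarrow> fa_word t \<in> path_span m"
  unfolding path_span_def by (rule fa.span_base) auto
lemma path_tail_word: "a \<in> letters \<Longrightarrow> t \<in> path_lists \<Longrightarrow> r \<le> length t \<Longrightarrow> fa_word (a @ t) \<in> path_tail r"
  unfolding path_tail_def by (rule fa.span_base) auto

lemma sder_word_path_span: assumes "t \<in> path_lists" "length t = Suc m" shows "sder_word (ecyc n) f L t \<in> path_span m"
  unfolding sder_word_sum
  by (intro fa.subspace_sum[OF path_span_subspace] fa.subspace_scale[OF path_span_subspace] path_span_word)
    (use assms in \<open>auto dest: in_set_takeD in_set_dropD\<close>)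

lemma sder_cyc_path_span: assumes "y \<in> path_span (Suc m)" shows "sder_cyc L y \<in> path_span m"
proof (rule fa_linear_span[OF sder_linear path_span_subspace _ assms[unfolded path_span_def]])
  fix x assume "x \<in> fa_word ` {t \<in> path_lists. length t = Suc m}"
  then obtain t where "x = fa_word t" "t \<in> path_lists" "length t = Suc m" by blast
  then show "sder_cyc L x \<in> path_span m" using sder_word_path_span by simp
qed

lemma rm_path_tail: assumes "x \<in> wspan {0..<n}" "t \<in> path_lists" "r \<le> length t" shows "rm t x \<in> path_tail r"
  by (rule wspan_lift[OF rm_linear path_tail_subspace _ assms(1)]) (use assms path_tail_word in auto)

lemma lm_path_tail: assumes "a \<in> letters" "y \<in> path_span m" shows "lm a y \<in> path_tail m"
proof (rule fa_linear_span[OF lm_linear path_tail_subspace _ assms(2)[unfolded path_span_def]])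
  fix x assume "x \<in> fa_word ` {t \<in> path_lists. length t = m}"
  then obtain t where x: "x = fa_word t" "t \<in> path_lists" "length t = m" by blast
  show "lm a x \<in> path_tail m" unfolding x(1) lm_word using x by (intro path_tail_word[OF assms(1)]) auto
qed

lemma sder_cyc_path_tail: assumes "y \<in> path_tail (Suc r)" shows "sder_cyc L y \<in> path_tail r"
proof (rule fa_linear_span[OF sder_linear path_tail_subspace _ assms[unfolded path_tail_def]])
  fix x assume "x \<in> {fa_word (a @ t) | a t. a \<in> letters \<and> t \<in> path_lists \<and> Suc r \<le> length t}"
  then obtain a t where x: "x = fa_word (a @ t)" "a \<in> letters" "t \<in> path_lists" "Suc r \<le> length t" by blast
  then obtain m where m: "length t = Suc m" by (cases t) auto
  have "rm t (sder_word (ecyc n) f L a) \<in> path_tail r" for f using x by (intro rm_path_tail sder_word_wspan) auto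
  moreover have "lm a (sder_word (ecyc n) id L t) \<in> path_tail r"
  proof -
    have "lm a (sder_word (ecyc n) id L t) \<in> path_tail m" using sder_word_path_span[OF x(3) m] x by (intro lm_path_tail) auto
    moreover have "r \<le> m" using m x by simp
    then have "path_tail m \<subseteq> path_tail r" unfolding path_tail_def by (intro fa.span_mono) (use le_trans in blast)
    ultimately show ?thesis by blast
  qed
  ultimately show "sder_cyc L x \<in> path_tail r" unfolding x(1) sder_word sder_word_append by (intro fa.subspace_add[OF path_tail_subspace])
qed

lemma sder_chain_path_tail: "y \<in> path_tail (r + length Ls) \<Longrightarrow> sder_chain (ecyc n) Ls y \<in> path_tail r"
  by (induction Ls arbitrary: y) (auto intro: sder_cyc_path_tail)

lemma sder_cyc_lm: assumes "a \<in> letters" "y \<in> path_span m" shows "sder_cyc L (lm a y) - lm a (sder_cyc L y) \<in> path_tail m"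
proof (rule fa_linear_span[OF _ path_tail_subspace _ assms(2)[unfolded path_span_def]])
  show "fa_linear (\<lambda>y. sder_cyc L (lm a y) - lm a (sder_cyc L y))"
    by (rule fa_linear_minus[OF fa_linear_comp[OF sder_linear lm_linear] fa_linear_comp[OF lm_linear sder_linear]])
  fix x assume "x \<in> fa_word ` {t \<in> path_lists. length t = m}"
  then obtain t where x: "x = fa_word t" "t \<in> path_lists" "length t = m" by auto
  have "rm t (sder_word (ecyc n) f L a) \<in> path_tail m" for f using x assms by (intro rm_path_tail sder_word_wspan) auto
  then show "sder_cyc L (lm a x) - lm a (sder_cyc L x) \<in> path_tail m" unfolding x(1) lm_word sder_word sder_word_append by simp
qed

text \<open>The tail exceeds \<open>r\<close> by the number of derivations, so deleting even one
  letter of \<open>a\<close> leaves more than \<open>r\<close> letters in it. Only the terms that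
  spend every derivation on the tail remain.\<close>

lemma sder_chain_lm:
  assumes "a \<in> letters"
  shows "y \<in> path_span (r + length Ls) \<Longrightarrow> sder_chain (ecyc n) Ls (lm a y) - lm a (sder_chain (ecyc n) Ls y) \<in> path_tail (Suc r)"
proof (induction Ls arbitrary: y)
  case Nil
  then show ?case by (simp add: fa.subspace_0[OF path_tail_subspace])
next
  case (Cons L Ls)
  have 1: "sder_cyc L y \<in> path_span (r + length Ls)" using Cons.prems by (intro sder_cyc_path_span) simp
  have "sder_cyc L (lm a y) - lm a (sder_cyc L y) \<in> path_tail (Suc r + length Ls)" using sder_cyc_lm[OF assms Cons.prems] by simp
  from sder_chain_path_tail[OF this] have "sder_chain (ecyc n) Ls (sder_cyc L (lm a y)) - sder_chain (ecyc n) Ls (lm a (sder_cyc L y)) \<in> path_tail (Suc r)"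
    by (simp add: lin_simps[OF sder_chain_linear])
  from fa.subspace_add[OF path_tail_subspace this Cons.IH[OF 1]] show ?case by simp
qed

lemma path_tail_ker_path: "path_tail 1 \<subseteq> ker_path"
  unfolding path_tail_def
proof (rule fa.span_minimal[OF _ ker_path_subspace], rule subsetI)
  fix x assume "x \<in> {fa_word (a @ t) | a t. a \<in> letters \<and> t \<in> path_lists \<and> 1 \<le> length t}"
  then obtain a t where x: "x = fa_word (a @ t)" "a \<in> letters" "t \<in> path_lists" "t \<noteq> []" by fastforce
  then have e: "a @ t = (a @ butlast t) @ [last t]" by simp
  have "last t \<in> {1..n - 1}" "butlast t \<in> letters"
    using x path_lists_letters[OF x(3)] last_in_set[OF x(4)] by (auto simp: in_lists_conv_set dest: in_set_butlastD)
  then show "x \<in> ker_path" unfolding x(1) e using x(2) by (intro path_end_ker_path) auto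
qed

text \<open>\<open>C\<close> is the value of the chain on \<open>t\<close> alone: 1 plus the
  constant term of a cone element, hence at least 1. The error of \<open>sder_chain_lm\<close> with
  \<open>r\<close> equal to 0 has a nonempty tail and lies in \<open>ker_path\<close>.\<close>

lemma strip:
  assumes "t \<in> path_red"
  obtains Ls C where "C \<noteq> 0" "\<And>a. a \<in> letters \<Longrightarrow> sder_chain (ecyc n) Ls (fa_word (a @ t)) - fa_scale C (fa_word a) \<in> ker_path"
proof -
  have tau_pair: "t \<in> path_lists" using assms by (simp add: path_red_def)
  have rem: "fa_word (take k w @ drop (Suc k) w) \<in> cone path_red K" if "w \<in> path_red" for w k
    using that by (intro cone_path) (auto simp: path_red_def dest: in_set_takeD in_set_dropD)
  have "0 \<in> cone path_red K" by (intro cone.base fa.subspace_0[OF K_subspace])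
  from chain[OF K_subspace path_red_pos rem sder_cyc_K order_refl path_red_step assms this]
  obtain Ls y where Ls: "length Ls = length t" and y: "y \<in> cone path_red K" "sder_chain (ecyc n) Ls (fa_word t + 0) = fa_word [] + y"
    by blast
  have tP: "fa_word t \<in> path_span (0 + length Ls)" using tau_pair Ls by (intro path_span_word) auto
  have "z \<in> path_span (m + length Ls) \<Longrightarrow> sder_chain (ecyc n) Ls z \<in> path_span m" for z m
    by (induction Ls arbitrary: z) (auto intro: sder_cyc_path_span)
  from this[OF tP] have "sder_chain (ecyc n) Ls (fa_word t) \<in> fa.span {fa_word []}"
  proof -
    have "{t \<in> path_lists. length t = 0} = {[]}" by auto
    then show ?thesis using \<open>sder_chain (ecyc n) Ls (fa_word t) \<in> path_span 0\<close> by (simp only: path_span_def image_insert image_empty)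
  qed
  then obtain C where C: "sder_chain (ecyc n) Ls (fa_word t) = fa_scale C (fa_word [])"
    by (auto simp: fa.span_singleton)
  have "C = (fa_word [] + y) []" using y(2) C by (simp add: pw_simps fa_word_def)
  then have "C \<noteq> 0" using cone_Nil[of K y path_red] K_Nil y(1) by (simp add: pw_simps fa_word_def)
  moreover have "sder_chain (ecyc n) Ls (fa_word (a @ t)) - fa_scale C (fa_word a) \<in> ker_path" if "a \<in> letters" for a
    using sder_chain_lm[OF that tP] path_tail_ker_path unfolding C by (auto simp: lrm_simps)
  ultimately show ?thesis by (rule that)
qed

lemma strip_sum:
  assumes t: "t \<in> path_red" and S: "\<And>g. g \<in> S \<Longrightarrow> a g \<in> letters"
    and x: "(\<Sum>g\<in>S. fa_scale (c g) (fa_word (a g @ t))) \<in> K"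
  shows "(\<Sum>g\<in>S. fa_scale (c g) (fa_word (a g))) \<in> ker_path"
proof -
  obtain Ls C where C: "C \<noteq> 0" and e: "\<And>a. a \<in> letters \<Longrightarrow> sder_chain (ecyc n) Ls (fa_word (a @ t)) - fa_scale C (fa_word a) \<in> ker_path"
    by (rule strip[OF t]) blast
  have "z \<in> K \<Longrightarrow> sder_chain (ecyc n) Ls z \<in> K" for z by (induction Ls arbitrary: z) (auto intro: sder_cyc_K)
  from K_ker_path[OF this[OF x]] have 1: "(\<Sum>g\<in>S. fa_scale (c g) (sder_chain (ecyc n) Ls (fa_word (a g @ t)))) \<in> ker_path"
    by (simp add: lin_simps[OF sder_chain_linear])
  have 2: "(\<Sum>g\<in>S. fa_scale (c g) (sder_chain (ecyc n) Ls (fa_word (a g @ t)) - fa_scale C (fa_word (a g)))) \<in> ker_path"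
    using S by (intro fa.subspace_sum[OF ker_path_subspace] fa.subspace_scale[OF ker_path_subspace] e)
  have "(\<Sum>g\<in>S. fa_scale (c g) (sder_chain (ecyc n) Ls (fa_word (a g @ t))))
     - (\<Sum>g\<in>S. fa_scale (c g) (sder_chain (ecyc n) Ls (fa_word (a g @ t)) - fa_scale C (fa_word (a g))))
     = fa_scale C (\<Sum>g\<in>S. fa_scale (c g) (fa_word (a g)))"
    by (simp add: sum_subtractf[symmetric] fa.scale_sum_right fa.scale_right_diff_distrib mult.commute)
  then have "fa_scale C (\<Sum>g\<in>S. fa_scale (c g) (fa_word (a g))) \<in> ker_path"
    using fa.subspace_diff[OF ker_path_subspace 1 2] by simp
  from fa.subspace_scale[OF ker_path_subspace this, of "inverse C"] show ?thesis using C by simp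
qed

lemma ker_path_lm: assumes "x \<in> ker_path" "u \<in> letters" shows "lm u x \<in> ker_path"
proof (rule fa_linear_span[OF lm_linear ker_path_subspace _ assms(1)[unfolded ker_path_def]])
  fix x assume "x \<in> K \<union> path_end"
  then show "lm u x \<in> ker_path"
  proof
    assume "x \<in> K" then show ?thesis using K_lm K_ker_path assms by blast
  next
    assume "x \<in> path_end"
    then obtain w j where x: "x = fa_word (w @ [j])" "w \<in> letters" "j \<in> {1..n - 1}" by (auto simp: path_end_def)
    have "fa_word ((u @ w) @ [j]) \<in> ker_path" using x assms by (intro path_end_ker_path) auto
    then show ?thesis using x by simp
  qed
qed

text \<open>The word of a Grassmannian permutation with a gap above n occurs, up to congruence, in a
  multiple of the k-th relation whose other words can be given endings in 1..n - 1.\<close>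

lemma nonBX_ker_path:
  assumes w: "w \<in> letters" "state w = Some p" and h: "p \<notin> Box" shows "fa_word w \<in> ker_path"
proof (cases "Grass p")
  case False
  then show ?thesis using nonGr_ker_path w by blast
next
  case True
  have G: "p \<in> AffSym" by (rule state_AffSym[OF w(2)])
  then obtain k where k: "k \<in> {1..n - 1}" "N \<le> inv p (int k + 1) - inv p (int k)"
    using True h unfolding Box_def Grass_def by (auto simp: not_less)
  have kn: "1 \<le> k" "k < n" using k n3 by auto
  let ?I = "(\<lambda>z. vtx (int z + int k)) ` {1..k}"
  obtain x where IS: "?I \<in> Sub k" and x: "x \<in> letters" "state (x @ trl_word k ?I) = Some p"
    using nonbox_factor[OF kn G _ k(2)] True unfolding Grass_def by blast
  have rest: "fa_word (x @ trl_word k I) \<in> ker_path" if "I \<in> Sub k - {?I}" for I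
  proof -
    have I: "I \<in> Sub k" "I \<noteq> ?I" using that by auto
    obtain j where j: "j \<in> {1..n - 1}" "inv (trl k I) (int j + 1) < inv (trl k I) (int j)"
      using trl_descent[OF kn I] by blast
    then have "\<not> Grass (trl k I)" unfolding Grass_def by (meson order_less_asym)
    then have "fa_word (trl_word k I) \<in> ker_path" using nonGr_ker_path trl_word_props[OF kn I(1)] by blast
    then show ?thesis using ker_path_lm[OF _ x(1)] by fastforce
  qed
  have "lm x (trl_rel k) \<in> ker_path" using K_ker_path[OF K_lm[OF trl_rel_kernel[OF kn] x(1)]] .
  moreover have "lm x (trl_rel k) = (\<Sum>I\<in>Sub k. fa_word (x @ trl_word k I))" by (simp add: trl_rel_def lrm_simps)
  moreover have "\<dots> = fa_word (x @ trl_word k ?I) + (\<Sum>I\<in>Sub k - {?I}. fa_word (x @ trl_word k I))"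
    by (rule sum.remove[OF finite_Sub IS])
  moreover have "(\<Sum>I\<in>Sub k - {?I}. fa_word (x @ trl_word k I)) \<in> ker_path"
    by (rule fa.subspace_sum[OF ker_path_subspace rest])
  ultimately have "fa_word (x @ trl_word k ?I) \<in> ker_path"
    using fa.subspace_diff[OF ker_path_subspace] by (metis add_diff_cancel_right')
  moreover have "wcong w (x @ trl_word k ?I)"
    using state_eq_wcong[OF w(1) _ w(2) x(2)] x(1) trl_word_props(1)[OF kn IS] by auto
  ultimately show ?thesis using ker_path_wcong by blast
qed

text \<open>Take a shortest \<open>g0\<close> with nonzero coefficient and multiply on the left by
  the word \<open>z\<close> that leads from it to the top. If \<open>z\<close> times another element
  \<open>h\<close> stays in the box, it still reaches the same top; the length leaves no room for
  further letters, so \<open>h = g0\<close>. Products outside the box vanish in the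
  quotient.\<close>

lemma box_independent:
  assumes S: "finite S" "S \<subseteq> Box" and x: "(\<Sum>g\<in>S. fa_scale (c g) (fa_word (red_word g))) \<in> ker_path" and g: "g \<in> S"
  shows "c g = 0"
proof (rule ccontr)
  assume cg: "c g \<noteq> 0"
  let ?P = "\<lambda>g. g \<in> S \<and> c g \<noteq> 0"
  have "\<exists>g. ?P g \<and> (\<forall>h. ?P h \<longrightarrow> nat (ell g) \<le> nat (ell h))"
    by (rule ex_has_least_nat[of ?P g]) (use g cg in auto)
  then obtain g0 where g0: "g0 \<in> S" "c g0 \<noteq> 0" and mn: "\<And>h. ?P h \<Longrightarrow> nat (ell g0) \<le> nat (ell h)" by blast
  have BG: "h \<in> AffSym" if "h \<in> S" for h using that S Box_AffSym by blast
  obtain z p where z: "z \<in> letters" and p: "is_top p" "state (z @ red_word g0) = Some p"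
    using reach_top[OF _ red_word[OF BG[OF g0(1)]]] g0(1) S by blast
  have pl: "ell p = int (length z) + ell g0" using state_ell[OF p(2)] state_ell[OF red_word(2)[OF BG[OF g0(1)]]] by simp
  have other: "fa_scale (c h) (fa_word (z @ red_word h)) \<in> ker_path" if h: "h \<in> S - {g0}" for h
  proof (cases "c h = 0")
    case True
    then show ?thesis by (simp add: fa.subspace_0[OF ker_path_subspace])
  next
    case False
    have zl: "z @ red_word h \<in> letters" using z red_word(1)[OF BG] h by auto
    have "fa_word (z @ red_word h) \<in> ker_path"
    proof (cases "state (z @ red_word h)")
      case None
      then show ?thesis using nil_ker_path state_None_nil zl by blast
    next
      case (Some p')
      show ?thesis
      proof (cases "p' \<in> Box")
        case True
        obtain z' p'' where z': "is_top p''" "state (z' @ z @ red_word h) = Some p''" using reach_top[OF True zl Some] by blast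
        have pp: "p'' = p" by (rule is_top_unique[OF z'(1) p(1)])
        have "nat (ell g0) \<le> nat (ell h)" using mn h False by blast
        then have "ell g0 \<le> ell h" using ell_nonneg[of h] by linarith
        moreover have "ell h = int (length (red_word h))" using state_ell[OF red_word(2)[OF BG]] h by blast
        moreover have "ell p = int (length (z' @ z @ red_word h))" using state_ell[OF z'(2)] pp by simp
        ultimately have "z' = []" using pl by simp
        then have "state (z @ red_word h) = Some p" using z'(2) pp by (simp only: append_Nil)
        then have "word_perm (z @ red_word h) = word_perm (z @ red_word g0)" using state_word_perm[OF p(2)] state_word_perm[of "z @ red_word h" p] by simp
        moreover have "word_perm (red_word h) = h" "word_perm (red_word g0) = g0"
          using state_word_perm[OF red_word(2)[OF BG[of h]]] state_word_perm[OF red_word(2)[OF BG[OF g0(1)]]] h by simp_all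
        ultimately have e: "h \<circ> word_perm z = g0 \<circ> word_perm z" by (simp only: word_perm_append)
        have "h y = g0 y" for y using fun_cong[OF e, of "inv (word_perm z) y"] word_perm_aperm by simp
        then show ?thesis using h by auto
      next
        case False
        then show ?thesis using nonBX_ker_path zl Some by blast
      qed
    qed
    then show ?thesis by (rule fa.subspace_scale[OF ker_path_subspace])
  qed
  have "lm z (\<Sum>g\<in>S. fa_scale (c g) (fa_word (red_word g))) \<in> ker_path" by (rule ker_path_lm[OF x z])
  then have "(\<Sum>g\<in>S. fa_scale (c g) (fa_word (z @ red_word g))) \<in> ker_path" by (simp add: lrm_simps)
  then have "fa_scale (c g0) (fa_word (z @ red_word g0)) + (\<Sum>g\<in>S - {g0}. fa_scale (c g) (fa_word (z @ red_word g))) \<in> ker_path"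
    by (subst (asm) sum.remove[OF S(1) g0(1)])
  moreover have "(\<Sum>g\<in>S - {g0}. fa_scale (c g) (fa_word (z @ red_word g))) \<in> ker_path"
    by (rule fa.subspace_sum[OF ker_path_subspace other])
  ultimately have "fa_scale (c g0) (fa_word (z @ red_word g0)) \<in> ker_path" by (rule subspace_cancel[OF ker_path_subspace])
  from fa.subspace_scale[OF ker_path_subspace this, of "inverse (c g0)"] have "fa_word (z @ red_word g0) \<in> ker_path" using g0 by simp
  moreover have "z @ red_word g0 \<in> letters" using z red_word(1)[OF BG[OF g0(1)]] by auto
  ultimately show False using Box_notin_ker_path p by (simp add: is_top_def)
qed

text \<open>The n strictly decreasing values in 1..n leave no choice.\<close>

lemma FinSym_w0:
  assumes t: "t \<in> path_lists" "state t = Some u" and d: "\<And>j. j \<in> {1..n - 1} \<Longrightarrow> inv u (int j + 1) < inv u (int j)"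
    and x: "1 \<le> x" "x \<le> N"
  shows "inv u x = N + 1 - x"
proof -
  have d': "inv u (j + 1) < inv u j" if "1 \<le> j" "j < N" for j
    using d[of "nat j"] that by (auto simp: nat_le_iff of_nat_diff le_nat_iff)
  have r: "1 \<le> inv u y \<and> inv u y \<le> N" if "1 \<le> y" "y \<le> N" for y using FinSym_inv_range[OF t that] .
  have up: "y \<le> N \<longrightarrow> inv u y \<le> N + 1 - y" if "1 \<le> y" for y
    using that
  proof (induction y rule: int_ge_induct)
    case base
    then show ?case using r[of 1] N_pos by simp
  next
    case (step y)
    then show ?case using d'[of y] by fastforce
  qed
  have dn: "1 \<le> y \<longrightarrow> N + 1 - y \<le> inv u y" if "y \<le> N" for y
    using that
  proof (induction y rule: int_le_induct)
    case base
    then show ?case using r[of N] N_pos by simp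
  next
    case (step y)
    then show ?case using d'[of "y - 1"] by fastforce
  qed
  show ?thesis using up[of x] dn[of x] x by simp
qed

definition is_longest :: "(int \<Rightarrow> int) \<Rightarrow> bool" where
  "is_longest p \<longleftrightarrow> aperm p \<and> (\<forall>x. 1 \<le> x \<and> x \<le> N \<longrightarrow> inv p x = N + 1 - x)"

lemma is_longest_unique: "is_longest p \<Longrightarrow> is_longest q \<Longrightarrow> p = q"
  by (rule aperm_eqI) (auto simp: is_longest_def)

lemma FinSym_ell_bound: assumes "t \<in> path_lists" "state t = Some u" shows "ell u \<le> int (card window_pairs)"
proof -
  have "ell u \<le> (\<Sum>x\<in>window_pairs. 1)" unfolding ell_def
  proof (rule sum_mono)
    fix x assume x: "x \<in> window_pairs"
    obtain a b where ab: "x = (a, b)" by (cases x)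
    have r: "1 \<le> a" "a < b" "b \<le> N" using x by (auto simp: ab window_pairs_def)
    define d where "d = inv u b - inv u a"
    have "- N < d" "d < N" unfolding d_def using FinSym_inv_range[OF assms, of a] FinSym_inv_range[OF assms, of b] r by auto
    then have "d div N = 0 \<or> (d + N) div N = 0"
      by (cases "0 \<le> d") (auto simp: div_pos_pos_trivial)
    then have "\<bar>d div N\<bar> \<le> 1" using N_pos by auto
    then show "(case x of (a, b) \<Rightarrow> \<bar>(inv u b - inv u a) div N\<bar>) \<le> 1" by (simp add: ab d_def)
  qed
  then show ?thesis by simp
qed

lemma reach_w0:
  assumes "t \<in> path_lists" "state t = Some u"
  shows "\<exists>t'\<in>path_lists. \<exists>p. is_longest p \<and> state (t @ t') = Some p"
  using assms
proof (induction "nat (int (card window_pairs) - ell u)" arbitrary: t u rule: less_induct)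
  case less
  have b: "aperm u" by (rule state_aperm[OF less.prems(2)])
  show ?case
  proof (cases "\<exists>j\<in>{1..n - 1}. inv u (int j) < inv u (int j + 1)")
    case False
    have "inv u (int j) \<noteq> inv u (int j + 1)" for j using aperm_inj[OF aperm_inv[OF b]] by simp
    then have "\<And>j. j \<in> {1..n - 1} \<Longrightarrow> inv u (int j + 1) < inv u (int j)" using False by (meson linorder_neqE)
    from FinSym_w0[OF less.prems this] have "is_longest u" using b by (simp add: is_longest_def)
    then show ?thesis using less.prems by (intro bexI[of _ "[]"]) auto
  next
    case True
    then obtain j where j: "j \<in> {1..n - 1}" "inv u (int j) < inv u (int j + 1)" by blast
    have s: "state (t @ [j]) = Some (aswap (int j) \<circ> u)" using state_snoc(1)[OF less.prems(2)] j by simp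
    have tj: "t @ [j] \<in> path_lists" using less.prems j by auto
    have "ell (aswap (int j) \<circ> u) = ell u + 1" using state_ell[OF s] state_ell[OF less.prems(2)] by simp
    moreover have "ell (aswap (int j) \<circ> u) \<le> int (card window_pairs)" by (rule FinSym_ell_bound[OF tj s])
    ultimately have "nat (int (card window_pairs) - ell (aswap (int j) \<circ> u)) < nat (int (card window_pairs) - ell u)" by simp
    from less.hyps[OF this tj s] obtain t' p where "t' \<in> path_lists" "is_longest p" "state (t @ j # t') = Some p" by auto
    then show ?thesis using j by (intro bexI[of _ "j # t'"]) auto
  qed
qed

text \<open>Take a shortest finite factor \<open>u0\<close> with nonzero coefficient and multiply on
  the right by \<open>t\<close> up to the longest element. Every other finite factor that occurs
  then yields a non-reduced word. The remaining summands share the longest element, which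
  \<open>strip_sum\<close> removes, and \<open>box_independent\<close> applies.\<close>

theorem basis_independent:
  assumes S: "finite S" "S \<subseteq> Box \<times> FinSym"
    and x: "(\<Sum>(g, u)\<in>S. fa_scale (c (g, u)) (fa_word (red_word g @ path_word u))) \<in> K" and s: "s \<in> S"
  shows "c s = 0"
proof (rule ccontr)
  assume cs: "c s \<noteq> 0"
  let ?P = "\<lambda>s. s \<in> S \<and> c s \<noteq> 0"
  have "\<exists>s. ?P s \<and> (\<forall>h. ?P h \<longrightarrow> nat (ell (snd s)) \<le> nat (ell (snd h)))"
    by (rule ex_has_least_nat[of ?P s]) (use s cs in auto)
  then obtain s0 where s0: "s0 \<in> S" "c s0 \<noteq> 0" and mn: "\<And>h. ?P h \<Longrightarrow> nat (ell (snd s0)) \<le> nat (ell (snd h))" by blast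
  obtain g0 u0 where e0: "s0 = (g0, u0)" by (cases s0)
  have u0: "u0 \<in> FinSym" using S s0 e0 by auto
  obtain t p where t: "t \<in> path_lists" and p: "is_longest p" "state (path_word u0 @ t) = Some p" using reach_w0[OF path_word[OF u0]] by blast
  have pl: "ell p = ell u0 + int (length t)" using state_ell[OF p(2)] state_ell[OF path_word(2)[OF u0]] by simp
  let ?f = "\<lambda>s. fa_scale (c s) (fa_word (red_word (fst s) @ path_word (snd s) @ t))"
  have other: "?f h \<in> K" if h: "h \<in> S" "snd h \<noteq> u0" for h
  proof (cases "c h = 0")
    case True
    then show ?thesis by (simp add: fa.subspace_0[OF K_subspace])
  next
    case False
    define u where "u = snd h"
    have u: "u \<in> FinSym" and g: "fst h \<in> AffSym" using S h Box_AffSym by (auto simp: u_def)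
    have tl: "path_word u @ t \<in> path_lists" using t path_word(1)[OF u] by auto
    have "state (path_word u @ t) = None"
    proof (cases "state (path_word u @ t)")
      case (Some p')
      obtain t' p'' where z': "is_longest p''" "state ((path_word u @ t) @ t') = Some p''" using reach_w0[OF tl Some] by blast
      have pp: "p'' = p" by (rule is_longest_unique[OF z'(1) p(1)])
      have "nat (ell u0) \<le> nat (ell u)" using mn[of h] h False by (simp add: e0 u_def)
      then have "ell u0 \<le> ell u" using ell_nonneg[of u] by linarith
      moreover have "ell u = int (length (path_word u))" using state_ell[OF path_word(2)[OF u]] .
      moreover have "ell p = int (length ((path_word u @ t) @ t'))" using state_ell[OF z'(2)] pp by simp
      ultimately have "t' = []" using pl by simp
      then have "state (path_word u @ t) = Some p" using z'(2) pp by (simp only: append_Nil2)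
      then have "word_perm (path_word u @ t) = word_perm (path_word u0 @ t)" using state_word_perm[OF p(2)] state_word_perm[of "path_word u @ t" p] by simp
      moreover have "word_perm (path_word u) = u" "word_perm (path_word u0) = u0" using state_word_perm[OF path_word(2)[OF u]] state_word_perm[OF path_word(2)[OF u0]] by simp_all
      ultimately have e: "word_perm t \<circ> u = word_perm t \<circ> u0" by (simp only: word_perm_append)
      have "u y = u0 y" for y using fun_cong[OF e, of y] aperm_inj[OF word_perm_aperm] by simp
      then show ?thesis using h by (auto simp: u_def)
    qed
    then have "fa_word (path_word u @ t) \<in> nil" using state_None_nil path_lists_letters[OF tl] by blast
    from nil_lm[OF this red_word(1)[OF g]] have "fa_word (red_word (fst h) @ path_word u @ t) \<in> K" using nil_kernel by auto
    then show ?thesis unfolding u_def by (rule fa.subspace_scale[OF K_subspace])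
  qed
  define T where "T = {s \<in> S. snd s = u0}"
  have fT: "finite T" "T \<subseteq> S" using S by (auto simp: T_def)
  have "rm t (\<Sum>(g, u)\<in>S. fa_scale (c (g, u)) (fa_word (red_word g @ path_word u))) \<in> K" by (rule K_rm[OF x path_lists_letters[OF t]])
  then have "sum ?f S \<in> K" by (simp add: lrm_simps case_prod_unfold)
  moreover have "sum ?f S = sum ?f (S - T) + sum ?f T" by (rule sum.subset_diff[OF fT(2) S(1)])
  moreover have "sum ?f (S - T) \<in> K"
    by (rule fa.subspace_sum[OF K_subspace]) (use other in \<open>auto simp: T_def\<close>)
  ultimately have "sum ?f T \<in> K" using subspace_cancel[OF K_subspace, of "sum ?f T" "sum ?f (S - T)"] by (simp only: add.commute)
  moreover have "sum ?f T = (\<Sum>g\<in>fst ` T. fa_scale (c (g, u0)) (fa_word (red_word g @ (path_word u0 @ t))))"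
  proof -
    have inj: "inj_on fst T" by (auto simp: T_def inj_on_def)
    show ?thesis by (subst sum.reindex[OF inj]) (auto simp: T_def intro!: sum.cong)
  qed
  ultimately have 1: "(\<Sum>g\<in>fst ` T. fa_scale (c (g, u0)) (fa_word (red_word g @ (path_word u0 @ t)))) \<in> K" by simp
  have TB: "fst ` T \<subseteq> Box" using S by (auto simp: T_def)
  have t0: "path_word u0 @ t \<in> path_red" using t path_word(1)[OF u0] p(2) by (auto simp: path_red_def)
  have "(\<Sum>g\<in>fst ` T. fa_scale (c (g, u0)) (fa_word (red_word g))) \<in> ker_path"
    by (rule strip_sum[OF t0 _ 1]) (use TB Box_AffSym red_word(1) in blast)
  from box_independent[OF _ TB this, of g0] have "c (g0, u0) = 0"
    using fT s0 e0 by (force simp: T_def image_iff)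
  then show False using s0 e0 by simp
qed

end

section \<open>Counting\<close>

text \<open>Permutations are counted by inserting the last value: all earlier values that are at least c are
raised by one.\<close>

definition up :: "nat \<Rightarrow> nat \<Rightarrow> nat" where "up c x = (if c \<le> x then Suc x else x)"

lemma up_less [simp]: "up c x < up c y \<longleftrightarrow> x < y" by (auto simp: up_def)
lemma up_neq [simp]: "up c x \<noteq> c" by (auto simp: up_def)
lemma up_inj: "inj (up c)" by (auto simp: up_def inj_def split: if_splits)
lemma up_gt: "c < up c x \<longleftrightarrow> c \<le> x" by (auto simp: up_def)
lemma up_lt: "up c x < c \<longleftrightarrow> x < c" by (auto simp: up_def)

definition perm_lists :: "nat \<Rightarrow> nat list set" where "perm_lists m = {k. distinct k \<and> set k = {0..<m}}"
definition cyc_lists :: "nat \<Rightarrow> nat list set" where "cyc_lists m = {k \<in> perm_lists m. hd k = 0}"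

lemma perm_lists_length: "k \<in> perm_lists m \<Longrightarrow> length k = m"
  unfolding perm_lists_def using distinct_card[of k] by auto

lemma up_image: "c \<le> m \<Longrightarrow> insert c (up c ` {0..<m}) = {0..<Suc m}"
proof -
  assume c: "c \<le> m"
  have "x \<in> insert c (up c ` {0..<m})" if "x < Suc m" for x
  proof (cases x c rule: linorder_cases)
    case less
    then show ?thesis using c by (intro insertI2 image_eqI[of _ _ x]) (auto simp: up_def)
  next
    case greater
    then show ?thesis using that by (intro insertI2 image_eqI[of _ _ "x - 1"]) (auto simp: up_def)
  qed simp
  then have "{0..<Suc m} \<subseteq> insert c (up c ` {0..<m})" by (meson atLeastLessThan_iff subsetI)
  moreover have "insert c (up c ` {0..<m}) \<subseteq> {0..<Suc m}" using c by (auto simp: up_def)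
  ultimately show ?thesis by (rule equalityI[rotated])
qed

lemma perm_lists_insert:
  "bij_betw (\<lambda>(k, c). map (up c) k @ [c]) (perm_lists m \<times> {0..m}) (perm_lists (Suc m))"
proof (rule bij_betw_imageI)
  show "inj_on (\<lambda>(k, c). map (up c) k @ [c]) (perm_lists m \<times> {0..m})"
    using inj_map_eq_map[OF up_inj] by (auto simp: inj_on_def)
  show "(\<lambda>(k, c). map (up c) k @ [c]) ` (perm_lists m \<times> {0..m}) = perm_lists (Suc m)"
  proof
    have "map (up c) k @ [c] \<in> perm_lists (Suc m)" if "k \<in> perm_lists m" "c \<le> m" for k c
      using that up_image[OF that(2)] up_inj[of c]
      by (auto simp: perm_lists_def distinct_map inj_on_def inj_def up_neq[THEN not_sym])
    then show "(\<lambda>(k, c). map (up c) k @ [c]) ` (perm_lists m \<times> {0..m}) \<subseteq> perm_lists (Suc m)" by auto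
    show "perm_lists (Suc m) \<subseteq> (\<lambda>(k, c). map (up c) k @ [c]) ` (perm_lists m \<times> {0..m})"
    proof
      fix k assume k: "k \<in> perm_lists (Suc m)"
      then have ne: "k \<noteq> []" using perm_lists_length by fastforce
      define c where "c = last k"
      define l where "l = map (\<lambda>x. if c < x then x - 1 else x) (butlast k)"
      have kc: "k = butlast k @ [c]" using ne by (simp add: c_def)
      have dk: "distinct k" "set k = {0..<Suc m}" using k by (auto simp: perm_lists_def)
      have nc: "c \<notin> set (butlast k)" using dk(1) by (subst (asm) kc) simp
      have ul: "up c (if c < x then x - 1 else x) = x" if "x \<noteq> c" for x using that by (auto simp: up_def)
      have ml: "map (up c) l = butlast k"
        unfolding l_def map_map
      proof (rule map_idI)
        fix x assume "x \<in> set (butlast k)"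
        then have "x \<noteq> c" using nc by auto
        then show "(up c \<circ> (\<lambda>x. if c < x then x - 1 else x)) x = x" unfolding comp_apply by (rule ul)
      qed
      have cm: "c \<le> m" using dk(2) last_in_set[OF ne] by (auto simp: c_def)
      have "set (butlast k) = {0..<Suc m} - {c}" using dk kc nc by (metis Diff_insert_absorb set_append list.set(1,2) Un_insert_right sup_bot_right)
      moreover have "up c ` {0..<m} = {0..<Suc m} - {c}" using up_image[OF cm] by (auto simp: image_iff)
      ultimately have "up c ` set l = up c ` {0..<m}" using ml by (metis set_map)
      then have "set l = {0..<m}" using inj_image_eq_iff[OF up_inj] by blast
      moreover have "distinct l" using dk(1) ml by (metis distinct_butlast distinct_map)
      ultimately have "l \<in> perm_lists m" by (simp add: perm_lists_def)
      moreover have "k = map (up c) l @ [c]" using kc ml by simp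
      ultimately show "k \<in> (\<lambda>(k, c). map (up c) k @ [c]) ` (perm_lists m \<times> {0..m})" using cm by force
    qed
  qed
qed

lemma cyc_lists_insert:
  assumes "1 \<le> m"
  shows "bij_betw (\<lambda>(k, c). map (up c) k @ [c]) (cyc_lists m \<times> {1..m}) (cyc_lists (Suc m))"
proof (rule bij_betw_subset[OF perm_lists_insert])
  show "cyc_lists m \<times> {1..m} \<subseteq> perm_lists m \<times> {0..m}" by (auto simp: cyc_lists_def)
  have h: "hd (map (up c) k @ [c]) = 0 \<longleftrightarrow> hd k = 0 \<and> 1 \<le> c" if "k \<in> perm_lists m" for k c
  proof -
    have "k \<noteq> []" using perm_lists_length[OF that] assms by auto
    then show ?thesis by (auto simp: hd_append hd_map up_def)
  qed
  show "(\<lambda>(k, c). map (up c) k @ [c]) ` (cyc_lists m \<times> {1..m}) = cyc_lists (Suc m)"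
  proof
    show "(\<lambda>(k, c). map (up c) k @ [c]) ` (cyc_lists m \<times> {1..m}) \<subseteq> cyc_lists (Suc m)"
    proof
      fix x assume "x \<in> (\<lambda>(k, c). map (up c) k @ [c]) ` (cyc_lists m \<times> {1..m})"
      then obtain k c where x: "x = map (up c) k @ [c]" "k \<in> perm_lists m" "hd k = 0" "1 \<le> c" "c \<le> m"
        by (auto simp: cyc_lists_def)
      have "(k, c) \<in> perm_lists m \<times> {0..m}" using x by simp
      from bspec[OF bij_betwE[OF perm_lists_insert] this] have "x \<in> perm_lists (Suc m)" unfolding x(1) by simp
      moreover have "hd x = 0" unfolding x(1) using h[OF x(2)] x(3,4) by blast
      ultimately show "x \<in> cyc_lists (Suc m)" by (simp only: cyc_lists_def mem_Collect_eq)
    qed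
    show "cyc_lists (Suc m) \<subseteq> (\<lambda>(k, c). map (up c) k @ [c]) ` (cyc_lists m \<times> {1..m})"
    proof
      fix k assume k: "k \<in> cyc_lists (Suc m)"
      then have "k \<in> (\<lambda>(k, c). map (up c) k @ [c]) ` (perm_lists m \<times> {0..m})"
        unfolding bij_betw_imp_surj_on[OF perm_lists_insert] by (simp only: cyc_lists_def mem_Collect_eq)
      then obtain l c where l: "l \<in> perm_lists m" "c \<le> m" "k = map (up c) l @ [c]" by auto
      have "hd k = 0" using k by (simp only: cyc_lists_def mem_Collect_eq)
      then have "hd l = 0" "1 \<le> c" using h[OF l(1), of c] unfolding l(3) by blast+
      then have "(l, c) \<in> cyc_lists m \<times> {1..m}" using l by (simp add: cyc_lists_def)
      then show "k \<in> (\<lambda>(k, c). map (up c) k @ [c]) ` (cyc_lists m \<times> {1..m})" by (rule rev_image_eqI) (simp add: l(3))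
    qed
  qed
qed

definition list_invs :: "nat list \<Rightarrow> nat" where
  "list_invs k = (\<Sum>j<length k. card {i. i < j \<and> k ! j < k ! i})"

text \<open>x lies on the cyclic arc from y to z.\<close>

definition cyc_between :: "nat \<Rightarrow> nat \<Rightarrow> nat \<Rightarrow> bool" where
  "cyc_between y x z \<longleftrightarrow> y < x \<and> x < z \<or> x < z \<and> z < y \<or> z < y \<and> y < x"

definition cyc_code :: "nat list \<Rightarrow> nat \<Rightarrow> nat" where
  "cyc_code k j = card {i. i < j \<and> cyc_between (k ! j) (k ! i) (k ! Suc j)}"

text \<open>\<open>n\<close> is kept fixed while \<open>k\<close> grows, so the factors of the old
  positions do not change under insertion. The factor \<open>n - 1 - j\<close> counts the window
  entries with index above \<open>j\<close>.\<close>

definition cyc_weight :: "nat \<Rightarrow> nat list \<Rightarrow> nat" where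
  "cyc_weight n k = (\<Sum>j<length k - 1. (n - 1 - j) * cyc_code k j)"

lemma card_index:
  assumes "k \<in> perm_lists m" shows "card {i. i < m \<and> P (k ! i)} = card {x. x < m \<and> P x}"
proof -
  have l: "length k = m" by (rule perm_lists_length[OF assms])
  have k: "distinct k" "set k = {0..<m}" using assms by (auto simp: perm_lists_def)
  have "(\<lambda>i. k ! i) ` {i. i < m \<and> P (k ! i)} = {x. x < m \<and> P x}"
  proof (intro set_eqI iffI)
    fix x assume "x \<in> (\<lambda>i. k ! i) ` {i. i < m \<and> P (k ! i)}"
    then show "x \<in> {x. x < m \<and> P x}" using nth_mem[of _ k] k(2) l by auto
  next
    fix x assume x: "x \<in> {x. x < m \<and> P x}"
    then have "x \<in> set k" using k(2) by simp
    then obtain i where "i < m" "k ! i = x" using l by (metis in_set_conv_nth)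
    then show "x \<in> (\<lambda>i. k ! i) ` {i. i < m \<and> P (k ! i)}" using x by auto
  qed
  moreover have "inj_on (\<lambda>i. k ! i) {i. i < m \<and> P (k ! i)}"
    using k(1) l by (auto simp: inj_on_def nth_eq_iff_index_eq)
  ultimately show ?thesis using card_image by fastforce
qed

text \<open>The new inversions are formed with the m - c earlier entries raised above
  \<open>c\<close>.\<close>

lemma list_invs_insert:
  assumes "k \<in> perm_lists m" "c \<le> m" shows "list_invs (map (up c) k @ [c]) = list_invs k + (m - c)"
proof -
  have l: "length k = m" by (rule perm_lists_length[OF assms(1)])
  let ?k = "map (up c) k @ [c]"
  have "{i. i < m \<and> c < up c (k ! i)} = {i. i < m \<and> c \<le> k ! i}" by (simp add: up_gt)
  then have "card {i. i < m \<and> ?k ! m < ?k ! i} = card {i. i < m \<and> c \<le> k ! i}"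
    using l by (auto simp: nth_append intro!: arg_cong[of _ _ card])
  also have "\<dots> = card {x. x < m \<and> c \<le> x}" by (rule card_index[OF assms(1)])
  also have "{x. x < m \<and> c \<le> x} = {c..<m}" by auto
  finally have 1: "card {i. i < m \<and> ?k ! m < ?k ! i} = m - c" by simp
  have "card {i. i < j \<and> ?k ! j < ?k ! i} = card {i. i < j \<and> k ! j < k ! i}" if "j < m" for j
    using that l by (auto simp: nth_append intro!: arg_cong[of _ _ card])
  then show ?thesis unfolding list_invs_def using l 1 by simp
qed

lemma cyc_between_up [simp]: "cyc_between (up c y) (up c x) (up c z) = cyc_between y x z" by (simp add: cyc_between_def)

text \<open>Appending \<open>c\<close> adds only the code of position m - 1, the number of entries
  on the arc from the old last entry to \<open>c\<close>. For \<open>c\<close> from 1 to m this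
  number takes each value below m once.\<close>

lemma cyc_weight_insert:
  assumes k: "k \<in> perm_lists m" "1 \<le> m" and c: "c \<le> m"
  defines "a \<equiv> k ! (m - 1)"
  shows "cyc_weight n (map (up c) k @ [c]) = cyc_weight n k + (n - m) * (if a < c then c - 1 - a else c + m - 1 - a)"
proof -
  have l: "length k = m" by (rule perm_lists_length[OF k(1)])
  let ?k = "map (up c) k @ [c]"
  have am: "a < m" unfolding a_def using k l nth_mem[of "m - 1" k] by (auto simp: perm_lists_def)
  have 1: "cyc_code ?k j = cyc_code k j" if "j < m - 1" for j
    unfolding cyc_code_def using that l by (auto simp: nth_append intro!: arg_cong[of _ _ card])
  have nb: "\<not> cyc_between (up c a) (up c a) c" by (auto simp: cyc_between_def)
  have "cyc_code ?k (m - 1) = card {i. i < m - 1 \<and> cyc_between (up c a) (up c (k ! i)) c}"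
    unfolding cyc_code_def a_def using k(2) l by (auto simp: nth_append intro!: arg_cong[of _ _ card])
  also have "{i. i < m - 1 \<and> cyc_between (up c a) (up c (k ! i)) c} = {i. i < m \<and> cyc_between (up c a) (up c (k ! i)) c}"
  proof -
    have "i < m \<longleftrightarrow> i < m - 1 \<or> i = m - 1" for i using k(2) by auto
    then show ?thesis using nb by (auto simp: a_def)
  qed
  also have "card \<dots> = card {x. x < m \<and> cyc_between (up c a) (up c x) c}" by (rule card_index[OF k(1)])
  also have "\<dots> = (if a < c then c - 1 - a else c + m - 1 - a)"
  proof (cases "a < c")
    case True
    then have "{x. x < m \<and> cyc_between (up c a) (up c x) c} = {a<..<c}"
      using c by (auto simp: cyc_between_def up_lt up_gt up_def split: if_splits)
    then show ?thesis using True by simp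
  next
    case False
    then have "{x. x < m \<and> cyc_between (up c a) (up c x) c} = {0..<c} \<union> {a<..<m}"
      using am by (auto simp: cyc_between_def up_lt up_gt up_def split: if_splits)
    moreover have "card ({0..<c} \<union> {a<..<m}) = c + (m - 1 - a)"
      using False by (subst card_Un_disjoint) auto
    ultimately show ?thesis using False am by simp
  qed
  finally have 2: "cyc_code ?k (m - 1) = (if a < c then c - 1 - a else c + m - 1 - a)" .
  have "cyc_weight n ?k = (\<Sum>j<Suc (m - 1). (n - 1 - j) * cyc_code ?k j)" unfolding cyc_weight_def using l k(2) by simp
  also have "\<dots> = (\<Sum>j<m - 1. (n - 1 - j) * cyc_code k j) + (n - 1 - (m - 1)) * cyc_code ?k (m - 1)" using 1 by simp
  also have "n - 1 - (m - 1) = n - m" using k(2) by simp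
  finally show ?thesis unfolding 2 cyc_weight_def l .
qed

lemma perm_lists_0: "perm_lists 0 = {[]}" by (auto simp: perm_lists_def)
lemma cyc_lists_1: "cyc_lists 1 = {[0]}"
proof -
  have "k = [0]" if "k \<in> perm_lists 1" for k
  proof -
    have "length k = 1" by (rule perm_lists_length[OF that])
    then obtain x where "k = [x]" by (auto simp: length_Suc_conv)
    then show ?thesis using that by (simp add: perm_lists_def)
  qed
  then show ?thesis by (auto simp: cyc_lists_def perm_lists_def)
qed

lemma gf_perm_lists: "(\<Sum>k\<in>perm_lists m. monom (1 :: int) (list_invs k)) = (\<Prod>i\<in>{1..m}. qint i)"
proof (induction m)
  case 0
  then show ?case by (simp add: perm_lists_0 list_invs_def)
next
  case (Suc m)
  have "(\<Sum>k\<in>perm_lists (Suc m). monom (1 :: int) (list_invs k)) = (\<Sum>(k, c)\<in>perm_lists m \<times> {0..m}. monom 1 (list_invs (map (up c) k @ [c])))"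
    by (subst sum.reindex_bij_betw[OF perm_lists_insert, symmetric]) (simp add: case_prod_unfold)
  also have "\<dots> = (\<Sum>(k, c)\<in>perm_lists m \<times> {0..m}. monom 1 (list_invs k) * monom 1 (m - c))"
    by (rule sum.cong) (auto simp: list_invs_insert mult_monom)
  also have "\<dots> = (\<Sum>k\<in>perm_lists m. monom 1 (list_invs k)) * (\<Sum>c\<in>{0..m}. monom 1 (m - c))"
    by (simp add: sum_product sum.cartesian_product)
  also have "(\<Sum>c\<in>{0..m}. monom (1 :: int) (m - c)) = qint (Suc m)"
    unfolding qint_def by (rule sum.reindex_bij_witness[of _ "\<lambda>i. m - i" "\<lambda>c. m - c"]) auto
  finally show ?case using Suc by (simp add: mult.commute)
qed

lemma gf_cyc_lists: "1 \<le> m \<Longrightarrow> (\<Sum>k\<in>cyc_lists m. monom (1 :: int) (cyc_weight n k)) = (\<Prod>i\<in>{1..<m}. \<Sum>e<i. monom 1 ((n - i) * e))"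
proof (induction m rule: nat_induct_at_least)
  case base
  have "cyc_lists (Suc 0) = {[0]}" using cyc_lists_1 by simp
  then show ?case by (simp add: cyc_weight_def)
next
  case (Suc m)
  have "(\<Sum>k\<in>cyc_lists (Suc m). monom (1 :: int) (cyc_weight n k)) = (\<Sum>(k, c)\<in>cyc_lists m \<times> {1..m}. monom 1 (cyc_weight n (map (up c) k @ [c])))"
    by (subst sum.reindex_bij_betw[OF cyc_lists_insert[OF Suc.hyps(1)], symmetric]) (simp add: case_prod_unfold)
  also have "\<dots> = (\<Sum>k\<in>cyc_lists m. \<Sum>c\<in>{1..m}. monom 1 (cyc_weight n (map (up c) k @ [c])))"
    by (simp add: sum.cartesian_product)
  also have "\<dots> = (\<Sum>k\<in>cyc_lists m. monom 1 (cyc_weight n k) * (\<Sum>e<m. monom 1 ((n - m) * e)))"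
  proof (rule sum.cong[OF refl])
    fix k assume "k \<in> cyc_lists m"
    then have k: "k \<in> perm_lists m" by (simp add: cyc_lists_def)
    define a where "a = k ! (m - 1)"
    have am: "a < m" unfolding a_def using k perm_lists_length[OF k] nth_mem[of "m - 1" k] Suc.hyps(1) by (auto simp: perm_lists_def)
    have "(\<Sum>c\<in>{1..m}. monom (1 :: int) (cyc_weight n (map (up c) k @ [c])))
       = (\<Sum>c\<in>{1..m}. monom 1 (cyc_weight n k) * monom 1 ((n - m) * (if a < c then c - 1 - a else c + m - 1 - a)))"
      using cyc_weight_insert[OF k Suc.hyps(1), of _ n] by (intro sum.cong) (auto simp: mult_monom a_def)
    also have "\<dots> = monom 1 (cyc_weight n k) * (\<Sum>c\<in>{1..m}. monom 1 ((n - m) * (if a < c then c - 1 - a else c + m - 1 - a)))"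
      by (simp add: sum_distrib_left)
    \<comment> \<open>The inverse of the arc length goes \<open>e\<close> steps beyond
      \<open>a + 1\<close> and wraps around within 1..m.\<close>
    also have "(\<Sum>c\<in>{1..m}. monom (1 :: int) ((n - m) * (if a < c then c - 1 - a else c + m - 1 - a))) = (\<Sum>e<m. monom 1 ((n - m) * e))"
      by (rule sum.reindex_bij_witness[of _ "\<lambda>e. if e < m - a then e + a + 1 else e + a + 1 - m" "\<lambda>c. if a < c then c - 1 - a else c + m - 1 - a"])
        (use am in auto)
    finally show "(\<Sum>c\<in>{1..m}. monom (1 :: int) (cyc_weight n (map (up c) k @ [c]))) = monom 1 (cyc_weight n k) * (\<Sum>e<m. monom 1 ((n - m) * e))" .
  qed
  also have "\<dots> = (\<Sum>k\<in>cyc_lists m. monom 1 (cyc_weight n k)) * (\<Sum>e<m. monom 1 ((n - m) * e))" by (simp add: sum_distrib_right)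
  finally show ?case using Suc by (simp add: atLeastLessThanSuc mult.commute)
qed

text \<open>Division with remainder by \<open>m\<close> on the exponents; the second factor is [k]
  taken at t^m.\<close>

lemma qint_mult: "qint (m * k) = qint m * (\<Sum>e<k. monom 1 (m * e))"
proof -
  have "qint m * (\<Sum>e<k. monom 1 (m * e)) = (\<Sum>i<m. \<Sum>e<k. monom 1 (i + m * e))"
    by (simp add: qint_def sum_product mult_monom)
  also have "\<dots> = (\<Sum>(i, e)\<in>{..<m} \<times> {..<k}. monom 1 (i + m * e))" by (simp add: sum.cartesian_product)
  also have "\<dots> = qint (m * k)" unfolding qint_def
  proof (rule sum.reindex_bij_witness[of _ "\<lambda>x. (x mod m, x div m)" "\<lambda>(i, e). i + m * e"])
    fix x assume "x \<in> {..<m * k}"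
    then have x: "x < m * k" by simp
    then have m: "0 < m" by (cases m) auto
    show "(x mod m, x div m) \<in> {..<m} \<times> {..<k}" using x m by (simp add: less_mult_imp_div_less mult.commute)
    show "(case (x mod m, x div m) of (i, e) \<Rightarrow> i + m * e) = x" by simp
  next
    fix b assume "b \<in> {..<m} \<times> {..<k}"
    then obtain i e where b: "b = (i, e)" "i < m" "e < k" by auto
    show "((case b of (i, e) \<Rightarrow> i + m * e) mod m, (case b of (i, e) \<Rightarrow> i + m * e) div m) = b" using b by simp
    have "i + m * e < m * Suc e" using b by simp
    also have "\<dots> \<le> m * k" using b by (intro mult_le_mono2) simp
    finally show "(case b of (i, e) \<Rightarrow> i + m * e) \<in> {..<m * k}" using b by simp
  qed (auto split: prod.splits)
  finally show ?thesis by simp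
qed

text \<open>By \<open>qint_mult\<close> each [k(n-k)] splits off a factor [n-k]; these factors and
  [n] together form the generating function of the permutations by inversions.\<close>

lemma gf_total:
  assumes "1 \<le> n"
  shows "(\<Prod>i\<in>{1..<n}. \<Sum>e<i. monom 1 ((n - i) * e)) * (\<Prod>i\<in>{1..n}. qint i)
     = qint n * (\<Prod>k\<in>{1..n - 1}. qint (k * (n - k)))"
proof -
  have s: "{1..n - 1} = {1..<n}" using assms by auto
  have "(\<Prod>k\<in>{1..<n}. qint (k * (n - k))) = (\<Prod>k\<in>{1..<n}. qint (n - k) * (\<Sum>e<k. monom 1 ((n - k) * e)))"
  proof (rule prod.cong[OF refl])
    fix k show "qint (k * (n - k)) = qint (n - k) * (\<Sum>e<k. monom 1 ((n - k) * e))"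
      unfolding mult.commute[of k "n - k"] by (rule qint_mult)
  qed
  also have "\<dots> = (\<Prod>k\<in>{1..<n}. qint (n - k)) * (\<Prod>k\<in>{1..<n}. \<Sum>e<k. monom 1 ((n - k) * e))"
    by (rule prod.distrib)
  also have "(\<Prod>k\<in>{1..<n}. qint (n - k)) = (\<Prod>k\<in>{1..<n}. qint k)"
    by (rule prod.reindex_bij_witness[of _ "\<lambda>k. n - k" "\<lambda>k. n - k"]) auto
  finally have e: "(\<Prod>k\<in>{1..<n}. qint (k * (n - k))) = (\<Prod>k\<in>{1..<n}. qint k) * (\<Prod>k\<in>{1..<n}. \<Sum>e<k. monom 1 ((n - k) * e))" .
  have "{1..n} = insert n {1..<n}" using assms by auto
  then have "(\<Prod>i\<in>{1..n}. qint i) = qint n * (\<Prod>k\<in>{1..<n}. qint k)" by simp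
  then show ?thesis unfolding s e by (simp add: ac_simps)
qed

lemma sum_sum_lessThan: "(\<Sum>b<m. \<Sum>j<b. f j) = (\<Sum>j<m. (m - 1 - j) * (f j :: nat))"
proof (induction m)
  case (Suc m)
  have "(\<Sum>j<m. (m - j) * f j) = (\<Sum>j<m. (m - 1 - j) * f j + f j)"
  proof (rule sum.cong[OF refl])
    fix j assume "j \<in> {..<m}"
    then have "m - j = Suc (m - 1 - j)" by auto
    then show "(m - j) * f j = (m - 1 - j) * f j + f j" by simp
  qed
  then show ?case using Suc by (simp add: sum.distrib)
qed simp

lemma perm_lists_sum: assumes "k \<in> perm_lists m" shows "(\<Sum>i<m. g (k ! i)) = (\<Sum>i<m. g i)"
proof -
  have "distinct k \<and> set k = {0..<m}" using assms by (simp only: perm_lists_def mem_Collect_eq)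
  then have k: "distinct k" "set k = {..<m}" by (simp_all only: atLeast0LessThan simp_thms)
  have "bij_betw ((!) k) {..<m} {..<m}"
    by (rule bij_betw_nth[OF k(1)]) (simp_all only: perm_lists_length[OF assms] k(2))
  from sum.reindex_bij_betw[OF this, of g] show ?thesis .
qed

section \<open>Windows, residues and the two length generating functions\<close>

context cyc
begin

text \<open>Window notation: values on 1..n with pairwise distinct residues extend by periodicity;
  surjectivity is the pigeonhole principle on residues.\<close>

lemma build:
  fixes f :: "int \<Rightarrow> int"
  assumes f: "\<And>x y. 1 \<le> x \<Longrightarrow> x \<le> N \<Longrightarrow> 1 \<le> y \<Longrightarrow> y \<le> N \<Longrightarrow> N dvd f x - f y \<Longrightarrow> x = y"
  obtains v where "aperm v" "\<And>x. 1 \<le> x \<Longrightarrow> x \<le> N \<Longrightarrow> v x = f x"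
proof -
  define v where "v x = f (wcls x) + (x - wcls x)" for x
  have cN: "wcls (x + N) = wcls x" for x
    by (rule wcls_eqI) (use wcls_dvd[of x] wcls_range[of x] dvd_add[of N "x - wcls x" N] in \<open>auto simp: algebra_simps\<close>)
  have per: "per v" unfolding per_def v_def using cN by simp
  have dv: "N dvd v x - f (wcls x)" for x using wcls_dvd[of x] by (simp add: v_def)
  have inj: "inj v"
  proof (rule injI)
    fix x y assume e: "v x = v y"
    have "N dvd f (wcls x) - f (wcls y)" using dvd_diff[OF dv[of y] dv[of x]] e by simp
    then have "wcls x = wcls y" using f wcls_range by blast
    then show "x = y" using e by (simp add: v_def)
  qed
  have "surj v"
    unfolding surj_def
  proof
    fix z
    have "inj_on (\<lambda>c. wcls (f c)) {1..N}"
    proof (rule inj_onI)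
      fix a b assume ab: "a \<in> {1..N}" "b \<in> {1..N}" "wcls (f a) = wcls (f b)"
      then have "N dvd f a - f b" using dvd_diff[OF wcls_dvd[of "f a"] wcls_dvd[of "f b"]] by simp
      then show "a = b" using f ab by auto
    qed
    then have "(\<lambda>c. wcls (f c)) ` {1..N} = {1..N}"
      by (intro endo_inj_surj) (auto simp: wcls_range)
    moreover have "wcls z \<in> {1..N}" using wcls_range by simp
    ultimately obtain c where c: "1 \<le> c" "c \<le> N" "wcls (f c) = wcls z" by (metis (no_types, lifting) atLeastAtMost_iff imageE)
    define x where "x = c + (z - f c)"
    have d: "N dvd z - f c" using dvd_diff[OF wcls_dvd[of z] wcls_dvd[of "f c"]] c(3) by simp
    have "wcls x = c" by (rule wcls_eqI) (use d c in \<open>auto simp: x_def\<close>)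
    then have "z = v x" by (simp add: v_def x_def)
    then show "\<exists>x. z = v x" by blast
  qed
  then have "aperm v" using inj per by (simp add: aperm_def bij_def)
  moreover have "v x = f x" if "1 \<le> x" "x \<le> N" for x using wcls_id[OF that] by (simp add: v_def)
  ultimately show ?thesis by (rule that)
qed

lemma inv_AffSym: "p \<in> AffSym \<Longrightarrow> inv p \<in> AffSym" by (simp add: AffSym_def aperm_inv drift_inv)

lemma FinSym_AffSym: "u \<in> FinSym \<Longrightarrow> u \<in> AffSym" by (auto simp: FinSym_def intro: state_AffSym)

text \<open>Descents of the inverse among 1..n - 1 are removed one by one, and the window stays in
  its range. An increasing map of the window into itself is the identity.\<close>

lemma FinSym_I:
  assumes "p \<in> AffSym" "\<And>x. 1 \<le> x \<Longrightarrow> x \<le> N \<Longrightarrow> 1 \<le> inv p x \<and> inv p x \<le> N" shows "p \<in> FinSym"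
  using assms
proof (induction "nat (ell p)" arbitrary: p rule: less_induct)
  case less
  have b: "aperm p" by (rule AffSym_aperm[OF less.prems(1)])
  show ?case
  proof (cases "\<exists>j\<in>{1..n - 1}. inv p (int j + 1) < inv p (int j)")
    case True
    then obtain j where j: "j \<in> {1..n - 1}" "inv p (int j + 1) < inv p (int j)" by blast
    let ?p = "aswap (int j) \<circ> p"
    have G: "?p \<in> AffSym" using less.prems(1) by (intro AffSym_comp AffSym_aswap)
    have e: "ell ?p = ell p - 1" by (rule ell_right_down[OF less.prems(1) j(2)])
    have jj: "1 \<le> int j" "int j \<le> N - 1" using j by auto
    have i: "inv ?p = inv p \<circ> aswap (int j)" by (rule aperm_inv_sw2[OF b])
    have "1 \<le> inv ?p x \<and> inv ?p x \<le> N" if "1 \<le> x" "x \<le> N" for x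
      unfolding i using aswap_fin[OF jj that] less.prems(2) that jj by auto
    moreover have "nat (ell ?p) < nat (ell p)" using e ell_nonneg[of ?p] by linarith
    ultimately have "?p \<in> FinSym" using less.hyps G by blast
    then obtain t where t: "t \<in> path_lists" "state t = Some ?p" by (auto simp: FinSym_def)
    have "inv ?p (int j) < inv ?p (int j + 1)" using j(2) unfolding i by (simp add: aswap_at)
    moreover have "aswap (int j) \<circ> ?p = p" by (simp add: fun_eq_iff)
    ultimately have "state (t @ [j]) = Some p" using state_snoc(1)[OF t(2), of j] by (simp del: o_apply)
    then show ?thesis using t j unfolding FinSym_def by (intro CollectI bexI[of _ "t @ [j]"]) auto
  next
    case False
    have "inv p (int j) \<noteq> inv p (int j + 1)" for j using aperm_inj[OF aperm_inv[OF b]] by simp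
    then have "Grass p" using False unfolding Grass_def by (meson linorder_neqE)
    then have state: "inv p j < inv p (j + 1)" if "1 \<le> j" "j < N" for j using Grass_step that by blast
    have up: "y \<le> N \<longrightarrow> y \<le> inv p y" if "1 \<le> y" for y
      using that
    proof (induction y rule: int_ge_induct)
      case base
      then show ?case using less.prems(2)[of 1] by simp
    next
      case (step y)
      then show ?case using state[of y] by fastforce
    qed
    have dn: "1 \<le> y \<longrightarrow> inv p y \<le> y" if "y \<le> N" for y
      using that
    proof (induction y rule: int_le_induct)
      case base
      then show ?case using less.prems(2)[of N] by simp
    next
      case (step y)
      then show ?case using state[of "y - 1"] by fastforce
    qed
    have "p = id" by (rule aperm_eqI[OF b aperm_id]) (use up dn in \<open>auto simp: inv_id[unfolded id_def] intro: antisym\<close>)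
    then show ?thesis unfolding FinSym_def by (intro CollectI bexI[of _ "[]"]) auto
  qed
qed

lemma window_pairs_sum: "(\<Sum>(a, b)\<in>window_pairs. F a b) = (\<Sum>j<n. \<Sum>i<j. F (int i + 1) (int j + 1))" for F :: "int \<Rightarrow> int \<Rightarrow> int"
proof -
  have "(\<Sum>(a, b)\<in>window_pairs. F a b) = (\<Sum>(j, i)\<in>Sigma {..<n} (\<lambda>j. {..<j}). F (int i + 1) (int j + 1))"
    by (rule sum.reindex_bij_witness[of _ "\<lambda>(j, i). (int i + 1, int j + 1)" "\<lambda>(a, b). (nat (b - 1), nat (a - 1))"])
      (auto simp: window_pairs_def)
  also have "\<dots> = (\<Sum>j<n. \<Sum>i<j. F (int i + 1) (int j + 1))" by (rule sum.Sigma[symmetric]) auto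
  finally show ?thesis .
qed

lemma perm_lists_I: assumes "distinct k" "set k \<subseteq> {0..<n}" "length k = n" shows "k \<in> perm_lists n"
  using assms distinct_card[of k] card_subset_eq[of "{0..<n}" "set k"] by (auto simp: perm_lists_def)

definition window_list :: "(int \<Rightarrow> int) \<Rightarrow> nat list" where
  "window_list p = map (\<lambda>x. nat (inv p (int x + 1) - 1)) [0..<n]"

lemma FinSym_r: "u \<in> FinSym \<Longrightarrow> 1 \<le> x \<Longrightarrow> x \<le> N \<Longrightarrow> 1 \<le> inv u x \<and> inv u x \<le> N"
  unfolding FinSym_def using FinSym_inv_range by blast

lemma window_list_nth: "u \<in> FinSym \<Longrightarrow> i < n \<Longrightarrow> int (window_list u ! i) = inv u (int i + 1) - 1"
  using FinSym_r[of u "int i + 1"] by (simp add: window_list_def)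

lemma window_list_bij: "bij_betw window_list FinSym (perm_lists n)"
proof (rule bij_betw_imageI)
  show "inj_on window_list FinSym"
  proof (rule inj_onI)
    fix p q assume a: "p \<in> FinSym" "q \<in> FinSym" "window_list p = window_list q"
    show "p = q"
    proof (rule aperm_eqI)
      show "aperm p" "aperm q" using a FinSym_AffSym AffSym_aperm by auto
      fix x assume x: "1 \<le> x" "x \<le> N"
      have "nat (x - 1) < n" "int (nat (x - 1)) + 1 = x" using x by auto
      then show "inv p x = inv q x" using window_list_nth[OF a(1), of "nat (x - 1)"] window_list_nth[OF a(2), of "nat (x - 1)"] a(3) by simp
    qed
  qed
  show "window_list ` FinSym = perm_lists n"
  proof
    show "window_list ` FinSym \<subseteq> perm_lists n"
    proof (rule image_subsetI, rule perm_lists_I)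
      fix u assume u: "u \<in> FinSym"
      have b: "aperm (inv u)" using u FinSym_AffSym AffSym_aperm aperm_inv by blast
      show "length (window_list u) = n" by (simp add: window_list_def)
      have "window_list u ! i \<noteq> window_list u ! j" if "i < n" "j < n" "i \<noteq> j" for i j
      proof
        assume "window_list u ! i = window_list u ! j"
        then have "inv u (int i + 1) = inv u (int j + 1)" using window_list_nth[OF u] that by (metis diff_add_cancel)
        then show False using aperm_inj[OF b] that by simp
      qed
      then show "distinct (window_list u)" by (simp add: distinct_conv_nth window_list_def)
      show "set (window_list u) \<subseteq> {0..<n}"
      proof
        fix x assume "x \<in> set (window_list u)"
        then obtain i where "i < n" "x = window_list u ! i" by (auto simp: in_set_conv_nth window_list_def)
        then show "x \<in> {0..<n}" using window_list_nth[OF u, of i] FinSym_r[OF u, of "int i + 1"] by auto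
      qed
    qed
    show "perm_lists n \<subseteq> window_list ` FinSym"
    proof
      fix k assume k: "k \<in> perm_lists n"
      have l: "length k = n" by (rule perm_lists_length[OF k])
      have kk: "distinct k" "set k = {0..<n}" using k by (auto simp: perm_lists_def)
      have kn: "k ! i < n" if "i < n" for i using nth_mem[of i k] kk l that by auto
      define f where "f x = int (k ! nat (x - 1)) + 1" for x :: int
      obtain v where v: "aperm v" "\<And>x. 1 \<le> x \<Longrightarrow> x \<le> N \<Longrightarrow> v x = f x"
      proof (rule build[of f])
        fix x y assume xy: "1 \<le> x" "x \<le> N" "1 \<le> y" "y \<le> N" "N dvd f x - f y"
        have i: "nat (x - 1) < n" "nat (y - 1) < n" using xy by auto
        have "int (k ! nat (x - 1)) = int (k ! nat (y - 1))"
          by (rule small_eq) (use xy kn[OF i(1)] kn[OF i(2)] in \<open>auto simp: f_def\<close>)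
        then have "nat (x - 1) = nat (y - 1)" using kk(1) l i by (simp add: nth_eq_iff_index_eq)
        then show "x = y" using xy by simp
      qed blast
      have "drift v = (\<Sum>i<n. int (k ! i) - int i)"
        unfolding drift_window[OF v(1)] by (rule sum.cong) (auto simp: v(2) f_def)
      also have "\<dots> = (\<Sum>i<n. int (k ! i)) - (\<Sum>i<n. int i)" by (rule sum_subtractf)
      also have "(\<Sum>i<n. int (k ! i)) = (\<Sum>i<n. int i)"
        by (rule perm_lists_sum[OF k])
      finally have G: "v \<in> AffSym" using v(1) by (simp add: AffSym_def)
      have iv: "inv (inv v) = v" by (rule aperm_inv_inv[OF v(1)])
      have u: "inv v \<in> FinSym"
      proof (rule FinSym_I[OF inv_AffSym[OF G]], unfold iv)
        fix x assume x: "1 \<le> x" "x \<le> N"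
        have "nat (x - 1) < n" using x by auto
        then show "1 \<le> v x \<and> v x \<le> N" using kn[of "nat (x - 1)"] v(2)[OF x] by (simp add: f_def)
      qed
      have "window_list (inv v) = k"
        by (rule nth_equalityI) (use l v(2) in \<open>auto simp: window_list_def iv f_def\<close>)
      then show "k \<in> window_list ` FinSym" using u by blast
    qed
  qed
qed

text \<open>Differences within the window have absolute value below n, so each quotient in Shi's
  formula is 0 or -1, and the formula counts inversions.\<close>

lemma FinSym_ell: assumes "u \<in> FinSym" shows "ell u = int (list_invs (window_list u))"
proof -
  have t: "\<bar>(inv u (int j + 1) - inv u (int i + 1)) div N\<bar> = (if window_list u ! j < window_list u ! i then 1 else 0)"
    if "i < j" "j < n" for i j
  proof -
    define d where "d = inv u (int j + 1) - inv u (int i + 1)"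
    have e: "d = int (window_list u ! j) - int (window_list u ! i)" using window_list_nth[OF assms] that by (simp add: d_def)
    have d: "- N < d" "d < N" using FinSym_r[OF assms, of "int i + 1"] FinSym_r[OF assms, of "int j + 1"] that by (auto simp: d_def)
    show ?thesis
    proof (cases "d < 0")
      case True
      have "(d + N) div N = 0" using d True by (intro div_pos_pos_trivial) auto
      then have "d div N = - 1" using N_pos by simp
      then show ?thesis using True e by (simp add: d_def[symmetric])
    next
      case False
      then have "d div N = 0" using d by (intro div_pos_pos_trivial) auto
      then show ?thesis using False e by (simp add: d_def[symmetric])
    qed
  qed
  have "ell u = (\<Sum>j<n. \<Sum>i<j. if window_list u ! j < window_list u ! i then 1 else 0)"
    unfolding ell_def window_pairs_sum using t by (intro sum.cong refl) auto
  also have "\<dots> = int (\<Sum>j<n. card {i. i < j \<and> window_list u ! j < window_list u ! i})"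
    unfolding of_nat_sum
  proof (rule sum.cong[OF refl])
    fix j
    have "(\<Sum>i<j. if window_list u ! j < window_list u ! i then 1 else 0 :: int) = (\<Sum>i\<in>{i. i < j \<and> window_list u ! j < window_list u ! i}. 1)"
      by (rule sum.mono_neutral_cong_right) auto
    then show "(\<Sum>i<j. if window_list u ! j < window_list u ! i then 1 else 0 :: int) = int (card {i. i < j \<and> window_list u ! j < window_list u ! i})" by simp
  qed
  finally show ?thesis by (simp add: list_invs_def window_list_def)
qed

text \<open>Subtracting the first entry makes the list start with 0, which leaves (n - 1)! lists;
  the lost constant is recovered from the drift.\<close>

definition residue_list :: "(int \<Rightarrow> int) \<Rightarrow> nat list" where
  "residue_list p = map (\<lambda>x. vtx (inv p (int x + 1) - inv p 1)) [0..<n]"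

lemma residue_list_dvd: "i < n \<Longrightarrow> N dvd inv p (int i + 1) - inv p 1 - int (residue_list p ! i)"
  using vtx_dvd[of "inv p (int i + 1) - inv p 1"] by (simp add: residue_list_def)

text \<open>Gaps in the box lie strictly between 0 and n, so their residues determine them.\<close>

lemma Box_gap_mod: assumes "p \<in> Box" "Suc j < n"
  shows "inv p (int (Suc j) + 1) - inv p (int j + 1) = (int (residue_list p ! Suc j) - int (residue_list p ! j)) mod N"
proof -
  let ?g = "inv p (int (Suc j) + 1) - inv p (int j + 1)"
  have "N dvd ?g - (int (residue_list p ! Suc j) - int (residue_list p ! j))"
    using dvd_diff[OF residue_list_dvd[of "Suc j" p] residue_list_dvd[of j p]] assms(2) by (simp add: algebra_simps)
  then have "?g mod N = (int (residue_list p ! Suc j) - int (residue_list p ! j)) mod N" by (simp add: mod_eq_dvd_iff)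
  moreover have "0 < ?g" "?g < N"
    using Grass_step[OF Box_Grass[OF assms(1)], of "int j + 1"] Box_gap[OF assms(1), of "int j + 1"] assms(2) by (simp_all add: add.commute)
  ultimately show ?thesis by simp
qed

lemma residue_list_perm_lists: assumes "p \<in> Box" shows "residue_list p \<in> cyc_lists n"
proof -
  have b: "aperm (inv p)" using assms Box_aperm aperm_inv by blast
  have "residue_list p ! i \<noteq> residue_list p ! j" if "i < n" "j < n" "i \<noteq> j" for i j
  proof
    assume e: "residue_list p ! i = residue_list p ! j"
    have "N dvd inv p (int i + 1) - inv p (int j + 1)"
      using dvd_diff[OF residue_list_dvd[OF that(1), of p] residue_list_dvd[OF that(2), of p]] e by (simp add: algebra_simps)
    then have "N dvd int i - int j" using aperm_dvd_iff[OF b] by fastforce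
    moreover have "\<bar>int i - int j\<bar> < N" using that by auto
    ultimately show False using small_eq[of "int i" "int j"] that by auto
  qed
  then have "residue_list p \<in> perm_lists n" by (intro perm_lists_I) (auto simp: distinct_conv_nth residue_list_def)
  moreover have "hd (residue_list p) = 0" using n3 by (simp add: residue_list_def hd_map hd_upt vtx_def)
  ultimately show ?thesis by (simp add: cyc_lists_def)
qed

lemma residue_list_bij: "bij_betw residue_list Box (cyc_lists n)"
proof (rule bij_betw_imageI)
  show "inj_on residue_list Box"
  proof (rule inj_onI)
    fix p q assume a: "p \<in> Box" "q \<in> Box" "residue_list p = residue_list q"
    show "p = q"
    proof (rule AffSym_gap_eq[OF Box_AffSym[OF a(1)] Box_AffSym[OF a(2)]])
      fix j assume j: "1 \<le> j" "j < N"
      obtain i where i: "j = int i + 1" using j by (metis diff_add_cancel diff_ge_0_iff_ge nonneg_int_cases)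
      then have "Suc i < n" "j + 1 = int (Suc i) + 1" using j by auto
      then show "inv p (j + 1) - inv p j = inv q (j + 1) - inv q j"
        using Box_gap_mod[OF a(1), of i] Box_gap_mod[OF a(2), of i] a(3) i by simp
    qed
  qed
  show "residue_list ` Box = cyc_lists n"
  proof
    show "residue_list ` Box \<subseteq> cyc_lists n" using residue_list_perm_lists by blast
    show "cyc_lists n \<subseteq> residue_list ` Box"
    proof
      fix k assume "k \<in> cyc_lists n"
      then have k: "k \<in> perm_lists n" and hk: "hd k = 0" by (auto simp: cyc_lists_def)
      have l: "length k = n" by (rule perm_lists_length[OF k])
      have k0: "k ! 0 = 0" using hk l n3 by (cases k) auto
      have kk: "distinct k" "set k = {0..<n}" using k by (auto simp: perm_lists_def)
      have kn: "k ! i < n" if "i < n" for i using nth_mem[of i k] kk l that by auto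
      \<comment> \<open>The increasing window with the prescribed residues and gaps below n,
        starting at 0.\<close>
      define F where "F i = (\<Sum>j<i. (int (k ! Suc j) - int (k ! j)) mod N)" for i
      have Fd: "N dvd F i - int (k ! i)" for i
      proof (induction i)
        case 0
        then show ?case by (simp add: F_def k0)
      next
        case (Suc i)
        have "N dvd (int (k ! Suc i) - int (k ! i)) mod N - (int (k ! Suc i) - int (k ! i))"
          by (metis dvd_minus_mod dvd_diff_commute)
        from dvd_add[OF this Suc] show ?case by (simp add: F_def algebra_simps)
      qed
      define w where "w i = (F i - int (k ! i)) div N" for i
      have Fw: "F i = int (k ! i) + N * w i" for i using Fd[of i] by (simp add: w_def)
      \<comment> \<open>The drift of the window shifted by \<open>s\<close> is n times the sum of
        all \<open>w i\<close> plus n times \<open>s - 1\<close>; this choice makes it zero.\<close>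
      define s where "s = 1 - (\<Sum>i<n. w i)"
      define f where "f x = s + F (nat (x - 1))" for x :: int
      obtain v where v: "aperm v" "\<And>x. 1 \<le> x \<Longrightarrow> x \<le> N \<Longrightarrow> v x = f x"
      proof (rule build[of f])
        fix x y assume xy: "1 \<le> x" "x \<le> N" "1 \<le> y" "y \<le> N" "N dvd f x - f y"
        have i: "nat (x - 1) < n" "nat (y - 1) < n" using xy by auto
        have "N dvd F (nat (x - 1)) - F (nat (y - 1))" using xy(5) by (simp add: f_def)
        from dvd_add[OF dvd_diff[OF this Fd[of "nat (x - 1)"]] Fd[of "nat (y - 1)"]]
        have "N dvd int (k ! nat (x - 1)) - int (k ! nat (y - 1))" by (simp add: algebra_simps)
        then have "int (k ! nat (x - 1)) = int (k ! nat (y - 1))"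
          by (rule small_eq) (use kn[OF i(1)] kn[OF i(2)] in auto)
        then have "nat (x - 1) = nat (y - 1)" using kk(1) l i by (simp add: nth_eq_iff_index_eq)
        then show "x = y" using xy by simp
      qed blast
      have "drift v = (\<Sum>i<n. (int (k ! i) - int i) + (N * w i + (s - 1)))"
        unfolding drift_window[OF v(1)] by (rule sum.cong) (auto simp: v(2) f_def Fw)
      also have "\<dots> = (\<Sum>i<n. int (k ! i)) - (\<Sum>i<n. int i) + (N * (\<Sum>i<n. w i) + N * (s - 1))"
        by (simp add: sum.distrib sum_subtractf sum_distrib_left)
      also have "(\<Sum>i<n. int (k ! i)) = (\<Sum>i<n. int i)"
        by (rule perm_lists_sum[OF k])
      finally have "drift v = N * ((\<Sum>i<n. w i) + (s - 1))" by (simp only: distrib_left diff_self add_0)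
      then have G: "v \<in> AffSym" using v(1) by (simp add: AffSym_def s_def)
      have iv: "inv (inv v) = v" by (rule aperm_inv_inv[OF v(1)])
      have gp: "0 < v (j + 1) - v j" "v (j + 1) - v j < N" if j: "1 \<le> j" "j < N" for j
      proof -
        define i where "i = nat (j - 1)"
        have i: "Suc i < n" "nat (j + 1 - 1) = Suc i" "nat (j - 1) = i" using j by (auto simp: i_def)
        have vj: "v (j + 1) - v j = (int (k ! Suc i) - int (k ! i)) mod N"
          using v(2)[of j] v(2)[of "j + 1"] j i by (simp add: f_def F_def)
        have "int (k ! Suc i) - int (k ! i) \<noteq> 0" using kk(1) l i by (simp add: nth_eq_iff_index_eq)
        then have "\<not> N dvd int (k ! Suc i) - int (k ! i)" using kn[of i] kn[of "Suc i"] i by (intro not_dvd_small) auto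
        then have "(int (k ! Suc i) - int (k ! i)) mod N \<noteq> 0" by (simp only: dvd_eq_mod_eq_0 not_False_eq_True)
        moreover have "0 \<le> (int (k ! Suc i) - int (k ! i)) mod N" "(int (k ! Suc i) - int (k ! i)) mod N < N"
          using N_pos by (rule pos_mod_sign, rule pos_mod_bound)
        ultimately show "0 < v (j + 1) - v j" "v (j + 1) - v j < N" unfolding vj by linarith+
      qed
      have B: "inv v \<in> Box"
        by (rule Box_I[OF inv_AffSym[OF G]]; unfold iv) (use gp in force)+
      have "residue_list (inv v) = k"
      proof (rule nth_equalityI)
        show "length (residue_list (inv v)) = length k" using l by (simp add: residue_list_def)
        fix i assume "i < length (residue_list (inv v))"
        then have i: "i < n" by (simp add: residue_list_def)
        have "v (int i + 1) - v 1 = F i" using v(2)[of 1] v(2)[of "int i + 1"] i n3 by (simp add: f_def F_def)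
        then have "residue_list (inv v) ! i = vtx (F i)" using i by (simp add: residue_list_def iv)
        also have "\<dots> = vtx (int (k ! i))" using Fd vtx_eq_iff by blast
        also have "\<dots> = k ! i" by (rule vtx_of_nat[OF kn[OF i]])
        finally show "residue_list (inv v) ! i = k ! i" .
      qed
      then show "k \<in> residue_list ` Box" using B by blast
    qed
  qed
qed

text \<open>The forward arcs from x to y and from y to z together reach once around the circle
  exactly when x is passed again, that is, when x lies on the arc from y to z.\<close>

lemma cyc_between_mod:
  assumes "x < n" "y < n" "z < n" "x \<noteq> y" "y \<noteq> z" "x \<noteq> z"
  shows "N \<le> (int y - int x) mod N + (int z - int y) mod N \<longleftrightarrow> cyc_between y x z"
proof -
  have m: "(int b - int a) mod N = (if a \<le> b then int b - int a else int b - int a + N)" if "a < n" "b < n" for a b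
  proof (cases "a \<le> b")
    case True
    then show ?thesis using that by simp
  next
    case False
    have "(int b - int a) mod N = (int b - int a + N) mod N" by simp
    also have "\<dots> = int b - int a + N" using False that by (intro mod_pos_pos_trivial) auto
    finally show ?thesis using False by simp
  qed
  show ?thesis unfolding m[OF assms(1,2)] m[OF assms(2,3)] cyc_between_def using assms by auto
qed

text \<open>Passing from the j-th to the next window entry, the quotient by n of the distance to an earlier entry
grows by one exactly when that entry lies on the cyclic arc that is swept; this contribution is kept
in the n - 1 - j later distances.\<close>

lemma Box_ell: assumes p: "p \<in> Box" shows "ell p = int (cyc_weight n (residue_list p))"
proof -
  define k where "k = residue_list p"
  have kP: "k \<in> perm_lists n" using residue_list_perm_lists[OF p] by (simp add: k_def cyc_lists_def)
  have l: "length k = n" by (rule perm_lists_length[OF kP])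
  have kk: "distinct k" "set k = {0..<n}" using kP by (auto simp: perm_lists_def)
  have kn: "k ! i < n" if "i < n" for i using nth_mem[of i k] kk l that by auto
  define v where "v i = inv p (int i + 1)" for i
  define G where "G i b = (v b - v i) div N" for i b
  define B where "B i j = (if i < j \<and> cyc_between (k ! j) (k ! i) (k ! Suc j) then 1 else 0 :: nat)" for i j
  have vm: "(v b - v a) mod N = (int (k ! b) - int (k ! a)) mod N" if "a < n" "b < n" for a b
  proof -
    have "N dvd (v b - v a) - (int (k ! b) - int (k ! a))"
      using dvd_diff[OF residue_list_dvd[OF that(2), of p] residue_list_dvd[OF that(1), of p]] by (simp add: v_def k_def algebra_simps)
    then show ?thesis by (simp add: mod_eq_dvd_iff)
  qed
  have gp: "v (Suc j) - v j = (int (k ! Suc j) - int (k ! j)) mod N" if "Suc j < n" for j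
    using Box_gap_mod[OF p that] by (simp add: v_def k_def)
  have step: "G i (Suc j) - G i j = int (B i j)" if ij: "i \<le> j" "Suc j < n" for i j
  proof -
    define r g where "r = (v j - v i) mod N" and "g = v (Suc j) - v j"
    have r: "0 \<le> r" "r < N" using N_pos by (simp_all add: r_def)
    have g: "0 \<le> g" "g < N" unfolding g_def gp[OF ij(2)] using N_pos by simp_all
    have "v (Suc j) - v i = (r + g) + N * G i j" unfolding r_def g_def G_def using div_mult_mod_eq[of "v j - v i" N] by (simp add: algebra_simps)
    then have "G i (Suc j) = G i j + (r + g) div N" using N_pos by (simp add: G_def)
    moreover have "(r + g) div N = (if N \<le> r + g then 1 else 0)"
    proof (cases "N \<le> r + g")
      case True
      have "(r + g - N) div N = 0" using r g True by (intro div_pos_pos_trivial) auto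
      moreover have "(r + g) div N = (r + g - N) div N + 1"
        using div_add_self2[of N "r + g - N"] N_pos by simp
      ultimately show ?thesis using True by simp
    next
      case False
      then show ?thesis using r g by (simp add: div_pos_pos_trivial)
    qed
    moreover have "N \<le> r + g \<longleftrightarrow> i < j \<and> cyc_between (k ! j) (k ! i) (k ! Suc j)"
    proof (cases "i = j")
      case True
      then have "r = 0" by (simp add: r_def)
      then show ?thesis using g True by simp
    next
      case False
      have "N \<le> r + g \<longleftrightarrow> cyc_between (k ! j) (k ! i) (k ! Suc j)"
        unfolding r_def g_def gp[OF ij(2)] vm[of i j, OF order_le_less_trans[OF ij(1)] , OF Suc_lessD[OF ij(2)] Suc_lessD[OF ij(2)]]
        by (rule cyc_between_mod) (use kn kk(1) l ij False in \<open>auto simp: nth_eq_iff_index_eq\<close>)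
      then show ?thesis using False ij by simp
    qed
    ultimately show ?thesis by (simp add: B_def)
  qed
  have Gs: "b < n \<longrightarrow> G i b = int (\<Sum>j<b. B i j)" if "i \<le> b" for i b
    using that
  proof (induction b rule: dec_induct)
    case base
    have "(\<Sum>j<i. B i j) = 0" by (simp add: B_def)
    then show ?case by (simp add: G_def)
  next
    case (step b)
    then show ?case using \<open>\<And>i j. i \<le> j \<Longrightarrow> Suc j < n \<Longrightarrow> G i (Suc j) - G i j = int (B i j)\<close>[of i b] by auto
  qed
  have bs: "(\<Sum>i<b. B i j) = cyc_code k j" if "j < b" for b j
  proof -
    have "(\<Sum>i<b. B i j) = (\<Sum>i\<in>{i. i < j \<and> cyc_between (k ! j) (k ! i) (k ! Suc j)}. 1)"
      by (rule sum.mono_neutral_cong_right) (use that in \<open>auto simp: B_def\<close>)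
    then show ?thesis by (simp add: cyc_code_def)
  qed
  have "ell p = (\<Sum>b<n. \<Sum>i<b. \<bar>G i b\<bar>)" unfolding ell_def window_pairs_sum by (simp add: G_def v_def)
  also have "\<dots> = (\<Sum>b<n. \<Sum>i<b. int (\<Sum>j<b. B i j))"
    using Gs by (intro sum.cong refl) (auto simp del: of_nat_sum)
  also have "\<dots> = int (\<Sum>b<n. \<Sum>i<b. \<Sum>j<b. B i j)" by simp
  also have "(\<Sum>b<n. \<Sum>i<b. \<Sum>j<b. B i j) = (\<Sum>b<n. \<Sum>j<b. \<Sum>i<b. B i j)"
    by (rule sum.cong[OF refl], rule sum.swap)
  also have "\<dots> = (\<Sum>b<n. \<Sum>j<b. cyc_code k j)" using bs by simp
  also have "\<dots> = (\<Sum>j<n. (n - 1 - j) * cyc_code k j)" by (rule sum_sum_lessThan)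
  also have "\<dots> = (\<Sum>j<n - 1. (n - 1 - j) * cyc_code k j)" by (rule sum.mono_neutral_right) auto
  finally show ?thesis unfolding cyc_weight_def k_def[symmetric] l .
qed

lemma finite_perm_lists: "finite (perm_lists m)"
  by (rule finite_subset[of _ "{k. set k \<subseteq> {0..<m} \<and> length k \<le> m}"])
    (use perm_lists_length in \<open>auto simp: finite_lists_length_le perm_lists_def\<close>)

lemma finite_FinSym: "finite FinSym" using bij_betw_finite[OF window_list_bij] finite_perm_lists by simp
lemma finite_Box: "finite Box"
  using bij_betw_finite[OF residue_list_bij] finite_subset[OF _ finite_perm_lists[of n], of "cyc_lists n"] by (auto simp: cyc_lists_def)

definition hilb :: "int poly" where "hilb = qint n * (\<Prod>k\<in>{1..n - 1}. qint (k * (n - k)))"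

lemma coeff_sum_monom: "finite S \<Longrightarrow> coeff (\<Sum>s\<in>S. monom (1 :: int) (f s)) d = int (card {s \<in> S. f s = d})"
proof -
  assume "finite S"
  then have "(\<Sum>s\<in>S. if f s = d then 1 else 0 :: int) = (\<Sum>s\<in>{s \<in> S. f s = d}. 1)"
    by (intro sum.mono_neutral_cong_right) auto
  then show ?thesis by (simp add: coeff_sum)
qed

text \<open>The two factors in \<open>gf_total\<close> are the length generating functions of
  \<open>Box\<close> and of \<open>FinSym\<close>.\<close>

lemma hilb_gf: "hilb = (\<Sum>(g, u)\<in>Box \<times> FinSym. monom 1 (nat (ell g + ell u)))"
proof -
  have "hilb = (\<Sum>k\<in>cyc_lists n. monom (1 :: int) (cyc_weight n k)) * (\<Sum>k\<in>perm_lists n. monom (1 :: int) (list_invs k))"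
    using gf_total[of n] gf_perm_lists[of n] gf_cyc_lists[of n n] n3 by (simp add: hilb_def)
  also have "(\<Sum>k\<in>cyc_lists n. monom (1 :: int) (cyc_weight n k)) = (\<Sum>g\<in>Box. monom 1 (cyc_weight n (residue_list g)))"
    by (rule sum.reindex_bij_betw[OF residue_list_bij, symmetric])
  also have "(\<Sum>k\<in>perm_lists n. monom (1 :: int) (list_invs k)) = (\<Sum>u\<in>FinSym. monom 1 (list_invs (window_list u)))"
    by (rule sum.reindex_bij_betw[OF window_list_bij, symmetric])
  also have "(\<Sum>g\<in>Box. monom (1 :: int) (cyc_weight n (residue_list g))) * (\<Sum>u\<in>FinSym. monom 1 (list_invs (window_list u)))
     = (\<Sum>(g, u)\<in>Box \<times> FinSym. monom 1 (cyc_weight n (residue_list g) + list_invs (window_list u)))"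
    by (simp add: sum_product sum.cartesian_product mult_monom)
  also have "\<dots> = (\<Sum>(g, u)\<in>Box \<times> FinSym. monom 1 (nat (ell g + ell u)))"
    by (rule sum.cong) (auto simp: Box_ell FinSym_ell nat_add_distrib)
  finally show ?thesis .
qed

end

text \<open>A basis of \<open>V\<close> is extended by the vectors \<open>f s\<close> one at a time;
  the hypothesis on coefficients keeps each new vector outside the span. The finite set
  \<open>T\<close> makes the basis of \<open>V\<close> finite, so cardinalities can be
  added.\<close>

lemma dim_independent_mod:
  fixes f :: "'b \<Rightarrow> 'a fa"
  assumes V: "fa.subspace V" "V \<subseteq> fa.span T" "finite T" and S: "finite S"
    and ind: "\<And>c. (\<Sum>s\<in>S. fa_scale (c s) (f s)) \<in> V \<Longrightarrow> \<forall>s\<in>S. c s = 0"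
  shows "fa_dim (f ` S \<union> V) = card S + fa_dim V"
proof -
  obtain B where B: "B \<subseteq> V" "fa.independent B" "V \<subseteq> fa.span B" "card B = fa.dim V"
    by (rule fa.basis_exists)
  have finB: "finite B" using fa.independent_span_bound[OF V(3) B(2)] B(1) V(2) by blast
  have sB: "fa.span B = V" using fa.span_minimal[OF B(1) V(1)] B(3) by blast
  have "fa.independent (f ` U \<union> B) \<and> card (f ` U \<union> B) = card U + card B" if "U \<subseteq> S" for U
    using finite_subset[OF that S] that
  proof (induction U rule: finite_induct)
    case empty
    then show ?case using B(2) by simp
  next
    case (insert a U)
    have U: "U \<subseteq> S" "a \<in> S" "finite U" using insert by auto
    have "f a \<notin> fa.span (f ` U \<union> B)"
    proof
      assume "f a \<in> fa.span (f ` U \<union> B)"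
      then obtain x y where xy: "f a = x + y" "x \<in> fa.span (f ` U)" "y \<in> V"
        unfolding fa.span_Un sB by blast
      have fsub: "fa.subspace {z. \<exists>c. z = (\<Sum>s\<in>U. fa_scale (c s) (f s))}"
      proof (rule fa.subspaceI)
        show "0 \<in> {z. \<exists>c. z = (\<Sum>s\<in>U. fa_scale (c s) (f s))}" by (auto intro!: exI[of _ "\<lambda>_. 0"])
      next
        fix x y assume "x \<in> {z. \<exists>c. z = (\<Sum>s\<in>U. fa_scale (c s) (f s))}" "y \<in> {z. \<exists>c. z = (\<Sum>s\<in>U. fa_scale (c s) (f s))}"
        then obtain c d where "x = (\<Sum>s\<in>U. fa_scale (c s) (f s))" "y = (\<Sum>s\<in>U. fa_scale (d s) (f s))" by blast
        then have "x + y = (\<Sum>s\<in>U. fa_scale (c s + d s) (f s))" by (simp add: sum.distrib fa.scale_left_distrib)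
        then show "x + y \<in> {z. \<exists>c. z = (\<Sum>s\<in>U. fa_scale (c s) (f s))}"
          by (intro CollectI exI[of _ "\<lambda>s. c s + d s"])
      next
        fix b x assume "x \<in> {z. \<exists>c. z = (\<Sum>s\<in>U. fa_scale (c s) (f s))}"
        then obtain c where "x = (\<Sum>s\<in>U. fa_scale (c s) (f s))" by blast
        then have "fa_scale b x = (\<Sum>s\<in>U. fa_scale (b * c s) (f s))" by (simp add: fa.scale_sum_right)
        then show "fa_scale b x \<in> {z. \<exists>c. z = (\<Sum>s\<in>U. fa_scale (c s) (f s))}"
          by (intro CollectI exI[of _ "\<lambda>s. b * c s"])
      qed
      have "f ` U \<subseteq> {z. \<exists>c. z = (\<Sum>s\<in>U. fa_scale (c s) (f s))}"
      proof (rule image_subsetI)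
        fix s assume s: "s \<in> U"
        have "(\<Sum>t\<in>U. fa_scale (if t = s then 1 else 0) (f t)) = (\<Sum>t\<in>U. if t = s then f t else 0)"
          by (rule sum.cong) auto
        also have "\<dots> = f s" using s U(3) by (simp add: sum.delta)
        finally have e: "(\<Sum>t\<in>U. fa_scale (if t = s then 1 else 0) (f t)) = f s" .
        show "f s \<in> {z. \<exists>c. z = (\<Sum>s\<in>U. fa_scale (c s) (f s))}"
          by (rule CollectI, rule exI[of _ "\<lambda>t. if t = s then 1 else 0"], rule e[symmetric])
      qed
      from fa.span_minimal[OF this fsub] obtain c where c: "x = (\<Sum>s\<in>U. fa_scale (c s) (f s))" using xy(2) by blast
      \<comment> \<open>The relation for \<open>f a\<close> with everything moved to one side,
        extended by zero to all of \<open>S\<close>.\<close>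
      define e where "e s = (if s = a then 1 else if s \<in> U then - c s else 0)" for s
      have "(\<Sum>s\<in>S. fa_scale (e s) (f s)) = (\<Sum>s\<in>insert a U. fa_scale (e s) (f s))"
        using U S by (intro sum.mono_neutral_right) (auto simp: e_def)
      also have "\<dots> = f a + (\<Sum>s\<in>U. fa_scale (e s) (f s))" using insert by (simp add: e_def)
      also have "(\<Sum>s\<in>U. fa_scale (e s) (f s)) = (\<Sum>s\<in>U. - fa_scale (c s) (f s))"
        using insert by (intro sum.cong) (auto simp: e_def fa.scale_minus_left)
      also have "\<dots> = - x" by (simp add: c sum_negf)
      also have "f a + - x = y" unfolding xy(1) by (simp only: add.commute[of x y] add.assoc right_minus add_0_right)
      finally have "(\<Sum>s\<in>S. fa_scale (e s) (f s)) = y" .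
      then have "e a = 0" using ind[of e] xy(3) U by simp
      then show False by (simp add: e_def)
    qed
    note nsp = this
    have nin: "f a \<notin> f ` U \<union> B" using nsp fa.span_base[of "f a" "f ` U \<union> B"] by (rule contrapos_nn)
    have IH: "fa.independent (f ` U \<union> B)" "card (f ` U \<union> B) = card U + card B" using insert.IH U(1) by blast+
    have e: "f ` insert a U \<union> B = insert (f a) (f ` U \<union> B)" by (simp only: image_insert Un_insert_left)
    have "fa.independent (insert (f a) (f ` U \<union> B))" by (rule fa.independent_insertI[OF nsp IH(1)])
    moreover have "finite (f ` U \<union> B)" using U(3) finB by simp
    then have "card (insert (f a) (f ` U \<union> B)) = card (insert a U) + card B"
      using nin IH(2) insert.hyps by (simp only: card_insert_disjoint add_Suc not_False_eq_True)
    ultimately show ?case unfolding e by (rule conjI)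
  qed
  from this[OF subset_refl] have i: "fa.independent (f ` S \<union> B)" "card (f ` S \<union> B) = card S + card B" by (rule conjunct1, rule conjunct2)
  have "fa.span (f ` S \<union> B) = fa.span (f ` S \<union> V)" 
    unfolding fa.span_Un sB fa.span_eq_iff[THEN iffD2, OF V(1)] ..
  from fa.dim_eq_card[OF this i(1)] show ?thesis using i(2) B(4) by (simp add: fa_dim_def)
qed

section \<open>The presentation and the graded dimensions\<close>

context cyc
begin

definition basis_word :: "(int \<Rightarrow> int) \<times> (int \<Rightarrow> int) \<Rightarrow> nat list" where "basis_word s = red_word (fst s) @ path_word (snd s)"

lemma basis_independent':
  assumes "finite S" "S \<subseteq> Box \<times> FinSym" "(\<Sum>s\<in>S. fa_scale (c s) (fa_word (basis_word s))) \<in> K"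
  shows "\<forall>s\<in>S. c s = 0"
  using basis_independent[OF assms(1,2), of c] assms(3) by (auto simp: basis_word_def case_prod_unfold)

lemma basis_word_letters: "s \<in> Box \<times> FinSym \<Longrightarrow> basis_word s \<in> letters"
  unfolding basis_word_def append_in_lists_conv using red_word(1)[OF Box_AffSym, of "fst s"] path_lists_letters[OF path_word(1), of "snd s"]
  by (simp add: mem_Times_iff)

lemma basis_word_length: "s \<in> Box \<times> FinSym \<Longrightarrow> int (length (basis_word s)) = ell (fst s) + ell (snd s)"
  using state_ell[OF red_word(2)[OF Box_AffSym]] state_ell[OF path_word(2)] by (auto simp: basis_word_def)

lemma rel_ideal_K: "rel_ideal \<subseteq> K"
proof
  fix x assume "x \<in> rel_ideal"
  then show "x \<in> K" unfolding rel_ideal_def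
  proof induction
    case (base r)
    have "braid_rels n \<subseteq> K" using nilcox_rels_kernel by (auto simp: nilcox_rels_def)
    then show ?case using base trl_rel_kernel n3 by auto
  next
    case (lmult x u)
    then show ?case using K_lm by (simp add: lm_def)
  next
    case (rmult x u)
    then show ?case using K_rm by (simp add: rm_def)
  qed (auto intro: fa.subspace_0[OF K_subspace] fa.subspace_add[OF K_subspace] fa.subspace_scale[OF K_subspace])
qed

definition basis_index :: "nat \<Rightarrow> ((int \<Rightarrow> int) \<times> (int \<Rightarrow> int)) set" where
  "basis_index d = {s \<in> Box \<times> FinSym. ell (fst s) + ell (snd s) = int d}"

lemma basis_index_sub: "basis_index d \<subseteq> Box \<times> FinSym" by (auto simp: basis_index_def)
lemma finite_basis_index: "finite (basis_index d)" using finite_subset[OF basis_index_sub] finite_Box finite_FinSym by blast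

lemma basis_words_basis_index: "basis_words d = (\<lambda>s. fa_word (basis_word s)) ` basis_index d"
  by (force simp: basis_words_def basis_index_def basis_word_def image_iff)

lemma word_basis_span: "w \<in> letters \<Longrightarrow> fa_word w \<in> basis_span (length w)"
  using basis_span_spanning[of w "[]"] by simp

lemma word_decomp:
  assumes "w \<in> letters"
  obtains b where "b \<in> fa.span (basis_words (length w))" "fa_word w - b \<in> rel_ideal"
proof -
  obtain b k where "fa_word w = b + k" "b \<in> fa.span (basis_words (length w))" "k \<in> fa.span rel_ideal"
    using word_basis_span[OF assms] unfolding basis_span_def fa.span_Un by blast
  moreover have "fa.span rel_ideal = rel_ideal" using rel_ideal_subspace fa.span_eq_iff by blast
  ultimately show ?thesis using that[of b] by simp
qed

text \<open>Squeeze: modulo \<open>rel_ideal\<close> every element is a combination of basis words,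
  and these are independent even modulo the larger \<open>K\<close>, so an element of
  \<open>K\<close> has no basis part.\<close>

theorem K_eq_rel_ideal: "K = rel_ideal"
proof
  show "K \<subseteq> rel_ideal"
  proof
    fix x assume x: "x \<in> K"
    let ?A = "(\<lambda>s. fa_word (basis_word s)) ` (Box \<times> FinSym)"
    have fin: "finite (Box \<times> FinSym)" using finite_Box finite_FinSym by blast
    have "fa_word w \<in> fa.span (?A \<union> rel_ideal)" if "w \<in> letters" for w
    proof -
      have "basis_span (length w) \<subseteq> fa.span (?A \<union> rel_ideal)"
        unfolding basis_span_def basis_words_basis_index using basis_index_sub by (intro fa.span_mono) auto
      then show ?thesis using word_basis_span[OF that] by blast
    qed
    then have "wspan {0..<n} \<subseteq> fa.span (?A \<union> rel_ideal)"
      unfolding wspan_def by (intro fa.span_minimal) auto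
    then have "x \<in> fa.span (?A \<union> rel_ideal)" using x by (auto simp: kernel_iff)
    then obtain b k where bk: "x = b + k" "b \<in> fa.span ?A" "k \<in> fa.span rel_ideal" unfolding fa.span_Un by blast
    have k: "k \<in> rel_ideal" using bk(3) rel_ideal_subspace fa.span_eq_iff by blast
    have bK: "b \<in> K" using fa.subspace_diff[OF K_subspace x, of k] k rel_ideal_K bk(1) by auto
    have inj: "inj_on (\<lambda>s. fa_word (basis_word s)) (Box \<times> FinSym)"
    proof (rule inj_onI, rule ccontr)
      fix s t assume state: "s \<in> Box \<times> FinSym" "t \<in> Box \<times> FinSym" "fa_word (basis_word s) = fa_word (basis_word t)" "s \<noteq> t"
      have "(\<Sum>r\<in>{s, t}. fa_scale ((\<lambda>r. if r = s then 1 else - 1) r) (fa_word (basis_word r))) \<in> K"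
        using state(3,4) fa.subspace_0[OF K_subspace] by (simp add: fa.scale_minus_left)
      from basis_independent'[OF _ _ this] show False using state by simp
    qed
    from bk(2) obtain c where "b = (\<Sum>v\<in>?A. fa_scale (c v) v)"
      unfolding fa.span_finite[OF finite_imageI[OF fin]] by blast
    also have "\<dots> = (\<Sum>s\<in>Box \<times> FinSym. fa_scale (c (fa_word (basis_word s))) (fa_word (basis_word s)))"
      by (subst sum.reindex[OF inj]) simp
    finally have b: "b = (\<Sum>s\<in>Box \<times> FinSym. fa_scale (c (fa_word (basis_word s))) (fa_word (basis_word s)))" .
    from basis_independent'[OF fin subset_refl, of "\<lambda>s. c (fa_word (basis_word s))"] bK
    have "\<forall>s\<in>Box \<times> FinSym. c (fa_word (basis_word s)) = 0" by (simp add: b)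
    then have "b = 0" unfolding b by (intro sum.neutral) auto
    then show "x \<in> rel_ideal" using bk(1) k by simp
  qed
qed (rule rel_ideal_K)

lemma homog_subspace: "fa.subspace {x. homog d x}"
proof (rule fa.subspaceI)
  fix x y :: "'b fa" assume "x \<in> {x. homog d x}" "y \<in> {x. homog d x}"
  then show "x + y \<in> {x. homog d x}" unfolding homog_def mem_Collect_eq plus_fun_apply by (metis add_0)
qed (auto simp: homog_def pw_simps)

lemma FKd_subspace: "fa.subspace (fk_ideal_deg n d)"
proof -
  have "fk_ideal_deg n d = FK \<inter> {x. homog d x}" by (auto simp: fk_ideal_deg_def)
  then show ?thesis using fa.subspace_inter[OF FK_subspace homog_subspace] by simp
qed

definition basis_edge_words :: "nat \<Rightarrow> (nat \<times> nat) fa set" where "basis_edge_words d = (\<lambda>s. fa_word (map (ecyc n) (basis_word s))) ` basis_index d"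

text \<open>The word and its basis part are both homogeneous of degree \<open>d\<close>, so their
  difference lies in the part of the ideal of this degree.\<close>

lemma cyc_word_span:
  assumes "w \<in> letters" "length w = d" shows "fa_word (map (ecyc n) w) \<in> fa.span (basis_edge_words d \<union> fk_ideal_deg n d)"
proof -
  obtain b where b: "b \<in> fa.span (basis_words d)" "fa_word w - b \<in> rel_ideal" using word_decomp[OF assms(1)] assms(2) by metis
  have p: "cop id b \<in> fa.span (basis_edge_words d)"
    by (rule fa_linear_span[OF cop_linear fa.subspace_span _ b(1)])
      (auto simp: basis_words_basis_index basis_edge_words_def cop_word_id simp del: id_apply intro!: fa.span_base)
  have hw: "homog d (cop id b)"
  proof -
    have "fa.span (basis_edge_words d) \<subseteq> {x. homog d x}"
    proof (rule fa.span_minimal[OF _ homog_subspace])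
      show "basis_edge_words d \<subseteq> {x. homog d x}"
        unfolding basis_edge_words_def using basis_word_length basis_index_sub by (fastforce intro!: homog_word simp: basis_index_def)
    qed
    then show ?thesis using p by blast
  qed
  have "cop id (fa_word w - b) \<in> FK" using b(2) rel_ideal_K by (auto simp: kernel_iff)
  then have 1: "fa_word (map (ecyc n) w) - cop id b \<in> FK" by (simp add: cop_simps cop_word_id del: id_apply)
  moreover have "homog d (fa_word (map (ecyc n) w) - cop id b)"
    using hw assms(2) by (intro homog_diff homog_word) simp
  ultimately have "fa_word (map (ecyc n) w) - cop id b \<in> fa.span (basis_edge_words d \<union> fk_ideal_deg n d)"
    by (intro fa.span_base) (simp add: fk_ideal_deg_def)
  moreover have "cop id b \<in> fa.span (basis_edge_words d \<union> fk_ideal_deg n d)" using p fa.span_mono[of "basis_edge_words d" "basis_edge_words d \<union> fk_ideal_deg n d"] by auto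
  ultimately show ?thesis using fa.span_add by fastforce
qed

text \<open>\<open>edge_words\<close> admits both orientations of an edge, \<open>ecyc\<close> only
  one; antisymmetry reverses the others and \<open>s\<close> collects the signs.\<close>

lemma edge_word_cyc:
  assumes "w \<in> lists {(i, j) \<in> fk_gens n. cycle_graph n i j}"
  shows "\<exists>w'\<in>letters. \<exists>s. length w' = length w \<and> fa_word w - fa_scale s (fa_word (map (ecyc n) w')) \<in> FK"
  using assms
proof (induction w)
  case Nil
  then show ?case by (intro bexI[of _ "[]"] exI[of _ 1]) (auto simp: FK_0)
next
  case (Cons c w)
  obtain i j where c: "c = (i, j)" by (cases c)
  have ij: "(i, j) \<in> fk_gens n" "cycle_graph n i j" "i < n" "j < n" using Cons.hyps(1) by (auto simp: c fk_gens_def)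
  from Cons.IH obtain w' s where w': "w' \<in> letters" "length w' = length w"
    "fa_word w - fa_scale s (fa_word (map (ecyc n) w')) \<in> FK" by blast
  let ?m = "map (ecyc n) w'"
  have "lm [c] (fa_word w - fa_scale s (fa_word ?m)) \<in> FK" using w'(3) ij by (intro FK_lm) (auto simp: c)
  then have 1: "fa_word (c # w) - fa_scale s (fa_word (c # ?m)) \<in> FK" by (simp add: lrm_simps)
  show ?case
  proof (cases "j = (i + 1) mod n")
    case True
    then have "c = ecyc n i" by (simp add: c ecyc_def)
    then show ?thesis using 1 w' ij by (intro bexI[of _ "i # w'"] exI[of _ s]) auto
  next
    case False
    then have "i = (j + 1) mod n" using ij by (auto simp: cycle_graph_def)
    then have e: "ecyc n j = (j, i)" by (simp add: ecyc_def)
    have "lm [(i, j)] (fa_word ?m) + lm [(j, i)] (fa_word ?m) \<in> FK"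
      using map_ecyc[OF w'(1)] by (intro FK_anti[OF ij(1)] wspan_word)
    then have "fa_scale s (fa_word (c # ?m) + fa_word (ecyc n j # ?m)) \<in> FK" by (intro FK_scale) (simp add: c e)
    from FK_add[OF 1 this] have F: "fa_word (c # w) - fa_scale (- s) (fa_word (map (ecyc n) (j # w'))) \<in> FK"
      by (simp add: fa.scale_right_distrib fa.scale_minus_left)
    have "j # w' \<in> letters" "length (j # w') = length (c # w)" using w' ij by auto
    then show ?thesis using F by blast
  qed
qed

lemma edge_span:
  "fa.span (edge_words n (cycle_graph n) d \<union> fk_ideal_deg n d) = fa.span (basis_edge_words d \<union> fk_ideal_deg n d)"
proof
  show "fa.span (edge_words n (cycle_graph n) d \<union> fk_ideal_deg n d) \<subseteq> fa.span (basis_edge_words d \<union> fk_ideal_deg n d)"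
  proof (rule fa.span_minimal[OF _ fa.subspace_span], rule subsetI)
    fix x assume "x \<in> edge_words n (cycle_graph n) d \<union> fk_ideal_deg n d"
    then show "x \<in> fa.span (basis_edge_words d \<union> fk_ideal_deg n d)"
    proof
      assume "x \<in> edge_words n (cycle_graph n) d"
      then obtain w where w: "x = fa_word w" "w \<in> lists {(i, j) \<in> fk_gens n. cycle_graph n i j}" "length w = d"
        unfolding edge_words_def by blast
      obtain w' s where w': "w' \<in> letters" "length w' = d" "fa_word w - fa_scale s (fa_word (map (ecyc n) w')) \<in> FK"
        using edge_word_cyc[OF w(2)] w(3) by blast
      have "homog d (fa_scale s (fa_word (map (ecyc n) w')))"
        using w'(2) fa.subspace_scale[OF homog_subspace, of "fa_word (map (ecyc n) w')" d s] homog_word[of "map (ecyc n) w'" d] by simp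
      then have "fa_word w - fa_scale s (fa_word (map (ecyc n) w')) \<in> fk_ideal_deg n d"
        using w'(3) w(3) by (auto simp: fk_ideal_deg_def intro!: homog_diff homog_word)
      then have "fa_word w - fa_scale s (fa_word (map (ecyc n) w')) \<in> fa.span (basis_edge_words d \<union> fk_ideal_deg n d)"
        by (intro fa.span_base) simp
      moreover have "fa_scale s (fa_word (map (ecyc n) w')) \<in> fa.span (basis_edge_words d \<union> fk_ideal_deg n d)"
        by (rule fa.span_scale[OF cyc_word_span[OF w'(1,2)]])
      ultimately show ?thesis unfolding w(1) using fa.span_add by fastforce
    qed (auto intro: fa.span_base)
  qed
  have "basis_edge_words d \<subseteq> edge_words n (cycle_graph n) d"
  proof
    fix x assume "x \<in> basis_edge_words d"
    then obtain s where s: "s \<in> basis_index d" "x = fa_word (map (ecyc n) (basis_word s))" unfolding basis_edge_words_def by blast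
    have sb: "s \<in> Box \<times> FinSym" using s(1) basis_index_sub by blast
    have "map (ecyc n) (basis_word s) \<in> lists {(i, j) \<in> fk_gens n. cycle_graph n i j}"
      using basis_word_letters[OF sb] ecyc_gens by (auto simp: in_lists_conv_set ecyc_def cycle_graph_def)
    moreover have "length (basis_word s) = d" using basis_word_length[OF sb] s(1) by (simp add: basis_index_def)
    ultimately show "x \<in> edge_words n (cycle_graph n) d" unfolding edge_words_def s(2) by force
  qed
  then show "fa.span (basis_edge_words d \<union> fk_ideal_deg n d) \<subseteq> fa.span (edge_words n (cycle_graph n) d \<union> fk_ideal_deg n d)"
    by (intro fa.span_mono) auto
qed

theorem fkG_dim_eq: "fkG_dim n (cycle_graph n) d = card (basis_index d)"
proof -
  \<comment> \<open>All words of length \<open>d\<close>: a finite spanning set that bounds the part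
    of the ideal in degree \<open>d\<close>.\<close>
  let ?T = "fa_word ` {w. set w \<subseteq> fk_gens n \<and> length w = d}"
  have fg: "finite (fk_gens n)"
    by (rule finite_subset[of _ "{0..<n} \<times> {0..<n}"]) (auto simp: fk_gens_def)
  have fT: "finite ?T" using finite_lists_length_eq[OF fg] by simp
  have VT: "fk_ideal_deg n d \<subseteq> fa.span ?T"
  proof
    fix x assume "x \<in> fk_ideal_deg n d"
    then have x: "x \<in> wspan (fk_gens n)" "homog d x" using FK_wspan by (auto simp: fk_ideal_deg_def)
    then have sup: "finite {w. x w \<noteq> 0}" "\<And>w. x w \<noteq> 0 \<Longrightarrow> w \<in> lists (fk_gens n)"
      unfolding fa_supported_wspan[symmetric] fa_supported_def by auto
    have "x = (\<Sum>w\<in>{w. x w \<noteq> 0}. fa_scale (x w) (fa_word w))"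
    proof
      fix u
      have "(\<Sum>w\<in>{w. x w \<noteq> 0}. fa_scale (x w) (fa_word w)) u = (\<Sum>w\<in>{w. x w \<noteq> 0}. if w = u then x u else 0)"
        unfolding fa_sum_apply by (rule sum.cong) (auto simp: fa_scale_def fa_word_def)
      also have "\<dots> = x u" using sup(1) by (simp add: sum.delta)
      finally show "x u = (\<Sum>w\<in>{w. x w \<noteq> 0}. fa_scale (x w) (fa_word w)) u" by simp
    qed
    moreover have "(\<Sum>w\<in>{w. x w \<noteq> 0}. fa_scale (x w) (fa_word w)) \<in> fa.span ?T"
    proof (intro fa.span_sum fa.span_scale fa.span_base imageI CollectI conjI)
      fix w assume "w \<in> {w. x w \<noteq> 0}"
      then show "set w \<subseteq> fk_gens n" "length w = d" using sup(2)[of w] x(2) by (auto simp: homog_def)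
    qed
    ultimately show "x \<in> fa.span ?T" by simp
  qed
  have ind: "\<forall>s\<in>basis_index d. c s = 0" if "(\<Sum>s\<in>basis_index d. fa_scale (c s) (fa_word (map (ecyc n) (basis_word s)))) \<in> fk_ideal_deg n d" for c
  proof (rule basis_independent'[OF finite_basis_index basis_index_sub])
    have "cop id (\<Sum>s\<in>basis_index d. fa_scale (c s) (fa_word (basis_word s))) \<in> FK"
      using that by (simp add: cop_simps cop_word_id fk_ideal_deg_def del: id_apply)
    moreover have "(\<Sum>s\<in>basis_index d. fa_scale (c s) (fa_word (basis_word s))) \<in> wspan {0..<n}"
      using basis_word_letters basis_index_sub by (intro fa.subspace_sum[OF wspan_subspace] wspan_scale wspan_word) blast
    ultimately show "(\<Sum>s\<in>basis_index d. fa_scale (c s) (fa_word (basis_word s))) \<in> K" by (simp add: kernel_iff)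
  qed
  have "fa_dim (edge_words n (cycle_graph n) d \<union> fk_ideal_deg n d) = fa_dim (basis_edge_words d \<union> fk_ideal_deg n d)"
    unfolding fa_dim_def using fa.dim_span edge_span by metis
  also have "\<dots> = card (basis_index d) + fa_dim (fk_ideal_deg n d)"
    unfolding basis_edge_words_def by (rule dim_independent_mod[OF FKd_subspace VT fT finite_basis_index ind])
  finally show ?thesis by (simp add: fkG_dim_def)
qed

lemma fkG_dim_coeff: "int (fkG_dim n (cycle_graph n) d) = coeff hilb d"
proof -
  have "coeff hilb d = int (card {s \<in> Box \<times> FinSym. nat (ell (fst s) + ell (snd s)) = d})"
    unfolding hilb_gf case_prod_unfold using finite_Box finite_FinSym by (intro coeff_sum_monom) blast
  also have "{s \<in> Box \<times> FinSym. nat (ell (fst s) + ell (snd s)) = d} = basis_index d"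
    using ell_nonneg by (auto simp: basis_index_def add_nonneg_nonneg)
  finally show ?thesis by (simp add: fkG_dim_eq)
qed

lemma trl_rel_homog: assumes "1 \<le> k" "k < n" shows "homog (k * (n - k)) (trl_rel k)"
proof -
  have "trl_rel k \<in> {x. homog (k * (n - k)) x}"
    unfolding trl_rel_def by (rule fa.subspace_sum[OF homog_subspace]) (use trl_word_props(3)[OF assms] in \<open>auto intro: homog_word\<close>)
  then show ?thesis by simp
qed

text \<open>No cancellation is possible in a sum of words.\<close>

lemma trl_rel_nonzero: assumes "1 \<le> k" "k < n" shows "trl_rel k \<noteq> 0"
proof
  assume z: "trl_rel k = 0"
  have I: "{0..<k} \<in> Sub k" using assms by (auto simp: Sub_def)
  let ?w = "trl_word k {0..<k}"
  have "trl_rel k ?w = (\<Sum>I\<in>Sub k. fa_word (trl_word k I) ?w)" by (simp add: trl_rel_def fa_sum_apply)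
  moreover have "fa_word ?w ?w \<le> (\<Sum>I\<in>Sub k. fa_word (trl_word k I) ?w)"
    by (rule member_le_sum[OF I]) (auto simp: fa_word_def)
  ultimately show False using z by (simp add: fa_word_def zero_fun_apply)
qed

end

section \<open>Degree, leading coefficient and value at 1\<close>

lemma coeff_qint: "coeff (qint k) i = (if i < k then 1 else 0)"
  by (simp add: qint_def coeff_sum sum.delta)

lemma degree_qint: "1 \<le> k \<Longrightarrow> degree (qint k) = k - 1"
  by (rule antisym) (auto intro!: degree_le le_degree simp: coeff_qint)

lemma lead_qint: "1 \<le> k \<Longrightarrow> lead_coeff (qint k) = 1" by (simp add: degree_qint coeff_qint)

lemma poly_qint: "poly (qint k) 1 = int k" by (simp add: qint_def poly_sum poly_monom)

lemma sum_choose2: "(\<Sum>k<Suc m. k) = Suc m choose 2"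
  by (induction m) (auto simp: numeral_2_eq_2)

text \<open>Raising m by one adds k to each term, so the sum grows by a triangular number, as in
  Pascal's rule.\<close>

lemma sum_choose3: "(\<Sum>k<m. k * (m - k)) = Suc m choose 3"
proof (induction m)
  case (Suc m)
  have "(\<Sum>k<Suc m. k * (Suc m - k)) = (\<Sum>k<Suc m. k * (m - k) + k)"
    by (rule sum.cong) (auto simp: Suc_diff_le)
  also have "\<dots> = (\<Sum>k<m. k * (m - k)) + (\<Sum>k<Suc m. k)" by (simp add: sum.distrib)
  also have "\<dots> = Suc (Suc m) choose 3" unfolding Suc sum_choose2 by (simp add: numeral_3_eq_3 numeral_2_eq_2)
  finally show ?case .
qed (simp add: numeral_3_eq_3)

context cyc
begin

lemma hilb_degree: "degree hilb = (n + 1) choose 3" and hilb_lead: "lead_coeff hilb = 1"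
proof -
  have p: "1 \<le> k * (n - k)" if "k \<in> {1..n - 1}" for k using that n3 by (auto simp: Suc_le_eq)
  have nz: "qint k \<noteq> 0" if "1 \<le> k" for k using lead_qint[OF that] by auto
  show "lead_coeff hilb = 1"
    unfolding hilb_def lead_coeff_mult lead_coeff_prod using lead_qint p n3 by simp
  have "degree hilb = (n - 1) + (\<Sum>k\<in>{1..n - 1}. k * (n - k) - 1)"
    unfolding hilb_def using n3 nz p
    by (subst degree_mult_eq) (auto simp: degree_prod_eq_sum_degree degree_qint)
  \<comment> \<open>The degree n - 1 of [n] makes up for the -1 in each of the n - 1 other
    factors.\<close>
  also have "\<dots> = (\<Sum>k\<in>{1..n - 1}. (k * (n - k) - 1) + 1)" unfolding sum.distrib by simp
  also have "\<dots> = (\<Sum>k\<in>{1..n - 1}. k * (n - k))" using p by (intro sum.cong) auto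
  also have "\<dots> = (\<Sum>k<n. k * (n - k))" by (rule sum.mono_neutral_left) auto
  finally show "degree hilb = (n + 1) choose 3" using sum_choose3[of n] by simp
qed

lemma hilb_at_1: "poly hilb 1 = int (fact n * fact (n - 1))"
proof -
  have "poly hilb 1 = int (n * (\<Prod>k\<in>{1..n - 1}. k * (n - k)))"
    by (simp add: hilb_def poly_prod poly_qint)
  also have "(\<Prod>k\<in>{1..n - 1}. k * (n - k)) = (\<Prod>k\<in>{1..n - 1}. k) * (\<Prod>k\<in>{1..n - 1}. n - k)" by (rule prod.distrib)
  also have "(\<Prod>k\<in>{1..n - 1}. n - k) = (\<Prod>k\<in>{1..n - 1}. k)"
    by (rule prod.reindex_bij_witness[of _ "\<lambda>k. n - k" "\<lambda>k. n - k"]) (use n3 in auto)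
  also have "(\<Prod>k\<in>{1..n - 1}. k) = fact (n - 1)" by (simp add: fact_prod)
  also have "n * (fact (n - 1) * fact (n - 1)) = (fact n * fact (n - 1) :: nat)"
    using n3 by (simp add: fact_reduce[of n])
  finally show ?thesis .
qed

end

theorem mainTheorem19:
  fixes n :: nat
  assumes "n \<ge> 3"
  shows "nilcox_rels n \<subseteq> cyc_kernel n
    \<and> (\<exists>r :: nat \<Rightarrow> nat fa.
          (\<forall>k\<in>{1..n-1}. r k \<in> cyc_kernel n \<and> r k \<noteq> 0 \<and> homog (k * (n - k)) (r k))
        \<and> cyc_kernel n = fa_ideal {0..<n}
             ({x \<in> cyc_kernel n. homog 2 x} \<union> braid_rels n \<union> r ` {1..n-1}))
    \<and> (\<forall>d. int (fkG_dim n (cycle_graph n) d)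
            = coeff (qint n * (\<Prod>k\<in>{1..n-1}. qint (k * (n - k)))) d)
    \<and> (\<Sum>d\<le>(n + 1) choose 3. fkG_dim n (cycle_graph n) d) = fact n * fact (n - 1)
    \<and> fkG_dim n (cycle_graph n) ((n + 1) choose 3) \<noteq> 0
    \<and> (\<forall>d > (n + 1) choose 3. fkG_dim n (cycle_graph n) d = 0)"
proof -
  interpret cyc n by unfold_locales (rule assms)
  let ?D = "(n + 1) choose 3" and ?f = "fkG_dim n (cycle_graph n)"
  have "\<forall>k\<in>{1..n-1}. trl_rel k \<in> cyc_kernel n \<and> trl_rel k \<noteq> 0 \<and> homog (k * (n - k)) (trl_rel k)"
    using trl_rel_kernel trl_rel_nonzero trl_rel_homog assms by auto
  moreover note K_eq_rel_ideal[unfolded rel_ideal_def]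
  moreover have "\<forall>d. int (?f d) = coeff (qint n * (\<Prod>k\<in>{1..n-1}. qint (k * (n - k)))) d"
    using fkG_dim_coeff unfolding hilb_def by blast
  moreover have "(\<Sum>d\<le>?D. ?f d) = fact n * fact (n - 1)"
  proof -
    \<comment> \<open>The total dimension is the value of the Hilbert polynomial at 1, since
      \<open>?D\<close> is its degree.\<close>
    have "int (\<Sum>d\<le>?D. ?f d) = (\<Sum>d\<le>degree hilb. coeff hilb d * 1 ^ d)"
      unfolding hilb_degree by (simp add: fkG_dim_coeff)
    also have "\<dots> = poly hilb 1" by (rule poly_altdef[symmetric])
    finally show ?thesis unfolding hilb_at_1 of_nat_eq_iff .
  qed
  moreover have "?f ?D \<noteq> 0" using fkG_dim_coeff[of ?D] hilb_lead unfolding hilb_degree by auto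
  moreover have "\<forall>d>?D. ?f d = 0"
    using fkG_dim_coeff coeff_eq_0[of hilb] unfolding hilb_degree by (metis of_nat_eq_0_iff)
  ultimately show ?thesis using nilcox_rels_kernel by blast
qed

end
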